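(* Let $(X,\omega)$ be a connected, compact symplectic manifold without boundary, of dimension $2n$. If $\dim X\ge 4$, there is a smooth $\mathrm{Ham}(\omega)$ invariant function $p\colon C^\infty(X)\to\mathbb R$ that is not invariant under volume preserving diffeomorphisms $X\to X$; that is, $p(\xi\circ g)=p(\xi)$ for all $\xi\in C^\infty(X)$ and $g\in\mathrm{Ham}(\omega)$, but there are a diffeomorphism $h\colon X\to X$ preserving $\omega^n$ and a $\xi\in C^\infty(X)$ with $p(\xi\circ h)\ne p(\xi)$.
   Context: $C^\infty(X)$ is the Fréchet space of smooth real-valued functions on $X$; smoothness of $p$ is in the usual sense of calculus on Fréchet spaces. $\mathrm{Ham}(\omega)$ is the group of Hamiltonian diffeomorphisms of $X$: time 1 maps of time dependent Hamiltonian vector fields $\mathrm{sgrad}\,\xi_t$ (symplectic gradients), $\xi_t\in C^\infty(X)$. *)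

theory Defs
  imports "HOL-Analysis.Analysis" "HOL-Combinatorics.Permutations"
begin

section \<open>Smooth maps between open subsets of Euclidean spaces\<close>

text \<open>Iterated directional derivatives; the directions are applied from the end of the list.\<close>

primrec iter_deriv ::
  "'a::euclidean_space list \<Rightarrow> ('a \<Rightarrow> 'b::euclidean_space) \<Rightarrow> 'a \<Rightarrow> 'b" where
  "iter_deriv [] f = f"
| "iter_deriv (v # vs) f = (\<lambda>x. frechet_derivative (iter_deriv vs f) (at x) v)"

text \<open>Only meant for open \<open>S\<close>.\<close>

definition smooth_on :: "'a::euclidean_space set \<Rightarrow> ('a \<Rightarrow> 'b::euclidean_space) \<Rightarrow> bool" where
  "smooth_on S f \<longleftrightarrow> (\<forall>vs. \<forall>x\<in>S. iter_deriv vs f differentiable (at x))"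


section \<open>Smooth manifolds without boundary\<close>

text \<open>A chart is a pair of its domain and its coordinate map; the values of the
  coordinate map outside the domain are irrelevant. Atlases are not required to be maximal.\<close>

type_synonym ('x, 'e) chart = "'x set \<times> ('x \<Rightarrow> 'e)"

definition chart_img :: "('x, 'e) chart \<Rightarrow> 'e set" where
  "chart_img c = snd c ` fst c"

definition chart_inv :: "('x, 'e) chart \<Rightarrow> 'e \<Rightarrow> 'x" where
  "chart_inv c = inv_into (fst c) (snd c)"

definition is_chart :: "'x topology \<Rightarrow> ('x, 'e::euclidean_space) chart \<Rightarrow> bool" where
  "is_chart X c \<longleftrightarrow>
     openin X (fst c) \<and> open (chart_img c) \<and>
     homeomorphic_map (subtopology X (fst c)) (top_of_set (chart_img c)) (snd c)"

definition smooth_atlas :: "'x topology \<Rightarrow> ('x, 'e::euclidean_space) chart set \<Rightarrow> bool" where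
  "smooth_atlas X A \<longleftrightarrow>
     (\<forall>c\<in>A. is_chart X c) \<and> (\<Union>c\<in>A. fst c) = topspace X \<and>
     (\<forall>c\<in>A. \<forall>d\<in>A. smooth_on (snd c ` (fst c \<inter> fst d)) (snd d \<circ> chart_inv c))"

definition smooth_manifold :: "'x topology \<Rightarrow> ('x, 'e::euclidean_space) chart set \<Rightarrow> bool" where
  "smooth_manifold X A \<longleftrightarrow> Hausdorff_space X \<and> second_countable X \<and> smooth_atlas X A"

definition smooth_fun :: "('x, 'e::euclidean_space) chart set \<Rightarrow> ('x \<Rightarrow> real) \<Rightarrow> bool" where
  "smooth_fun A f \<longleftrightarrow> (\<forall>c\<in>A. smooth_on (chart_img c) (f \<circ> chart_inv c))"

definition smooth_map ::
  "'x topology \<Rightarrow> ('x, 'd::euclidean_space) chart set \<Rightarrow>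
   'y topology \<Rightarrow> ('y, 'e::euclidean_space) chart set \<Rightarrow> ('x \<Rightarrow> 'y) \<Rightarrow> bool" where
  "smooth_map X A Y B f \<longleftrightarrow>
     continuous_map X Y f \<and>
     (\<forall>c\<in>A. \<forall>d\<in>B. smooth_on (snd c ` {x \<in> fst c. f x \<in> fst d}) (snd d \<circ> f \<circ> chart_inv c))"

text \<open>Diffeomorphisms of \<open>X\<close> are extended to the whole type by the identity.\<close>

definition diffeos :: "'x topology \<Rightarrow> ('x, 'e::euclidean_space) chart set \<Rightarrow> ('x \<Rightarrow> 'x) set" where
  "diffeos X A =
     {g. g permutes topspace X \<and> smooth_map X A X A g \<and> smooth_map X A X A (inv g)}"

text \<open>The product atlas of \<open>\<real> \<times> X\<close>, used for smoothness in time and space jointly.\<close>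

definition line_times :: "('x, 'e) chart set \<Rightarrow> (real \<times> 'x, real \<times> 'e) chart set" where
  "line_times A = (\<lambda>c. (UNIV \<times> fst c, map_prod id (snd c))) ` A"

text \<open>The differential of \<open>f\<close> at \<open>x\<close>, read in the chart \<open>c\<close> around \<open>x\<close> and the chart
  \<open>d\<close> around \<open>f x\<close>.\<close>

definition tangent_map ::
  "('x, 'd::euclidean_space) chart \<Rightarrow> ('y, 'e::euclidean_space) chart \<Rightarrow> ('x \<Rightarrow> 'y) \<Rightarrow> 'x \<Rightarrow> 'd \<Rightarrow> 'e"
  where "tangent_map c d f x = frechet_derivative (snd d \<circ> f \<circ> chart_inv c) (at (snd c x))"


section \<open>Symplectic forms and their powers\<close>

text \<open>A 2-form is given by its local representatives: \<open>\<omega> c y\<close> is the bilinear form on the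
  model space which represents it in the chart \<open>c\<close> at the point with coordinates \<open>y\<close>;
  representatives in different charts are related by the transition maps.\<close>

type_synonym ('x, 'e) two_form = "('x, 'e) chart \<Rightarrow> 'e \<Rightarrow> 'e \<Rightarrow> 'e \<Rightarrow> real"

definition smooth_two_form ::
  "('x, 'e::euclidean_space) chart set \<Rightarrow> ('x, 'e) two_form \<Rightarrow> bool" where
  "smooth_two_form A \<omega> \<longleftrightarrow>
     (\<forall>c\<in>A. \<forall>y\<in>chart_img c. bilinear (\<omega> c y) \<and> (\<forall>u. \<omega> c y u u = 0)) \<and>
     (\<forall>c\<in>A. \<forall>u v. smooth_on (chart_img c) (\<lambda>y. \<omega> c y u v)) \<and>
     (\<forall>c\<in>A. \<forall>d\<in>A. \<forall>x\<in>fst c \<inter> fst d. \<forall>u v.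
        \<omega> c (snd c x) u v =
        \<omega> d (snd d x) (tangent_map c d id x u) (tangent_map c d id x v))"

text \<open>The exterior derivative of a 2-form in a chart, evaluated on constant vector fields.\<close>

definition ext_deriv2 ::
  "('e::euclidean_space \<Rightarrow> 'e \<Rightarrow> 'e \<Rightarrow> real) \<Rightarrow> 'e \<Rightarrow> 'e \<Rightarrow> 'e \<Rightarrow> 'e \<Rightarrow> real" where
  "ext_deriv2 \<alpha> y u v w =
     frechet_derivative (\<lambda>z. \<alpha> z v w) (at y) u
     - frechet_derivative (\<lambda>z. \<alpha> z u w) (at y) v
     + frechet_derivative (\<lambda>z. \<alpha> z u v) (at y) w"

definition symplectic_form ::
  "('x, 'e::euclidean_space) chart set \<Rightarrow> ('x, 'e) two_form \<Rightarrow> bool" where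
  "symplectic_form A \<omega> \<longleftrightarrow>
     smooth_two_form A \<omega> \<and>
     (\<forall>c\<in>A. \<forall>y\<in>chart_img c. \<forall>u v w. ext_deriv2 (\<omega> c) y u v w = 0) \<and>
     (\<forall>c\<in>A. \<forall>y\<in>chart_img c. \<forall>u. (\<forall>v. \<omega> c y u v = 0) \<longrightarrow> u = 0)"

text \<open>Alternating \<open>k\<close>-linear forms are functions of sequences of vectors which depend only
  on the first \<open>k\<close> entries. \<open>wedge k l\<close> is the exterior product of a \<open>k\<close>-form and an \<open>l\<close>-form.\<close>

definition wedge ::
  "nat \<Rightarrow> nat \<Rightarrow> ((nat \<Rightarrow> 'e) \<Rightarrow> real) \<Rightarrow> ((nat \<Rightarrow> 'e) \<Rightarrow> real) \<Rightarrow> (nat \<Rightarrow> 'e) \<Rightarrow> real" where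
  "wedge k l \<alpha> \<beta> v =
     (\<Sum>\<sigma> | \<sigma> permutes {..<k + l}.
        of_int (sign \<sigma>) * \<alpha> (\<lambda>i. v (\<sigma> i)) * \<beta> (\<lambda>i. v (\<sigma> (k + i)))) / (fact k * fact l)"

primrec wedge_power :: "('e \<Rightarrow> 'e \<Rightarrow> real) \<Rightarrow> nat \<Rightarrow> (nat \<Rightarrow> 'e) \<Rightarrow> real" where
  "wedge_power b 0 = (\<lambda>v. 1)"
| "wedge_power b (Suc k) = wedge 2 (2 * k) (\<lambda>v. b (v 0) (v 1)) (wedge_power b k)"

text \<open>\<open>h\<close> pulls back the form \<open>\<omega>\<^sup>n\<close> to itself.\<close>

definition preserves_power ::
  "('x, 'e::euclidean_space) chart set \<Rightarrow> ('x, 'e) two_form \<Rightarrow> nat \<Rightarrow> ('x \<Rightarrow> 'x) \<Rightarrow> bool" where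
  "preserves_power A \<omega> n h \<longleftrightarrow>
     (\<forall>c\<in>A. \<forall>d\<in>A. \<forall>x\<in>fst c. h x \<in> fst d \<longrightarrow>
        (\<forall>v. wedge_power (\<omega> d (snd d (h x))) n (\<lambda>i. tangent_map c d h x (v i)) =
             wedge_power (\<omega> c (snd c x)) n v))"


section \<open>Hamiltonian diffeomorphisms\<close>

text \<open>The symplectic gradient of \<open>\<xi>\<close> in the chart \<open>c\<close>, with the convention
  \<open>\<omega>(sgrad \<xi>, \<cdot>) = d\<xi>\<close>. The opposite sign convention replaces \<open>\<xi>\<close> by \<open>-\<xi>\<close> and gives the
  same group of Hamiltonian diffeomorphisms.\<close>

definition sgrad ::
  "('x, 'e::euclidean_space) two_form \<Rightarrow> ('x, 'e) chart \<Rightarrow> ('x \<Rightarrow> real) \<Rightarrow> 'e \<Rightarrow> 'e" where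
  "sgrad \<omega> c \<xi> y =
     (THE v. \<forall>w. \<omega> c y v w = frechet_derivative (\<xi> \<circ> chart_inv c) (at y) w)"

text \<open>\<open>G\<close> is the flow of the time dependent vector field \<open>sgrad \<xi>\<^sub>t\<close>. On a compact manifold it
  exists for all times, and since smooth functions on \<open>[0, 1] \<times> X\<close> extend smoothly to
  \<open>\<real> \<times> X\<close>, letting time range over \<open>\<real>\<close> does not affect the set of time 1 maps.\<close>

definition hamiltonian_flow ::
  "'x topology \<Rightarrow> ('x, 'e::euclidean_space) chart set \<Rightarrow> ('x, 'e) two_form \<Rightarrow>
   (real \<Rightarrow> 'x \<Rightarrow> real) \<Rightarrow> (real \<Rightarrow> 'x \<Rightarrow> 'x) \<Rightarrow> bool" where
  "hamiltonian_flow X A \<omega> \<xi> G \<longleftrightarrow>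
     smooth_map (prod_topology euclideanreal X) (line_times A) X A (\<lambda>(t, x). G t x) \<and>
     (\<forall>x\<in>topspace X. G 0 x = x) \<and>
     (\<forall>t. \<forall>x\<in>topspace X. \<forall>c\<in>A. G t x \<in> fst c \<longrightarrow>
        ((\<lambda>s. snd c (G s x)) has_vector_derivative sgrad \<omega> c (\<xi> t) (snd c (G t x))) (at t))"

definition Ham ::
  "'x topology \<Rightarrow> ('x, 'e::euclidean_space) chart set \<Rightarrow> ('x, 'e) two_form \<Rightarrow> ('x \<Rightarrow> 'x) set" where
  "Ham X A \<omega> =
     {g \<in> diffeos X A. \<exists>\<xi> G. smooth_fun (line_times A) (\<lambda>(t, x). \<xi> t x) \<and>
        hamiltonian_flow X A \<omega> \<xi> G \<and> (\<forall>x\<in>topspace X. g x = G 1 x)}"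


section \<open>The Frechet space of smooth functions and smooth functions on it\<close>

text \<open>Functions on \<open>X\<close> are extended to the whole type by zero.\<close>

definition Cinf :: "'x topology \<Rightarrow> ('x, 'e::euclidean_space) chart set \<Rightarrow> ('x \<Rightarrow> real) set" where
  "Cinf X A = {f. smooth_fun A f \<and> (\<forall>x. x \<notin> topspace X \<longrightarrow> f x = 0)}"

definition Cinf_seminorm ::
  "('x, 'e::euclidean_space) chart \<Rightarrow> 'e set \<Rightarrow> 'e list \<Rightarrow> ('x \<Rightarrow> real) \<Rightarrow> real" where
  "Cinf_seminorm c K vs f = (SUP y\<in>K. \<bar>iter_deriv vs (f \<circ> chart_inv c) y\<bar>)"

text \<open>The topology of uniform convergence of all derivatives on compact subsets of charts.\<close>

definition Cinf_topology ::
  "'x topology \<Rightarrow> ('x, 'e::euclidean_space) chart set \<Rightarrow> ('x \<Rightarrow> real) topology" where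
  "Cinf_topology X A = topology_generated_by
     (insert (Cinf X A)
       {{g \<in> Cinf X A. Cinf_seminorm c K vs (\<lambda>x. g x - f x) < \<epsilon>} | c K vs f \<epsilon>.
          c \<in> A \<and> compact K \<and> K \<noteq> {} \<and> K \<subseteq> chart_img c \<and> f \<in> Cinf X A \<and> \<epsilon> > 0})"

text \<open>Iterated directional derivatives of a function \<open>p\<close> on a space of functions, and
  smoothness in the sense of calculus on Frechet spaces: for every \<open>k\<close> the derivative
  \<open>D\<^sup>k p (f; h\<^sub>1, \<dots>, h\<^sub>k)\<close> exists and is jointly continuous in all \<open>k + 1\<close> arguments.\<close>

primrec dir_deriv ::
  "('x \<Rightarrow> real) list \<Rightarrow> (('x \<Rightarrow> real) \<Rightarrow> real) \<Rightarrow> ('x \<Rightarrow> real) \<Rightarrow> real" where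
  "dir_deriv [] p f = p f"
| "dir_deriv (h # hs) p f = deriv (\<lambda>t::real. dir_deriv hs p (\<lambda>x. f x + t * h x)) 0"

definition frechet_smooth ::
  "('x \<Rightarrow> real) topology \<Rightarrow> (('x \<Rightarrow> real) \<Rightarrow> real) \<Rightarrow> bool" where
  "frechet_smooth T p \<longleftrightarrow>
     (\<forall>hs\<in>lists (topspace T). \<forall>h\<in>topspace T. \<forall>f\<in>topspace T.
        (\<lambda>t::real. dir_deriv hs p (\<lambda>x. f x + t * h x)) field_differentiable (at 0)) \<and>
     (\<forall>k. continuous_map (prod_topology T (product_topology (\<lambda>_. T) {..<k})) euclideanreal
        (\<lambda>(f, h). dir_deriv (map h [0..<k]) p f))"

end

theory Submission
  imports Defs
begin

text \<open>
  Symplectic maps preserve, and volume preserving maps need not preserve, the relative invariants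
  of the Hessian of \<open>\<xi>\<close> and \<open>\<omega>\<close> at a critical point: with determinants taken in a chart,
  \<open>d = (det Hess / det \<omega>)\<^sup>2\<close> is invariant under both, but \<open>e = det (Hess + \<omega>) / det \<omega>\<close> only under
  the former. Let \<open>\<chi>\<close> be smooth, flat, supported in \<open>[0, \<infinity>)\<close>, and
  \<open>p \<xi> = \<Sum> \<chi> (d - \<delta>) e\<close> over the critical points of \<open>\<xi>\<close>. The cutoff discards degenerate critical
  points, so locally in \<open>\<xi>\<close> the sum is finite and its terms are smooth expressions in the jet of
  \<open>\<xi>\<close> at a critical point that moves smoothly with \<open>\<xi>\<close>. To break invariance, straighten the
  density of \<open>\<omega>\<^sup>n\<close> in a chart, twist by a rotation that dies off away from the origin, and apply
  the twist to a \<open>\<xi>\<close> that is quadratic near its fixed point; when the dimension is at least 3,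
  some rotation in a coordinate plane changes \<open>e\<close> for a suitable quadratic form.
\<close>

section \<open>Calculus of smooth maps\<close>

text \<open>The dimension enters through \<open>e\<close>: in dimension 2 one has
  \<open>det (Hess + \<omega>) = det Hess + det \<omega>\<close>, so that \<open>e\<close> carries
  no more than \<open>det Hess / det \<omega>\<close>; in higher dimension it also sees the position
  of the Hessian relative to \<open>\<omega>\<close>. The obstacle is smoothness on a Frechet space,
  where critical points may appear, merge or degenerate as \<open>\<xi>\<close> varies. The
  threshold \<open>\<delta> > 0\<close> keeps every contributing point away from degeneracy by a
  fixed margin, and flatness of \<open>\<chi>\<close> lets a point cross the threshold smoothly;
  \<open>\<delta>\<close> is chosen only at the end, as half the value of \<open>d\<close> at the
  critical point to be detected. No implicit function theorem on the function space is invoked: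
  contraction in the model space yields a critical point depending continuously on
  \<open>\<xi>\<close>, differentiability is then proved along lines only, and Cramer's rule
  expresses the derivative by jets at the same point. One class of expressions, closed under such
  differentiation, therefore supplies all higher derivatives together with their joint
  continuity.\<close>

abbreviation fd :: "('a::euclidean_space \<Rightarrow> 'b::euclidean_space) \<Rightarrow> 'a \<Rightarrow> 'a \<Rightarrow> 'b" where
  "fd f x \<equiv> frechet_derivative f (at x)"

lemma fd_eq: "(f has_derivative f') (at x) \<Longrightarrow> fd f x = f'"
  by (rule frechet_derivative_at[symmetric])

lemma fd_works: "f differentiable (at x) \<Longrightarrow> (f has_derivative fd f x) (at x)"
  by (simp add: frechet_derivative_works)

lemma fd_cong:
  assumes "open S" "x \<in> S" "\<And>y. y \<in> S \<Longrightarrow> f y = g y"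
  shows "fd f x = fd g x"
proof -
  have "(f has_derivative f') (at x) \<longleftrightarrow> (g has_derivative f') (at x)" for f'
    using has_derivative_transform_within_open[of f f' x UNIV S g]
      has_derivative_transform_within_open[of g f' x UNIV S f] assms by auto
  then show ?thesis
    by (simp add: frechet_derivative_def)
qed

lemma differentiable_cong:
  assumes "open S" "x \<in> S" "\<And>y. y \<in> S \<Longrightarrow> f y = g y" "f differentiable (at x)"
  shows "g differentiable (at x)"
  using has_derivative_transform_within_open[of f _ x UNIV S g] assms
  unfolding differentiable_def by blast

lemma iter_deriv_append: "iter_deriv (vs @ ws) f = iter_deriv vs (iter_deriv ws f)"
  by (induction vs) simp_all

lemma iter_deriv_cong:
  assumes "open S" "\<And>y. y \<in> S \<Longrightarrow> f y = g y"
  shows "x \<in> S \<Longrightarrow> iter_deriv vs f x = iter_deriv vs g x"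
proof (induction vs arbitrary: x)
  case Nil
  then show ?case using assms by simp
next
  case (Cons v vs)
  then show ?case using fd_cong[OF assms(1) Cons.prems, of "iter_deriv vs f" "iter_deriv vs g"]
    by simp
qed

text \<open>Truncating \<open>smooth_on\<close> at a finite order gives the closure properties an
  induction: by \<open>ck_SucI\<close>, order \<open>Suc k\<close> reduces to order \<open>k\<close>
  of the derivative in each constant direction. At order 0 the condition is plain
  differentiability.\<close>

definition ck :: "nat \<Rightarrow> 'a::euclidean_space set \<Rightarrow> ('a \<Rightarrow> 'b::euclidean_space) \<Rightarrow> bool" where
  "ck k S f \<longleftrightarrow> (\<forall>vs. length vs \<le> k \<longrightarrow> (\<forall>x\<in>S. iter_deriv vs f differentiable (at x)))"

lemma smooth_on_iff_ck: "smooth_on S f \<longleftrightarrow> (\<forall>k. ck k S f)"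
  unfolding smooth_on_def ck_def by blast

lemma ck_0: "ck 0 S f \<longleftrightarrow> (\<forall>x\<in>S. f differentiable (at x))"
  by (simp add: ck_def)

lemma ck_mono: "ck k S f \<Longrightarrow> j \<le> k \<Longrightarrow> ck j S f"
  unfolding ck_def by (meson order_trans)

lemma ck_differentiable: "ck k S f \<Longrightarrow> x \<in> S \<Longrightarrow> f differentiable (at x)"
  unfolding ck_def by (metis iter_deriv.simps(1) le0 list.size(3))

text \<open>\<open>iter_deriv\<close> recurses on the derivative taken last, the head of the list.
  Here the derivative taken first, the end of the list, is split off, so that an induction
  hypothesis applies to the function \<open>\<lambda>x. fd f x v\<close>.\<close>

lemma ck_Suc:
  "ck (Suc k) S f \<longleftrightarrow> (\<forall>x\<in>S. f differentiable (at x)) \<and> (\<forall>v. ck k S (\<lambda>x. fd f x v))"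
proof safe
  fix x assume "ck (Suc k) S f" "x \<in> S"
  then show "f differentiable (at x)" by (rule ck_differentiable)
next
  fix v assume *: "ck (Suc k) S f"
  show "ck k S (\<lambda>x. fd f x v)"
    unfolding ck_def
  proof safe
    fix vs :: "'a list" and x assume "length vs \<le> k" "x \<in> S"
    then have "iter_deriv (vs @ [v]) f differentiable at x"
      using * unfolding ck_def by auto
    then show "iter_deriv vs (\<lambda>x. fd f x v) differentiable at x"
      by (simp add: iter_deriv_append)
  qed
next
  assume d: "\<forall>x\<in>S. f differentiable (at x)" and *: "\<forall>v. ck k S (\<lambda>x. fd f x v)"
  show "ck (Suc k) S f"
    unfolding ck_def
  proof safe
    fix vs :: "'a list" and x assume l: "length vs \<le> Suc k" and x: "x \<in> S"
    show "iter_deriv vs f differentiable at x"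
    proof (cases vs rule: rev_cases)
      case Nil
      then show ?thesis using d x by simp
    next
      case (snoc ws w)
      then show ?thesis using * l x by (simp add: iter_deriv_append ck_def)
    qed
  qed
qed

lemma ck_cong:
  assumes "open S" "\<And>y. y \<in> S \<Longrightarrow> f y = g y" "ck k S f"
  shows "ck k S g"
  unfolding ck_def
proof safe
  fix vs :: "'a list" and x assume *: "length vs \<le> k" "x \<in> S"
  then have "iter_deriv vs f differentiable at x" using assms(3) by (simp add: ck_def)
  then show "iter_deriv vs g differentiable at x"
    by (rule differentiable_cong[OF assms(1) *(2), rotated])
      (rule iter_deriv_cong[of S f g], use assms(1,2) in auto)
qed

lemma ck_SucI:
  assumes "open S" "\<And>x. x \<in> S \<Longrightarrow> (f has_derivative f' x) (at x)"
    and "\<And>v. ck k S (\<lambda>x. f' x v)"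
  shows "ck (Suc k) S f"
  unfolding ck_Suc
proof safe
  fix x assume "x \<in> S" then show "f differentiable at x"
    using assms(2) differentiable_def by blast
next
  fix v show "ck k S (\<lambda>x. fd f x v)"
    by (rule ck_cong[OF assms(1) _ assms(3)[of v]]) (simp add: fd_eq[OF assms(2)])
qed

lemma ck_fd: "ck (Suc k) S f \<Longrightarrow> ck k S (\<lambda>x. fd f x v)"
  by (simp add: ck_Suc)

lemma ck_const: "ck k S (\<lambda>x. c)"
proof (induction k arbitrary: c)
  case 0 then show ?case by (simp add: ck_0)
next
  case (Suc k)
  show ?case unfolding ck_Suc using Suc[of 0] by simp
qed

lemma ck_linear:
  assumes "bounded_linear L" and "open S" "ck k S f"
  shows "ck k S (\<lambda>x. L (f x))"
  using assms(3)
proof (induction k arbitrary: f)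
  case 0
  then show ?case unfolding ck_0
    by (metis bounded_linear.has_derivative[OF assms(1)] differentiable_def)
next
  case (Suc k)
  show ?case
  proof (rule ck_SucI[OF assms(2)])
    fix x assume "x \<in> S"
    then show "((\<lambda>x. L (f x)) has_derivative (\<lambda>v. L (fd f x v))) (at x)"
      using bounded_linear.has_derivative[OF assms(1)] fd_works ck_differentiable Suc.prems by blast
  qed (use Suc ck_fd in blast)
qed

lemma ck_ident: "ck k S (\<lambda>x. x)"
proof (cases k)
  case 0 then show ?thesis by (simp add: ck_0)
next
  case (Suc j)
  then show ?thesis by (simp add: ck_Suc ck_const)
qed

lemma ck_add:
  assumes "open S" "ck k S f" "ck k S g"
  shows "ck k S (\<lambda>x. f x + g x)"
  using assms(2,3)
proof (induction k arbitrary: f g)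
  case 0
  then show ?case unfolding ck_0 by auto
next
  case (Suc k)
  show ?case
  proof (rule ck_SucI[OF assms(1)])
    fix x assume "x \<in> S"
    then show "((\<lambda>x. f x + g x) has_derivative (\<lambda>v. fd f x v + fd g x v)) (at x)"
      using has_derivative_add fd_works ck_differentiable Suc.prems by blast
  qed (use Suc ck_fd in blast)
qed

lemma ck_sum:
  assumes "open S" "\<And>i. i \<in> I \<Longrightarrow> ck k S (f i)"
  shows "ck k S (\<lambda>x. \<Sum>i\<in>I. f i x)"
  using assms(2)
  by (induction I rule: infinite_finite_induct) (auto intro!: ck_add assms(1) ck_const)

lemma ck_scaleR:
  fixes a :: "'a::euclidean_space \<Rightarrow> real"
  assumes "open S" "ck k S a" "ck k S f"
  shows "ck k S (\<lambda>x. a x *\<^sub>R f x)"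
  using assms(2,3)
proof (induction k arbitrary: a f)
  case 0
  then show ?case unfolding ck_0 by auto
next
  case (Suc k)
  show ?case
  proof (rule ck_SucI[OF assms(1)])
    fix x assume "x \<in> S"
    then show "((\<lambda>x. a x *\<^sub>R f x) has_derivative (\<lambda>v. a x *\<^sub>R fd f x v + fd a x v *\<^sub>R f x)) (at x)"
      using Suc.prems by (intro has_derivative_scaleR fd_works ck_differentiable)
  next
    fix v
    \<comment> \<open>The product rule leaves one factor undifferentiated; its order is lowered to
      match the derivative of the other.\<close>
    have "ck k S a" "ck k S f" using Suc.prems ck_mono le_Suc_eq by blast+
    then show "ck k S (\<lambda>x. a x *\<^sub>R fd f x v + fd a x v *\<^sub>R f x)"
      using Suc by (auto intro!: ck_add assms(1) Suc.IH ck_fd)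
  qed
qed

lemma ck_mult:
  fixes a b :: "'a::euclidean_space \<Rightarrow> real"
  assumes "open S" "ck k S a" "ck k S b"
  shows "ck k S (\<lambda>x. a x * b x)"
  using ck_scaleR[OF assms] by simp

lemma ck_prod:
  fixes f :: "'i \<Rightarrow> 'a::euclidean_space \<Rightarrow> real"
  assumes "open S" "\<And>i. i \<in> I \<Longrightarrow> ck k S (f i)"
  shows "ck k S (\<lambda>x. \<Prod>i\<in>I. f i x)"
  using assms(2)
  by (induction I rule: infinite_finite_induct) (auto intro!: ck_mult assms(1) ck_const)

lemma ck_cmult:
  fixes a :: "'a::euclidean_space \<Rightarrow> real"
  assumes "open S" "ck k S a"
  shows "ck k S (\<lambda>x. c * a x)"
  by (rule ck_mult[OF assms(1) ck_const assms(2)])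

lemma ck_minus:
  assumes "open S" "ck k S f"
  shows "ck k S (\<lambda>x. - f x)"
  by (rule ck_linear[OF _ assms]) (rule bounded_linear_minus[OF bounded_linear_ident])

lemma ck_diff:
  assumes "open S" "ck k S f" "ck k S g"
  shows "ck k S (\<lambda>x. f x - g x)"
  using ck_add[OF assms(1,2) ck_minus[OF assms(1,3)]] by simp

lemma ck_inner_right:
  assumes "open S" "ck k S f"
  shows "ck k S (\<lambda>x. f x \<bullet> b)"
  by (rule ck_linear[OF _ assms]) (rule bounded_linear_inner_left)

lemma fd_sum_Basis:
  assumes "f differentiable (at x)"
  shows "fd f x v = (\<Sum>b\<in>Basis. (v \<bullet> b) *\<^sub>R fd f x b)"
proof -
  have l: "linear (fd f x)" using assms linear_frechet_derivative by blast
  have "fd f x v = fd f x (\<Sum>b\<in>Basis. (v \<bullet> b) *\<^sub>R b)" by (simp add: euclidean_representation)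
  also have "\<dots> = (\<Sum>b\<in>Basis. (v \<bullet> b) *\<^sub>R fd f x b)"
    by (simp add: linear_sum[OF l] linear_cmul[OF l])
  finally show ?thesis .
qed

lemma fd_compose:
  assumes "f differentiable (at x)" "g differentiable (at (f x))"
  shows "fd (\<lambda>x. g (f x)) x v = fd g (f x) (fd f x v)"
proof -
  have "((\<lambda>x. g (f x)) has_derivative (\<lambda>v. fd g (f x) (fd f x v))) (at x)"
    by (rule has_derivative_compose[OF fd_works[OF assms(1)] fd_works[OF assms(2)]])
  then show ?thesis by (simp add: fd_eq)
qed

lemma ck_compose:
  assumes "open S" "open T" "ck k S f" "ck k T g" "\<And>x. x \<in> S \<Longrightarrow> f x \<in> T"
  shows "ck k S (\<lambda>x. g (f x))"
  using assms(3,4)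
proof (induction k arbitrary: g)
  case 0
  then show ?case unfolding ck_0 using assms(5)
    by (metis differentiable_compose)
next
  case (Suc k)
  show ?case
  proof (rule ck_SucI[OF assms(1)])
    fix x assume x: "x \<in> S"
    then have "(f has_derivative fd f x) (at x)" "(g has_derivative fd g (f x)) (at (f x))"
      using fd_works ck_differentiable Suc.prems assms(5) by blast+
    from has_derivative_compose[OF this]
    show "((\<lambda>x. g (f x)) has_derivative (\<lambda>v. fd g (f x) (fd f x v))) (at x)" .
  next
    fix v
    have f: "ck k S f" using Suc.prems(1) ck_mono le_Suc_eq by blast
    \<comment> \<open>The direction \<open>fd f x v\<close> varies with \<open>x\<close>, whereas
      the induction hypothesis covers constant directions only; hence the expansion in the
      basis.\<close>
    have "ck k S (\<lambda>x. \<Sum>b\<in>Basis. (fd f x v \<bullet> b) *\<^sub>R fd g (f x) b)"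
      using Suc.prems by (intro ck_sum ck_scaleR ck_inner_right assms(1) ck_fd Suc.IH f) auto
    then show "ck k S (\<lambda>x. fd g (f x) (fd f x v))"
    proof (rule ck_cong[OF assms(1), rotated])
      fix x assume "x \<in> S"
      then have "g differentiable (at (f x))"
        using ck_differentiable Suc.prems(2) assms(5) by blast
      then show "(\<Sum>b\<in>Basis. (fd f x v \<bullet> b) *\<^sub>R fd g (f x) b) = fd g (f x) (fd f x v)"
        by (simp add: fd_sum_Basis[symmetric])
    qed
  qed
qed

lemma has_derivative_real_ck:
  fixes f :: "real \<Rightarrow> real"
  assumes "open S" "\<And>x. x \<in> S \<Longrightarrow> (f has_real_derivative f' x) (at x)" "ck k S f'"
  shows "ck (Suc k) S f"
proof (rule ck_SucI[OF assms(1)])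
  fix x assume "x \<in> S"
  then show "(f has_derivative (\<lambda>v. f' x * v)) (at x)"
    using assms(2) by (simp add: has_field_derivative_def)
qed (use ck_mult[OF assms(1,3) ck_const] in simp)

text \<open>Spares formulas for all higher derivatives of \<open>inverse\<close>, sine and cosine: a
  family closed under differentiation suffices.\<close>

lemma smooth_on_real_family:
  fixes f :: "real \<Rightarrow> real"
  assumes S: "open S" and "P f"
    and "\<And>f. P f \<Longrightarrow> \<exists>f'. P f' \<and> (\<forall>x\<in>S. (f has_real_derivative f' x) (at x))"
  shows "smooth_on S f"
  unfolding smooth_on_iff_ck
proof
  fix k
  show "ck k S f" using assms(2)
  proof (induction k arbitrary: f)
    case 0
    then show ?case unfolding ck_0 using assms(3) real_differentiable_def by blast
  next
    case (Suc k)
    then show ?case using assms(3) has_derivative_real_ck[OF S] by meson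
  qed
qed


section \<open>Closure properties of smooth maps\<close>

lemma smooth_on_const: "smooth_on S (\<lambda>x. c)"
  by (simp add: smooth_on_iff_ck ck_const)
lemma smooth_on_ident: "smooth_on S (\<lambda>x. x)"
  by (simp add: smooth_on_iff_ck ck_ident)
lemma smooth_on_add: "open S \<Longrightarrow> smooth_on S f \<Longrightarrow> smooth_on S g \<Longrightarrow> smooth_on S (\<lambda>x. f x + g x)"
  by (simp add: smooth_on_iff_ck ck_add)
lemma smooth_on_diff: "open S \<Longrightarrow> smooth_on S f \<Longrightarrow> smooth_on S g \<Longrightarrow> smooth_on S (\<lambda>x. f x - g x)"
  by (simp add: smooth_on_iff_ck ck_diff)
lemma smooth_on_scaleR:
  fixes a :: "'a::euclidean_space \<Rightarrow> real"
  shows "open S \<Longrightarrow> smooth_on S a \<Longrightarrow> smooth_on S f \<Longrightarrow> smooth_on S (\<lambda>x. a x *\<^sub>R f x)"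
  by (simp add: smooth_on_iff_ck ck_scaleR)
lemma smooth_on_mult:
  fixes a b :: "'a::euclidean_space \<Rightarrow> real"
  shows "open S \<Longrightarrow> smooth_on S a \<Longrightarrow> smooth_on S b \<Longrightarrow> smooth_on S (\<lambda>x. a x * b x)"
  by (simp add: smooth_on_iff_ck ck_mult)
lemma smooth_on_sum: "open S \<Longrightarrow> (\<And>i. i \<in> I \<Longrightarrow> smooth_on S (f i)) \<Longrightarrow> smooth_on S (\<lambda>x. \<Sum>i\<in>I. f i x)"
  by (simp add: smooth_on_iff_ck ck_sum)
lemma smooth_on_prod:
  fixes f :: "'i \<Rightarrow> 'a::euclidean_space \<Rightarrow> real"
  shows "open S \<Longrightarrow> (\<And>i. i \<in> I \<Longrightarrow> smooth_on S (f i)) \<Longrightarrow> smooth_on S (\<lambda>x. \<Prod>i\<in>I. f i x)"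
  by (simp add: smooth_on_iff_ck ck_prod)
lemma smooth_on_linear: "bounded_linear L \<Longrightarrow> open S \<Longrightarrow> smooth_on S f \<Longrightarrow> smooth_on S (\<lambda>x. L (f x))"
  by (simp add: smooth_on_iff_ck ck_linear)
lemma smooth_on_inner_right: "open S \<Longrightarrow> smooth_on S f \<Longrightarrow> smooth_on S (\<lambda>x. f x \<bullet> b)"
  by (simp add: smooth_on_iff_ck ck_inner_right)
lemma smooth_on_cong: "open S \<Longrightarrow> (\<And>y. y \<in> S \<Longrightarrow> f y = g y) \<Longrightarrow> smooth_on S f \<Longrightarrow> smooth_on S g"
  using ck_cong[of S f g] by (simp add: smooth_on_iff_ck)
lemma smooth_on_subset: "smooth_on S f \<Longrightarrow> T \<subseteq> S \<Longrightarrow> smooth_on T f"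
  unfolding smooth_on_def by blast
lemma smooth_on_compose:
  "open S \<Longrightarrow> open T \<Longrightarrow> smooth_on S f \<Longrightarrow> smooth_on T g \<Longrightarrow> (\<And>x. x \<in> S \<Longrightarrow> f x \<in> T) \<Longrightarrow>
    smooth_on S (\<lambda>x. g (f x))"
  by (simp add: smooth_on_iff_ck ck_compose)
lemma smooth_on_differentiable: "smooth_on S f \<Longrightarrow> x \<in> S \<Longrightarrow> f differentiable (at x)"
  unfolding smooth_on_iff_ck by (rule ck_differentiable[of 0]) auto
lemma smooth_on_fd: "smooth_on S f \<Longrightarrow> smooth_on S (\<lambda>x. fd f x v)"
  by (simp add: smooth_on_iff_ck ck_fd)
lemma smooth_on_iter_deriv: "smooth_on S f \<Longrightarrow> smooth_on S (iter_deriv vs f)"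
  unfolding smooth_on_def by (simp flip: iter_deriv_append)
lemma smooth_on_continuous_on: "smooth_on S f \<Longrightarrow> continuous_on S f"
  by (meson continuous_at_imp_continuous_on differentiable_imp_continuous_within smooth_on_differentiable)

lemma smooth_on_inner_self:
  fixes y0 :: "'a::euclidean_space"
  shows "smooth_on UNIV (\<lambda>z. (z - y0) \<bullet> (z - y0))"
proof -
  have "smooth_on UNIV (\<lambda>z. \<Sum>i\<in>Basis. ((z - y0) \<bullet> i) * ((z - y0) \<bullet> i))"
    by (intro smooth_on_sum smooth_on_mult smooth_on_inner_right smooth_on_diff smooth_on_ident
        smooth_on_const open_UNIV)
  then show ?thesis by (simp flip: euclidean_inner)
qed

lemma smooth_on_local:
  assumes "\<And>x. x \<in> S \<Longrightarrow> \<exists>U g. open U \<and> x \<in> U \<and> smooth_on U g \<and> (\<forall>y\<in>U. f y = g y)"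
  shows "smooth_on S f"
  unfolding smooth_on_def
proof safe
  fix vs :: "'a list" and x assume "x \<in> S"
  from assms[OF this] obtain U g where "open U \<and> x \<in> U \<and> smooth_on U g \<and> (\<forall>y\<in>U. f y = g y)"
    by (elim exE)
  then have *: "open U" "x \<in> U" "smooth_on U g" "\<And>y. y \<in> U \<Longrightarrow> f y = g y"
    by blast+
  have "smooth_on U f" by (rule smooth_on_cong[OF *(1) _ *(3)]) (simp add: *(4))
  then show "iter_deriv vs f differentiable at x" using *(2) by (simp add: smooth_on_def)
qed

section \<open>Elementary functions, flat functions and cutoffs\<close>

lemma DERIV_inverse_pow:
  fixes x :: real
  assumes "x \<noteq> 0"
  shows "((\<lambda>x. inverse x ^ n) has_real_derivative - real n * inverse x ^ Suc n) (at x)"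
proof (induction n)
  case (Suc n)
  show ?case
    by (rule DERIV_cong[OF DERIV_mult[OF DERIV_inverse[OF assms] Suc, folded power_Suc]])
      (simp add: algebra_simps power2_eq_square)
qed simp

lemma smooth_on_inverse: "smooth_on {x::real. x \<noteq> 0} inverse"
proof -
  let ?P = "\<lambda>f. \<exists>c n. \<forall>x::real. f x = c * inverse x ^ n"
  have S: "open {x::real. x \<noteq> 0}"
    by (rule open_Collect_neq) (auto intro: continuous_intros)
  have p: "?P inverse" by (rule exI[of _ 1], rule exI[of _ 1]) simp
  show ?thesis
  proof (rule smooth_on_real_family[OF S, of ?P], rule p)
    fix f assume "?P f"
    then obtain c n where f: "f = (\<lambda>x. c * inverse x ^ n)" by blast
    have "(f has_real_derivative (- c * n) * inverse x ^ (Suc n)) (at x)" if "x \<noteq> 0" for x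
      unfolding f using DERIV_cmult[OF DERIV_inverse_pow[OF that, of n], of c]
      by (simp add: mult.assoc)
    then show "\<exists>f'. ?P f' \<and> (\<forall>x\<in>{x::real. x \<noteq> 0}. (f has_real_derivative f' x) (at x))"
      by (intro exI[of _ "\<lambda>x. (- c * n) * inverse x ^ (Suc n)"]) blast
  qed
qed

lemma smooth_on_divide:
  fixes f g :: "'a::euclidean_space \<Rightarrow> real"
  assumes "open S" "smooth_on S f" "smooth_on S g" "\<And>x. x \<in> S \<Longrightarrow> g x \<noteq> 0"
  shows "smooth_on S (\<lambda>x. f x / g x)"
proof -
  have "open {x::real. x \<noteq> 0}"
    by (rule open_Collect_neq) (auto intro: continuous_intros)
  from smooth_on_compose[OF assms(1) this assms(3) smooth_on_inverse]
  have "smooth_on S (\<lambda>x. inverse (g x))" using assms(4) by simp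
  from smooth_on_mult[OF assms(1,2) this] show ?thesis by (simp add: divide_inverse)
qed

lemma smooth_on_sin_cos: "smooth_on UNIV (\<lambda>x::real. a * sin x + b * cos x)"
proof (rule smooth_on_real_family[of _ "\<lambda>f. \<exists>a b. \<forall>x::real. f x = a * sin x + b * cos x"])
  fix f :: "real \<Rightarrow> real" assume "\<exists>a b. \<forall>x. f x = a * sin x + b * cos x"
  then obtain a b where f: "f = (\<lambda>x. a * sin x + b * cos x)" by blast
  have "(f has_real_derivative (- b) * sin x + a * cos x) (at x)" for x
    unfolding f by (auto intro!: derivative_eq_intros)
  then show "\<exists>f'. (\<exists>a b. \<forall>x. f' x = a * sin x + b * cos x) \<and> (\<forall>x\<in>UNIV. (f has_real_derivative f' x) (at x))"
    by (intro exI[of _ "\<lambda>x. (- b) * sin x + a * cos x"]) blast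
qed auto

text \<open>The function wanted is \<open>flat 0\<close>. The powers of \<open>inverse x\<close> are
  carried along because the derivative of \<open>flat n\<close> is a combination of
  \<open>flat (n + 1)\<close> and \<open>flat (n + 2)\<close>.\<close>

definition flat :: "nat \<Rightarrow> real \<Rightarrow> real" where
  "flat n x = (if x > 0 then inverse x ^ n * exp (- inverse x) else 0)"

text \<open>A single term of the exponential series at \<open>inverse x\<close> gives the bound; its
  second order is what makes the difference quotient at 0 tend to 0.\<close>

lemma flat_bound: "\<bar>flat n x\<bar> \<le> fact (n + 2) * x\<^sup>2"
proof (cases "x > 0")
  case True
  let ?u = "inverse x"
  have u: "?u > 0" using True by simp
  have "?u ^ (n + 2) / fact (n + 2) \<le> exp ?u"
  proof -
    have s: "summable (\<lambda>k. ?u ^ k /\<^sub>R fact k)" by (rule summable_exp_generic)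
    have "(\<Sum>k\<in>{n+2}. ?u ^ k /\<^sub>R fact k) \<le> (\<Sum>k. ?u ^ k /\<^sub>R fact k)"
      using u by (intro sum_le_suminf[OF s]) auto
    then show ?thesis by (simp add: exp_def field_simps)
  qed
  then have "?u ^ (n + 2) * exp (- ?u) \<le> (exp ?u * fact (n + 2)) * exp (- ?u)"
    by (intro mult_right_mono) (simp_all add: divide_le_eq del: power_inverse)
  also have "\<dots> = fact (n + 2)" by (simp add: exp_minus)
  finally have "?u ^ (n + 2) * exp (- ?u) \<le> fact (n + 2)" .
  then have "(?u ^ (n + 2) * exp (- ?u)) * x\<^sup>2 \<le> fact (n + 2) * x\<^sup>2"
    by (rule mult_right_mono) simp
  moreover have "?u ^ (n + 2) * x\<^sup>2 = ?u ^ n"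
    using True by (simp add: power_add power2_eq_square field_simps)
  then have "(?u ^ (n + 2) * exp (- ?u)) * x\<^sup>2 = flat n x"
    using True by (simp add: flat_def mult.assoc mult.commute mult.left_commute)
  moreover have "flat n x \<ge> 0" by (simp add: flat_def)
  ultimately show ?thesis by linarith
qed (simp add: flat_def)

lemma flat_deriv: "(flat n has_real_derivative (- real n * flat (n + 1) x + flat (n + 2) x)) (at x)"
proof -
  consider "x > 0" | "x < 0" | "x = 0" by linarith
  then show ?thesis
  proof cases
    case 1
    have "((\<lambda>x. inverse x ^ n * exp (- inverse x)) has_real_derivative
        (- real n * flat (n + 1) x + flat (n + 2) x)) (at x)"
      using 1
      by (intro DERIV_cong[OF DERIV_mult[OF DERIV_inverse_pow
            DERIV_chain2[OF DERIV_exp DERIV_minus[OF DERIV_inverse]]]])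
        (auto simp: flat_def algebra_simps power2_eq_square)
    then show ?thesis
      by (rule DERIV_cong_ev[THEN iffD1, rotated -1])
        (use 1 eventually_nhds_in_open[of "{0<..}" x] in \<open>auto elim!: eventually_mono simp: flat_def\<close>)
  next
    case 2
    have "((\<lambda>x. 0) has_real_derivative (- real n * flat (n + 1) x + flat (n + 2) x)) (at x)"
      using 2 by (auto simp: flat_def)
    then show ?thesis
      by (rule DERIV_cong_ev[THEN iffD1, rotated -1])
        (use 2 eventually_nhds_in_open[of "{..<0}" x] in \<open>auto elim!: eventually_mono simp: flat_def\<close>)
  next
    case 3
    have "((\<lambda>h. flat n h / h) \<longlongrightarrow> 0) (at 0)"
    proof (rule Lim_null_comparison)
      have "norm (flat n h / h) \<le> fact (n + 2) * \<bar>h\<bar>" if "h \<noteq> 0" for h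
      proof -
        have "norm (flat n h / h) \<le> fact (n + 2) * h\<^sup>2 / \<bar>h\<bar>"
          using flat_bound[of n h] by (simp add: abs_divide divide_right_mono del: fact_Suc)
        also have "\<dots> = fact (n + 2) * \<bar>h\<bar>"
          using that by (metis abs_ge_zero abs_le_zero_iff divide_divide_eq_right mult_cancel_right nonzero_mult_div_cancel_right power2_abs power2_eq_square times_divide_eq_right)
        finally show ?thesis .
      qed
      then show "\<forall>\<^sub>F h in at 0. norm (flat n h / h) \<le> fact (n + 2) * \<bar>h\<bar>"
        by (auto simp: eventually_at_filter)
      show "((\<lambda>h::real. fact (n + 2) * \<bar>h\<bar>) \<longlongrightarrow> 0) (at 0)"
        by (rule tendsto_eq_rhs[OF tendsto_mult[OF tendsto_const tendsto_rabs[OF tendsto_ident_at]]]) simp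
    qed
    then show ?thesis using 3 by (simp add: DERIV_def flat_def)
  qed
qed

lemma smooth_on_flat: "smooth_on UNIV (flat n)"
  unfolding smooth_on_iff_ck
proof
  fix k show "ck k UNIV (flat n)"
  proof (induction k arbitrary: n)
    case 0
    then show ?case using flat_deriv real_differentiable_def by (auto simp: ck_0)
  next
    case (Suc k)
    have "ck k UNIV (\<lambda>x. - real n * flat (n + 1) x + flat (n + 2) x)"
      by (intro ck_add ck_cmult Suc) auto
    then show ?case by (rule has_derivative_real_ck[OF open_UNIV flat_deriv])
  qed
qed

definition cutoff :: "real \<Rightarrow> real" where
  "cutoff x = flat 0 (2 - x) / (flat 0 (2 - x) + flat 0 (x - 1))"

lemma flat0_pos: "x > 0 \<Longrightarrow> flat 0 x > 0" "flat 0 x \<ge> 0" "x \<le> 0 \<Longrightarrow> flat 0 x = 0"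
  by (auto simp: flat_def)

lemma cutoff_simps: "x \<le> 1 \<Longrightarrow> cutoff x = 1" "x \<ge> 2 \<Longrightarrow> cutoff x = 0"
  using flat0_pos(1)[of "2 - x"] by (simp_all add: cutoff_def flat0_pos(3))

lemma smooth_on_cutoff: "smooth_on UNIV cutoff"
proof -
  have a: "smooth_on UNIV (\<lambda>x. flat 0 (2 - x))" "smooth_on UNIV (\<lambda>x. flat 0 (x - 1))"
    by (intro smooth_on_compose[OF open_UNIV open_UNIV _ smooth_on_flat] smooth_on_diff open_UNIV
        smooth_on_const smooth_on_ident; simp)+
  have nz: "flat 0 (2 - x) + flat 0 (x - 1) \<noteq> 0" for x
    using flat0_pos(1)[of "2 - x"] flat0_pos(1)[of "x - 1"] flat0_pos(2)[of "2 - x"] flat0_pos(2)[of "x - 1"]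
    by (cases "x < 2") auto
  have "smooth_on UNIV (\<lambda>x. flat 0 (2 - x) / (flat 0 (2 - x) + flat 0 (x - 1)))"
    by (intro smooth_on_divide smooth_on_add a open_UNIV nz)
  then show ?thesis by (simp add: cutoff_def[abs_def])
qed

section \<open>Symmetry of second derivatives\<close>

lemma has_derivative_along_line:
  fixes f :: "'a::euclidean_space \<Rightarrow> 'b::euclidean_space"
  assumes "f differentiable (at (x + s *\<^sub>R u))"
  shows "((\<lambda>s. f (x + s *\<^sub>R u)) has_vector_derivative fd f (x + s *\<^sub>R u) u) (at s)"
proof -
  have "((\<lambda>s. x + s *\<^sub>R u) has_derivative (\<lambda>h. h *\<^sub>R u)) (at s)"
    by (auto intro!: derivative_eq_intros)
  from has_derivative_compose[OF this fd_works[OF assms]]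
  have "((\<lambda>s. f (x + s *\<^sub>R u)) has_derivative (\<lambda>h. fd f (x + s *\<^sub>R u) (h *\<^sub>R u))) (at s)" .
  moreover have "fd f (x + s *\<^sub>R u) (h *\<^sub>R u) = h *\<^sub>R fd f (x + s *\<^sub>R u) u" for h
    using linear_cmul[OF linear_frechet_derivative[OF assms]] by simp
  ultimately show ?thesis by (simp add: has_vector_derivative_def)
qed

text \<open>The mean value theorem twice: along \<open>u\<close> for the increment of
  \<open>f\<close> in direction \<open>v\<close>, then along \<open>v\<close> for the derivative in
  direction \<open>u\<close>.\<close>

lemma second_difference:
  fixes f :: "'a::euclidean_space \<Rightarrow> real"
  assumes f: "smooth_on S f"
    and S: "\<And>s t. 0 \<le> s \<Longrightarrow> s \<le> h \<Longrightarrow> 0 \<le> t \<Longrightarrow> t \<le> h \<Longrightarrow> x + s *\<^sub>R u + t *\<^sub>R v \<in> S" and h: "h > 0"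
  shows "\<exists>s t. 0 < s \<and> s < h \<and> 0 < t \<and> t < h \<and>
    f (x + h *\<^sub>R u + h *\<^sub>R v) - f (x + h *\<^sub>R u) - f (x + h *\<^sub>R v) + f x =
      h\<^sup>2 * iter_deriv [v, u] f (x + s *\<^sub>R u + t *\<^sub>R v)"
proof -
  let ?g = "\<lambda>s. f (x + h *\<^sub>R v + s *\<^sub>R u) - f (x + s *\<^sub>R u)"
  have d1: "((\<lambda>s. f (x + t *\<^sub>R v + s *\<^sub>R u)) has_real_derivative fd f (x + t *\<^sub>R v + s *\<^sub>R u) u) (at s)"
    if "0 \<le> s" "s \<le> h" "0 \<le> t" "t \<le> h" for s t
    using has_derivative_along_line[of f "x + t *\<^sub>R v" s u] S[OF that]
      smooth_on_differentiable[OF f, of "x + t *\<^sub>R v + s *\<^sub>R u"]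
    by (simp add: has_real_derivative_iff_has_vector_derivative add_ac)
  have "(?g has_real_derivative fd f (x + h *\<^sub>R v + s *\<^sub>R u) u - fd f (x + s *\<^sub>R u) u) (at s)"
    if "0 \<le> s" "s \<le> h" for s
    using DERIV_diff[OF d1[of s h] d1[of s 0]] that h by simp
  from MVT2[OF h this] obtain s where s: "0 < s" "s < h"
    and e1: "?g h - ?g 0 = h * (fd f (x + h *\<^sub>R v + s *\<^sub>R u) u - fd f (x + s *\<^sub>R u) u)"
    by auto
  have "((\<lambda>t. fd f (x + s *\<^sub>R u + t *\<^sub>R v) u) has_real_derivative
      iter_deriv [v, u] f (x + s *\<^sub>R u + t *\<^sub>R v)) (at t)" if "0 \<le> t" "t \<le> h" for t
    using has_derivative_along_line[of "\<lambda>y. fd f y u" "x + s *\<^sub>R u" t v] S[of s t] that s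
      smooth_on_differentiable[OF smooth_on_fd[OF f, of u], of "x + s *\<^sub>R u + t *\<^sub>R v"]
    by (simp add: has_real_derivative_iff_has_vector_derivative add_ac)
  from MVT2[OF h this] obtain t where t: "0 < t" "t < h"
    and e2: "fd f (x + s *\<^sub>R u + h *\<^sub>R v) u - fd f (x + s *\<^sub>R u) u =
      h * iter_deriv [v, u] f (x + s *\<^sub>R u + t *\<^sub>R v)"
    by auto
  have "?g h - ?g 0 = h * (h * iter_deriv [v, u] f (x + s *\<^sub>R u + t *\<^sub>R v))"
    using e1 e2 by (simp add: add_ac)
  then show ?thesis using s t
    by (intro exI[of _ s] exI[of _ t]) (simp add: power2_eq_square add_ac)
qed

text \<open>The second difference is symmetric in \<open>u\<close> and \<open>v\<close>, so it
  equals \<open>h\<^sup>2\<close> times either mixed derivative at points near \<open>x\<close>;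
  continuity of both forces them to agree at \<open>x\<close>.\<close>

lemma iter_deriv_commute_real:
  fixes f :: "'a::euclidean_space \<Rightarrow> real"
  assumes f: "smooth_on S f" and S: "open S" "x \<in> S"
  shows "iter_deriv [u, v] f x = iter_deriv [v, u] f x"
proof (rule ccontr)
  let ?A = "iter_deriv [u, v] f" and ?B = "iter_deriv [v, u] f"
  assume ne: "?A x \<noteq> ?B x"
  define e where "e = \<bar>?A x - ?B x\<bar> / 2"
  have e: "e > 0" using ne by (simp add: e_def)
  have "continuous_on S ?A" "continuous_on S ?B"
    using smooth_on_continuous_on[OF smooth_on_iter_deriv[OF f]] by blast+
  then have "isCont ?A x" "isCont ?B x" using S by (auto simp: continuous_on_eq_continuous_at)
  then obtain d1 d2 where d: "d1 > 0" "\<And>y. dist y x < d1 \<Longrightarrow> dist (?A y) (?A x) < e"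
      "d2 > 0" "\<And>y. dist y x < d2 \<Longrightarrow> dist (?B y) (?B x) < e"
    using e unfolding continuous_at_eps_delta by (metis (no_types, lifting))
  obtain d3 where d3: "d3 > 0" "ball x d3 \<subseteq> S" using S openE by blast
  define d where "d = min d1 (min d2 d3)"
  \<comment> \<open>Keeps the parallelogram spanned by the two increments within
    \<open>d / 2\<close> of \<open>x\<close>; the summand 1 covers vanishing \<open>u\<close> and
    \<open>v\<close>.\<close>
  define h where "h = d / (2 * (norm u + norm v + 1))"
  have dp: "d > 0" using d d3 by (simp add: d_def)
  have np: "norm u + norm v + 1 > 0" by (smt (verit) norm_ge_zero)
  then have h: "h > 0" using dp by (simp add: h_def)
  have near: "dist (x + s *\<^sub>R u + t *\<^sub>R v) x < d" if "0 \<le> s" "s \<le> h" "0 \<le> t" "t \<le> h" for s t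
  proof -
    have "dist (x + s *\<^sub>R u + t *\<^sub>R v) x \<le> s * norm u + t * norm v"
      using norm_triangle_ineq[of "s *\<^sub>R u" "t *\<^sub>R v"] that by (simp add: dist_norm add.assoc)
    also have "\<dots> \<le> h * norm u + h * norm v"
      using that by (intro add_mono mult_right_mono) auto
    also have "\<dots> \<le> h * (norm u + norm v + 1)" using h by (simp add: algebra_simps)
    also have "\<dots> = d / 2" using np unfolding h_def by (metis less_irrefl nonzero_eq_divide_eq times_divide_eq_left
          divide_divide_eq_left mult.commute)
    also have "\<dots> < d" using dp by simp
    finally show ?thesis .
  qed
  have inS: "x + s *\<^sub>R u + t *\<^sub>R v \<in> S" if "0 \<le> s" "s \<le> h" "0 \<le> t" "t \<le> h" for s t
    using near[OF that] d3 by (auto simp: d_def dist_commute subset_iff)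
  obtain s t where st: "0 < s" "s < h" "0 < t" "t < h" and 1:
    "f (x + h *\<^sub>R u + h *\<^sub>R v) - f (x + h *\<^sub>R u) - f (x + h *\<^sub>R v) + f x = h\<^sup>2 * ?B (x + s *\<^sub>R u + t *\<^sub>R v)"
    using second_difference[OF f inS h] by blast
  have inS': "x + s *\<^sub>R v + t *\<^sub>R u \<in> S" if "0 \<le> s" "s \<le> h" "0 \<le> t" "t \<le> h" for s t
    using inS[OF that(3,4,1,2)] by (simp add: add_ac)
  obtain s' t' where st': "0 < s'" "s' < h" "0 < t'" "t' < h" and 2:
    "f (x + h *\<^sub>R v + h *\<^sub>R u) - f (x + h *\<^sub>R v) - f (x + h *\<^sub>R u) + f x = h\<^sup>2 * ?A (x + s' *\<^sub>R v + t' *\<^sub>R u)"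
    using second_difference[OF f inS' h] by blast
  have "x + h *\<^sub>R v + h *\<^sub>R u = x + h *\<^sub>R u + h *\<^sub>R v" by simp
  then have "h\<^sup>2 * ?A (x + s' *\<^sub>R v + t' *\<^sub>R u) = h\<^sup>2 * ?B (x + s *\<^sub>R u + t *\<^sub>R v)"
    using 1 2 by (simp only:)
  then have eq: "?A (x + s' *\<^sub>R v + t' *\<^sub>R u) = ?B (x + s *\<^sub>R u + t *\<^sub>R v)" using h by simp
  have "dist (?A (x + s' *\<^sub>R v + t' *\<^sub>R u)) (?A x) < e"
    by (rule d) (use near[of t' s'] st' in \<open>simp add: d_def add_ac\<close>)
  moreover have "dist (?B (x + s *\<^sub>R u + t *\<^sub>R v)) (?B x) < e"
    by (rule d) (use near[of s t] st in \<open>simp add: d_def\<close>)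
  ultimately show False unfolding eq e_def dist_real_def by (simp add: abs_if split: if_splits)
qed

lemma fd_inner:
  assumes "f differentiable (at x)"
  shows "fd (\<lambda>x. f x \<bullet> b) x v = fd f x v \<bullet> b"
  using fd_eq[OF bounded_linear.has_derivative[OF bounded_linear_inner_left fd_works[OF assms]], of b]
  by simp

lemma iter_deriv_commute:
  assumes f: "smooth_on S f" and S: "open S" "x \<in> S"
  shows "iter_deriv [u, v] f x = iter_deriv [v, u] f x"
proof (rule euclidean_eqI)
  fix b :: 'b assume "b \<in> Basis"
  have *: "iter_deriv [u, v] f x \<bullet> b = iter_deriv [u, v] (\<lambda>x. f x \<bullet> b) x" for u v
  proof -
    have "iter_deriv [u, v] f x \<bullet> b = fd (\<lambda>y. fd f y v \<bullet> b) x u"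
      using fd_inner[OF smooth_on_differentiable[OF smooth_on_fd[OF f] S(2)]] by simp
    also have "\<dots> = fd (\<lambda>y. fd (\<lambda>z. f z \<bullet> b) y v) x u"
      by (rule fun_cong[OF fd_cong[OF S]]) (simp add: fd_inner[OF smooth_on_differentiable[OF f]])
    finally show ?thesis by simp
  qed
  show "iter_deriv [u, v] f x \<bullet> b = iter_deriv [v, u] f x \<bullet> b"
    unfolding * using iter_deriv_commute_real[OF smooth_on_inner_right[OF S(1) f] S] by blast
qed

section \<open>Alternating forms and determinants\<close>

text \<open>A fixed numbering of the basis: determinants below are sums over permutations of
  indices, while the basis of the model space is an unordered set.\<close>

definition eb :: "nat \<Rightarrow> 'e::euclidean_space" where
  "eb = (SOME e. bij_betw e {..<DIM('e)} (Basis :: 'e set))"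

lemma bij_betw_eb: "bij_betw (eb :: nat \<Rightarrow> 'e::euclidean_space) {..<DIM('e)} Basis"
proof -
  have "\<exists>e. bij_betw e {..<DIM('e)} (Basis :: 'e set)"
    using ex_bij_betw_nat_finite[of "Basis :: 'e set"] by (simp add: atLeast0LessThan)
  then show ?thesis unfolding eb_def by (rule someI_ex)
qed

lemma eb_Basis: "i < DIM('e) \<Longrightarrow> (eb i :: 'e::euclidean_space) \<in> Basis"
  using bij_betw_eb bij_betwE by blast

lemma eb_inner:
  "i < DIM('e) \<Longrightarrow> j < DIM('e) \<Longrightarrow> (eb i :: 'e::euclidean_space) \<bullet> eb j = (if i = j then 1 else 0)"
  using bij_betw_eb[where 'e='e] eb_Basis[where 'e='e]
  by (auto simp: inner_Basis bij_betw_def inj_on_def)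

lemma sum_eb: "(\<Sum>i<DIM('e). f (eb i :: 'e::euclidean_space)) = (\<Sum>b\<in>Basis. f b)"
  by (rule sum.reindex_bij_betw[OF bij_betw_eb])

lemma eb_expansion: "(\<Sum>i<DIM('e). (x \<bullet> eb i) *\<^sub>R eb i) = (x :: 'e::euclidean_space)"
  unfolding sum_eb[of "\<lambda>b. (x \<bullet> b) *\<^sub>R b"] by (rule euclidean_representation)

lemma eb_eqI: "(\<And>i. i < DIM('e) \<Longrightarrow> x \<bullet> eb i = y \<bullet> eb i) \<Longrightarrow> x = (y :: 'e::euclidean_space)"
  by (subst (1 2) eb_expansion[symmetric]) simp

text \<open>Arguments are infinite sequences of which only the first \<open>k\<close> entries count,
  in accordance with \<open>wedge\<close>.\<close>

definition altform :: "nat \<Rightarrow> ((nat \<Rightarrow> 'e::real_vector) \<Rightarrow> real) \<Rightarrow> bool" where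
  "altform k F \<longleftrightarrow> (\<forall>v w. (\<forall>i<k. v i = w i) \<longrightarrow> F v = F w) \<and>
    (\<forall>v i. i < k \<longrightarrow> linear (\<lambda>x. F (v(i := x)))) \<and>
    (\<forall>v \<tau>. \<tau> permutes {..<k} \<longrightarrow> F (\<lambda>i. v (\<tau> i)) = of_int (sign \<tau>) * F v)"

lemma altform_cong: "altform k F \<Longrightarrow> (\<And>i. i < k \<Longrightarrow> v i = w i) \<Longrightarrow> F v = F w"
  unfolding altform_def by blast
lemma altform_linear: "altform k F \<Longrightarrow> i < k \<Longrightarrow> linear (\<lambda>x. F (v(i := x)))"
  unfolding altform_def by blast
lemma altform_permute:
  "altform k F \<Longrightarrow> \<tau> permutes {..<k} \<Longrightarrow> F (\<lambda>i. v (\<tau> i)) = of_int (sign \<tau>) * F v"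
  unfolding altform_def by blast

lemma altform_eq_0:
  assumes F: "altform k F" and ij: "i < k" "j < k" "i \<noteq> j" "v i = v j"
  shows "F v = 0"
proof -
  have "F (\<lambda>l. v (Transposition.transpose i j l)) = of_int (sign (Transposition.transpose i j)) * F v"
    using ij by (intro altform_permute[OF F] permutes_swap_id) auto
  moreover have "(\<lambda>l. v (Transposition.transpose i j l)) = v"
    using ij by (auto simp: Transposition.transpose_def fun_eq_iff)
  ultimately show ?thesis using ij by (simp add: sign_swap_id)
qed

lemma altform_pullback:
  assumes "altform k F" "linear T"
  shows "altform k (\<lambda>v. F (\<lambda>i. T (v i)))"
  unfolding altform_def
proof (intro conjI allI impI)
  fix v w :: "nat \<Rightarrow> 'b" assume "\<forall>i<k. v i = w i"
  then show "F (\<lambda>i. T (v i)) = F (\<lambda>i. T (w i))" by (intro altform_cong[OF assms(1)]) simp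
next
  fix v i assume "i < k"
  have "(\<lambda>x. F (\<lambda>l. T ((v(i := x)) l))) = (\<lambda>y. F ((\<lambda>l. T (v l))(i := y))) \<circ> T"
    by (auto intro!: arg_cong[where f=F] simp: fun_eq_iff)
  then show "linear (\<lambda>x. F (\<lambda>l. T ((v(i := x)) l)))"
    using linear_compose[OF assms(2) altform_linear[OF assms(1) \<open>i < k\<close>]] by simp
next
  fix v \<tau> assume "\<tau> permutes {..<k}"
  from altform_permute[OF assms(1) this, of "\<lambda>i. T (v i)"]
  show "F (\<lambda>i. T (v (\<tau> i))) = of_int (sign \<tau>) * F (\<lambda>i. T (v i))" .
qed

text \<open>The Leibniz determinant of the leading \<open>k\<close> by \<open>k\<close> block of an
  infinite array.\<close>

definition ndet :: "nat \<Rightarrow> (nat \<Rightarrow> nat \<Rightarrow> real) \<Rightarrow> real" where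
  "ndet k m = (\<Sum>\<sigma> | \<sigma> permutes {..<k}. of_int (sign \<sigma>) * (\<Prod>i<k. m i (\<sigma> i)))"

lemma ndet_cong: "(\<And>i j. i < k \<Longrightarrow> j < k \<Longrightarrow> m i j = m' i j) \<Longrightarrow> ndet k m = ndet k m'"
  unfolding ndet_def
  by (intro sum.cong refl arg_cong2[where f="(*)"] prod.cong) (auto dest: permutes_in_image)

lemma ndet_diag:
  assumes "\<And>a b. a < k \<Longrightarrow> b < k \<Longrightarrow> a \<noteq> b \<Longrightarrow> m a b = 0"
  shows "ndet k m = (\<Prod>a<k. m a a)"
proof -
  have "ndet k m = (\<Sum>\<sigma>\<in>{id}. of_int (sign \<sigma>) * (\<Prod>i<k. m i (\<sigma> i)))"
    unfolding ndet_def
  proof (rule sum.mono_neutral_right, goal_cases)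
    case 3
    show ?case
    proof
      fix \<sigma> assume "\<sigma> \<in> {\<sigma>. \<sigma> permutes {..<k}} - {id}"
      then have s: "\<sigma> permutes {..<k}" "\<sigma> \<noteq> id" by auto
      then obtain a where "\<sigma> a \<noteq> a" by (auto simp: fun_eq_iff)
      moreover then have "a < k" using s(1) by (metis lessThan_iff permutes_not_in)
      moreover have "\<sigma> a < k" using s(1) \<open>a < k\<close> by (metis lessThan_iff permutes_in_image)
      ultimately have "m a (\<sigma> a) = 0" using assms by metis
      then have "(\<Prod>i<k. m i (\<sigma> i)) = 0" using \<open>a < k\<close> by (intro prod_zero) auto
      then show "of_int (sign \<sigma>) * (\<Prod>i<k. m i (\<sigma> i)) = 0" by simp
    qed
  qed (auto simp: finite_permutations permutes_id)
  then show ?thesis by (simp add: sign_id)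
qed

text \<open>Only the identity and the transposition of \<open>i\<close> and \<open>j\<close> survive
  in the Leibniz sum. It serves rotations in a coordinate plane and the limit matrix in
  \<open>diag_form_asymptotics\<close>.\<close>

lemma ndet_block:
  assumes ij: "i < k" "j < k" "i \<noteq> j"
    and z: "\<And>a b. a < k \<Longrightarrow> b < k \<Longrightarrow> a \<noteq> b \<Longrightarrow> {a, b} \<noteq> {i, j} \<Longrightarrow> m a b = 0"
  shows "ndet k m = (m i i * m j j - m i j * m j i) * (\<Prod>a\<in>{..<k} - {i, j}. m a a)"
proof -
  let ?t = "Transposition.transpose i j"
  have t: "?t permutes {..<k}" using ij by (intro permutes_swap_id) auto
  have neq: "id \<noteq> ?t" using ij by (metis eq_id_iff transpose_apply_first)
  have "ndet k m = (\<Sum>\<sigma>\<in>{id, ?t}. of_int (sign \<sigma>) * (\<Prod>a<k. m a (\<sigma> a)))"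
    unfolding ndet_def
  proof (rule sum.mono_neutral_right, goal_cases)
    case 3
    show ?case
    proof
      fix \<sigma> assume "\<sigma> \<in> {\<sigma>. \<sigma> permutes {..<k}} - {id, ?t}"
      then have s: "\<sigma> permutes {..<k}" "\<sigma> \<noteq> id" "\<sigma> \<noteq> ?t" by auto
      have in_k: "\<sigma> a < k" if "a < k" for a using s(1) that by (metis lessThan_iff permutes_in_image)
      have inj: "\<sigma> a = \<sigma> b \<longleftrightarrow> a = b" for a b using permutes_inj[OF s(1)] by (auto dest: injD)
      have out: "\<sigma> a = a" if "\<not> a < k" for a using s(1) that by (metis lessThan_iff permutes_not_in)
      have "\<exists>a<k. \<sigma> a \<noteq> a \<and> {a, \<sigma> a} \<noteq> {i, j}"
      proof (rule ccontr)
        assume "\<not> ?thesis"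
        then have c: "\<sigma> a = a \<or> {a, \<sigma> a} = {i, j}" for a using out by blast
        have o: "\<sigma> a = a" if "a \<noteq> i" "a \<noteq> j" for a using c[of a] that by auto
        show False
        proof (cases "\<sigma> i = i")
          case True
          then have "\<sigma> j = j" using c[of j] inj[of i j] ij by (auto simp: doubleton_eq_iff)
          then have "\<sigma> x = x" for x using o True by (cases "x = i \<or> x = j") auto
          then have "\<sigma> = id" by (simp add: fun_eq_iff)
          then show False using s by simp
        next
          case False
          then have i: "\<sigma> i = j" using c[of i] by (auto simp: doubleton_eq_iff)
          then have "\<sigma> j = i" using c[of j] inj[of i j] ij by (auto simp: doubleton_eq_iff)
          then have "\<sigma> = ?t" using o i by (auto simp: fun_eq_iff Transposition.transpose_def)
          then show False using s by simp
        qed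
      qed
      then obtain a where a: "a < k" "m a (\<sigma> a) = 0" using z in_k by metis
      then have "(\<Prod>i<k. m i (\<sigma> i)) = 0" by (intro prod_zero) auto
      then show "of_int (sign \<sigma>) * (\<Prod>i<k. m i (\<sigma> i)) = 0" by simp
    qed
  qed (use t in \<open>auto simp: finite_permutations permutes_id\<close>)
  also have "\<dots> = (\<Prod>a<k. m a a) - (\<Prod>a<k. m a (?t a))"
    using neq ij by (simp add: sign_swap_id sign_id)
  also have "(\<Prod>a<k. m a a) = m i i * m j j * (\<Prod>a\<in>{..<k} - {i, j}. m a a)"
    using ij by (subst prod.subset_diff[of "{i, j}"]) auto
  also have "(\<Prod>a<k. m a (?t a)) = m i j * m j i * (\<Prod>a\<in>{..<k} - {i, j}. m a (?t a))"
    using ij by (subst prod.subset_diff[of "{i, j}"]) auto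
  also have "(\<Prod>a\<in>{..<k} - {i, j}. m a (?t a)) = (\<Prod>a\<in>{..<k} - {i, j}. m a a)"
    by (intro prod.cong) (auto simp: Transposition.transpose_def)
  finally show ?thesis by (simp add: algebra_simps)
qed

lemma ndet_transpose: "ndet k (\<lambda>i j. m j i) = ndet k m"
proof -
  have "ndet k (\<lambda>i j. m j i) =
      (\<Sum>\<sigma> | \<sigma> permutes {..<k}. of_int (sign (inv \<sigma>)) * (\<Prod>i<k. m (inv \<sigma> i) i))"
    unfolding ndet_def by (rule sum_permutations_inverse)
  also have "\<dots> = ndet k m"
    unfolding ndet_def
  proof (rule sum.cong[OF refl])
    fix \<sigma> assume "\<sigma> \<in> {\<sigma>. \<sigma> permutes {..<k}}"
    then have s: "\<sigma> permutes {..<k}" by simp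
    have "(\<Prod>i<k. m (inv \<sigma> i) i) = (\<Prod>i<k. m (inv \<sigma> (\<sigma> i)) (\<sigma> i))"
      by (rule prod.permute[OF s, unfolded comp_def])
    also have "\<dots> = (\<Prod>i<k. m i (\<sigma> i))" by (simp add: permutes_inverses[OF s])
    finally show "of_int (sign (inv \<sigma>)) * (\<Prod>i<k. m (inv \<sigma> i) i) =
      of_int (sign \<sigma>) * (\<Prod>i<k. m i (\<sigma> i))"
      using s by (simp add: sign_inverse permutation_permutes[THEN iffD2, OF exI, OF conjI[OF finite_lessThan]])
  qed
  finally show ?thesis .
qed

text \<open>Regards a determinant of pairings as an alternating form in its rows, so that
  multiplicativity of determinants becomes uniqueness of forms of top degree.\<close>

lemma altform_gram:
  fixes B :: "'a::real_vector \<Rightarrow> 'b \<Rightarrow> real"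
  assumes "\<And>y. linear (\<lambda>x. B x y)"
  shows "altform k (\<lambda>u. ndet k (\<lambda>i j. B (u i) (v j)))"
  unfolding altform_def
proof (intro conjI allI impI)
  fix u w :: "nat \<Rightarrow> 'a" assume "\<forall>i<k. u i = w i"
  then show "ndet k (\<lambda>i j. B (u i) (v j)) = ndet k (\<lambda>i j. B (w i) (v j))"
    by (intro ndet_cong) simp
next
  fix u and l :: nat assume l: "l < k"
  have "(\<Prod>i<k. B ((u(l := x)) i) (v (\<sigma> i))) =
      (\<Prod>i\<in>{..<k} - {l}. B (u i) (v (\<sigma> i))) * B x (v (\<sigma> l))" for x \<sigma>
    using l by (subst prod.remove[of _ l]) (auto intro!: prod.cong)
  then have "(\<lambda>x. ndet k (\<lambda>i j. B ((u(l := x)) i) (v j))) = (\<lambda>x. \<Sum>\<sigma> | \<sigma> permutes {..<k}.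
      (of_int (sign \<sigma>) * (\<Prod>i\<in>{..<k} - {l}. B (u i) (v (\<sigma> i)))) *\<^sub>R B x (v (\<sigma> l)))"
    by (simp add: ndet_def mult.assoc)
  moreover have "linear \<dots>"
    by (intro linear_compose_sum ballI linear_compose_scale_right assms)
  ultimately show "linear (\<lambda>x. ndet k (\<lambda>i j. B ((u(l := x)) i) (v j)))" by simp
next
  fix u \<tau> assume t: "\<tau> permutes {..<k}"
  have p: "permutation p" if "p permutes {..<k}" for p using that permutation_permutes by blast
  have "ndet k (\<lambda>i j. B (u (\<tau> i)) (v j)) =
     (\<Sum>\<sigma> | \<sigma> permutes {..<k}. of_int (sign (\<sigma> \<circ> \<tau>)) * (\<Prod>i<k. B (u (\<tau> i)) (v ((\<sigma> \<circ> \<tau>) i))))"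
    unfolding ndet_def by (rule sum_permutations_compose_right[OF t])
  also have "\<dots> = (\<Sum>\<sigma> | \<sigma> permutes {..<k}. of_int (sign \<tau>) * (of_int (sign \<sigma>) * (\<Prod>i<k. B (u i) (v (\<sigma> i)))))"
  proof (rule sum.cong[OF refl])
    fix \<sigma> assume "\<sigma> \<in> {\<sigma>. \<sigma> permutes {..<k}}"
    then have s: "\<sigma> permutes {..<k}" by simp
    have "(\<Prod>i<k. B (u (\<tau> i)) (v ((\<sigma> \<circ> \<tau>) i))) = (\<Prod>i<k. B (u i) (v (\<sigma> i)))"
      using prod.permute[OF t, of "\<lambda>i. B (u i) (v (\<sigma> i))"] by (simp add: comp_def)
    then show "of_int (sign (\<sigma> \<circ> \<tau>)) * (\<Prod>i<k. B (u (\<tau> i)) (v ((\<sigma> \<circ> \<tau>) i))) =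
        of_int (sign \<tau>) * (of_int (sign \<sigma>) * (\<Prod>i<k. B (u i) (v (\<sigma> i))))"
      by (simp add: sign_compose p s t)
  qed
  also have "\<dots> = of_int (sign \<tau>) * ndet k (\<lambda>i j. B (u i) (v j))"
    by (simp add: ndet_def sum_distrib_left)
  finally show "ndet k (\<lambda>i j. B (u (\<tau> i)) (v j)) = of_int (sign \<tau>) * ndet k (\<lambda>i j. B (u i) (v j))" .
qed

text \<open>Three determinants are kept apart because they transform differently:
  \<open>vdet\<close> is the standard volume form, \<open>tdet\<close> is multiplicative, and
  \<open>bdet\<close> picks up the square of \<open>tdet T\<close> when both arguments are
  transformed by \<open>T\<close>.\<close>

definition vdet :: "(nat \<Rightarrow> 'e::euclidean_space) \<Rightarrow> real" where
  "vdet v = ndet DIM('e) (\<lambda>i j. v i \<bullet> eb j)"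

definition tdet :: "('e::euclidean_space \<Rightarrow> 'e) \<Rightarrow> real" where
  "tdet T = vdet (\<lambda>i. T (eb i))"

definition bdet :: "('e::euclidean_space \<Rightarrow> 'e \<Rightarrow> real) \<Rightarrow> real" where
  "bdet B = ndet DIM('e) (\<lambda>i j. B (eb i) (eb j))"

lemma altform_vdet: "altform DIM('e) (vdet :: (nat \<Rightarrow> 'e::euclidean_space) \<Rightarrow> real)"
  unfolding vdet_def by (rule altform_gram) (simp add: bounded_linear.linear bounded_linear_inner_left)

lemma vdet_eb: "vdet (eb :: nat \<Rightarrow> 'e::euclidean_space) = 1"
  unfolding vdet_def by (subst ndet_diag) (simp_all add: eb_inner)

text \<open>Multilinear expansion, by induction on the number \<open>m\<close> of slots already
  replaced by basis vectors.\<close>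

lemma altform_expand:
  fixes F :: "(nat \<Rightarrow> 'e::euclidean_space) \<Rightarrow> real"
  assumes F: "altform k F"
  shows "m \<le> k \<Longrightarrow> F v = (\<Sum>s\<in>PiE {..<m} (\<lambda>_. {..<DIM('e)}).
    (\<Prod>i<m. v i \<bullet> eb (s i)) * F (\<lambda>i. if i < m then eb (s i) else v i))"
proof (induction m)
  case (Suc m)
  let ?N = "DIM('e)"
  have step: "F (\<lambda>i. if i < m then eb (s i) else v i) =
      (\<Sum>a<?N. (v m \<bullet> eb a) * F (\<lambda>i. if i < Suc m then eb ((s(m := a)) i) else v i))" for s
  proof -
    let ?w = "\<lambda>i. if i < m then eb (s i) else v i"
    have l: "linear (\<lambda>x. F (?w(m := x)))" using Suc.prems by (intro altform_linear[OF F]) simp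
    have "F ?w = F (?w(m := (\<Sum>a<?N. (v m \<bullet> eb a) *\<^sub>R eb a)))"
      by (simp add: eb_expansion fun_upd_idem)
    also have "\<dots> = (\<Sum>a<?N. (v m \<bullet> eb a) * F (?w(m := eb a)))"
      using linear_sum[OF l, of "\<lambda>a. (v m \<bullet> eb a) *\<^sub>R eb a" "{..<?N}"]
      by (simp add: linear_cmul[OF l])
    also have "\<dots> = (\<Sum>a<?N. (v m \<bullet> eb a) * F (\<lambda>i. if i < Suc m then eb ((s(m := a)) i) else v i))"
      by (intro sum.cong refl arg_cong2[where f="(*)"] arg_cong[where f=F]) (auto simp: fun_eq_iff)
    finally show ?thesis .
  qed
  let ?g = "\<lambda>s. (\<Prod>i<Suc m. v i \<bullet> eb (s i)) * F (\<lambda>i. if i < Suc m then eb (s i) else v i)"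
  have inj: "inj_on (\<lambda>(y, g). g(m := y)) ({..<?N} \<times> PiE {..<m} (\<lambda>_. {..<?N}))"
    by (rule inj_combinator) simp
  have "(\<Sum>s\<in>PiE {..<Suc m} (\<lambda>_. {..<?N}). ?g s) =
      (\<Sum>s\<in>(\<lambda>(y, g). g(m := y)) ` ({..<?N} \<times> PiE {..<m} (\<lambda>_. {..<?N})). ?g s)"
    by (simp add: lessThan_Suc PiE_insert_eq)
  also have "\<dots> = (\<Sum>(a, s)\<in>{..<?N} \<times> PiE {..<m} (\<lambda>_. {..<?N}). ?g (s(m := a)))"
  proof (subst sum.reindex[OF inj], rule sum.cong[OF refl])
    fix x assume "x \<in> {..<?N} \<times> PiE {..<m} (\<lambda>_. {..<?N})"
    obtain a s where x: "x = (a, s)" by (cases x)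
    show "(?g \<circ> (\<lambda>(y, g). g(m := y))) x = (case x of (a, s) \<Rightarrow> ?g (s(m := a)))"
      unfolding x comp_def case_prod_conv ..
  qed
  also have "\<dots> = (\<Sum>s\<in>PiE {..<m} (\<lambda>_. {..<?N}). \<Sum>a<?N. ?g (s(m := a)))"
    unfolding sum.cartesian_product[symmetric] by (rule sum.swap)
  also have "\<dots> = (\<Sum>s\<in>PiE {..<m} (\<lambda>_. {..<?N}).
      (\<Prod>i<m. v i \<bullet> eb (s i)) * F (\<lambda>i. if i < m then eb (s i) else v i))"
  proof (rule sum.cong[OF refl])
    fix s
    have "(\<Prod>i<m. v i \<bullet> eb ((s(m := a)) i)) = (\<Prod>i<m. v i \<bullet> eb (s i))" for a
      by (intro prod.cong) auto
    then show "(\<Sum>a<?N. ?g (s(m := a))) =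
        (\<Prod>i<m. v i \<bullet> eb (s i)) * F (\<lambda>i. if i < m then eb (s i) else v i)"
      unfolding step sum_distrib_left by (intro sum.cong refl) (simp add: mult_ac)
  qed
  also have "\<dots> = F v" using Suc by simp
  finally show ?case by simp
qed simp

text \<open>Forms of top degree make up a line: in the full expansion an index map that is not
  injective contributes 0, and the others are permutations. \<open>tdet_compose\<close>,
  \<open>bdet_gram\<close> and \<open>wedge_power_tdet\<close> are applications.\<close>

theorem altform_eq_vdet:
  fixes F :: "(nat \<Rightarrow> 'e::euclidean_space) \<Rightarrow> real"
  assumes F: "altform DIM('e) F"
  shows "F v = vdet v * F eb"
proof -
  let ?N = "DIM('e)"
  let ?P = "PiE {..<?N} (\<lambda>_. {..<?N})"
  let ?G = "\<lambda>s. (\<Prod>i<?N. v i \<bullet> eb (s i)) * F (\<lambda>i. eb (s i))"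
  have "F v = (\<Sum>s\<in>?P. (\<Prod>i<?N. v i \<bullet> eb (s i)) * F (\<lambda>i. if i < ?N then eb (s i) else v i))"
    by (rule altform_expand[OF F]) simp
  also have "\<dots> = (\<Sum>s\<in>?P. ?G s)"
    by (intro sum.cong refl arg_cong2[where f="(*)"] altform_cong[OF F]) simp
  \<comment> \<open>Restriction turns a permutation, which is the identity off the index set, into
    an extensional index map.\<close>
  also have "\<dots> = (\<Sum>s\<in>(\<lambda>\<sigma>. restrict \<sigma> {..<?N}) ` {\<sigma>. \<sigma> permutes {..<?N}}. ?G s)"
  proof (rule sum.mono_neutral_right)
    show "(\<lambda>\<sigma>. restrict \<sigma> {..<?N}) ` {\<sigma>. \<sigma> permutes {..<?N}} \<subseteq> ?P"
    proof (rule image_subsetI)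
      fix \<sigma> assume "\<sigma> \<in> {\<sigma>. \<sigma> permutes {..<?N}}"
      then show "restrict \<sigma> {..<?N} \<in> ?P"
        by (intro restrict_PiE_iff[THEN iffD2] ballI) (metis mem_Collect_eq permutes_in_image)
    qed
    show "\<forall>s\<in>?P - (\<lambda>\<sigma>. restrict \<sigma> {..<?N}) ` {\<sigma>. \<sigma> permutes {..<?N}}. ?G s = 0"
    proof
      fix s assume s: "s \<in> ?P - (\<lambda>\<sigma>. restrict \<sigma> {..<?N}) ` {\<sigma>. \<sigma> permutes {..<?N}}"
      have "\<not> inj_on s {..<?N}"
      proof
        assume i: "inj_on s {..<?N}"
        let ?\<sigma> = "\<lambda>i. if i < ?N then s i else i"
        have "s ` {..<?N} \<subseteq> {..<?N}" using s by auto
        then have "s ` {..<?N} = {..<?N}" using i endo_inj_surj by blast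
        then have "bij_betw ?\<sigma> {..<?N} {..<?N}"
          using i bij_betw_cong[of "{..<?N}" s ?\<sigma> "{..<?N}"] unfolding bij_betw_def[of s] by simp
        then have "?\<sigma> permutes {..<?N}" by (intro bij_imp_permutes) auto
        moreover have "s = restrict ?\<sigma> {..<?N}" using s by (auto simp: fun_eq_iff PiE_def extensional_def)
        ultimately show False using s by blast
      qed
      then obtain a b where "a < ?N" "b < ?N" "a \<noteq> b" "s a = s b" by (auto simp: inj_on_def)
      then have "F (\<lambda>i. eb (s i)) = 0" by (intro altform_eq_0[OF F, of a b]) auto
      then show "?G s = 0" by simp
    qed
  qed (auto intro: finite_PiE)
  also have "\<dots> = (\<Sum>\<sigma> | \<sigma> permutes {..<?N}. ?G (restrict \<sigma> {..<?N}))"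
  proof (subst sum.reindex)
    show "inj_on (\<lambda>\<sigma>. restrict \<sigma> {..<?N}) {\<sigma>. \<sigma> permutes {..<?N}}"
    proof (rule inj_onI)
      fix p q assume *: "p \<in> {\<sigma>. \<sigma> permutes {..<?N}}" "q \<in> {\<sigma>. \<sigma> permutes {..<?N}}"
        "restrict p {..<?N} = restrict q {..<?N}"
      show "p = q"
      proof
        fix i show "p i = q i"
        proof (cases "i < ?N")
          case True
          then show ?thesis by (metis *(3) lessThan_iff restrict_apply')
        next
          case False
          then show ?thesis using *(1,2) by (simp add: permutes_def)
        qed
      qed
    qed
  qed simp
  also have "\<dots> = (\<Sum>\<sigma> | \<sigma> permutes {..<?N}. of_int (sign \<sigma>) * (\<Prod>i<?N. v i \<bullet> eb (\<sigma> i)) * F eb)"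
  proof (rule sum.cong[OF refl])
    fix \<sigma> assume "\<sigma> \<in> {\<sigma>. \<sigma> permutes {..<?N}}"
    then have s: "\<sigma> permutes {..<?N}" by simp
    have "F (\<lambda>i. eb (restrict \<sigma> {..<?N} i)) = F (\<lambda>i. eb (\<sigma> i))"
      by (intro altform_cong[OF F]) simp
    also have "\<dots> = of_int (sign \<sigma>) * F eb" by (rule altform_permute[OF F s])
    finally show "?G (restrict \<sigma> {..<?N}) = of_int (sign \<sigma>) * (\<Prod>i<?N. v i \<bullet> eb (\<sigma> i)) * F eb"
      by simp
  qed
  also have "\<dots> = vdet v * F eb" by (simp add: vdet_def ndet_def sum_distrib_right)
  finally show ?thesis .
qed

section \<open>Determinants of linear maps and of bilinear forms\<close>

lemma tdet_compose:
  assumes "linear S"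
  shows "tdet (\<lambda>x. S (T x)) = tdet T * tdet S"
  using altform_eq_vdet[OF altform_pullback[OF altform_vdet assms], of "\<lambda>i. T (eb i)"]
  by (simp add: tdet_def)

lemma tdet_ident: "tdet (\<lambda>x. x) = 1"
  by (simp add: tdet_def vdet_eb)

lemma bdet_gram:
  assumes "bilinear B"
  shows "ndet DIM('e) (\<lambda>i j. B (u i) (v j)) = vdet u * vdet v * bdet (B :: 'e::euclidean_space \<Rightarrow> 'e \<Rightarrow> real)"
proof -
  have l: "linear (\<lambda>x. B x y)" "linear (\<lambda>x. B y x)" for y using assms by (auto simp: bilinear_def)
  have "ndet DIM('e) (\<lambda>i j. B (u i) (v j)) = vdet u * ndet DIM('e) (\<lambda>i j. B (eb i) (v j))"
    by (rule altform_eq_vdet[OF altform_gram[OF l(1)]])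
  also have "ndet DIM('e) (\<lambda>i j. B (eb i) (v j)) = ndet DIM('e) (\<lambda>i j. B (eb j) (v i))"
    by (rule ndet_transpose[symmetric])
  also have "\<dots> = vdet v * ndet DIM('e) (\<lambda>i j. B (eb j) (eb i))"
    by (rule altform_eq_vdet[OF altform_gram[OF l(2)]])
  also have "ndet DIM('e) (\<lambda>i j. B (eb j) (eb i)) = bdet B"
    unfolding bdet_def by (rule ndet_transpose)
  finally show ?thesis by simp
qed

lemma bdet_congruence:
  assumes "bilinear B"
  shows "bdet (\<lambda>u v. B (T u) (T v)) = (tdet T)\<^sup>2 * bdet B"
  unfolding bdet_def[of "\<lambda>u v. B (T u) (T v)"] bdet_gram[OF assms]
  by (simp add: tdet_def power2_eq_square)

text \<open>The components of \<open>x\<close> along the other basis vectors duplicate a vector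
  already present and contribute 0.\<close>

lemma altform_upd:
  assumes F: "altform DIM('e) F" and k: "k < DIM('e)"
  shows "F (eb(k := x)) = (x \<bullet> eb k) * F (eb :: nat \<Rightarrow> 'e::euclidean_space)"
proof -
  have l: "linear (\<lambda>x. F (eb(k := x)))" by (rule altform_linear[OF F k])
  have "F (eb(k := x)) = F (eb(k := (\<Sum>a<DIM('e). (x \<bullet> eb a) *\<^sub>R eb a)))" by (simp add: eb_expansion)
  also have "\<dots> = (\<Sum>a<DIM('e). (x \<bullet> eb a) * F (eb(k := eb a)))"
    using linear_sum[OF l, of "\<lambda>a. (x \<bullet> eb a) *\<^sub>R eb a" "{..<DIM('e)}"]
    by (simp add: linear_cmul[OF l])
  also have "\<dots> = (\<Sum>a<DIM('e). if a = k then (x \<bullet> eb k) * F eb else 0)"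
  proof (intro sum.cong refl)
    fix a assume "a \<in> {..<DIM('e)}"
    then show "(x \<bullet> eb a) * F (eb(k := eb a)) = (if a = k then (x \<bullet> eb k) * F eb else 0)"
      using altform_eq_0[OF F, of a k "eb(k := eb a)"] k by auto
  qed
  also have "\<dots> = (x \<bullet> eb k) * F eb" using k by simp
  finally show ?thesis .
qed

text \<open>Cramer's rule. It is what turns the velocity of a critical point into an algebraic
  expression in jets.\<close>

lemma bdet_cramer:
  assumes "bilinear (B :: 'e::euclidean_space \<Rightarrow> 'e \<Rightarrow> real)" "k < DIM('e)"
  shows "ndet DIM('e) (\<lambda>i j. if i = k then B x (eb j) else B (eb i) (eb j)) = (x \<bullet> eb k) * bdet B"
proof -
  have l: "linear (\<lambda>x. B x y)" for y using assms by (auto simp: bilinear_def)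
  have "ndet DIM('e) (\<lambda>i j. B ((eb(k := x)) i) (eb j)) = (x \<bullet> eb k) * bdet B"
    unfolding bdet_def by (rule altform_upd[OF altform_gram[OF l] assms(2)])
  then show ?thesis by (simp add: if_distrib[where f="\<lambda>x. B x _"] fun_upd_def cong: if_cong)
qed

lemma bdet_nonzero_iff:
  assumes B: "bilinear (B :: 'e::euclidean_space \<Rightarrow> 'e \<Rightarrow> real)"
  shows "bdet B \<noteq> 0 \<longleftrightarrow> (\<forall>x. (\<forall>y. B x y = 0) \<longrightarrow> x = 0)"
proof (intro iffI allI impI)
  fix x assume nz: "bdet B \<noteq> 0" and x: "\<forall>y. B x y = 0"
  show "x = 0"
  proof (rule eb_eqI)
    fix k assume k: "k < DIM('e)"
    have "ndet DIM('e) (\<lambda>i j. if i = k then B x (eb j) else B (eb i) (eb j)) = 0"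
      unfolding ndet_def using k x by (intro sum.neutral ballI) (auto intro!: bexI[of _ k])
    then show "x \<bullet> eb k = 0 \<bullet> eb k" using bdet_cramer[OF B k, of x] nz by simp
  qed
next
  assume nd: "\<forall>x. (\<forall>y. B x y = 0) \<longrightarrow> x = 0"
  have l: "linear (\<lambda>x. B x y)" "linear (\<lambda>x. B y x)" for y using B by (auto simp: bilinear_def)
  let ?T = "\<lambda>x. \<Sum>j<DIM('e). B x (eb j) *\<^sub>R (eb j :: 'e)"
  have Tk: "?T x \<bullet> eb k = B x (eb k)" if "k < DIM('e)" for x k
    using that by (simp add: inner_sum_left eb_inner if_distrib[where f="\<lambda>x. _ * x"] cong: if_cong)
  have lin: "linear ?T"
    by (rule linearI) (auto simp: linear_add[OF l(1)] linear_cmul[OF l(1)] algebra_simps sum.distrib scaleR_sum_right)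
  have "inj ?T"
    unfolding linear_injective_0[OF lin]
  proof safe
    fix x assume z: "?T x = 0"
    have "B x y = 0" for y
    proof -
      have "B x y = B x (\<Sum>j<DIM('e). (y \<bullet> eb j) *\<^sub>R eb j)" by (simp add: eb_expansion)
      also have "\<dots> = (\<Sum>j<DIM('e). (y \<bullet> eb j) * B x (eb j))"
        by (simp add: linear_sum[OF l(2)] linear_cmul[OF l(2)])
      also have "\<dots> = 0" using Tk[of _ x] z by (intro sum.neutral) auto
      finally show ?thesis .
    qed
    then show "x = 0" using nd by blast
  qed
  then have "surj ?T" using lin linear_injective_imp_surjective by blast
  \<comment> \<open>The vectors dual to the basis under \<open>B\<close>: their pairing with the
    basis has determinant 1, and \<open>bdet_gram\<close> makes \<open>bdet B\<close> a factor of
    it.\<close>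
  define u where "u i = inv ?T (eb i)" for i
  have u: "?T (u i) = eb i" for i unfolding u_def by (rule surj_f_inv_f[OF \<open>surj ?T\<close>])
  have "ndet DIM('e) (\<lambda>i j. B (u i) (eb j)) = 1"
  proof (subst ndet_diag)
    fix a b assume "a < DIM('e)" "b < DIM('e)" "a \<noteq> b"
    then show "B (u a) (eb b) = 0" using Tk[of b "u a"] unfolding u by (simp add: eb_inner)
  next
    show "(\<Prod>a<DIM('e). B (u a) (eb a)) = 1"
    proof (intro prod.neutral ballI)
      fix a assume "a \<in> {..<DIM('e)}"
      then show "B (u a) (eb a) = 1" using Tk[of a "u a"] unfolding u by (simp add: eb_inner)
    qed
  qed
  then show "bdet B \<noteq> 0" unfolding bdet_gram[OF B] by auto
qed

text \<open>Makes the definite description in \<open>sgrad\<close> meaningful.\<close>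

lemma nondegenerate_solve:
  assumes B: "bilinear (B :: 'e::euclidean_space \<Rightarrow> 'e \<Rightarrow> real)" and "bdet B \<noteq> 0" and L: "linear L"
  shows "\<exists>!x. \<forall>y. B x y = L y"
proof -
  have nd: "\<And>x. (\<forall>y. B x y = 0) \<Longrightarrow> x = 0" using bdet_nonzero_iff[OF B] assms(2) by blast
  have l: "linear (\<lambda>x. B x y)" "linear (\<lambda>x. B y x)" for y using B by (auto simp: bilinear_def)
  let ?T = "\<lambda>x. \<Sum>b\<in>Basis. B x b *\<^sub>R (b :: 'e)"
  have lin: "linear ?T"
    by (rule linearI) (auto simp: linear_add[OF l(1)] linear_cmul[OF l(1)] algebra_simps sum.distrib scaleR_sum_right)
  have ext: "B x y = L y" if "linear L" "\<And>b. b \<in> Basis \<Longrightarrow> B x b = L b" for x y and L :: "'e \<Rightarrow> real"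
    using linear_eq_stdbasis[OF l(2)[of x] that(1)] that(2) by metis
  have "inj ?T"
    unfolding linear_injective_0[OF lin]
  proof safe
    fix x assume "?T x = 0"
    then have "B x b = 0" if "b \<in> Basis" for b
      using inner_sum_left_Basis[OF that, of "B x"] by simp
    then show "x = 0" using nd ext[of "\<lambda>_. 0" x] linear_zero by blast
  qed
  then have "surj ?T" using lin linear_injective_imp_surjective by blast
  then obtain x where x: "?T x = (\<Sum>b\<in>Basis. L b *\<^sub>R b)" by (rule surjE)(rule that, erule sym)
  have "B x b = L b" if "b \<in> Basis" for b
    using arg_cong[OF x, of "\<lambda>z. z \<bullet> b"] that by (simp add: inner_sum_left_Basis)
  then have 1: "\<forall>y. B x y = L y" using ext[OF L] by blast
  show ?thesis
  proof (rule ex1I, rule 1)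
    fix z assume "\<forall>y. B z y = L y"
    then have "\<forall>y. B (z - x) y = 0" using 1 linear_diff[OF l(1)] by simp
    then show "z = x" using nd[of "z - x"] by simp
  qed
qed

text \<open>The rank one term is added slot by slot. Products with \<open>w\<close> in two slots
  vanish by alternation, so slot \<open>i\<close> adds exactly
  \<open>(eb i \<bullet> p) * (w \<bullet> eb i)\<close>. The derivatives of the straightening map
  and, up to a rotation, of the twist have this shape.\<close>

lemma tdet_rank_one:
  fixes p w :: "'e::euclidean_space"
  shows "tdet (\<lambda>x. x + (x \<bullet> p) *\<^sub>R w) = 1 + w \<bullet> p"
proof -
  let ?N = "DIM('e)"
  define c where "c m i = (if i < m then eb i + (eb i \<bullet> p) *\<^sub>R w else eb i)" for m i
  have upd: "vdet (f(m := x + c *\<^sub>R y)) = vdet (f(m := x)) + c * vdet (f(m := y))"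
    if "m < ?N" for m c x y and f :: "nat \<Rightarrow> 'e"
    using linear_add[OF altform_linear[OF altform_vdet that, of f]]
      linear_cmul[OF altform_linear[OF altform_vdet that, of f]] by simp
  have Suc_c: "c (Suc m) = (c m)(m := eb m + (eb m \<bullet> p) *\<^sub>R w)" for m by (auto simp: fun_eq_iff c_def)
  have same: "(c m)(m := eb m) = c m" for m by (auto simp: fun_eq_iff c_def)
  have slot: "m \<le> j \<Longrightarrow> j < ?N \<Longrightarrow> vdet ((c m)(j := w)) = w \<bullet> eb j" for m j
  proof (induction m)
    case 0
    have "c 0 = eb" by (simp add: c_def fun_eq_iff)
    then show ?case using 0 altform_upd[OF altform_vdet, of j w] by (simp only: vdet_eb mult_1_right)
  next
    case (Suc m)
    have z: "vdet (((c m)(j := w))(m := w)) = 0"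
      using Suc.prems by (intro altform_eq_0[OF altform_vdet, of m j]) auto
    have "(c (Suc m))(j := w) = ((c m)(j := w))(m := eb m + (eb m \<bullet> p) *\<^sub>R w)"
      using Suc.prems by (auto simp: fun_eq_iff c_def)
    moreover have "((c m)(j := w))(m := eb m) = (c m)(j := w)"
      using Suc.prems by (auto simp: fun_eq_iff c_def)
    ultimately show ?case using upd[of m "(c m)(j := w)"] Suc z by (simp del: fun_upd_apply)
  qed
  have "m \<le> ?N \<Longrightarrow> vdet (c m) = 1 + (\<Sum>i<m. (eb i \<bullet> p) * (w \<bullet> eb i))" for m
  proof (induction m)
    case 0
    have "c 0 = eb" by (simp add: c_def fun_eq_iff)
    then show ?case by (simp add: vdet_eb)
  next
    case (Suc m)
    then show ?case unfolding Suc_c using upd[of m "c m"] slot[of m m] by (simp add: same del: fun_upd_apply)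
  qed
  from this[of ?N] have "vdet (c ?N) = 1 + (\<Sum>b\<in>Basis. (b \<bullet> p) * (w \<bullet> b))"
    by (simp add: sum_eb[of "\<lambda>b. (b \<bullet> p) * (w \<bullet> b)"])
  moreover have "(\<Sum>b\<in>Basis. (b \<bullet> p) * (w \<bullet> b)) = w \<bullet> p"
    by (subst euclidean_inner) (simp add: inner_commute mult.commute)
  moreover have "tdet (\<lambda>x. x + (x \<bullet> p) *\<^sub>R w) = vdet (c ?N)"
    unfolding tdet_def by (rule altform_cong[OF altform_vdet]) (simp add: c_def)
  ultimately show ?thesis by simp
qed

section \<open>Wedge products and powers of a 2-form\<close>

lemma altform_wedge:
  assumes a: "altform k \<alpha>" and b: "altform l \<beta>"
  shows "altform (k + l) (wedge k l \<alpha> \<beta>)"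
  unfolding altform_def
proof (intro conjI allI impI)
  fix v w :: "nat \<Rightarrow> 'a" assume vw: "\<forall>i<k + l. v i = w i"
  show "wedge k l \<alpha> \<beta> v = wedge k l \<alpha> \<beta> w"
    unfolding wedge_def
  proof (intro arg_cong2[where f="(/)"] sum.cong refl arg_cong2[where f="(*)"])
    fix \<sigma> assume "\<sigma> \<in> {\<sigma>. \<sigma> permutes {..<k + l}}"
    then have s: "\<sigma> i < k + l" if "i < k + l" for i using that by (metis lessThan_iff mem_Collect_eq permutes_in_image)
    show "\<alpha> (\<lambda>i. v (\<sigma> i)) = \<alpha> (\<lambda>i. w (\<sigma> i))" using s vw by (intro altform_cong[OF a]) simp
    show "\<beta> (\<lambda>i. v (\<sigma> (k + i))) = \<beta> (\<lambda>i. w (\<sigma> (k + i)))" using s vw by (intro altform_cong[OF b]) simp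
  qed
next
  fix v :: "nat \<Rightarrow> 'a" and i assume i: "i < k + l"
  have "linear (\<lambda>x. of_int (sign \<sigma>) * \<alpha> (\<lambda>j. (v(i := x)) (\<sigma> j)) * \<beta> (\<lambda>j. (v(i := x)) (\<sigma> (k + j))))"
    if "\<sigma> permutes {..<k + l}" for \<sigma>
  proof -
    \<comment> \<open>The slot into which \<open>\<sigma>\<close> puts the variable vector; it
      belongs to exactly one of the two factors, which then supplies linearity.\<close>
    define a' where "a' = inv \<sigma> i"
    have s: "\<sigma> j = i \<longleftrightarrow> j = a'" for j
      unfolding a'_def using that by (metis permutes_inverses)
    have a'k: "a' < k + l"
      unfolding a'_def using that i by (metis lessThan_iff permutes_in_image permutes_inv)
    show ?thesis
    proof (cases "a' < k")
      case True
      have 1: "(\<lambda>j. (v(i := x)) (\<sigma> j)) = (\<lambda>j. v (\<sigma> j))(a' := x)" for x by (auto simp: fun_eq_iff s)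
      have 2: "(\<lambda>j. (v(i := x)) (\<sigma> (k + j))) = (\<lambda>j. v (\<sigma> (k + j)))" for x using True by (auto simp: fun_eq_iff s)
      show ?thesis unfolding 1 2
        using linear_compose_scale_right[OF altform_linear[OF a True],
            of "of_int (sign \<sigma>) * \<beta> (\<lambda>j. v (\<sigma> (k + j)))" "\<lambda>j. v (\<sigma> j)"] by (simp add: mult_ac)
    next
      case False
      have 1: "\<alpha> (\<lambda>j. (v(i := x)) (\<sigma> j)) = \<alpha> (\<lambda>j. v (\<sigma> j))" for x
        using False by (intro altform_cong[OF a]) (auto simp: s)
      have 2: "(\<lambda>j. (v(i := x)) (\<sigma> (k + j))) = (\<lambda>j. v (\<sigma> (k + j)))(a' - k := x)" for x
        using False by (auto simp: fun_eq_iff s)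
      have "a' - k < l" using False a'k by simp
      show ?thesis unfolding 1 2
        using linear_compose_scale_right[OF altform_linear[OF b \<open>a' - k < l\<close>],
            of "of_int (sign \<sigma>) * \<alpha> (\<lambda>j. v (\<sigma> j))" "\<lambda>j. v (\<sigma> (k + j))"] by (simp add: mult_ac)
    qed
  qed
  then have "linear (\<lambda>x. (1 / (fact k * fact l)) *\<^sub>R (\<Sum>\<sigma> | \<sigma> permutes {..<k + l}.
      of_int (sign \<sigma>) * \<alpha> (\<lambda>j. (v(i := x)) (\<sigma> j)) * \<beta> (\<lambda>j. (v(i := x)) (\<sigma> (k + j)))))"
    by (intro linear_compose_scale_right linear_compose_sum) blast
  then show "linear (\<lambda>x. wedge k l \<alpha> \<beta> (v(i := x)))" by (simp add: wedge_def)
next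
  fix v :: "nat \<Rightarrow> 'a" and \<tau> assume t: "\<tau> permutes {..<k + l}"
  have p: "permutation p" if "p permutes {..<k + l}" for p using that permutation_permutes by blast
  have "(\<Sum>\<sigma> | \<sigma> permutes {..<k + l}. of_int (sign \<sigma>) * \<alpha> (\<lambda>i. v (\<sigma> i)) * \<beta> (\<lambda>i. v (\<sigma> (k + i)))) =
    (\<Sum>\<sigma> | \<sigma> permutes {..<k + l}. of_int (sign (\<tau> \<circ> \<sigma>)) * \<alpha> (\<lambda>i. v ((\<tau> \<circ> \<sigma>) i)) * \<beta> (\<lambda>i. v ((\<tau> \<circ> \<sigma>) (k + i))))"
    by (rule setum_permutations_compose_left[OF t])
  also have "\<dots> = (\<Sum>\<sigma> | \<sigma> permutes {..<k + l}. of_int (sign \<tau>) *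
      (of_int (sign \<sigma>) * \<alpha> (\<lambda>i. v (\<tau> (\<sigma> i))) * \<beta> (\<lambda>i. v (\<tau> (\<sigma> (k + i))))))"
    by (intro sum.cong refl) (simp add: sign_compose p t)
  finally have e: "(\<Sum>\<sigma> | \<sigma> permutes {..<k + l}. of_int (sign \<sigma>) * \<alpha> (\<lambda>i. v (\<sigma> i)) * \<beta> (\<lambda>i. v (\<sigma> (k + i)))) =
    of_int (sign \<tau>) * (\<Sum>\<sigma> | \<sigma> permutes {..<k + l}.
      of_int (sign \<sigma>) * \<alpha> (\<lambda>i. v (\<tau> (\<sigma> i))) * \<beta> (\<lambda>i. v (\<tau> (\<sigma> (k + i)))))"
    by (simp add: sum_distrib_left)
  have sq: "of_int (sign \<tau>) * (of_int (sign \<tau>) * x) = (x :: real)" for x by (simp add: sign_def)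
  show "wedge k l \<alpha> \<beta> (\<lambda>i. v (\<tau> i)) = of_int (sign \<tau>) * wedge k l \<alpha> \<beta> v"
    unfolding wedge_def e by (simp add: sq)
qed

lemma altform_2:
  assumes "bilinear b" "\<And>u. b u u = 0"
  shows "altform 2 (\<lambda>v. b (v 0) (v (1::nat)))"
  unfolding altform_def
proof (intro conjI allI impI)
  have l: "linear (\<lambda>x. b x y)" "linear (\<lambda>x. b y x)" for y using assms by (auto simp: bilinear_def)
  fix v w :: "nat \<Rightarrow> 'a" and i :: nat and \<tau>
  show "\<forall>i<2. v i = w i \<Longrightarrow> b (v 0) (v 1) = b (w 0) (w 1)" by auto
  show "i < 2 \<Longrightarrow> linear (\<lambda>x. b ((v(i := x)) 0) ((v(i := x)) 1))"
    using l by (cases "i = 0") (auto simp: less_2_cases_iff)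
  assume t: "\<tau> permutes {..<2::nat}"
  have anti: "b x y = - b y x" for x y
  proof -
    have "b (x + y) (x + y) = b x x + b x y + (b y x + b y y)"
      by (simp add: linear_add[OF l(1)] linear_add[OF l(2)])
    then show ?thesis using assms(2) by simp
  qed
  have r: "\<tau> 0 < 2" "\<tau> 1 < 2" using t by (metis lessThan_iff permutes_in_image zero_less_numeral one_less_numeral_iff semiring_norm(76))+
  have o: "\<tau> j = j" if "j \<noteq> 0" "j \<noteq> 1" for j using t that by (auto simp: permutes_def)
  have ne: "\<tau> 0 \<noteq> \<tau> 1" using permutes_inj[OF t] by (auto dest: injD)
  show "b (v (\<tau> 0)) (v (\<tau> 1)) = of_int (sign \<tau>) * b (v 0) (v 1)"
  proof (cases "\<tau> 0 = 0")
    case True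
    then have "\<tau> 1 = 1" using r ne by auto
    then have "\<tau> x = x" for x using True o by (cases "x = 0 \<or> x = 1") auto
    then have "\<tau> = id" by (simp add: fun_eq_iff)
    then show ?thesis by (simp add: sign_id)
  next
    case False
    then have "\<tau> 0 = 1" "\<tau> 1 = 0" using r ne by auto
    moreover from this have "\<tau> = Transposition.transpose 0 1" using o by (auto simp: fun_eq_iff Transposition.transpose_def)
    ultimately show ?thesis using anti[of "v 1" "v 0"] by (simp add: sign_swap_id)
  qed
qed

lemma altform_wedge_power:
  assumes "bilinear b" "\<And>u. b u u = 0"
  shows "altform (2 * n) (wedge_power b n)"
proof (induction n)
  case 0
  show ?case unfolding altform_def
    by (auto simp: linear_iff permutes_empty sign_id)
next
  case (Suc n)
  from altform_wedge[OF altform_2[OF assms] this] show ?case by simp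
qed

lemma wedge_power_pullback:
  "wedge_power (\<lambda>u v. b (T u) (T v)) n v = wedge_power b n (\<lambda>i. T (v i))"
  by (induction n arbitrary: v) (simp_all add: wedge_def)

text \<open>Reduces the pullback of a top power to one scalar identity between the densities
  \<open>wedge_power b n eb\<close>. This is the identity that the twist is built to
  satisfy.\<close>

lemma wedge_power_tdet:
  assumes b: "bilinear b" "\<And>u. b u u = 0" and "bilinear b'" "\<And>u. b' u u = 0"
    and n: "DIM('e::euclidean_space) = 2 * n" and T: "linear (T :: 'e \<Rightarrow> 'e)"
    and eq: "tdet T * wedge_power b n eb = wedge_power b' n eb"
  shows "wedge_power b n (\<lambda>i. T (v i)) = wedge_power b' n v"
proof -
  have F: "altform DIM('e) (wedge_power b n)" "altform DIM('e) (wedge_power b' n)"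
    unfolding n using altform_wedge_power assms by blast+
  have "wedge_power b n (\<lambda>i. T (v i)) = vdet v * wedge_power b n (\<lambda>i. T (eb i))"
    by (rule altform_eq_vdet[OF altform_pullback[OF F(1) T]])
  also have "wedge_power b n (\<lambda>i. T (eb i)) = tdet T * wedge_power b n eb"
    unfolding tdet_def by (rule altform_eq_vdet[OF F(1)])
  finally show ?thesis using altform_eq_vdet[OF F(2), of v] eq by simp
qed

section \<open>Hamiltonian flows preserve the symplectic form\<close>

lemma bilinear_expand:
  assumes "bilinear (B :: 'e::euclidean_space \<Rightarrow> 'e \<Rightarrow> real)"
  shows "B a b = (\<Sum>i\<in>Basis. \<Sum>j\<in>Basis. ((a \<bullet> i) * (b \<bullet> j)) * B i j)"
proof -
  have "B a b = B (\<Sum>i\<in>Basis. (a \<bullet> i) *\<^sub>R i) (\<Sum>j\<in>Basis. (b \<bullet> j) *\<^sub>R j)"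
    by (simp add: euclidean_representation)
  also have "\<dots> = (\<Sum>(i, j)\<in>Basis \<times> Basis. B ((a \<bullet> i) *\<^sub>R i) ((b \<bullet> j) *\<^sub>R j))"
    by (rule bilinear_sum[OF assms])
  also have "\<dots> = (\<Sum>i\<in>Basis. \<Sum>j\<in>Basis. ((a \<bullet> i) * (b \<bullet> j)) * B i j)"
    by (simp add: sum.cartesian_product bilinear_lmul[OF assms] bilinear_rmul[OF assms] mult_ac)
  finally show ?thesis .
qed

text \<open>The product rule in the base point and both vectors. Smoothness of the form is given for
  constant vectors only, so it is first expanded in the basis.\<close>

lemma has_derivative_form:
  fixes w :: "'e::euclidean_space \<Rightarrow> 'e \<Rightarrow> 'e \<Rightarrow> real"
  assumes V: "open V" "z s \<in> V" and bil: "\<And>y. y \<in> V \<Longrightarrow> bilinear (w y)"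
    and sm: "\<And>u v. smooth_on V (\<lambda>y. w y u v)"
    and z: "(z has_derivative z') (at s)" and a: "(a has_derivative a') (at s)"
    and b: "(b has_derivative b') (at s)"
  shows "((\<lambda>s. w (z s) (a s) (b s)) has_derivative
    (\<lambda>h. fd (\<lambda>y. w y (a s) (b s)) (z s) (z' h) + w (z s) (a' h) (b s) + w (z s) (a s) (b' h))) (at s)"
proof -
  have dw: "((\<lambda>y. w y u v) has_derivative fd (\<lambda>y. w y u v) (z s)) (at (z s))" for u v
    using fd_works[OF smooth_on_differentiable[OF sm V(2)]] .
  have fdw: "fd (\<lambda>y. w y u v) (z s) k =
      (\<Sum>i\<in>Basis. \<Sum>j\<in>Basis. ((u \<bullet> i) * (v \<bullet> j)) * fd (\<lambda>y. w y i j) (z s) k)" for u v k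
  proof -
    have "((\<lambda>y. \<Sum>i\<in>Basis. \<Sum>j\<in>Basis. ((u \<bullet> i) * (v \<bullet> j)) * w y i j) has_derivative
      (\<lambda>k. \<Sum>i\<in>Basis. \<Sum>j\<in>Basis. ((u \<bullet> i) * (v \<bullet> j)) * fd (\<lambda>y. w y i j) (z s) k)) (at (z s))"
      by (intro has_derivative_sum has_derivative_mult_right dw)
    then have "((\<lambda>y. w y u v) has_derivative
      (\<lambda>k. \<Sum>i\<in>Basis. \<Sum>j\<in>Basis. ((u \<bullet> i) * (v \<bullet> j)) * fd (\<lambda>y. w y i j) (z s) k)) (at (z s))"
      by (rule has_derivative_transform_within_open[OF _ V]) (simp add: bilinear_expand[OF bil, symmetric])
    then show ?thesis by (simp add: fd_eq)
  qed
  have "isCont z s" using z has_derivative_continuous by blast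
  then have ev: "\<forall>\<^sub>F r in at s. z r \<in> V"
    unfolding isCont_def by (rule topological_tendstoD[OF _ V])
  have "((\<lambda>s. \<Sum>i\<in>Basis. \<Sum>j\<in>Basis. ((a s \<bullet> i) * (b s \<bullet> j)) * w (z s) i j) has_derivative
    (\<lambda>h. \<Sum>i\<in>Basis. \<Sum>j\<in>Basis. ((a s \<bullet> i) * (b s \<bullet> j)) * fd (\<lambda>y. w y i j) (z s) (z' h) +
      ((a s \<bullet> i) * (b' h \<bullet> j) + (a' h \<bullet> i) * (b s \<bullet> j)) * w (z s) i j)) (at s)"
    by (rule has_derivative_sum[OF has_derivative_sum[OF
        has_derivative_mult[OF has_derivative_mult[OF has_derivative_inner_left[OF a] has_derivative_inner_left[OF b]]
          has_derivative_compose[OF z dw]]]])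
  moreover have "(\<Sum>i\<in>Basis. \<Sum>j\<in>Basis. ((a s \<bullet> i) * (b s \<bullet> j)) * fd (\<lambda>y. w y i j) (z s) (z' h) +
      ((a s \<bullet> i) * (b' h \<bullet> j) + (a' h \<bullet> i) * (b s \<bullet> j)) * w (z s) i j) =
    fd (\<lambda>y. w y (a s) (b s)) (z s) (z' h) + w (z s) (a' h) (b s) + w (z s) (a s) (b' h)" for h
    unfolding fdw[of "a s" "b s"] bilinear_expand[OF bil[OF V(2)], of "a' h" "b s"]
      bilinear_expand[OF bil[OF V(2)], of "a s" "b' h"]
    by (simp add: sum.distrib algebra_simps)
  ultimately have "((\<lambda>s. \<Sum>i\<in>Basis. \<Sum>j\<in>Basis. ((a s \<bullet> i) * (b s \<bullet> j)) * w (z s) i j) has_derivative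
    (\<lambda>h. fd (\<lambda>y. w y (a s) (b s)) (z s) (z' h) + w (z s) (a' h) (b s) + w (z s) (a s) (b' h))) (at s)"
    by simp
  then show ?thesis
  proof (rule has_derivative_transform_eventually)
    show "\<forall>\<^sub>F r in at s. (\<Sum>i\<in>Basis. \<Sum>j\<in>Basis. ((a r \<bullet> i) * (b r \<bullet> j)) * w (z r) i j) = w (z r) (a r) (b r)"
      using ev by (rule eventually_mono) (simp add: bilinear_expand[OF bil, symmetric])
  qed (use V in \<open>simp_all add: bilinear_expand[OF bil, symmetric]\<close>)
qed

lemma fd_partial_snd:
  assumes "\<psi> differentiable (at (t, y))"
  shows "((\<lambda>y. \<psi> (t, y)) has_derivative (\<lambda>u. fd \<psi> (t, y) (0, u))) (at y)"
  by (rule has_derivative_compose[of "\<lambda>y. (t, y)" "\<lambda>u. (0, u)" y UNIV \<psi> "fd \<psi> (t, y)"])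
    (auto intro!: derivative_eq_intros fd_works assms)

lemma fd_partial_fst:
  fixes \<psi> :: "real \<times> 'a::euclidean_space \<Rightarrow> 'b::euclidean_space"
  assumes "\<psi> differentiable (at (t, y))"
  shows "((\<lambda>t. \<psi> (t, y)) has_vector_derivative fd \<psi> (t, y) (1, 0)) (at t)"
proof -
  have 1: "((\<lambda>t. \<psi> (t, y)) has_derivative (\<lambda>h. fd \<psi> (t, y) (h, 0))) (at t)"
    by (rule has_derivative_compose[of "\<lambda>t. (t, y)" "\<lambda>h. (h, 0)" t UNIV \<psi> "fd \<psi> (t, y)"])
      (auto intro!: derivative_eq_intros fd_works assms)
  have 2: "(\<lambda>h. fd \<psi> (t, y) (h, 0)) = (\<lambda>h. h *\<^sub>R fd \<psi> (t, y) (1, 0))"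
  proof
    fix h :: real
    have "fd \<psi> (t, y) (h, 0) = fd \<psi> (t, y) (h *\<^sub>R (1, 0))" by simp
    also have "\<dots> = h *\<^sub>R fd \<psi> (t, y) (1, 0)"
      by (rule linear_cmul[OF linear_frechet_derivative[OF assms]])
    finally show "fd \<psi> (t, y) (h, 0) = h *\<^sub>R fd \<psi> (t, y) (1, 0)" .
  qed
  show ?thesis unfolding has_vector_derivative_def by (rule has_derivative_eq_rhs[OF 1 2])
qed

text \<open>Differentiating Hamilton's equation in space and using \<open>d\<omega> = 0\<close> gives
  \<open>d/dt (\<psi>\<^sub>t\<^sup>* \<omega>) = 0\<close>; no smoothness of the symplectic gradient itself is needed.\<close>

lemma hamilton_pullback_constant:
  fixes w :: "'e::euclidean_space \<Rightarrow> 'e \<Rightarrow> 'e \<Rightarrow> real" and \<psi> :: "real \<times> 'e \<Rightarrow> 'e"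
  assumes O: "open O'" "(t, y) \<in> O'" and V: "open V" and \<psi>: "smooth_on O' \<psi>"
    and OV: "\<And>q. q \<in> O' \<Longrightarrow> \<psi> q \<in> V"
    and bil: "\<And>z. z \<in> V \<Longrightarrow> bilinear (w z)" and alt: "\<And>z u. z \<in> V \<Longrightarrow> w z u u = 0"
    and sm: "\<And>u v. smooth_on V (\<lambda>z. w z u v)"
    and closed: "\<And>z a b c. z \<in> V \<Longrightarrow> ext_deriv2 w z a b c = 0"
    and f: "smooth_on (UNIV \<times> V) f"
    and ham: "\<And>q b. q \<in> O' \<Longrightarrow> w (\<psi> q) (fd \<psi> q (1, 0)) b = fd f (fst q, \<psi> q) (0, b)"
  shows "((\<lambda>s. w (\<psi> (s, y)) (fd \<psi> (s, y) (0, u)) (fd \<psi> (s, y) (0, v))) has_real_derivative 0) (at t)"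
proof -
  define q where "q = (t, y)"
  have q: "q \<in> O'" using O by (simp add: q_def)
  define z where "z = \<psi> q"
  have zV: "z \<in> V" using OV[OF q] by (simp add: z_def)
  define P where "P u p = fd \<psi> p (0, u)" for u p
  define Q where "Q p = fd \<psi> p (1, 0)" for p
  have dpsi: "(\<psi> has_derivative fd \<psi> q) (at q)" by (rule fd_works[OF smooth_on_differentiable[OF \<psi> q]])
  have dP: "(P u has_derivative fd (P u) q) (at q)" for u
    unfolding P_def by (rule fd_works[OF smooth_on_differentiable[OF smooth_on_fd[OF \<psi>] q]])
  have dQ: "(Q has_derivative fd Q q) (at q)"
    unfolding Q_def by (rule fd_works[OF smooth_on_differentiable[OF smooth_on_fd[OF \<psi>] q]])
  \<comment> \<open>Mixed derivatives of the flow: the variation of its velocity in direction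
    \<open>u\<close> is the rate of change of the transported vector \<open>P u\<close>.\<close>
  have swap: "fd Q q (0, u) = fd (P u) q (1, 0)" for u
    using iter_deriv_commute[OF \<psi> O(1) q, of "(0, u)" "(1, 0)"] by (simp add: Q_def[abs_def] P_def[abs_def])
  have V': "open (UNIV \<times> V :: (real \<times> 'e) set)" using V by (simp add: open_Times)
  have key: "w z (fd (P u) q (1, 0)) b =
      iter_deriv [(0, P u q), (0, b)] f (t, z) - fd (\<lambda>z. w z (Q q) b) z (P u q)" for u b
  proof -
    have 1: "((\<lambda>p. w (\<psi> p) (Q p) b) has_derivative
      (\<lambda>h. fd (\<lambda>z. w z (Q q) b) z (fd \<psi> q h) + w z (fd Q q h) b + w z (Q q) 0)) (at q)"
      unfolding z_def
      by (rule has_derivative_form[OF V OV[OF q] bil sm dpsi dQ]) auto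
    let ?g = "\<lambda>p. fd f p (0, b)"
    have tz: "(t, z) \<in> UNIV \<times> V" using zV by simp
    have "((\<lambda>p. (fst p, \<psi> p)) has_derivative (\<lambda>h. (fst h, fd \<psi> q h))) (at q)"
      by (intro has_derivative_Pair has_derivative_fst has_derivative_ident dpsi)
    from has_derivative_compose[OF this, of ?g "fd ?g (t, z)"]
      fd_works[OF smooth_on_differentiable[OF smooth_on_fd[OF f] tz]]
    have "((\<lambda>p. ?g (fst p, \<psi> p)) has_derivative (\<lambda>h. fd ?g (t, z) (fst h, fd \<psi> q h))) (at q)"
      by (simp add: z_def q_def)
    then have 2: "((\<lambda>p. w (\<psi> p) (Q p) b) has_derivative (\<lambda>h. fd ?g (t, z) (fst h, fd \<psi> q h))) (at q)"
      by (rule has_derivative_transform_within_open[OF _ O(1) q]) (simp add: ham Q_def)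
    have "w z (Q q) 0 = 0" using bilinear_rzero[OF bil[OF zV]] by simp
    then have "fd (\<lambda>z. w z (Q q) b) z (fd \<psi> q h) + w z (fd Q q h) b = fd ?g (t, z) (fst h, fd \<psi> q h)" for h
      using fun_cong[OF has_derivative_unique[OF 1 2], of h] by simp
    from this[of "(0, u)"] show ?thesis unfolding swap[symmetric] by (simp add: P_def)
  qed
  have dline: "((\<lambda>s. g (s, y)) has_derivative (\<lambda>h. g' (h, 0))) (at t)"
    if "(g has_derivative g') (at q)" for g :: "real \<times> 'e \<Rightarrow> 'e" and g'
    using that unfolding q_def
    by (rule has_derivative_compose[rotated]) (auto intro!: derivative_eq_intros)
  have anti: "w z a b = - w z b a" for a b
  proof -
    have "w z (a + b) (a + b) = w z a a + w z a b + (w z b a + w z b b)"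
      by (simp add: bilinear_ladd[OF bil[OF zV]] bilinear_radd[OF bil[OF zV]])
    then show ?thesis using alt[OF zV] by simp
  qed
  have "((\<lambda>s. w (\<psi> (s, y)) (P u (s, y)) (P v (s, y))) has_derivative
    (\<lambda>h. fd (\<lambda>z. w z (P u q) (P v q)) z (fd \<psi> q (h, 0)) + w z (fd (P u) q (h, 0)) (P v q) +
       w z (P u q) (fd (P v) q (h, 0)))) (at t)"
    using has_derivative_form[OF V _ bil sm dline[OF dpsi] dline[OF dP[of u]] dline[OF dP[of v]]] zV
    by (simp add: z_def q_def)
  moreover have "fd (\<lambda>z. w z (P u q) (P v q)) z (fd \<psi> q (h, 0)) + w z (fd (P u) q (h, 0)) (P v q) +
       w z (P u q) (fd (P v) q (h, 0)) = 0" for h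
  proof -
    have l: "fd g q (h, 0) = h *\<^sub>R fd g q (1, 0)" if "(g has_derivative fd g q) (at q)"
      for g :: "real \<times> 'e \<Rightarrow> 'e"
      using linear_cmul[OF has_derivative_linear[OF that], of h "(1, 0)"] by simp
    have lw: "fd (\<lambda>z. w z (P u q) (P v q)) z (h *\<^sub>R k) = h * fd (\<lambda>z. w z (P u q) (P v q)) z k" for k
      using linear_cmul[OF linear_frechet_derivative[OF smooth_on_differentiable[OF sm zV]]] by simp
    \<comment> \<open>The two second derivatives of \<open>f\<close> cancel by symmetry, and what
      remains is the exterior derivative on \<open>Q q\<close>, \<open>P u q\<close>,
      \<open>P v q\<close>.\<close>
    have comm: "iter_deriv [(0, P u q), (0, P v q)] f (t, z) = iter_deriv [(0, P v q), (0, P u q)] f (t, z)"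
      by (rule iter_deriv_commute[OF f V']) (use zV in simp)
    have "fd (\<lambda>z. w z (P u q) (P v q)) z (Q q) + w z (fd (P u) q (1, 0)) (P v q) +
       w z (P u q) (fd (P v) q (1, 0)) = ext_deriv2 w z (Q q) (P u q) (P v q)"
      unfolding anti[of "P u q"] key comm ext_deriv2_def by simp
    also have "\<dots> = 0" by (rule closed[OF zV])
    finally have e: "fd (\<lambda>z. w z (P u q) (P v q)) z (Q q) + w z (fd (P u) q (1, 0)) (P v q) +
       w z (P u q) (fd (P v) q (1, 0)) = 0" .
    show ?thesis
      unfolding l[OF dpsi] l[OF dP] lw bilinear_lmul[OF bil[OF zV]] bilinear_rmul[OF bil[OF zV]]
      using arg_cong[OF e, of "\<lambda>x. h * x"] by (simp add: Q_def algebra_simps)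
  qed
  ultimately have "((\<lambda>s. w (\<psi> (s, y)) (P u (s, y)) (P v (s, y))) has_derivative (\<lambda>h. 0)) (at t)" by simp
  then show ?thesis by (simp add: P_def has_field_derivative_def lambda_zero)
qed

section \<open>Charts and local representatives on a symplectic manifold\<close>

locale symplectic_manifold =
  fixes X :: "'x topology" and A :: "('x, 'e::euclidean_space) chart set" and \<omega> :: "('x, 'e) two_form"
  assumes mfd: "smooth_manifold X A" and sympl: "symplectic_form A \<omega>"
begin

lemma chart:
  assumes "c \<in> A"
  shows "openin X (fst c)" "open (chart_img c)" "fst c \<subseteq> topspace X" "inj_on (snd c) (fst c)"
    "homeomorphic_map (subtopology X (fst c)) (top_of_set (chart_img c)) (snd c)"
proof -
  have "is_chart X c" using mfd assms by (auto simp: smooth_manifold_def smooth_atlas_def)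
  then show "openin X (fst c)" "open (chart_img c)"
    and h: "homeomorphic_map (subtopology X (fst c)) (top_of_set (chart_img c)) (snd c)"
    by (auto simp: is_chart_def)
  then show s: "fst c \<subseteq> topspace X" using openin_subset by blast
  show "inj_on (snd c) (fst c)"
    using homeomorphic_imp_injective_map[OF h] s by (simp add: topspace_subtopology inf_absorb2)
qed

lemma chart_inv:
  assumes "c \<in> A"
  shows "x \<in> fst c \<Longrightarrow> chart_inv c (snd c x) = x"
    "y \<in> chart_img c \<Longrightarrow> snd c (chart_inv c y) = y"
    "y \<in> chart_img c \<Longrightarrow> chart_inv c y \<in> fst c" "x \<in> fst c \<Longrightarrow> snd c x \<in> chart_img c"
  using chart(4)[OF assms]
  by (auto simp: chart_inv_def chart_img_def inv_into_into f_inv_into_f)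

lemma cover: "x \<in> topspace X \<Longrightarrow> \<exists>c\<in>A. x \<in> fst c"
  using mfd by (auto simp: smooth_manifold_def smooth_atlas_def)

lemma transition_smooth:
  "c \<in> A \<Longrightarrow> d \<in> A \<Longrightarrow> smooth_on (snd c ` (fst c \<inter> fst d)) (snd d \<circ> chart_inv c)"
  using mfd by (simp add: smooth_manifold_def smooth_atlas_def)

lemma continuous_map_chart:
  assumes "c \<in> A" shows "continuous_map (subtopology X (fst c)) euclidean (snd c)"
  using homeomorphic_imp_continuous_map[OF chart(5)[OF assms]] by (simp add: continuous_map_in_subtopology)

lemma continuous_map_chart_inv:
  assumes "c \<in> A" shows "continuous_map (top_of_set (chart_img c)) X (chart_inv c)"
proof -
  obtain g where g: "homeomorphic_maps (subtopology X (fst c)) (top_of_set (chart_img c)) (snd c) g"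
    using chart(5)[OF assms] homeomorphic_map_maps by blast
  then have "continuous_map (top_of_set (chart_img c)) X g"
    by (simp add: homeomorphic_maps_def continuous_map_in_subtopology)
  moreover have "g y = chart_inv c y" if y: "y \<in> chart_img c" for y
  proof -
    obtain x where x: "x \<in> fst c" "y = snd c x" using y unfolding chart_img_def by blast
    then have "g y = x" using g chart(3)[OF assms] by (auto simp: homeomorphic_maps_def)
    then show ?thesis using x chart_inv(1)[OF assms] by simp
  qed
  ultimately show ?thesis by (rule continuous_map_eq) simp
qed

lemma open_chart_preimage:
  assumes c: "c \<in> A" and U: "openin X U"
  shows "open {y \<in> chart_img c. chart_inv c y \<in> U}"
proof -
  have "openin (top_of_set (chart_img c)) {y \<in> chart_img c. chart_inv c y \<in> U}"
    using openin_continuous_map_preimage[OF continuous_map_chart_inv[OF c] U] by simp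
  then show ?thesis using chart(2)[OF c] by (simp add: openin_open_eq)
qed

lemma openin_chart_preimage:
  assumes c: "c \<in> A" and U: "open U"
  shows "openin X {x \<in> fst c. snd c x \<in> U}"
proof -
  have "openin (subtopology X (fst c)) {x \<in> topspace (subtopology X (fst c)). snd c x \<in> U}"
    by (rule openin_continuous_map_preimage[OF continuous_map_chart[OF c]]) (simp add: U)
  moreover have "{x \<in> topspace (subtopology X (fst c)). snd c x \<in> U} = {x \<in> fst c. snd c x \<in> U}"
    using chart(3)[OF c] by auto
  ultimately show ?thesis using chart(1)[OF c] by (simp add: openin_open_subtopology)
qed

lemma chart_image_eq:
  assumes c: "c \<in> A"
  shows "snd c ` {x \<in> fst c. P x} = {y \<in> chart_img c. P (chart_inv c y)}"
proof (intro set_eqI iffI)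
  fix y assume "y \<in> {y \<in> chart_img c. P (chart_inv c y)}"
  then show "y \<in> snd c ` {x \<in> fst c. P x}"
    using chart_inv[OF c] by (intro image_eqI[of _ _ "chart_inv c y"]) auto
next
  fix y assume "y \<in> snd c ` {x \<in> fst c. P x}"
  then obtain x where "x \<in> fst c" "P x" "y = snd c x" by blast
  then show "y \<in> {y \<in> chart_img c. P (chart_inv c y)}" using chart_inv(1,4)[OF c, of x] by simp
qed

lemma form:
  assumes "c \<in> A"
  shows "y \<in> chart_img c \<Longrightarrow> bilinear (\<omega> c y)" "y \<in> chart_img c \<Longrightarrow> \<omega> c y u u = 0"
    "smooth_on (chart_img c) (\<lambda>y. \<omega> c y u v)"
    "y \<in> chart_img c \<Longrightarrow> ext_deriv2 (\<omega> c) y u v w = 0"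
    "y \<in> chart_img c \<Longrightarrow> bdet (\<omega> c y) \<noteq> 0"
proof -
  show b: "y \<in> chart_img c \<Longrightarrow> bilinear (\<omega> c y)" for y
    using sympl assms by (simp add: symplectic_form_def smooth_two_form_def)
  show "y \<in> chart_img c \<Longrightarrow> bdet (\<omega> c y) \<noteq> 0"
    using bdet_nonzero_iff[OF b] sympl assms by (simp add: symplectic_form_def)
qed (use sympl assms in \<open>simp_all add: symplectic_form_def smooth_two_form_def\<close>)

lemma form_transition:
  assumes "c \<in> A" "d \<in> A" "x \<in> fst c" "x \<in> fst d"
  shows "\<omega> c (snd c x) u v = \<omega> d (snd d x) (tangent_map c d id x u) (tangent_map c d id x v)"
  using sympl assms unfolding symplectic_form_def smooth_two_form_def by blast

definition rep :: "('x, 'e) chart \<Rightarrow> ('x, 'e) chart \<Rightarrow> ('x \<Rightarrow> 'x) \<Rightarrow> 'e \<Rightarrow> 'e" where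
  "rep c d g = (\<lambda>y. snd d (g (chart_inv c y)))"

definition repdom :: "('x, 'e) chart \<Rightarrow> ('x, 'e) chart \<Rightarrow> ('x \<Rightarrow> 'x) \<Rightarrow> 'e set" where
  "repdom c d g = {y \<in> chart_img c. g (chart_inv c y) \<in> fst d}"

lemma tangent_map_rep: "tangent_map c d g x = fd (rep c d g) (snd c x)"
  by (simp add: tangent_map_def rep_def comp_def)

lemma smooth_map_rep:
  assumes g: "smooth_map X A X A g" and c: "c \<in> A" and d: "d \<in> A"
  shows "open (repdom c d g)" "smooth_on (repdom c d g) (rep c d g)"
proof -
  have "continuous_map (top_of_set (chart_img c)) X (g \<circ> chart_inv c)"
    using g by (intro continuous_map_compose[OF continuous_map_chart_inv[OF c]]) (simp add: smooth_map_def)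
  from openin_continuous_map_preimage[OF this chart(1)[OF d]]
  show "open (repdom c d g)" using chart(2)[OF c] by (simp add: openin_open_eq repdom_def)
  have "smooth_on (snd c ` {x \<in> fst c. g x \<in> fst d}) (snd d \<circ> g \<circ> chart_inv c)"
    using g c d by (simp add: smooth_map_def)
  then show "smooth_on (repdom c d g) (rep c d g)"
    unfolding chart_image_eq[OF c] by (simp add: repdom_def rep_def comp_def)
qed

lemma smooth_map_id: "smooth_map X A X A id"
  unfolding smooth_map_def
proof (intro conjI ballI)
  fix c d assume "c \<in> A" "d \<in> A"
  then show "smooth_on (snd c ` {x \<in> fst c. id x \<in> fst d}) (snd d \<circ> id \<circ> chart_inv c)"
    using transition_smooth[of c d] by (simp add: Int_def)
qed simp

lemma line_chart_inv:
  assumes c: "c \<in> A" and "y \<in> chart_img c"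
  shows "chart_inv (UNIV \<times> fst c, map_prod id (snd c)) (t::real, y) = (t, chart_inv c y)"
proof -
  have "inj_on (map_prod id (snd c)) (UNIV \<times> fst c)"
    using map_prod_inj_on[of id UNIV "snd c" "fst c"] chart(4)[OF c] by simp
  moreover have "(t, chart_inv c y) \<in> UNIV \<times> fst c" using chart_inv[OF c] assms(2) by simp
  ultimately have "inv_into (UNIV \<times> fst c) (map_prod id (snd c)) (map_prod id (snd c) (t, chart_inv c y)) = (t, chart_inv c y)"
    by (rule inv_into_f_f)
  then show ?thesis using chart_inv[OF c] assms(2) by (simp add: chart_inv_def[of "(_, _)"])
qed

lemma line_flow_smooth:
  assumes G: "smooth_map (prod_topology euclideanreal X) (line_times A) X A (\<lambda>(t, x). G t x)"
    and c: "c \<in> A" and d: "d \<in> A"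
  defines "O' \<equiv> {q. snd q \<in> chart_img c \<and> G (fst q) (chart_inv c (snd q)) \<in> fst d}"
  shows "open O'" "smooth_on O' (\<lambda>q. snd d (G (fst q) (chart_inv c (snd q))))"
proof -
  have cm: "continuous_map (prod_topology euclideanreal X) X (\<lambda>(t, x). G t x)"
    using G by (simp add: smooth_map_def)
  have "continuous_map (prod_topology euclideanreal (top_of_set (chart_img c))) X
      ((\<lambda>(t, x). G t x) \<circ> (\<lambda>q. (fst q, chart_inv c (snd q))))"
    by (rule continuous_map_compose[OF _ cm], intro continuous_map_pairedI continuous_map_fst
      continuous_map_compose[OF continuous_map_snd continuous_map_chart_inv[OF c], unfolded comp_def])
  then have "openin (prod_topology euclideanreal (top_of_set (chart_img c)))
      {q \<in> topspace (prod_topology euclideanreal (top_of_set (chart_img c))).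
        ((\<lambda>(t, x). G t x) \<circ> (\<lambda>q. (fst q, chart_inv c (snd q)))) q \<in> fst d}"
    by (rule openin_continuous_map_preimage) (rule chart(1)[OF d])
  moreover have "prod_topology euclideanreal (top_of_set (chart_img c)) = top_of_set (UNIV \<times> chart_img c)"
    by (metis prod_topology_subtopology_eu subtopology_UNIV)
  moreover have "open (UNIV \<times> chart_img c :: (real \<times> 'e) set)" using chart(2)[OF c] by (simp add: open_Times)
  moreover have "{q \<in> UNIV \<times> chart_img c. ((\<lambda>(t, x). G t x) \<circ> (\<lambda>q. (fst q, chart_inv c (snd q)))) q \<in> fst d} = O'"
    by (auto simp: O'_def)
  ultimately show oO: "open O'" by (simp add: openin_open_eq)
  let ?c = "(UNIV \<times> fst c, map_prod id (snd c)) :: (real \<times> 'x, real \<times> 'e) chart"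
  have "?c \<in> line_times A" using c by (auto simp: line_times_def)
  then have "smooth_on (snd ?c ` {x \<in> fst ?c. (\<lambda>(t, x). G t x) x \<in> fst d})
      (snd d \<circ> (\<lambda>(t, x). G t x) \<circ> chart_inv ?c)"
    using G d unfolding smooth_map_def by blast
  moreover have "snd ?c ` {x \<in> fst ?c. (\<lambda>(t, x). G t x) x \<in> fst d} = O'"
  proof (intro set_eqI iffI)
    fix q assume "q \<in> O'"
    then show "q \<in> snd ?c ` {x \<in> fst ?c. (\<lambda>(t, x). G t x) x \<in> fst d}"
      using chart_inv[OF c] by (intro image_eqI[of _ _ "(fst q, chart_inv c (snd q))"]) (auto simp: O'_def)
  qed (use chart_inv[OF c] in \<open>auto simp: O'_def\<close>)
  ultimately have "smooth_on O' (snd d \<circ> (\<lambda>(t, x). G t x) \<circ> chart_inv ?c)" by simp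
  then show "smooth_on O' (\<lambda>q. snd d (G (fst q) (chart_inv c (snd q))))"
  proof (rule smooth_on_cong[OF oO, rotated])
    fix q assume "q \<in> O'"
    then have "chart_inv ?c (fst q, snd q) = (fst q, chart_inv c (snd q))"
      by (intro line_chart_inv[OF c]) (auto simp: O'_def)
    then show "(snd d \<circ> (\<lambda>(t, x). G t x) \<circ> chart_inv ?c) q = snd d (G (fst q) (chart_inv c (snd q)))" by simp
  qed
qed

lemma line_fun_smooth:
  assumes "smooth_fun (line_times A) (\<lambda>(t, x). \<xi> t x)" and c: "c \<in> A"
  shows "smooth_on (UNIV \<times> chart_img c) (\<lambda>q. \<xi> (fst q) (chart_inv c (snd q)))"
proof -
  let ?c = "(UNIV \<times> fst c, map_prod id (snd c)) :: (real \<times> 'x, real \<times> 'e) chart"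
  have "?c \<in> line_times A" using c by (auto simp: line_times_def)
  then have "smooth_on (chart_img ?c) ((\<lambda>(t, x). \<xi> t x) \<circ> chart_inv ?c)"
    using assms(1) unfolding smooth_fun_def by blast
  moreover have "chart_img ?c = UNIV \<times> chart_img c" by (simp add: chart_img_def map_prod_surj_on)
  ultimately have "smooth_on (UNIV \<times> chart_img c) ((\<lambda>(t, x). \<xi> t x) \<circ> chart_inv ?c)" by simp
  then show ?thesis
  proof (rule smooth_on_cong[rotated 2])
    show "open (UNIV \<times> chart_img c :: (real \<times> 'e) set)" using chart(2)[OF c] by (simp add: open_Times)
    fix q :: "real \<times> 'e" assume "q \<in> UNIV \<times> chart_img c"
    then have "chart_inv ?c (fst q, snd q) = (fst q, chart_inv c (snd q))"
      by (intro line_chart_inv[OF c]) auto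
    then show "((\<lambda>(t, x). \<xi> t x) \<circ> chart_inv ?c) q = \<xi> (fst q) (chart_inv c (snd q))" by simp
  qed
qed

lemma sgrad_eq:
  assumes c: "c \<in> A" and y: "y \<in> chart_img c" and f: "(f \<circ> chart_inv c) differentiable (at y)"
  shows "\<omega> c y (sgrad \<omega> c f y) b = fd (f \<circ> chart_inv c) y b"
  using theI'[OF nondegenerate_solve[OF form(1)[OF c y] form(5)[OF c y] linear_frechet_derivative[OF f]]]
  unfolding sgrad_def by blast

definition preserves_form :: "('x \<Rightarrow> 'x) \<Rightarrow> bool" where
  "preserves_form g \<longleftrightarrow> (\<forall>c\<in>A. \<forall>d\<in>A. \<forall>x\<in>fst c. g x \<in> fst d \<longrightarrow> (\<forall>u v.
     \<omega> c (snd c x) u v = \<omega> d (snd d (g x)) (tangent_map c d g x u) (tangent_map c d g x v)))"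

text \<open>A trajectory may leave any single chart. The pulled back form \<open>\<phi> d t\<close>
  does not depend on the chart \<open>d\<close> around \<open>G t x0\<close>, so a chart may be
  chosen separately for each time and the value is still constant in time.\<close>

theorem Ham_preserves_form:
  assumes "g \<in> Ham X A \<omega>"
  shows "preserves_form g"
  unfolding preserves_form_def
proof (intro ballI impI allI)
  fix c d1 x0 u v assume c: "c \<in> A" and d1: "d1 \<in> A" and x0: "x0 \<in> fst c" and gx0: "g x0 \<in> fst d1"
  obtain \<xi> G where \<xi>: "smooth_fun (line_times A) (\<lambda>(t, x). \<xi> t x)"
    and fl: "hamiltonian_flow X A \<omega> \<xi> G" and gG: "\<And>x. x \<in> topspace X \<Longrightarrow> g x = G 1 x"
    using assms by (auto simp: Ham_def)
  have G: "smooth_map (prod_topology euclideanreal X) (line_times A) X A (\<lambda>(t, x). G t x)"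
    and G0: "\<And>x. x \<in> topspace X \<Longrightarrow> G 0 x = x"
    and ode: "\<And>t x d. x \<in> topspace X \<Longrightarrow> d \<in> A \<Longrightarrow> G t x \<in> fst d \<Longrightarrow>
      ((\<lambda>s. snd d (G s x)) has_vector_derivative sgrad \<omega> d (\<xi> t) (snd d (G t x))) (at t)"
    using fl by (auto simp: hamiltonian_flow_def)
  define y0 where "y0 = snd c x0"
  have y0: "y0 \<in> chart_img c" "chart_inv c y0 = x0" using chart_inv[OF c] x0 by (auto simp: y0_def)
  have x0X: "x0 \<in> topspace X" using chart(3)[OF c] x0 by blast
  define \<psi> where "\<psi> d q = snd d (G (fst q) (chart_inv c (snd q)))" for d :: "('x, 'e) chart" and q
  define O' where "O' d = {q. snd q \<in> chart_img c \<and> G (fst q) (chart_inv c (snd q)) \<in> fst d}" for d :: "('x, 'e) chart"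
  have O: "open (O' d)" "smooth_on (O' d) (\<psi> d)" if "d \<in> A" for d
    using line_flow_smooth[OF G c that] by (simp_all add: O'_def \<psi>_def[abs_def])
  have \<psi>d: "\<psi> d differentiable (at q)" if "d \<in> A" "q \<in> O' d" for d q
    using smooth_on_differentiable[OF O(2)] that by blast
  have GX: "G t x0 \<in> topspace X" for t
    using G x0X by (auto simp: smooth_map_def continuous_map_def Pi_iff)
  define \<phi> where "\<phi> d t = \<omega> d (\<psi> d (t, y0)) (fd (\<psi> d) (t, y0) (0, u)) (fd (\<psi> d) (t, y0) (0, v))" for d t
  have indep: "\<phi> d t = \<phi> d' t" if d: "d \<in> A" "d' \<in> A" "G t x0 \<in> fst d" "G t x0 \<in> fst d'" for d d' t
  proof -
    have q: "(t, y0) \<in> O' d" "(t, y0) \<in> O' d'" using y0 d by (auto simp: O'_def)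
    have z: "\<psi> d (t, y0) = snd d (G t x0)" by (simp add: \<psi>_def y0)
    have r: "rep d d' id differentiable at (\<psi> d (t, y0))"
      by (rule smooth_on_differentiable[OF smooth_map_rep(2)[OF smooth_map_id d(1,2)]])
        (use d chart_inv[OF d(1)] in \<open>simp add: z repdom_def\<close>)
    have eq: "rep d d' id (\<psi> d q) = \<psi> d' q" if "q \<in> O' d \<inter> O' d'" for q
      using that chart_inv(1)[OF d(1)] by (simp add: rep_def \<psi>_def O'_def)
    have "fd (\<psi> d') (t, y0) = fd (\<lambda>q. rep d d' id (\<psi> d q)) (t, y0)"
      by (rule fd_cong[OF open_Int[OF O(1)[OF d(1)] O(1)[OF d(2)]]]) (use q eq in auto)
    then have "fd (\<psi> d') (t, y0) k = tangent_map d d' id (G t x0) (fd (\<psi> d) (t, y0) k)" for k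
      using fd_compose[OF \<psi>d[OF d(1) q(1)] r] by (simp add: tangent_map_rep z)
    then show ?thesis
      using form_transition[OF d] unfolding \<phi>_def by (simp add: z) (simp add: \<psi>_def y0)
  qed
  have deriv0: "(\<phi> d has_real_derivative 0) (at t)" if d: "d \<in> A" "G t x0 \<in> fst d" for d t
    unfolding \<phi>_def
  proof (rule hamilton_pullback_constant[OF O(1)[OF d(1)] _ chart(2)[OF d(1)] O(2)[OF d(1)],
        where f = "\<lambda>q. \<xi> (fst q) (chart_inv d (snd q))"])
    show "(t, y0) \<in> O' d" using y0 d by (auto simp: O'_def)
    show "\<psi> d q \<in> chart_img d" if "q \<in> O' d" for q
      using that chart_inv(4)[OF d(1)] by (simp add: \<psi>_def O'_def)
    show fs: "smooth_on (UNIV \<times> chart_img d) (\<lambda>q. \<xi> (fst q) (chart_inv d (snd q)))"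
      by (rule line_fun_smooth[OF \<xi> d(1)])
    fix q b assume q: "q \<in> O' d"
    obtain s y where sy: "q = (s, y)" by (cases q)
    let ?x = "chart_inv c y"
    have yx: "y \<in> chart_img c" "G s ?x \<in> fst d" using q by (auto simp: sy O'_def)
    have xX: "?x \<in> topspace X" using yx chart_inv(3)[OF c] chart(3)[OF c] by blast
    have z: "\<psi> d (s, y) = snd d (G s ?x)" by (simp add: \<psi>_def)
    have zI: "\<psi> d q \<in> chart_img d" using yx chart_inv(4)[OF d(1)] by (simp add: z sy)
    have "((\<lambda>s. snd d (G s ?x)) has_vector_derivative fd (\<psi> d) (s, y) (1, 0)) (at s)"
      using fd_partial_fst[OF \<psi>d[OF d(1) q, unfolded sy]] by (simp add: \<psi>_def)
    then have Q: "fd (\<psi> d) q (1, 0) = sgrad \<omega> d (\<xi> s) (\<psi> d q)"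
      unfolding sy z by (rule vector_derivative_unique_at[OF _ ode[OF xX d(1) yx(2)]])
    have "(\<lambda>q. \<xi> (fst q) (chart_inv d (snd q))) differentiable at (s, \<psi> d q)"
      by (rule smooth_on_differentiable[OF fs]) (use zI in simp)
    from fd_partial_snd[OF this]
    have e: "((\<xi> s \<circ> chart_inv d) has_derivative
        (\<lambda>u. fd (\<lambda>q. \<xi> (fst q) (chart_inv d (snd q))) (s, \<psi> d q) (0, u))) (at (\<psi> d q))"
      by (simp add: comp_def)
    show "\<omega> d (\<psi> d q) (fd (\<psi> d) q (1, 0)) b =
        fd (\<lambda>q. \<xi> (fst q) (chart_inv d (snd q))) (fst q, \<psi> d q) (0, b)"
      unfolding Q using sgrad_eq[OF d(1) zI, of "\<xi> s" b] e fd_eq[OF e]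
      by (simp add: sy differentiable_def) blast
  qed (use form[OF d(1)] in auto)
  define ch where "ch t = (SOME d. d \<in> A \<and> G t x0 \<in> fst d)" for t
  have ch: "ch t \<in> A" "G t x0 \<in> fst (ch t)" for t
    using someI_ex[of "\<lambda>d. d \<in> A \<and> G t x0 \<in> fst d"] cover[OF GX[of t]] unfolding ch_def by blast+
  \<comment> \<open>The choice \<open>ch\<close> is not continuous, but the chart
    \<open>ch t\<close> serves at all nearby times \<open>s\<close>, and by \<open>indep\<close> it
    gives the same value as \<open>ch s\<close>.\<close>
  have "((\<lambda>t. \<phi> (ch t) t) has_real_derivative 0) (at t)" for t
  proof (rule has_field_derivative_transform_within_open[OF deriv0[OF ch]])
    have "open ((\<lambda>s. (s, y0)) -` O' (ch t))"
      by (rule open_vimage[OF O(1)[OF ch(1)]]) (auto intro: continuous_intros)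
    moreover have "(\<lambda>s. (s, y0)) -` O' (ch t) = {s. G s x0 \<in> fst (ch t)}" using y0 by (auto simp: O'_def)
    ultimately show "open {s. G s x0 \<in> fst (ch t)}" by simp
  qed (use ch indep in auto)
  then have const: "\<phi> (ch 1) 1 = \<phi> (ch 0) 0"
    using DERIV_isconst_all[of "\<lambda>t. \<phi> (ch t) t"] by blast
  have Xc: "chart_inv c y \<in> topspace X" if "y \<in> chart_img c" for y
    using chart_inv(3)[OF c that] chart(3)[OF c] by blast
  have "\<phi> c 0 = \<omega> c y0 u v"
  proof -
    have q: "(0, y0) \<in> O' c" using y0 x0 G0[OF x0X] by (auto simp: O'_def)
    have "fd (\<psi> c) (0, y0) (0, k) = k" for k
    proof -
      have "((\<lambda>y. \<psi> c (0, y)) has_derivative (\<lambda>k. k)) (at y0)"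
        by (rule has_derivative_transform_within_open[OF has_derivative_ident chart(2)[OF c] y0(1)])
          (use Xc G0 chart_inv(2)[OF c] in \<open>simp add: \<psi>_def\<close>)
      then show ?thesis using has_derivative_unique[OF fd_partial_snd[OF \<psi>d[OF c q]]] by metis
    qed
    then show ?thesis using G0[OF x0X] y0(2) by (simp add: \<phi>_def \<psi>_def) (simp add: y0_def)
  qed
  moreover have "\<phi> d1 1 = \<omega> d1 (snd d1 (g x0)) (tangent_map c d1 g x0 u) (tangent_map c d1 g x0 v)"
  proof -
    have q: "(1, y0) \<in> O' d1" using y0 gx0 gG[OF x0X] by (auto simp: O'_def)
    have "fd (\<psi> d1) (1, y0) (0, k) = tangent_map c d1 g x0 k" for k
    proof -
      have "(rep c d1 g has_derivative (\<lambda>u. fd (\<psi> d1) (1, y0) (0, u))) (at y0)"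
        by (rule has_derivative_transform_within_open[OF fd_partial_snd[OF \<psi>d[OF d1 q]] chart(2)[OF c] y0(1)])
          (use Xc gG in \<open>simp add: \<psi>_def rep_def\<close>)
      then show ?thesis by (simp add: tangent_map_rep fd_eq y0_def[symmetric])
    qed
    then show ?thesis using gG[OF x0X] by (simp add: \<phi>_def \<psi>_def y0)
  qed
  moreover have "\<phi> d1 1 = \<phi> (ch 1) 1" by (rule indep) (use d1 gx0 gG[OF x0X] ch in auto)
  moreover have "\<phi> c 0 = \<phi> (ch 0) 0" by (rule indep) (use c x0 G0[OF x0X] ch[of 0] in simp_all)
  ultimately show "\<omega> c (snd c x0) u v =
      \<omega> d1 (snd d1 (g x0)) (tangent_map c d1 g x0 u) (tangent_map c d1 g x0 v)"
    using const by (simp add: y0_def)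
qed

end

section \<open>The invariant function\<close>

lemma iter_deriv_2_expand:
  fixes F :: "'a::euclidean_space \<Rightarrow> real"
  assumes F: "smooth_on V F" and V: "open V" "z \<in> V"
  shows "iter_deriv [k, v] F z = (\<Sum>b\<in>Basis. (v \<bullet> b) * iter_deriv [k, b] F z)"
proof -
  have "((\<lambda>z. \<Sum>b\<in>Basis. (v \<bullet> b) * fd F z b) has_derivative
      (\<lambda>k. \<Sum>b\<in>Basis. (v \<bullet> b) * fd (\<lambda>z. fd F z b) z k)) (at z)"
    by (intro has_derivative_sum has_derivative_mult_right
        fd_works[OF smooth_on_differentiable[OF smooth_on_fd[OF F] V(2)]])
  then have "((\<lambda>z. fd F z v) has_derivative
      (\<lambda>k. \<Sum>b\<in>Basis. (v \<bullet> b) * fd (\<lambda>z. fd F z b) z k)) (at z)"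
  proof (rule has_derivative_transform_within_open[OF _ V])
    fix y assume "y \<in> V"
    from fd_sum_Basis[OF smooth_on_differentiable[OF F this], of v]
    show "(\<Sum>b\<in>Basis. (v \<bullet> b) * fd F y b) = fd F y v" by simp
  qed
  then show ?thesis by (simp add: fd_eq)
qed

lemma bilinear_iter_deriv_2:
  fixes F :: "'a::euclidean_space \<Rightarrow> real"
  assumes F: "smooth_on V F" and V: "open V" "z \<in> V"
  shows "bilinear (\<lambda>u v. iter_deriv [u, v] F z)"
  unfolding bilinear_def
proof (intro conjI allI)
  fix u
  have eq: "(\<lambda>v. iter_deriv [u, v] F z) = (\<lambda>v. \<Sum>b\<in>Basis. (v \<bullet> b) * iter_deriv [u, b] F z)"
    by (intro ext iter_deriv_2_expand[OF assms])
  show "linear (\<lambda>v. iter_deriv [u, v] F z)"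
    unfolding eq by (rule linearI) (simp_all add: inner_add_left distrib_right sum.distrib sum_distrib_left mult.assoc)
next
  fix v show "linear (\<lambda>u. iter_deriv [u, v] F z)"
    using linear_frechet_derivative[OF smooth_on_differentiable[OF smooth_on_fd[OF F] V(2)]] by simp
qed

text \<open>The second derivative of \<open>\<psi>\<close> enters multiplied by the first derivative
  of \<open>F\<close>, which vanishes at a critical point; there the Hessian transforms as a
  bilinear form.\<close>

lemma hessian_pullback:
  fixes F :: "'b::euclidean_space \<Rightarrow> real" and \<psi> :: "'a::euclidean_space \<Rightarrow> 'b"
  assumes W: "open W" "y \<in> W" and V: "open V" and WV: "\<And>x. x \<in> W \<Longrightarrow> \<psi> x \<in> V"
    and \<psi>: "smooth_on W \<psi>" and F: "smooth_on V F" and crit: "\<And>v. fd F (\<psi> y) v = 0"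
  shows "iter_deriv [u, v] (\<lambda>x. F (\<psi> x)) y = iter_deriv [fd \<psi> y u, fd \<psi> y v] F (\<psi> y)"
proof -
  have yV: "\<psi> y \<in> V" using WV W by blast
  have "((\<lambda>x. \<Sum>b\<in>Basis. (fd \<psi> x v \<bullet> b) * fd F (\<psi> x) b) has_derivative
      (\<lambda>h. \<Sum>b\<in>Basis. (fd \<psi> y v \<bullet> b) * fd (\<lambda>z. fd F z b) (\<psi> y) (fd \<psi> y h) +
        (fd (\<lambda>x. fd \<psi> x v) y h \<bullet> b) * fd F (\<psi> y) b)) (at y)"
    by (rule has_derivative_sum[OF has_derivative_mult[OF has_derivative_inner_left[OF fd_works]
          has_derivative_compose[OF fd_works fd_works]]])
      (use smooth_on_differentiable[OF smooth_on_fd[OF \<psi>] W(2)] smooth_on_differentiable[OF \<psi> W(2)]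
        smooth_on_differentiable[OF smooth_on_fd[OF F] yV] in blast)+
  then have "((\<lambda>x. fd (\<lambda>x. F (\<psi> x)) x v) has_derivative
      (\<lambda>h. \<Sum>b\<in>Basis. (fd \<psi> y v \<bullet> b) * fd (\<lambda>z. fd F z b) (\<psi> y) (fd \<psi> y h) +
        (fd (\<lambda>x. fd \<psi> x v) y h \<bullet> b) * fd F (\<psi> y) b)) (at y)"
  proof (rule has_derivative_transform_within_open[OF _ W])
    fix x assume x: "x \<in> W"
    note d = smooth_on_differentiable[OF \<psi> x] smooth_on_differentiable[OF F WV[OF x]]
    show "(\<Sum>b\<in>Basis. (fd \<psi> x v \<bullet> b) * fd F (\<psi> x) b) = fd (\<lambda>x. F (\<psi> x)) x v"
      unfolding fd_compose[OF d] by (subst (2) fd_sum_Basis[OF d(2)]) simp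
  qed
  then have "iter_deriv [u, v] (\<lambda>x. F (\<psi> x)) y =
      (\<Sum>b\<in>Basis. (fd \<psi> y v \<bullet> b) * fd (\<lambda>z. fd F z b) (\<psi> y) (fd \<psi> y u))"
    by (simp add: fd_eq crit)
  also have "\<dots> = iter_deriv [fd \<psi> y u, fd \<psi> y v] F (\<psi> y)"
    using iter_deriv_2_expand[OF F V yV, of "fd \<psi> y u" "fd \<psi> y v"] by simp
  finally show ?thesis .
qed

lemma bilinear_add_fun: "bilinear B \<Longrightarrow> bilinear C \<Longrightarrow> bilinear (\<lambda>u v. B u v + C u v)"
  by (simp add: bilinear_def linear_compose_add)

section \<open>Invariants of critical points and their sum\<close>

context symplectic_manifold
begin

abbreviation rp :: "('x, 'e) chart \<Rightarrow> ('x \<Rightarrow> real) \<Rightarrow> 'e \<Rightarrow> real" where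
  "rp c f \<equiv> f \<circ> chart_inv c"

definition hess :: "('x, 'e) chart \<Rightarrow> ('x \<Rightarrow> real) \<Rightarrow> 'e \<Rightarrow> 'e \<Rightarrow> 'e \<Rightarrow> real" where
  "hess c f y u v = iter_deriv [u, v] (rp c f) y"

definition crit :: "('x, 'e) chart \<Rightarrow> ('x \<Rightarrow> real) \<Rightarrow> 'e \<Rightarrow> bool" where
  "crit c f y \<longleftrightarrow> (\<forall>v. iter_deriv [v] (rp c f) y = 0)"

text \<open>The square lets a single threshold serve Hessian determinants of either sign.\<close>

definition disc :: "('x, 'e) chart \<Rightarrow> ('x \<Rightarrow> real) \<Rightarrow> 'e \<Rightarrow> real" where
  "disc c f y = (bdet (hess c f y) / bdet (\<omega> c y))\<^sup>2"

definition hinv :: "('x, 'e) chart \<Rightarrow> ('x \<Rightarrow> real) \<Rightarrow> 'e \<Rightarrow> real" where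
  "hinv c f y = bdet (\<lambda>u v. hess c f y u v + \<omega> c y u v) / bdet (\<omega> c y)"

definition contrib :: "real \<Rightarrow> ('x, 'e) chart \<Rightarrow> ('x \<Rightarrow> real) \<Rightarrow> 'e \<Rightarrow> real" where
  "contrib \<delta> c f y = (if crit c f y then flat 0 (disc c f y - \<delta>) * hinv c f y else 0)"

text \<open>An arbitrary choice; by \<open>pt_contrib_chart\<close> contributions do not depend on
  it.\<close>

definition chart_at :: "'x \<Rightarrow> ('x, 'e) chart" where
  "chart_at x = (SOME c. c \<in> A \<and> x \<in> fst c)"

definition pt_contrib :: "real \<Rightarrow> ('x \<Rightarrow> real) \<Rightarrow> 'x \<Rightarrow> real" where
  "pt_contrib \<delta> f x = contrib \<delta> (chart_at x) f (snd (chart_at x) x)"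

text \<open>Only points with nonzero contribution are summed, since a function may have infinitely
  many critical points. For positive \<open>\<delta>\<close> and compact \<open>X\<close> the set is
  finite by \<open>finite_supp\<close>.\<close>

definition supp :: "real \<Rightarrow> ('x \<Rightarrow> real) \<Rightarrow> 'x set" where
  "supp \<delta> f = {x \<in> topspace X. pt_contrib \<delta> f x \<noteq> 0}"

definition pfun :: "real \<Rightarrow> ('x \<Rightarrow> real) \<Rightarrow> real" where
  "pfun \<delta> f = (\<Sum>x\<in>supp \<delta> f. pt_contrib \<delta> f x)"

lemma chart_at: "x \<in> topspace X \<Longrightarrow> chart_at x \<in> A" "x \<in> topspace X \<Longrightarrow> x \<in> fst (chart_at x)"
  using someI_ex[of "\<lambda>c. c \<in> A \<and> x \<in> fst c"] cover[of x] unfolding chart_at_def by blast+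

lemma smooth_rp: "f \<in> Cinf X A \<Longrightarrow> c \<in> A \<Longrightarrow> smooth_on (chart_img c) (rp c f)"
  by (simp add: Cinf_def smooth_fun_def)

lemma bilinear_hess: "f \<in> Cinf X A \<Longrightarrow> c \<in> A \<Longrightarrow> y \<in> chart_img c \<Longrightarrow> bilinear (hess c f y)"
  unfolding hess_def by (rule bilinear_iter_deriv_2[OF smooth_rp chart(2)])

text \<open>The Hessian, the form and their sum are pulled back by the same linear map
  \<open>T\<close>, so that all three determinants acquire the factor
  \<open>(tdet T)\<^sup>2\<close>. With \<open>g = id\<close> this gives independence of the chart,
  with a Hamiltonian \<open>g\<close> the invariance.\<close>

lemma contrib_pullback:
  assumes f: "f \<in> Cinf X A" and g: "smooth_map X A X A g" and c: "c \<in> A" and d: "d \<in> A"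
    and x: "x \<in> fst c" "g x \<in> fst d"
    and form_eq: "\<And>u v. \<omega> c (snd c x) u v = \<omega> d (snd d (g x)) (tangent_map c d g x u) (tangent_map c d g x v)"
  shows "contrib \<delta> c (f \<circ> g) (snd c x) = contrib \<delta> d f (snd d (g x))"
proof -
  define y where "y = snd c x"
  define \<psi> where "\<psi> = rep c d g"
  define T where "T = fd \<psi> y"
  let ?W = "repdom c d g"
  have W: "open ?W" "smooth_on ?W \<psi>" using smooth_map_rep[OF g c d] by (simp_all add: \<psi>_def)
  have yW: "y \<in> ?W" using x chart_inv[OF c] by (simp add: y_def repdom_def)
  have \<psi>y: "\<psi> y = snd d (g x)" using x chart_inv(1)[OF c] by (simp add: \<psi>_def y_def rep_def)
  have WV: "\<psi> z \<in> chart_img d" if "z \<in> ?W" for z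
    using that chart_inv(4)[OF d] by (simp add: repdom_def \<psi>_def rep_def)
  have yc: "y \<in> chart_img c" "\<psi> y \<in> chart_img d" using yW WV by (auto simp: repdom_def)
  have F: "smooth_on (chart_img d) (rp d f)" by (rule smooth_rp[OF f d])
  have eq: "rp c (f \<circ> g) z = rp d f (\<psi> z)" if "z \<in> ?W" for z
    using that chart_inv(1)[OF d] by (simp add: \<psi>_def rep_def repdom_def)
  have jet: "iter_deriv vs (rp c (f \<circ> g)) y = iter_deriv vs (\<lambda>z. rp d f (\<psi> z)) y" for vs
    by (rule iter_deriv_cong[OF W(1) eq yW])
  note diff = smooth_on_differentiable[OF W(2) yW] smooth_on_differentiable[OF F yc(2)]
  have wT: "\<omega> c y = (\<lambda>u v. \<omega> d (\<psi> y) (T u) (T v))"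
    using form_eq by (simp add: fun_eq_iff T_def \<psi>_def tangent_map_rep y_def[symmetric] \<psi>y[unfolded \<psi>_def])
  have lT: "linear T" unfolding T_def by (rule linear_frechet_derivative[OF diff(1)])
  have bd: "bdet (\<omega> c y) = (tdet T)\<^sup>2 * bdet (\<omega> d (\<psi> y))"
    unfolding wT by (rule bdet_congruence[OF form(1)[OF d yc(2)]])
  then have t0: "(tdet T)\<^sup>2 \<noteq> 0" "bdet (\<omega> d (\<psi> y)) \<noteq> 0" using form(5)[OF c yc(1)] by auto
  \<comment> \<open>\<open>T\<close> pulls back a form to a nondegenerate one, so it is injective,
    hence surjective; surjectivity is what carries criticality over in both directions.\<close>
  have "inj T"
    unfolding linear_injective_0[OF lT]
  proof safe
    fix u assume "T u = 0"
    then have "\<omega> c y u v = 0" for v using bilinear_lzero[OF form(1)[OF d yc(2)]] by (simp add: wT)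
    then show "u = 0" using bdet_nonzero_iff[OF form(1)[OF c yc(1)]] form(5)[OF c yc(1)] by blast
  qed
  then have surj: "surj T" using linear_injective_imp_surjective lT by blast
  have "iter_deriv [v] (rp c (f \<circ> g)) y = iter_deriv [T v] (rp d f) (\<psi> y)" for v
    unfolding jet using fd_compose[OF diff] by (simp add: T_def comp_def)
  then have cr: "crit c (f \<circ> g) y \<longleftrightarrow> crit d f (\<psi> y)"
    unfolding crit_def using surj by (metis surjD)
  show ?thesis
  proof (cases "crit d f (\<psi> y)")
    case True
    then have c0: "fd (rp d f) (\<psi> y) v = 0" for v by (simp add: crit_def)
    have h: "hess c (f \<circ> g) y = (\<lambda>u v. hess d f (\<psi> y) (T u) (T v))"
      unfolding hess_def jet T_def
      by (intro ext hessian_pullback[OF W(1) yW chart(2)[OF d] WV W(2) F c0])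
    have bh: "bdet (hess c (f \<circ> g) y) = (tdet T)\<^sup>2 * bdet (hess d f (\<psi> y))"
      unfolding h by (rule bdet_congruence[OF bilinear_hess[OF f d yc(2)]])
    have bs: "bdet (\<lambda>u v. hess c (f \<circ> g) y u v + \<omega> c y u v) =
        (tdet T)\<^sup>2 * bdet (\<lambda>u v. hess d f (\<psi> y) u v + \<omega> d (\<psi> y) u v)"
      unfolding h wT
      by (rule bdet_congruence[OF bilinear_add_fun[OF bilinear_hess[OF f d yc(2)] form(1)[OF d yc(2)]]])
    have "disc c (f \<circ> g) y = disc d f (\<psi> y)" "hinv c (f \<circ> g) y = hinv d f (\<psi> y)"
      unfolding disc_def hinv_def bh bs bd using t0 by simp_all
    then show ?thesis using True cr by (simp add: contrib_def y_def[symmetric] \<psi>y[symmetric])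
  next
    case False
    then show ?thesis using cr by (simp add: contrib_def y_def[symmetric] \<psi>y[symmetric])
  qed
qed

lemma pt_contrib_chart:
  assumes f: "f \<in> Cinf X A" and c: "c \<in> A" and x: "x \<in> fst c"
  shows "pt_contrib \<delta> f x = contrib \<delta> c f (snd c x)"
proof -
  have X: "x \<in> topspace X" using chart(3)[OF c] x by blast
  have "contrib \<delta> (chart_at x) (f \<circ> id) (snd (chart_at x) x) = contrib \<delta> c f (snd c (id x))"
    by (rule contrib_pullback[OF f smooth_map_id chart_at(1)[OF X] c])
      (use x chart_at[OF X] form_transition[OF chart_at(1)[OF X] c chart_at(2)[OF X] x] in simp_all)
  then show ?thesis by (simp add: pt_contrib_def)
qed

text \<open>\<open>g\<close> maps the points contributing to \<open>f \<circ> g\<close> bijectively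
  onto those contributing to \<open>f\<close>, with equal contributions, so the sum is merely
  reindexed.\<close>

theorem pfun_Ham_invariant:
  assumes f: "f \<in> Cinf X A" and g: "g \<in> Ham X A \<omega>"
  shows "pfun \<delta> (f \<circ> g) = pfun \<delta> f"
proof -
  have gd: "g permutes topspace X" "smooth_map X A X A g" using g by (auto simp: Ham_def diffeos_def)
  have pt: "pt_contrib \<delta> (f \<circ> g) x = pt_contrib \<delta> f (g x)" if x: "x \<in> topspace X" for x
  proof -
    have gx: "g x \<in> topspace X" using x gd(1) by (simp add: permutes_in_image)
    show ?thesis
      unfolding pt_contrib_def
      using Ham_preserves_form[OF g] chart_at[OF x] chart_at[OF gx]
      by (intro contrib_pullback[OF f gd(2)]) (auto simp: preserves_form_def)
  qed
  have "bij_betw g (supp \<delta> (f \<circ> g)) (supp \<delta> f)"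
    unfolding bij_betw_def
  proof
    show "inj_on g (supp \<delta> (f \<circ> g))" using permutes_inj_on[OF gd(1)] .
    show "g ` supp \<delta> (f \<circ> g) = supp \<delta> f"
    proof (intro set_eqI iffI)
      fix x assume "x \<in> supp \<delta> f"
      then have x: "x \<in> topspace X" "pt_contrib \<delta> f x \<noteq> 0" by (auto simp: supp_def)
      have i: "inv g x \<in> topspace X" "g (inv g x) = x"
        using permutes_in_image[OF permutes_inv[OF gd(1)]] permutes_inverses(1)[OF gd(1)] x by auto
      then show "x \<in> g ` supp \<delta> (f \<circ> g)" using pt[OF i(1)] x by (intro image_eqI[of _ _ "inv g x"]) (auto simp: supp_def)
    qed (use pt permutes_in_image[OF gd(1)] in \<open>auto simp: supp_def\<close>)
  qed
  from sum.reindex_bij_betw[OF this, of "pt_contrib \<delta> f"]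
  show ?thesis unfolding pfun_def by (simp add: pt supp_def)
qed

end

section \<open>The Frechet space of smooth functions\<close>

lemma continuous_map_metricI:
  fixes f :: "'a \<Rightarrow> 'b::metric_space"
  assumes "\<And>x e. x \<in> topspace T \<Longrightarrow> e > 0 \<Longrightarrow> \<exists>U. openin T U \<and> x \<in> U \<and> (\<forall>y\<in>U. dist (f y) (f x) < e)"
  shows "continuous_map T euclidean f"
  unfolding continuous_map_def
proof (intro conjI allI impI)
  fix V :: "'b set" assume "openin euclidean V"
  then have V: "open V" by simp
  show "openin T {x \<in> topspace T. f x \<in> V}"
  proof (subst openin_subopen, intro ballI)
    fix x assume "x \<in> {x \<in> topspace T. f x \<in> V}"
    then obtain e where e: "e > 0" "ball (f x) e \<subseteq> V" "x \<in> topspace T" using V openE by blast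
    then obtain U where U: "openin T U" "x \<in> U" "\<And>y. y \<in> U \<Longrightarrow> dist (f y) (f x) < e"
      using assms by metis
    have "U \<subseteq> {x \<in> topspace T. f x \<in> V}"
    proof
      fix y assume "y \<in> U"
      then show "y \<in> {x \<in> topspace T. f x \<in> V}"
        using U(3)[of y] openin_subset[OF U(1)] e(2) by (auto simp: dist_commute subset_iff)
    qed
    then show "\<exists>U. openin T U \<and> x \<in> U \<and> U \<subseteq> {x \<in> topspace T. f x \<in> V}" using U by blast
  qed
qed simp

lemma continuous_map_metricD:
  fixes f :: "'a \<Rightarrow> 'b::metric_space"
  assumes "continuous_map T euclidean f" "x \<in> topspace T" "e > 0"
  shows "\<exists>U. openin T U \<and> x \<in> U \<and> (\<forall>y\<in>U. dist (f y) (f x) < e)"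
proof (intro exI conjI)
  show "openin T {y \<in> topspace T. f y \<in> ball (f x) e}"
    by (rule openin_continuous_map_preimage[OF assms(1)]) simp
qed (use assms in \<open>auto simp: dist_commute\<close>)

lemma iter_deriv_add_cmult:
  fixes F G :: "'a::euclidean_space \<Rightarrow> real"
  assumes S: "open S" and F: "smooth_on S F" and G: "smooth_on S G"
  shows "y \<in> S \<Longrightarrow> iter_deriv vs (\<lambda>y. F y + t * G y) y = iter_deriv vs F y + t * iter_deriv vs G y"
proof (induction vs arbitrary: y)
  case (Cons v vs)
  have "((\<lambda>y. iter_deriv vs F y + t * iter_deriv vs G y) has_derivative
      (\<lambda>v. fd (iter_deriv vs F) y v + t * fd (iter_deriv vs G) y v)) (at y)"
    by (intro has_derivative_add has_derivative_mult_right fd_works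
        smooth_on_differentiable[OF smooth_on_iter_deriv Cons.prems] F G)
  then have "(iter_deriv vs (\<lambda>y. F y + t * G y) has_derivative
      (\<lambda>v. fd (iter_deriv vs F) y v + t * fd (iter_deriv vs G) y v)) (at y)"
    by (rule has_derivative_transform_within_open[OF _ S Cons.prems]) (simp add: Cons.IH)
  then show ?case by (simp add: fd_eq)
qed simp

section \<open>Seminorms, jets and lines in the space of smooth functions\<close>

context symplectic_manifold
begin

abbreviation TT :: "('x \<Rightarrow> real) topology" where
  "TT \<equiv> Cinf_topology X A"

lemma topspace_TT [simp]: "topspace TT = Cinf X A"
  unfolding Cinf_topology_def by auto

lemma Cinf_line: "f \<in> Cinf X A \<Longrightarrow> h \<in> Cinf X A \<Longrightarrow> (\<lambda>x. f x + t * h x) \<in> Cinf X A"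
proof -
  assume *: "f \<in> Cinf X A" "h \<in> Cinf X A"
  have "smooth_on (chart_img c) (rp c (\<lambda>x. f x + t * h x))" if c: "c \<in> A" for c
  proof -
    have "smooth_on (chart_img c) (\<lambda>y. rp c f y + t * rp c h y)"
      by (intro smooth_on_add smooth_on_mult smooth_on_const chart(2)[OF c] smooth_rp c *)
    then show ?thesis by (simp add: comp_def)
  qed
  then show ?thesis using * by (simp add: Cinf_def smooth_fun_def)
qed

lemma iter_deriv_line:
  assumes "f \<in> Cinf X A" "h \<in> Cinf X A" "c \<in> A" "y \<in> chart_img c"
  shows "iter_deriv vs (rp c (\<lambda>x. f x + t * h x)) y = iter_deriv vs (rp c f) y + t * iter_deriv vs (rp c h) y"
  using iter_deriv_add_cmult[OF chart(2)[OF assms(3)] smooth_rp[OF assms(1,3)] smooth_rp[OF assms(2,3)] assms(4)]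
  by (simp add: comp_def)

lemma Cinf_diff: "f \<in> Cinf X A \<Longrightarrow> h \<in> Cinf X A \<Longrightarrow> (\<lambda>x. f x - h x) \<in> Cinf X A"
  using Cinf_line[of f h "- 1"] by simp

lemma iter_deriv_diff:
  assumes "f \<in> Cinf X A" "h \<in> Cinf X A" "c \<in> A" "y \<in> chart_img c"
  shows "iter_deriv vs (rp c (\<lambda>x. f x - h x)) y = iter_deriv vs (rp c f) y - iter_deriv vs (rp c h) y"
  using iter_deriv_line[OF assms, of vs "- 1"] by simp

text \<open>Compactness of \<open>K\<close> bounds the set of values, so that its \<open>SUP\<close>
  is a true upper bound.\<close>

lemma seminorm_upper:
  assumes f: "f \<in> Cinf X A" and c: "c \<in> A" and K: "compact K" "K \<subseteq> chart_img c" and y: "y \<in> K"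
  shows "\<bar>iter_deriv vs (rp c f) y\<bar> \<le> Cinf_seminorm c K vs f"
proof -
  have "continuous_on K (\<lambda>y. \<bar>iter_deriv vs (rp c f) y\<bar>)"
    using smooth_on_continuous_on[OF smooth_on_iter_deriv[OF smooth_rp[OF f c]]] K(2)
    by (intro continuous_intros) (rule continuous_on_subset)
  then have "bdd_above ((\<lambda>y. \<bar>iter_deriv vs (rp c f) y\<bar>) ` K)"
    by (rule bounded_imp_bdd_above[OF compact_imp_bounded[OF compact_continuous_image[OF _ K(1)]]])
  then show ?thesis unfolding Cinf_seminorm_def by (rule cSUP_upper[OF y])
qed

lemma seminorm_least:
  assumes "K \<noteq> {}" "\<And>y. y \<in> K \<Longrightarrow> \<bar>iter_deriv vs (rp c f) y\<bar> \<le> M"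
  shows "Cinf_seminorm c K vs f \<le> M"
  unfolding Cinf_seminorm_def using assms by (intro cSUP_least) auto

lemma openin_seminorm_ball:
  assumes "c \<in> A" "compact K" "K \<noteq> {}" "K \<subseteq> chart_img c" "f \<in> Cinf X A" "e > 0"
  shows "openin TT {g \<in> Cinf X A. Cinf_seminorm c K vs (\<lambda>x. g x - f x) < e}"
  unfolding Cinf_topology_def by (rule topology_generated_by_Basis) (use assms in blast)

text \<open>Continuity must be joint, because critical points move with the function. A seminorm
  over a closed ball controls the change of function at all points of that ball, and continuity of
  the fixed derivative controls the change of point.\<close>

lemma continuous_map_jet:
  assumes c: "c \<in> A"
  shows "continuous_map (prod_topology TT (top_of_set (chart_img c))) euclideanreal
    (\<lambda>p. iter_deriv vs (rp c (fst p)) (snd p))"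
proof (rule continuous_map_metricI)
  fix p and e :: real assume p: "p \<in> topspace (prod_topology TT (top_of_set (chart_img c)))" and e: "e > 0"
  obtain f y where fy: "p = (f, y)" "f \<in> Cinf X A" "y \<in> chart_img c" using p by auto
  note sf = smooth_on_continuous_on[OF smooth_on_iter_deriv[OF smooth_rp[OF fy(2) c], of vs]]
  then have "isCont (iter_deriv vs (rp c f)) y"
    using chart(2)[OF c] fy(3) continuous_on_eq_continuous_at by blast
  then obtain d where d: "d > 0" "\<And>z. dist z y < d \<Longrightarrow> dist (iter_deriv vs (rp c f) z) (iter_deriv vs (rp c f) y) < e / 2"
    using e unfolding continuous_at_eps_delta by (metis half_gt_zero)
  obtain r where r: "r > 0" "cball y r \<subseteq> chart_img c" using chart(2)[OF c] fy(3) open_contains_cball by blast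
  let ?V = "{g \<in> Cinf X A. Cinf_seminorm c (cball y r) vs (\<lambda>x. g x - f x) < e / 2}"
  let ?W = "chart_img c \<inter> ball y (min d r)"
  have V: "openin TT ?V" using c r fy e by (intro openin_seminorm_ball) auto
  have "Cinf_seminorm c (cball y r) vs (\<lambda>x. f x - f x) \<le> 0"
  proof (rule seminorm_least)
    fix z assume "z \<in> cball y r"
    then have "z \<in> chart_img c" using r by blast
    then show "\<bar>iter_deriv vs (rp c (\<lambda>x. f x - f x)) z\<bar> \<le> 0"
      using iter_deriv_diff[OF fy(2) fy(2) c] by simp
  qed (use r in auto)
  then have "f \<in> ?V" using fy e by simp
  moreover have "openin (top_of_set (chart_img c)) ?W" by (simp add: openin_open_Int)
  ultimately have "openin (prod_topology TT (top_of_set (chart_img c))) (?V \<times> ?W)" "p \<in> ?V \<times> ?W"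
    using V fy d r by (auto simp: openin_prod_Times_iff)
  moreover have "dist (iter_deriv vs (rp c (fst q)) (snd q)) (iter_deriv vs (rp c (fst p)) (snd p)) < e"
    if "q \<in> ?V \<times> ?W" for q
  proof -
    obtain g z where gz: "q = (g, z)" by (cases q)
    have q: "q = (g, z)" "g \<in> Cinf X A" "z \<in> chart_img c" "dist z y < d" "z \<in> cball y r"
      and sn: "Cinf_seminorm c (cball y r) vs (\<lambda>x. g x - f x) < e / 2"
      using that gz by (auto simp: dist_commute)
    have "\<bar>iter_deriv vs (rp c g) z - iter_deriv vs (rp c f) z\<bar> < e / 2"
      using seminorm_upper[OF Cinf_diff[OF q(2) fy(2)] c compact_cball r(2) q(5), of vs] sn
      by (simp add: iter_deriv_diff[OF q(2) fy(2) c q(3)])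
    then show ?thesis using d(2)[OF q(4)] unfolding q fy fst_conv snd_conv dist_real_def by linarith
  qed
  ultimately show "\<exists>U. openin (prod_topology TT (top_of_set (chart_img c))) U \<and> p \<in> U \<and>
      (\<forall>q\<in>U. dist (iter_deriv vs (rp c (fst q)) (snd q)) (iter_deriv vs (rp c (fst p)) (snd p)) < e)"
    by blast
qed

lemma continuous_map_jet_compose:
  assumes c: "c \<in> A" and F: "continuous_map Y TT F" and y: "continuous_map Y euclidean y"
    and im: "\<And>p. p \<in> topspace Y \<Longrightarrow> y p \<in> chart_img c"
  shows "continuous_map Y euclideanreal (\<lambda>p. iter_deriv vs (rp c (F p)) (y p))"
proof -
  have "continuous_map Y (prod_topology TT (top_of_set (chart_img c))) (\<lambda>p. (F p, y p))"
    using F y im by (intro continuous_map_pairedI) (auto simp: continuous_map_in_subtopology)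
  from continuous_map_compose[OF this continuous_map_jet[OF c]] show ?thesis by (simp add: comp_def)
qed

text \<open>Along the line every seminorm distance is Lipschitz in \<open>t\<close>, with the
  seminorm of \<open>h\<close> as constant.\<close>

lemma continuous_map_line:
  assumes f: "f \<in> Cinf X A" and h: "h \<in> Cinf X A"
  shows "continuous_map euclideanreal TT (\<lambda>t x. f x + t * h x)"
  unfolding Cinf_topology_def
proof (rule continuous_on_generated_topo)
  fix U assume "U \<in> insert (Cinf X A)
       {{g \<in> Cinf X A. Cinf_seminorm c K vs (\<lambda>x. g x - f x) < \<epsilon>} | c K vs f \<epsilon>.
          c \<in> A \<and> compact K \<and> K \<noteq> {} \<and> K \<subseteq> chart_img c \<and> f \<in> Cinf X A \<and> \<epsilon> > 0}"
  then consider "U = Cinf X A" | c K vs g e where "c \<in> A" "compact K" "K \<noteq> {}" "K \<subseteq> chart_img c"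
      "g \<in> Cinf X A" "e > 0" "U = {u \<in> Cinf X A. Cinf_seminorm c K vs (\<lambda>x. u x - g x) < e}"
    by blast
  then show "openin euclideanreal ((\<lambda>t x. f x + t * h x) -` U \<inter> topspace euclideanreal)"
  proof cases
    case 1
    then have "(\<lambda>t x. f x + t * h x) -` U = UNIV" using Cinf_line[OF f h] by auto
    then show ?thesis by simp
  next
    case 2
    let ?s = "\<lambda>t. Cinf_seminorm c K vs (\<lambda>x. (f x + t * h x) - g x)"
    let ?m = "Cinf_seminorm c K vs h"
    have m0: "?m \<ge> 0" using seminorm_upper[OF h 2(1,2,4)] 2(3) by (meson abs_ge_zero equals0I order_trans)
    have lip: "?s t \<le> ?s t0 + \<bar>t - t0\<bar> * ?m" for t t0
    proof (rule seminorm_least[OF 2(3)])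
      fix y assume y: "y \<in> K"
      then have yc: "y \<in> chart_img c" using 2 by blast
      have e: "iter_deriv vs (rp c (\<lambda>x. (f x + t * h x) - g x)) y =
          iter_deriv vs (rp c f) y + t * iter_deriv vs (rp c h) y - iter_deriv vs (rp c g) y" for t
        by (simp add: iter_deriv_diff[OF Cinf_line[OF f h] 2(5,1) yc] iter_deriv_line[OF f h 2(1) yc])
      have "\<bar>iter_deriv vs (rp c (\<lambda>x. (f x + t * h x) - g x)) y\<bar> \<le>
          \<bar>iter_deriv vs (rp c (\<lambda>x. (f x + t0 * h x) - g x)) y\<bar> + \<bar>t - t0\<bar> * \<bar>iter_deriv vs (rp c h) y\<bar>"
        unfolding e abs_mult[symmetric] by (simp add: algebra_simps)
      also have "\<dots> \<le> ?s t0 + \<bar>t - t0\<bar> * ?m"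
        using seminorm_upper[OF Cinf_diff[OF Cinf_line[OF f h] 2(5)] 2(1,2,4) y, of vs]
          seminorm_upper[OF h 2(1,2,4) y, of vs] by (intro add_mono mult_left_mono) auto
      finally show "\<bar>iter_deriv vs (rp c (\<lambda>x. (f x + t * h x) - g x)) y\<bar> \<le> ?s t0 + \<bar>t - t0\<bar> * ?m" .
    qed
    have "(\<lambda>t x. f x + t * h x) -` U = {t. ?s t < e}" using Cinf_line[OF f h] 2(7) by auto
    moreover have "open {t. ?s t < e}"
      unfolding open_dist
    proof
      fix t0 assume "t0 \<in> {t. ?s t < e}"
      then have t0: "?s t0 < e" by simp
      \<comment> \<open>The summand 1 keeps the quotient meaningful when the seminorm of
        \<open>h\<close> is 0.\<close>
      define d where "d = (e - ?s t0) / (?m + 1)"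
      have d: "d > 0" using t0 m0 by (simp add: d_def)
      have "?s t < e" if "dist t t0 < d" for t
      proof -
        have "\<bar>t - t0\<bar> * ?m \<le> \<bar>t - t0\<bar> * (?m + 1)" by (simp add: mult_left_mono)
        also have "\<dots> < d * (?m + 1)" using that m0 by (intro mult_strict_right_mono) (auto simp: dist_real_def)
        also have "\<dots> = e - ?s t0" using m0 by (simp add: d_def)
        finally show ?thesis using lip[of t t0] by simp
      qed
      then show "\<exists>d>0. \<forall>t. dist t t0 < d \<longrightarrow> t \<in> {t. ?s t < e}" using d by blast
    qed
    ultimately show ?thesis by simp
  qed
qed (use Cinf_line[OF f h] in auto)

text \<open>Derivatives along lines through \<open>f\<close> thus see only a neighbourhood of
  \<open>f\<close>; all local representations below rely on it.\<close>

lemma eventually_line: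
  assumes f: "f \<in> U" and h: "h \<in> Cinf X A" and U: "openin TT U"
  shows "\<forall>\<^sub>F t in nhds 0. (\<lambda>x. f x + t * h x) \<in> U"
proof -
  have "f \<in> Cinf X A" using f openin_subset[OF U] by auto
  then have "open {t. (\<lambda>x. f x + t * h x) \<in> U}"
    using openin_continuous_map_preimage[OF continuous_map_line[OF _ h] U] by simp
  then show ?thesis using f unfolding eventually_nhds
    by (intro exI[of _ "{t. (\<lambda>x. f x + t * h x) \<in> U}"]) simp
qed

end

section \<open>Functions of jets at nondegenerate critical points\<close>

text \<open>Implicit differentiation along a curve of zeros that is given beforehand and known only
  to be continuous. Since \<open>L (x t - x 0)\<close> equals \<open>- t *\<^sub>R R t\<close> up to
  \<open>o(x t - x 0)\<close> and \<open>L\<close> is bounded below, \<open>x\<close> first turns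
  out to be Lipschitz at 0; with this the error is \<open>o(t)\<close>, and the derivative solves
  \<open>L x' = - R 0\<close>.\<close>

lemma perturbed_zero_derivative:
  fixes \<Phi> :: "'e::euclidean_space \<Rightarrow> 'e" and R :: "real \<Rightarrow> 'e" and x :: "real \<Rightarrow> 'e"
  assumes \<Phi>: "(\<Phi> has_derivative L) (at (x 0))" "\<Phi> (x 0) = 0" and inj: "inj L"
    and x: "isCont x 0" and R: "isCont R 0" and eq: "\<forall>\<^sub>F t in nhds 0. \<Phi> (x t) + t *\<^sub>R R t = 0"
  shows "\<exists>x'. (x has_vector_derivative x') (at 0) \<and> L x' + R 0 = 0"
proof -
  have lin: "linear L" using \<Phi>(1) has_derivative_linear by blast
  obtain m where m: "m > 0" "\<And>v. m * norm v \<le> norm (L v)"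
    using linear_inj_bounded_below_pos[OF lin inj] by blast
  have "surj L" using linear_injective_imp_surjective[OF lin inj] by simp
  then obtain x' where x': "L x' = - R 0" by (metis surjD)
  have small: "\<exists>d>0. \<forall>v. norm (v - x 0) < d \<longrightarrow> norm (\<Phi> v - L (v - x 0)) \<le> e * norm (v - x 0)" if "e > 0" for e
    using \<Phi> that unfolding has_derivative_at_alt by simp
  define M where "M = norm (R 0) + 1"
  have M: "M > 0" unfolding M_def by (smt (verit) norm_ge_zero)
  have bnd: "\<forall>\<^sub>F t in nhds 0. norm (R t - R 0) < e" if "e > 0" for e
    using R that unfolding continuous_at_eps_delta eventually_nhds_metric dist_norm by auto
  have xb: "\<forall>\<^sub>F t in nhds 0. norm (x t - x 0) < e" if "e > 0" for e
    using x that unfolding continuous_at_eps_delta eventually_nhds_metric dist_norm by auto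
  have rem: "\<forall>\<^sub>F t in nhds 0. norm (t *\<^sub>R R t + L (x t - x 0)) \<le> e * norm (x t - x 0)" if e: "e > 0" for e
  proof -
    obtain d where d: "d > 0" "\<And>v. norm (v - x 0) < d \<Longrightarrow> norm (\<Phi> v - L (v - x 0)) \<le> e * norm (v - x 0)"
      using small[OF e] by blast
    show ?thesis using xb[OF d(1)] eq
    proof eventually_elim
      case (elim t)
      then have "\<Phi> (x t) = - (t *\<^sub>R R t)" by (simp add: eq_neg_iff_add_eq_0)
      then have "norm (- (t *\<^sub>R R t + L (x t - x 0))) \<le> e * norm (x t - x 0)"
        using d(2)[OF elim(1)] by (simp add: algebra_simps)
      then show ?case by (simp only: norm_minus_cancel)
    qed
  qed
  have lip: "\<forall>\<^sub>F t in nhds 0. norm (x t - x 0) \<le> (2 * M / m) * \<bar>t\<bar>"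
    using rem[OF half_gt_zero[OF m(1)]] bnd[OF zero_less_one]
  proof eventually_elim
    case (elim t)
    have "norm (R t) \<le> M" using elim(2) norm_triangle_ineq2[of "R t" "R 0"] by (simp add: M_def)
    then have t: "norm (t *\<^sub>R R t) \<le> \<bar>t\<bar> * M" by (simp add: mult_left_mono)
    have "m * norm (x t - x 0) \<le> norm (L (x t - x 0))" by (rule m)
    also have "\<dots> \<le> norm (t *\<^sub>R R t + L (x t - x 0)) + norm (t *\<^sub>R R t)"
      using norm_triangle_ineq4[of "t *\<^sub>R R t + L (x t - x 0)" "t *\<^sub>R R t"] by simp
    also have "\<dots> \<le> m * norm (x t - x 0) / 2 + \<bar>t\<bar> * M" using elim(1) t by simp
    finally show ?case using m(1) by (simp add: field_simps)
  qed
  have "(x has_derivative (\<lambda>t. t *\<^sub>R x')) (at 0)"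
    unfolding has_derivative_at_alt
  proof (intro conjI allI impI)
    show "bounded_linear (\<lambda>t. t *\<^sub>R x')" by (rule bounded_linear_scaleR_left)
    fix e :: real assume e: "e > 0"
    \<comment> \<open>By \<open>lip\<close> the remainder then costs at most
      \<open>e * m / 2\<close> times \<open>\<bar>t\<bar>\<close>; continuity of \<open>R\<close>
      pays the other half.\<close>
    define e1 where "e1 = e * m / 2 / (2 * M / m)"
    have e1: "e1 > 0" using e m M by (simp add: e1_def)
    have e2: "e * m / 2 > 0" using e m by simp
    have "\<forall>\<^sub>F t in nhds 0. norm (x t - x 0 - t *\<^sub>R x') \<le> e * \<bar>t\<bar>"
      using rem[OF e1] lip bnd[OF e2]
    proof eventually_elim
      case (elim t)
      have "L (x t - x 0 - t *\<^sub>R x') = (t *\<^sub>R R t + L (x t - x 0)) - t *\<^sub>R (R t - R 0)"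
        unfolding linear_diff[OF lin, of "x t - x 0"] linear_cmul[OF lin] x' by (simp add: scaleR_diff_right)
      then have "m * norm (x t - x 0 - t *\<^sub>R x') \<le> norm ((t *\<^sub>R R t + L (x t - x 0)) - t *\<^sub>R (R t - R 0))"
        using m(2)[of "x t - x 0 - t *\<^sub>R x'"] by simp
      also have "\<dots> \<le> norm (t *\<^sub>R R t + L (x t - x 0)) + norm (t *\<^sub>R (R t - R 0))" by (rule norm_triangle_ineq4)
      also have "\<dots> \<le> e1 * ((2 * M / m) * \<bar>t\<bar>) + \<bar>t\<bar> * (e * m / 2)"
      proof (rule add_mono)
        show "norm (t *\<^sub>R R t + L (x t - x 0)) \<le> e1 * ((2 * M / m) * \<bar>t\<bar>)"
          using elim(1) mult_left_mono[OF elim(2), of e1] e1 by linarith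
        show "norm (t *\<^sub>R (R t - R 0)) \<le> \<bar>t\<bar> * (e * m / 2)"
          unfolding norm_scaleR using elim(3) by (intro mult_left_mono) auto
      qed
      also have "\<dots> = m * (e * \<bar>t\<bar>)" using m M by (simp add: e1_def field_simps)
      finally show ?case using m(1) by simp
    qed
    then show "\<exists>d>0. \<forall>y. norm (y - 0) < d \<longrightarrow> norm (x y - x 0 - (y - 0) *\<^sub>R x') \<le> e * norm (y - 0)"
      unfolding eventually_nhds_metric by (simp add: dist_norm)
  qed
  then show ?thesis using x' by (auto simp: has_vector_derivative_def)
qed

context symplectic_manifold
begin

text \<open>A continuous branch of nondegenerate critical points over an open set of functions. Its
  differentiability along lines is derived in \<open>selection_derivative\<close>.\<close>

definition selection :: "('x \<Rightarrow> real) set \<Rightarrow> ('x, 'e) chart \<Rightarrow> (('x \<Rightarrow> real) \<Rightarrow> 'e) \<Rightarrow> bool" where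
  "selection U c x \<longleftrightarrow> c \<in> A \<and> openin TT U \<and> continuous_map (subtopology TT U) euclidean x \<and>
    (\<forall>f\<in>U. x f \<in> chart_img c \<and> crit c f (x f) \<and> bdet (hess c f (x f)) \<noteq> 0)"

lemma selectionD:
  assumes "selection U c x"
  shows "c \<in> A" "openin TT U" "continuous_map (subtopology TT U) euclidean x"
    "f \<in> U \<Longrightarrow> f \<in> Cinf X A" "f \<in> U \<Longrightarrow> x f \<in> chart_img c" "f \<in> U \<Longrightarrow> iter_deriv [v] (rp c f) (x f) = 0"
    "f \<in> U \<Longrightarrow> bdet (hess c f (x f)) \<noteq> 0"
  using assms openin_subset[of TT U] by (auto simp: selection_def crit_def)

lemma selection_subset: "selection U c x \<Longrightarrow> openin TT V \<Longrightarrow> V \<subseteq> U \<Longrightarrow> selection V c x"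
  unfolding selection_def using continuous_map_from_subtopology_mono by blast

text \<open>Component \<open>k\<close> of the solution \<open>x'\<close> of
  \<open>hess c f y x' v = - dh v\<close> by Cramer's rule: the speed of the critical point
  \<open>y\<close> when \<open>f\<close> moves in direction \<open>h\<close>.\<close>

definition velocity :: "('x, 'e) chart \<Rightarrow> 'e \<Rightarrow> ('x \<Rightarrow> real) \<Rightarrow> ('x \<Rightarrow> real) \<Rightarrow> nat \<Rightarrow> real" where
  "velocity c y f h k = ndet DIM('e) (\<lambda>i j. if i = k then - iter_deriv [eb j] (rp c h) y
     else iter_deriv [eb i, eb j] (rp c f) y) / bdet (hess c f y)"

text \<open>On the branch over \<open>f + t h\<close> the gradient of \<open>f\<close> plus
  \<open>t\<close> times the gradient of \<open>h\<close> vanishes, the situation of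
  \<open>perturbed_zero_derivative\<close>: \<open>?\<Phi>\<close> is the gradient of
  \<open>f\<close>, \<open>?L\<close> its Hessian, and \<open>?R\<close> the gradient of
  \<open>h\<close> at the moving point.\<close>

lemma selection_derivative:
  assumes s: "selection U c x" and f: "f \<in> U" and h: "h \<in> Cinf X A"
  shows "\<exists>x'. ((\<lambda>t. x (\<lambda>z. f z + t * h z)) has_vector_derivative x') (at 0) \<and>
    (\<forall>k<DIM('e). x' \<bullet> eb k = velocity c (x f) f h k)"
proof -
  note c = selectionD(1)[OF s] and fC = selectionD(4)[OF s f]
  define y where "y = x f"
  have y: "y \<in> chart_img c" using selectionD(5)[OF s f] by (simp add: y_def)
  let ?l = "\<lambda>t z. f z + t * h z"
  let ?\<Phi> = "\<lambda>z. \<Sum>b\<in>Basis. fd (rp c f) z b *\<^sub>R (b :: 'e)"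
  let ?R = "\<lambda>t. \<Sum>b\<in>Basis. iter_deriv [b] (rp c h) (x (?l t)) *\<^sub>R (b :: 'e)"
  let ?L = "\<lambda>u. \<Sum>b\<in>Basis. hess c f y u b *\<^sub>R (b :: 'e)"
  have l0: "?l 0 = f" by simp
  note B = bilinear_hess[OF fC c y]
  have l: "linear (\<lambda>x. hess c f y x v)" "linear (\<lambda>x. hess c f y v x)" for v using B by (auto simp: bilinear_def)
  have nd: "\<forall>u. (\<forall>v. hess c f y u v = 0) \<longrightarrow> u = 0"
    using bdet_nonzero_iff[OF B] selectionD(7)[OF s f] by (simp add: y_def)
  have lin: "linear ?L"
    by (rule linearI) (auto simp: linear_add[OF l(1)] linear_cmul[OF l(1)] algebra_simps sum.distrib scaleR_sum_right)
  have "inj ?L"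
    unfolding linear_injective_0[OF lin]
  proof safe
    fix u assume u: "?L u = 0"
    have "hess c f y u b = 0" if "b \<in> Basis" for b
      using inner_sum_left_Basis[OF that, of "hess c f y u"] u by simp
    then have "hess c f y u v = 0" for v
      using linear_eq_stdbasis[OF l(2)[of u] linear_zero] by metis
    then show "u = 0" using nd by blast
  qed
  moreover have "(?\<Phi> has_derivative ?L) (at (x (?l 0)))"
    unfolding l0 y_def[symmetric] hess_def iter_deriv.simps
    by (intro has_derivative_sum has_derivative_scaleR_left fd_works
        smooth_on_differentiable[OF smooth_on_fd[OF smooth_rp[OF fC c]] y])
  moreover have "?\<Phi> (x (?l 0)) = 0"
    using selectionD(6)[OF s f] by (simp add: l0)
  moreover have ev: "\<forall>\<^sub>F t in nhds 0. ?l t \<in> U" by (rule eventually_line[OF f h selectionD(2)[OF s]])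
  then obtain S where S: "open S" "0 \<in> S" "\<And>t. t \<in> S \<Longrightarrow> ?l t \<in> U" by (auto simp: eventually_nhds)
  have cl: "continuous_map (top_of_set S) (subtopology TT U) ?l"
    using continuous_map_from_subtopology[OF continuous_map_line[OF fC h]] S(3)
    by (auto simp: continuous_map_in_subtopology)
  have cx: "continuous_map (top_of_set S) euclidean (\<lambda>t. x (?l t))"
    using continuous_map_compose[OF cl selectionD(3)[OF s]] by (simp add: comp_def)
  then have x0: "isCont (\<lambda>t. x (?l t)) 0" using S by (simp add: continuous_on_eq_continuous_at)
  moreover have "isCont ?R 0"
  proof -
    have "continuous_map (top_of_set S) euclideanreal (\<lambda>t. iter_deriv [b] (rp c h) (x (?l t)))" for b
      by (rule continuous_map_jet_compose[OF c _ cx]) (use h S(3) selectionD(5)[OF s] in auto)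
    then have "continuous_on S ?R" by (intro continuous_intros) auto
    then show ?thesis using S by (simp add: continuous_on_eq_continuous_at)
  qed
  moreover have "\<forall>\<^sub>F t in nhds 0. ?\<Phi> (x (?l t)) + t *\<^sub>R ?R t = 0"
    using ev
  proof eventually_elim
    case (elim t)
    have "iter_deriv [b] (rp c (?l t)) (x (?l t)) = 0" for b by (rule selectionD(6)[OF s elim])
    then have "fd (rp c f) (x (?l t)) b + t * iter_deriv [b] (rp c h) (x (?l t)) = 0" for b
      unfolding iter_deriv_line[OF fC h c selectionD(5)[OF s elim]] by simp
    then have "(\<Sum>b\<in>Basis. (fd (rp c f) (x (?l t)) b + t * iter_deriv [b] (rp c h) (x (?l t))) *\<^sub>R b) = 0"
      by (intro sum.neutral) simp
    then show ?case by (simp add: scaleR_add_left sum.distrib scaleR_sum_right)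
  qed
  ultimately obtain x' where x': "((\<lambda>t. x (?l t)) has_vector_derivative x') (at 0)" "?L x' + ?R 0 = 0"
    using perturbed_zero_derivative[of ?\<Phi> ?L "\<lambda>t. x (?l t)" ?R] by blast
  have eq: "hess c f y x' b = - iter_deriv [b] (rp c h) y" if "b \<in> Basis" for b
  proof -
    have "(?L x' + ?R 0) \<bullet> b = hess c f y x' b + iter_deriv [b] (rp c h) y"
      using that by (simp add: inner_add_left l0 y_def[symmetric] del: iter_deriv.simps)
    then show ?thesis using x'(2) by simp
  qed
  have "x' \<bullet> eb k = velocity c (x f) f h k" if k: "k < DIM('e)" for k
  proof -
    have "(x' \<bullet> eb k) * bdet (hess c f y) =
        ndet DIM('e) (\<lambda>i j. if i = k then hess c f y x' (eb j) else hess c f y (eb i) (eb j))"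
      by (rule bdet_cramer[OF B k, symmetric])
    also have "\<dots> = ndet DIM('e) (\<lambda>i j. if i = k then - iter_deriv [eb j] (rp c h) y
     else iter_deriv [eb i, eb j] (rp c f) y)"
      by (rule ndet_cong) (simp add: eq[OF eb_Basis], simp add: hess_def)
    finally show ?thesis using selectionD(7)[OF s f]
      unfolding velocity_def y_def by (simp add: nonzero_eq_divide_eq del: iter_deriv.simps)
  qed
  then show ?thesis using x'(1) by blast
qed

end

lemma DERIV_eventually:
  assumes "(f has_real_derivative D) (at x)" "\<forall>\<^sub>F y in nhds x. g y = f y"
  shows "(g has_real_derivative D) (at x)"
  using DERIV_cong_ev[OF refl assms(2) refl] assms(1) by blast

section \<open>Algebraic expressions in jets along branches of critical points\<close>

context symplectic_manifold
begin

text \<open>\<open>jalg U k q\<close>: \<open>q f H\<close> is an algebraic expression in the jets of \<open>f\<close> and of the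
  directions \<open>H 0, \<dots>, H (k - 1)\<close> at critical points of \<open>f\<close>. The class consists of continuous
  functions and is closed under differentiation in \<open>f\<close> along a new direction \<open>H k\<close>, which makes
  all its members smooth on \<open>U\<close>.\<close>

inductive jalg :: "('x \<Rightarrow> real) set \<Rightarrow> nat \<Rightarrow> (('x \<Rightarrow> real) \<Rightarrow> (nat \<Rightarrow> 'x \<Rightarrow> real) \<Rightarrow> real) \<Rightarrow> bool"
  for U :: "('x \<Rightarrow> real) set" where
  const: "jalg U k (\<lambda>f H. a)"
| point: "selection U c x \<Longrightarrow> smooth_on (chart_img c) g \<Longrightarrow> jalg U k (\<lambda>f H. g (x f))"
| jet: "selection U c x \<Longrightarrow> jalg U k (\<lambda>f H. iter_deriv vs (rp c f) (x f))"
| hjet: "selection U c x \<Longrightarrow> j < k \<Longrightarrow> jalg U k (\<lambda>f H. iter_deriv vs (rp c (H j)) (x f))"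
| add: "jalg U k q \<Longrightarrow> jalg U k r \<Longrightarrow> jalg U k (\<lambda>f H. q f H + r f H)"
| mult: "jalg U k q \<Longrightarrow> jalg U k r \<Longrightarrow> jalg U k (\<lambda>f H. q f H * r f H)"
| comp: "jalg U k q \<Longrightarrow> smooth_on UNIV g \<Longrightarrow> jalg U k (\<lambda>f H. g (q f H))"
| inv: "jalg U k q \<Longrightarrow> (\<And>f H. f \<in> U \<Longrightarrow> q f H \<noteq> 0) \<Longrightarrow> jalg U k (\<lambda>f H. inverse (q f H))"

lemma jalg_mono: "jalg U k q \<Longrightarrow> k \<le> k' \<Longrightarrow> jalg U k' q"
  by (induction rule: jalg.induct) (auto intro: jalg.intros)

lemma jalg_sum: "(\<And>i. i \<in> I \<Longrightarrow> jalg U k (q i)) \<Longrightarrow> jalg U k (\<lambda>f H. \<Sum>i\<in>I. q i f H)"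
  by (induction I rule: infinite_finite_induct) (auto intro: jalg.intros)

lemma jalg_prod: "(\<And>i. i \<in> I \<Longrightarrow> jalg U k (q i)) \<Longrightarrow> jalg U k (\<lambda>f H. \<Prod>i\<in>I. q i f H)"
  by (induction I rule: infinite_finite_induct) (auto intro: jalg.intros)

lemma jalg_cmult: "jalg U k q \<Longrightarrow> jalg U k (\<lambda>f H. a * q f H)"
  using jalg.mult[OF jalg.const] .

lemma jalg_minus: "jalg U k q \<Longrightarrow> jalg U k (\<lambda>f H. - q f H)"
  using jalg_cmult[of U k q "- 1"] by simp

lemma jalg_divide:
  assumes "jalg U k q" "jalg U k r" "\<And>f H. f \<in> U \<Longrightarrow> r f H \<noteq> 0"
  shows "jalg U k (\<lambda>f H. q f H / r f H)"
  using jalg.mult[OF assms(1) jalg.inv[OF assms(2,3)]] by (simp add: divide_inverse)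

lemma jalg_ndet:
  assumes "\<And>i j. i < n \<Longrightarrow> j < n \<Longrightarrow> jalg U k (\<lambda>f H. m i j f H)"
  shows "jalg U k (\<lambda>f H. ndet n (\<lambda>i j. m i j f H))"
  unfolding ndet_def
proof (intro jalg_sum jalg_cmult jalg_prod)
  fix \<sigma> i assume "\<sigma> \<in> {\<sigma>. \<sigma> permutes {..<n}}" "i \<in> {..<n}"
  then show "jalg U k (m i (\<sigma> i))" using permutes_in_image[of \<sigma> "{..<n}" i] by (intro assms) auto
qed

lemma jalg_bdet_hess: "selection U c x \<Longrightarrow> jalg U k (\<lambda>f H. bdet (hess c f (x f)))"
  unfolding bdet_def hess_def by (intro jalg_ndet jalg.jet)

lemma jalg_velocity:
  assumes s: "selection U c x" and "j < k" "l < DIM('e)"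
  shows "jalg U k (\<lambda>f H. velocity c (x f) f (H j) l)"
  unfolding velocity_def
proof (intro jalg_divide jalg_ndet jalg_bdet_hess s)
  fix i i' :: nat
  show "jalg U k (\<lambda>f H. if i = l then - iter_deriv [eb i'] (rp c (H j)) (x f)
      else iter_deriv [eb i, eb i'] (rp c f) (x f))"
    using assms by (cases "i = l")
      (auto intro: jalg_minus jalg.hjet jalg.jet simp del: iter_deriv.simps)
qed (rule selectionD(7)[OF s])

lemma jalg_continuous:
  assumes "jalg U k q"
  shows "continuous_map (prod_topology (subtopology TT U) (product_topology (\<lambda>_. TT) {..<k}))
    euclideanreal (\<lambda>p. q (fst p) (snd p))"
  using assms
proof induction
  case (const k a)
  then show ?case by simp
next
  let ?P = "\<lambda>k. prod_topology (subtopology TT U) (product_topology (\<lambda>_. TT) {..<k})"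
  have xc: "continuous_map (?P k) euclidean (\<lambda>p. x (fst p))" if "selection U c x" for k c x
    using continuous_map_compose[OF continuous_map_fst selectionD(3)[OF that]] by (simp add: comp_def)
  have xi: "x (fst p) \<in> chart_img c" if "selection U c x" "p \<in> topspace (?P k)" for k c x p
    using selectionD(5)[OF that(1)] that(2) by auto
  have fc: "continuous_map (?P k) TT fst" for k
    using continuous_map_fst[of "subtopology TT U"] unfolding continuous_map_in_subtopology by blast
  {
    case (point c x g k)
    have 1: "continuous_map (?P k) (top_of_set (chart_img c)) (\<lambda>p. x (fst p))"
      using xc[OF point(1)] xi[OF point(1)] by (auto simp: continuous_map_in_subtopology)
    have 2: "continuous_map (top_of_set (chart_img c)) euclideanreal g"
      using smooth_on_continuous_on[OF point(2)] by simp
    from continuous_map_compose[OF 1 2] show ?case by (simp add: comp_def)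
  next
    case (jet c x k vs)
    show ?case by (rule continuous_map_jet_compose[OF selectionD(1)[OF jet(1)] fc xc[OF jet(1)] xi[OF jet(1)]])
  next
    case (hjet c x j k vs)
    have "continuous_map (?P k) TT (\<lambda>p. snd p j)"
      using continuous_map_compose[OF continuous_map_snd continuous_map_product_projection[of j "{..<k}" "\<lambda>_. TT"]]
        hjet(2) by (simp add: comp_def)
    then show ?case
      by (rule continuous_map_jet_compose[OF selectionD(1)[OF hjet(1)] _ xc[OF hjet(1)] xi[OF hjet(1)]])
  next
    case (add k q r)
    then show ?case by (intro continuous_map_add)
  next
    case (mult k q r)
    then show ?case by (intro continuous_map_real_mult)
  next
    case (comp k q g)
    have "continuous_map euclideanreal euclideanreal g"
      using smooth_on_continuous_on[OF comp(2)] by simp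
    from continuous_map_compose[OF comp.IH this] show ?case by (simp add: comp_def)
  next
    case (inv k q)
    then show ?case by (intro continuous_map_real_inverse) auto
  }
qed

lemma sum_eb_linear:
  fixes L :: "'e \<Rightarrow> real"
  assumes L: "linear L" and v: "\<And>k. k < DIM('e) \<Longrightarrow> x' \<bullet> eb k = v k"
  shows "L x' = (\<Sum>k<DIM('e). v k * L (eb k))"
proof -
  have "L x' = L (\<Sum>k<DIM('e). (x' \<bullet> eb k) *\<^sub>R eb k)" by (simp add: eb_expansion)
  also have "\<dots> = (\<Sum>k<DIM('e). v k * L (eb k))"
    unfolding linear_sum[OF L] by (intro sum.cong refl) (simp add: linear_cmul[OF L] v)
  finally show ?thesis .
qed

lemma selection_chain:
  assumes s: "selection U c x" and f: "f \<in> U" and h: "h \<in> Cinf X A"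
    and g: "g differentiable (at (x f))"
  shows "((\<lambda>t. g (x (\<lambda>z. f z + t * h z))) has_real_derivative
    (\<Sum>k<DIM('e). velocity c (x f) f h k * fd g (x f) (eb k))) (at 0)"
proof -
  obtain x' where x': "((\<lambda>t. x (\<lambda>z. f z + t * h z)) has_vector_derivative x') (at 0)"
    "\<And>k. k < DIM('e) \<Longrightarrow> x' \<bullet> eb k = velocity c (x f) f h k"
    using selection_derivative[OF s f h] by blast
  have l: "linear (fd g (x f))" by (rule linear_frechet_derivative[OF g])
  have "((\<lambda>t. g (x (\<lambda>z. f z + t * h z))) has_derivative (\<lambda>t. fd g (x f) (t *\<^sub>R x'))) (at 0)"
    by (rule has_derivative_compose[OF x'(1)[unfolded has_vector_derivative_def]]) (use fd_works[OF g] in simp)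
  moreover have "fd g (x f) (t *\<^sub>R x') = (\<Sum>k<DIM('e). velocity c (x f) f h k * fd g (x f) (eb k)) * t" for t
    unfolding linear_cmul[OF l] using sum_eb_linear[OF l x'(2)] by simp
  ultimately show ?thesis by (simp add: has_field_derivative_def)
qed

text \<open>Moving \<open>f\<close> moves the critical point, which by the chain rule yields one
  more jet order times a velocity. A jet of \<open>f\<close> itself also changes with the function,
  whence the additional jet of \<open>H k\<close>; a jet of an earlier direction \<open>H j\<close>
  does not.\<close>

lemma jalg_derivative:
  assumes "jalg U k q"
  shows "\<exists>q'. jalg U (Suc k) q' \<and> (\<forall>f\<in>U. \<forall>H. (\<forall>i\<le>k. H i \<in> Cinf X A) \<longrightarrow>
    ((\<lambda>t. q (\<lambda>z. f z + t * H k z) H) has_real_derivative q' f H) (at 0))"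
  using assms
proof induction
  case (const k a)
  show ?case by (intro exI[of _ "\<lambda>f H. 0"]) (auto intro: jalg.const)
next
  case (point c x g k)
  show ?case
  proof (intro exI[of _ "\<lambda>f H. \<Sum>l<DIM('e). velocity c (x f) f (H k) l * fd g (x f) (eb l)"] conjI ballI allI impI)
    show "jalg U (Suc k) (\<lambda>f H. \<Sum>l<DIM('e). velocity c (x f) f (H k) l * fd g (x f) (eb l))"
      using point by (intro jalg_sum jalg.mult jalg_velocity jalg.point smooth_on_fd) auto
    fix f H assume "f \<in> U" "\<forall>i\<le>k. H i \<in> Cinf X A"
    then show "((\<lambda>t. g (x (\<lambda>z. f z + t * H k z))) has_real_derivative
        (\<Sum>l<DIM('e). velocity c (x f) f (H k) l * fd g (x f) (eb l))) (at 0)"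
      using point selectionD(5)[OF point(1)]
      by (intro selection_chain[OF point(1)] smooth_on_differentiable[OF point(2)]) auto
  qed
next
  case (jet c x k vs)
  let ?q = "\<lambda>f H. (\<Sum>l<DIM('e). velocity c (x f) f (H k) l * iter_deriv (eb l # vs) (rp c f) (x f)) +
      iter_deriv vs (rp c (H k)) (x f)"
  show ?case
  proof (intro exI[of _ ?q] conjI ballI allI impI)
    show "jalg U (Suc k) ?q"
      using jet by (intro jalg.add jalg_sum jalg.mult jalg_velocity jalg.jet jalg.hjet) auto
    fix f and H :: "nat \<Rightarrow> 'x \<Rightarrow> real" assume f: "f \<in> U" and H: "\<forall>i\<le>k. H i \<in> Cinf X A"
    have h: "H k \<in> Cinf X A" using H by simp
    let ?l = "\<lambda>t z. f z + t * H k z"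
    note c = selectionD(1)[OF jet(1)] and fC = selectionD(4)[OF jet(1) f] and y = selectionD(5)[OF jet(1) f]
    note dF = smooth_on_differentiable[OF smooth_on_iter_deriv[OF smooth_rp[OF fC c]] y]
    note dG = smooth_on_differentiable[OF smooth_on_iter_deriv[OF smooth_rp[OF h c]] y]
    have "((\<lambda>t. iter_deriv vs (rp c f) (x (?l t)) + t * iter_deriv vs (rp c (H k)) (x (?l t)))
        has_real_derivative ?q f H) (at 0)"
      by (rule DERIV_cong[OF DERIV_add[OF selection_chain[OF jet(1) f h dF]
            DERIV_mult[OF DERIV_ident selection_chain[OF jet(1) f h dG]]]]) simp
    then show "((\<lambda>t. iter_deriv vs (rp c (?l t)) (x (?l t))) has_real_derivative ?q f H) (at 0)"
    proof (rule DERIV_eventually)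
      show "\<forall>\<^sub>F t in nhds 0. iter_deriv vs (rp c (?l t)) (x (?l t)) =
          iter_deriv vs (rp c f) (x (?l t)) + t * iter_deriv vs (rp c (H k)) (x (?l t))"
        using eventually_line[OF f h selectionD(2)[OF jet(1)]]
        by eventually_elim (rule iter_deriv_line[OF fC h c selectionD(5)[OF jet(1)]])
    qed
  qed
next
  case (hjet c x j k vs)
  let ?q = "\<lambda>f H. \<Sum>l<DIM('e). velocity c (x f) f (H k) l * iter_deriv (eb l # vs) (rp c (H j)) (x f)"
  show ?case
  proof (intro exI[of _ ?q] conjI ballI allI impI)
    show "jalg U (Suc k) ?q"
      using hjet by (intro jalg_sum jalg.mult jalg_velocity jalg.hjet) auto
    fix f and H :: "nat \<Rightarrow> 'x \<Rightarrow> real" assume f: "f \<in> U" and H: "\<forall>i\<le>k. H i \<in> Cinf X A"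
    have h: "H k \<in> Cinf X A" "H j \<in> Cinf X A" using H hjet(2) by auto
    show "((\<lambda>t. iter_deriv vs (rp c (H j)) (x (\<lambda>z. f z + t * H k z))) has_real_derivative ?q f H) (at 0)"
      using selection_chain[OF hjet(1) f h(1) smooth_on_differentiable[OF
          smooth_on_iter_deriv[OF smooth_rp[OF h(2) selectionD(1)[OF hjet(1)]]] selectionD(5)[OF hjet(1) f]]]
      by simp
  qed
next
  case (add k q r)
  then obtain q' r' where *: "jalg U (Suc k) q'" "jalg U (Suc k) r'"
    "\<And>f H. f \<in> U \<Longrightarrow> \<forall>i\<le>k. H i \<in> Cinf X A \<Longrightarrow> ((\<lambda>t. q (\<lambda>z. f z + t * H k z) H) has_real_derivative q' f H) (at 0)"
    "\<And>f H. f \<in> U \<Longrightarrow> \<forall>i\<le>k. H i \<in> Cinf X A \<Longrightarrow> ((\<lambda>t. r (\<lambda>z. f z + t * H k z) H) has_real_derivative r' f H) (at 0)"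
    by blast
  show ?case
  proof (intro exI[of _ "\<lambda>f H. q' f H + r' f H"] conjI jalg.add * ballI allI impI)
    fix f and H :: "nat \<Rightarrow> 'x \<Rightarrow> real" assume "f \<in> U" "\<forall>i\<le>k. H i \<in> Cinf X A"
    from DERIV_add[OF *(3)[OF this] *(4)[OF this]]
    show "((\<lambda>t. q (\<lambda>z. f z + t * H k z) H + r (\<lambda>z. f z + t * H k z) H) has_real_derivative
      q' f H + r' f H) (at 0)" .
  qed
next
  case (mult k q r)
  then obtain q' r' where *: "jalg U (Suc k) q'" "jalg U (Suc k) r'"
    "\<And>f H. f \<in> U \<Longrightarrow> \<forall>i\<le>k. H i \<in> Cinf X A \<Longrightarrow> ((\<lambda>t. q (\<lambda>z. f z + t * H k z) H) has_real_derivative q' f H) (at 0)"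
    "\<And>f H. f \<in> U \<Longrightarrow> \<forall>i\<le>k. H i \<in> Cinf X A \<Longrightarrow> ((\<lambda>t. r (\<lambda>z. f z + t * H k z) H) has_real_derivative r' f H) (at 0)"
    by blast
  show ?case
  proof (intro exI[of _ "\<lambda>f H. q' f H * r f H + r' f H * q f H"] conjI ballI allI impI)
    show "jalg U (Suc k) (\<lambda>f H. q' f H * r f H + r' f H * q f H)"
      using mult(1,2) jalg_mono[of U k _ "Suc k"] by (intro jalg.add jalg.mult *) auto
    fix f and H :: "nat \<Rightarrow> 'x \<Rightarrow> real" assume "f \<in> U" "\<forall>i\<le>k. H i \<in> Cinf X A"
    from DERIV_mult[OF *(3)[OF this] *(4)[OF this]]
    show "((\<lambda>t. q (\<lambda>z. f z + t * H k z) H * r (\<lambda>z. f z + t * H k z) H) has_real_derivative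
      q' f H * r f H + r' f H * q f H) (at 0)" by simp
  qed
next
  case (comp k q g)
  then obtain q' where *: "jalg U (Suc k) q'"
    "\<And>f H. f \<in> U \<Longrightarrow> \<forall>i\<le>k. H i \<in> Cinf X A \<Longrightarrow> ((\<lambda>t. q (\<lambda>z. f z + t * H k z) H) has_real_derivative q' f H) (at 0)"
    by blast
  have g: "(g has_real_derivative fd g y 1) (at y)" for y
  proof -
    have d: "g differentiable (at y)" using smooth_on_differentiable[OF comp(2)] by simp
    have "fd g y h = fd g y 1 * h" for h
      using linear_cmul[OF linear_frechet_derivative[OF d], of h 1] by simp
    then have "fd g y = (*) (fd g y 1)" by (intro ext)
    then show ?thesis using fd_works[OF d] unfolding has_field_derivative_def by metis
  qed
  show ?case
  proof (intro exI[of _ "\<lambda>f H. fd g (q f H) 1 * q' f H"] conjI ballI allI impI)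
    show "jalg U (Suc k) (\<lambda>f H. fd g (q f H) 1 * q' f H)"
      by (rule jalg.mult[OF jalg.comp[OF jalg_mono[OF comp(1)] smooth_on_fd[OF comp(2)]] *(1)]) simp
    fix f and H :: "nat \<Rightarrow> 'x \<Rightarrow> real" assume "f \<in> U" "\<forall>i\<le>k. H i \<in> Cinf X A"
    from DERIV_chain2[OF g *(2)[OF this]]
    show "((\<lambda>t. g (q (\<lambda>z. f z + t * H k z) H)) has_real_derivative fd g (q f H) 1 * q' f H) (at 0)"
      by simp
  qed
next
  case (inv k q)
  then obtain q' where *: "jalg U (Suc k) q'"
    "\<And>f H. f \<in> U \<Longrightarrow> \<forall>i\<le>k. H i \<in> Cinf X A \<Longrightarrow> ((\<lambda>t. q (\<lambda>z. f z + t * H k z) H) has_real_derivative q' f H) (at 0)"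
    by blast
  show ?case
  proof (intro exI[of _ "\<lambda>f H. - (inverse (q f H) * q' f H * inverse (q f H))"] conjI ballI allI impI)
    show "jalg U (Suc k) (\<lambda>f H. - (inverse (q f H) * q' f H * inverse (q f H)))"
    proof -
      have i: "jalg U (Suc k) (\<lambda>f H. inverse (q f H))"
        by (rule jalg.inv[OF jalg_mono[OF inv(1)] inv(2)]) simp_all
      show ?thesis by (rule jalg_minus[OF jalg.mult[OF jalg.mult[OF i *(1)] i]])
    qed
    fix f and H :: "nat \<Rightarrow> 'x \<Rightarrow> real" assume f: "f \<in> U" "\<forall>i\<le>k. H i \<in> Cinf X A"
    from DERIV_inverse'[OF *(2)[OF this]] inv(2)[OF f(1)]
    show "((\<lambda>t. inverse (q (\<lambda>z. f z + t * H k z) H)) has_real_derivative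
        - (inverse (q f H) * q' f H * inverse (q f H))) (at 0)" by simp
  qed
qed

lemma map_rev_upt: "map f (rev [0..<Suc k]) = f k # map f (rev [0..<k])"
  by simp

text \<open>Iterating \<open>jalg_derivative\<close> represents all derivatives of \<open>p\<close>
  near \<open>f\<close> by continuous expressions \<open>Q k\<close>. In \<open>Q k\<close> the
  direction of the first differentiation is \<open>H 0\<close>, whereas \<open>dir_deriv\<close>
  keeps it at the end of its list; hence the reversals.\<close>

theorem frechet_smooth_if_locally_jalg:
  assumes loc: "\<And>f. f \<in> Cinf X A \<Longrightarrow> \<exists>U q. openin TT U \<and> f \<in> U \<and> jalg U 0 q \<and> (\<forall>g\<in>U. \<forall>H. p g = q g H)"
  shows "frechet_smooth TT p"
proof -
  have main: "\<exists>U Q. openin TT U \<and> f \<in> U \<and> (\<forall>k. jalg U k (Q k)) \<and>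
      (\<forall>k. \<forall>g\<in>U. \<forall>H. (\<forall>i\<le>k. H i \<in> Cinf X A) \<longrightarrow>
        ((\<lambda>t. Q k (\<lambda>z. g z + t * H k z) H) has_real_derivative Q (Suc k) g H) (at 0)) \<and>
      (\<forall>k. \<forall>g\<in>U. \<forall>H. (\<forall>i<k. H i \<in> Cinf X A) \<longrightarrow> dir_deriv (map H (rev [0..<k])) p g = Q k g H)"
    if fC: "f \<in> Cinf X A" for f
  proof -
    obtain U q where U: "openin TT U" "f \<in> U" and q: "jalg U 0 q" "\<And>g H. g \<in> U \<Longrightarrow> p g = q g H"
      using loc[OF fC] by blast
    \<comment> \<open>The clause for \<open>k = 0\<close> ties the dependent choice to the given
      representation of \<open>p\<close>.\<close>
    have "\<exists>Q. \<forall>k. (jalg U k (Q k) \<and> (k = 0 \<longrightarrow> Q k = q)) \<and> (\<forall>g\<in>U. \<forall>H. (\<forall>i\<le>k. H i \<in> Cinf X A) \<longrightarrow>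
        ((\<lambda>t. Q k (\<lambda>z. g z + t * H k z) H) has_real_derivative Q (Suc k) g H) (at 0))"
    proof (rule dependent_nat_choice)
      show "\<exists>x. jalg U 0 x \<and> ((0::nat) = 0 \<longrightarrow> x = q)" using q(1) by blast
      fix x and n :: nat assume "jalg U n x \<and> (n = 0 \<longrightarrow> x = q)"
      then show "\<exists>y. (jalg U (Suc n) y \<and> (Suc n = 0 \<longrightarrow> y = q)) \<and>
        (\<forall>g\<in>U. \<forall>H. (\<forall>i\<le>n. H i \<in> Cinf X A) \<longrightarrow>
          ((\<lambda>t. x (\<lambda>z. g z + t * H n z) H) has_real_derivative y g H) (at 0))"
        using jalg_derivative[of U n x] by blast
    qed
    then obtain Q where Q0: "\<forall>k. (jalg U k (Q k) \<and> (k = 0 \<longrightarrow> Q k = q)) \<and> (\<forall>g\<in>U. \<forall>H. (\<forall>i\<le>k. H i \<in> Cinf X A) \<longrightarrow>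
        ((\<lambda>t. Q k (\<lambda>z. g z + t * H k z) H) has_real_derivative Q (Suc k) g H) (at 0))"
      by (elim exE)
    have Q: "\<And>k. jalg U k (Q k)" "Q 0 = q" using Q0 by blast+
    have Qd: "((\<lambda>t. Q k (\<lambda>z. g z + t * H k z) H) has_real_derivative Q (Suc k) g H) (at 0)"
      if "g \<in> U" "\<forall>i\<le>k. H i \<in> Cinf X A" for k g H
      using Q0[rule_format, of k, THEN conjunct2] that by blast
    have dd: "dir_deriv (map H (rev [0..<k])) p g = Q k g H" if "g \<in> U" "\<forall>i<k. H i \<in> Cinf X A" for k g H
      using that
    proof (induction k arbitrary: g)
      case 0
      then show ?case using q(2) Q(2) by simp
    next
      case (Suc k)
      have H: "H k \<in> Cinf X A" "\<forall>i\<le>k. H i \<in> Cinf X A" "\<forall>i<k. H i \<in> Cinf X A" using Suc.prems by auto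
      have "\<forall>\<^sub>F t in nhds 0. dir_deriv (map H (rev [0..<k])) p (\<lambda>z. g z + t * H k z) = Q k (\<lambda>z. g z + t * H k z) H"
        using eventually_line[OF Suc.prems(1) H(1) U(1)] by eventually_elim (rule Suc.IH[OF _ H(3)])
      then have "((\<lambda>t. dir_deriv (map H (rev [0..<k])) p (\<lambda>z. g z + t * H k z)) has_real_derivative Q (Suc k) g H) (at 0)"
        by (rule DERIV_eventually[OF Qd[OF Suc.prems(1) H(2)]])
      then show ?case unfolding map_rev_upt dir_deriv.simps by (rule DERIV_imp_deriv)
    qed
    show ?thesis
      by (rule exI[of _ U], rule exI[of _ Q], intro conjI allI ballI impI, fact U(1), fact U(2),
          fact Q(1), rule Qd, assumption, assumption, rule dd)
  qed
  show ?thesis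
    unfolding frechet_smooth_def
  proof (intro conjI ballI allI)
    fix hs h f assume hs: "hs \<in> lists (topspace TT)" and h: "h \<in> topspace TT" and f: "f \<in> topspace TT"
    define k where "k = length hs"
    \<comment> \<open>Below \<open>k\<close> these are the entries of \<open>hs\<close> in reverse;
      entry \<open>k\<close> is the next direction \<open>h\<close>, along which \<open>Q k\<close>
      is differentiated.\<close>
    define H where "H i = (if i < k then hs ! (k - 1 - i) else h)" for i
    have hsH: "hs = map H (rev [0..<k])"
      by (rule nth_equalityI) (auto simp: k_def H_def rev_nth)
    have HC: "H i \<in> Cinf X A" for i using hs h by (auto simp: H_def k_def)
    obtain U Q where U: "openin TT U" "f \<in> U"
      and Qd: "\<And>k. \<forall>g\<in>U. \<forall>H. (\<forall>i\<le>k. H i \<in> Cinf X A) \<longrightarrow>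
        ((\<lambda>t. Q k (\<lambda>z. g z + t * H k z) H) has_real_derivative Q (Suc k) g H) (at 0)"
      and pQ: "\<And>k. \<forall>g\<in>U. \<forall>H. (\<forall>i<k. H i \<in> Cinf X A) \<longrightarrow> dir_deriv (map H (rev [0..<k])) p g = Q k g H"
      using main[of f] f by auto
    have Hk: "H k = h" by (simp add: H_def)
    have "\<forall>\<^sub>F t in nhds 0. dir_deriv hs p (\<lambda>z. f z + t * h z) = Q k (\<lambda>z. f z + t * h z) H"
      using eventually_line[OF U(2) h[unfolded topspace_TT] U(1)]
      by eventually_elim (use pQ[of k] HC in \<open>simp add: hsH\<close>)
    moreover have "((\<lambda>t. Q k (\<lambda>z. f z + t * h z) H) has_real_derivative Q (Suc k) f H) (at 0)"
      using Qd[of k, rule_format, OF U(2), of H] HC unfolding Hk by blast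
    ultimately have "((\<lambda>t. dir_deriv hs p (\<lambda>z. f z + t * h z)) has_real_derivative Q (Suc k) f H) (at 0)"
      by (rule DERIV_eventually[rotated])
    then show "(\<lambda>t. dir_deriv hs p (\<lambda>x. f x + t * h x)) field_differentiable at 0"
      unfolding field_differentiable_def by blast
  next
    fix k :: nat
    let ?P = "product_topology (\<lambda>_. TT) {..<k}"
    let ?d = "\<lambda>(f, h). dir_deriv (map h [0..<k]) p f"
    show "continuous_map (prod_topology TT ?P) euclideanreal ?d"
    proof (rule continuous_map_metricI)
      fix fh and e :: real assume fh: "fh \<in> topspace (prod_topology TT ?P)" and e: "e > 0"
      obtain f h where fhe: "fh = (f, h)" by (cases fh)
      have f: "f \<in> Cinf X A" using fh fhe by auto
      obtain U Q where UQ: "openin TT U \<and> f \<in> U \<and> (\<forall>k. jalg U k (Q k)) \<and>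
        (\<forall>k. \<forall>g\<in>U. \<forall>H. (\<forall>i\<le>k. H i \<in> Cinf X A) \<longrightarrow>
          ((\<lambda>t. Q k (\<lambda>z. g z + t * H k z) H) has_real_derivative Q (Suc k) g H) (at 0)) \<and>
        (\<forall>k. \<forall>g\<in>U. \<forall>H. (\<forall>i<k. H i \<in> Cinf X A) \<longrightarrow> dir_deriv (map H (rev [0..<k])) p g = Q k g H)"
        using main[OF f] by (elim exE)
      have U: "openin TT U" "f \<in> U" and Qa: "jalg U k (Q k)" using UQ by blast+
      have pQ: "dir_deriv (map H (rev [0..<k])) p g = Q k g H" if "g \<in> U" "\<forall>i<k. H i \<in> Cinf X A" for g H
        using UQ[THEN conjunct2, THEN conjunct2, THEN conjunct2, THEN conjunct2, rule_format, of g k H] that by blast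
      let ?S = "prod_topology (subtopology TT U) ?P"
      \<comment> \<open>The reversal passes from the order \<open>[0..<k]\<close> in
        \<open>frechet_smooth\<close> to that of \<open>pQ\<close>; it is restricted so as to stay
        in the product space.\<close>
      let ?r = "\<lambda>h. \<lambda>i\<in>{..<k}. h (k - 1 - i)"
      have "continuous_map ?P ?P ?r"
        unfolding continuous_map_componentwise
        by (auto intro!: continuous_map_product_projection)
      then have "continuous_map ?S ?S (\<lambda>p. (fst p, ?r (snd p)))"
        by (intro continuous_map_pairedI continuous_map_fst
            continuous_map_compose[OF continuous_map_snd, unfolded comp_def])
      from continuous_map_compose[OF this jalg_continuous[OF Qa]]
      have cont: "continuous_map ?S euclideanreal (\<lambda>p. Q k (fst p) (?r (snd p)))" by (simp add: comp_def)
      have eq: "?d p = Q k (fst p) (?r (snd p))" if p: "p \<in> topspace ?S" for p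
      proof -
        obtain g h where gh: "p = (g, h)" by (cases p)
        have h: "h i \<in> Cinf X A" if "i < k" for i using p that by (auto simp: gh PiE_def)
        have "map h [0..<k] = map (?r h) (rev [0..<k])"
          by (rule nth_equalityI) (auto simp: rev_nth)
        then show ?thesis using pQ h p by (auto simp: gh)
      qed
      have sub: "?S = subtopology (prod_topology TT ?P) (U \<times> topspace ?P)"
        by (rule prod_topology_subtopology(1))
      have o: "openin (prod_topology TT ?P) (U \<times> topspace ?P)" unfolding openin_prod_Times_iff using U(1) openin_topspace by blast
      have fS: "fh \<in> topspace ?S" using fh fhe U by auto
      obtain V where V: "openin ?S V" "fh \<in> V" "\<And>p. p \<in> V \<Longrightarrow> dist (Q k (fst p) (?r (snd p))) (Q k (fst fh) (?r (snd fh))) < e"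
        using continuous_map_metricD[OF cont fS e] by blast
      have VS: "V \<subseteq> topspace ?S" using openin_subset[OF V(1)] .
      have "openin (prod_topology TT ?P) V"
      proof -
        obtain V' where V': "openin (prod_topology TT ?P) V'" "V = V' \<inter> (U \<times> topspace ?P)"
          using V(1) unfolding sub openin_subtopology by blast
        show ?thesis unfolding V'(2) by (rule openin_Int[OF V'(1) o])
      qed
      moreover have "dist (?d p) (?d fh) < e" if "p \<in> V" for p
        unfolding eq[OF subsetD[OF VS that]] eq[OF fS] by (rule V(3)[OF that])
      ultimately show "\<exists>V. openin (prod_topology TT ?P) V \<and> fh \<in> V \<and> (\<forall>p\<in>V. dist (?d p) (?d fh) < e)"
        using V(2) by blast
    qed
  qed
qed

end

section \<open>Smoothness of the invariant function\<close>

lemma linear_eq_0_on_Basis: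
  fixes L :: "'e::euclidean_space \<Rightarrow> real"
  assumes "linear L" "\<And>b. b \<in> Basis \<Longrightarrow> L b = 0"
  shows "L v = 0"
  using linear_eq_stdbasis[OF assms(1) linear_zero assms(2)] by (rule fun_cong)

text \<open>Bounds an operator norm by a finite sum of matrix entries; for Hessians such a sum
  depends continuously on function and point.\<close>

lemma bilinear_bound:
  fixes B :: "'e::euclidean_space \<Rightarrow> 'e \<Rightarrow> real"
  assumes B: "bilinear B" and b: "(\<Sum>i\<in>Basis. \<Sum>j\<in>Basis. \<bar>B i j\<bar>) \<le> K"
  shows "norm (\<Sum>j\<in>Basis. B v j *\<^sub>R j) \<le> K * norm v"
proof -
  have l: "linear (\<lambda>x. B x y)" for y using B by (auto simp: bilinear_def)
  have Bv: "B v j = (\<Sum>i\<in>Basis. (v \<bullet> i) * B i j)" for j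
  proof -
    have "B v j = B (\<Sum>i\<in>Basis. (v \<bullet> i) *\<^sub>R i) j" by (simp add: euclidean_representation)
    also have "\<dots> = (\<Sum>i\<in>Basis. (v \<bullet> i) * B i j)" by (simp add: linear_sum[OF l] linear_cmul[OF l])
    finally show ?thesis .
  qed
  have "norm (\<Sum>j\<in>Basis. B v j *\<^sub>R j) \<le> (\<Sum>j\<in>Basis. \<bar>B v j\<bar>)"
    by (rule order_trans[OF norm_sum]) (simp add: sum_mono)
  also have "\<dots> \<le> (\<Sum>j\<in>Basis. \<Sum>i\<in>Basis. norm v * \<bar>B i j\<bar>)"
  proof (rule sum_mono)
    fix j :: 'e assume "j \<in> Basis"
    have "\<bar>B v j\<bar> \<le> (\<Sum>i\<in>Basis. \<bar>(v \<bullet> i) * B i j\<bar>)" unfolding Bv by (rule sum_abs)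
    also have "\<dots> \<le> (\<Sum>i\<in>Basis. norm v * \<bar>B i j\<bar>)"
      by (rule sum_mono) (simp add: abs_mult mult_right_mono Basis_le_norm)
    finally show "\<bar>B v j\<bar> \<le> (\<Sum>i\<in>Basis. norm v * \<bar>B i j\<bar>)" .
  qed
  also have "\<dots> = norm v * (\<Sum>i\<in>Basis. \<Sum>j\<in>Basis. \<bar>B i j\<bar>)"
    by (subst sum.swap) (simp add: sum_distrib_left)
  also have "\<dots> \<le> K * norm v" using mult_left_mono[OF b, of "norm v"] by (simp add: mult.commute)
  finally show ?thesis .
qed

section \<open>Existence of branches and local finiteness\<close>

context symplectic_manifold
begin

lemma continuous_map_bdet:
  assumes "\<And>i j. i < DIM('e) \<Longrightarrow> j < DIM('e) \<Longrightarrow> continuous_map Y euclideanreal (\<lambda>p. B p (eb i) (eb j))"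
  shows "continuous_map Y euclideanreal (\<lambda>p. bdet (B p :: 'e \<Rightarrow> 'e \<Rightarrow> real))"
  unfolding bdet_def ndet_def
proof (intro continuous_map_sum continuous_map_real_mult_left continuous_map_prod)
  fix \<sigma> i assume "\<sigma> \<in> {\<sigma>. \<sigma> permutes {..<DIM('e)}}" "i \<in> {..<DIM('e)}"
  then show "continuous_map Y euclideanreal (\<lambda>p. B p (eb i) (eb (\<sigma> i)))"
    using permutes_in_image[of \<sigma> "{..<DIM('e)}" i] by (intro assms) auto
qed (auto simp: finite_permutations)

lemma smooth_bdet_form: "c \<in> A \<Longrightarrow> smooth_on (chart_img c) (\<lambda>y. bdet (\<omega> c y))"
  unfolding bdet_def ndet_def
  by (intro smooth_on_sum smooth_on_mult smooth_on_const smooth_on_prod chart(2) form(3))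

lemma continuous_map_disc:
  assumes c: "c \<in> A"
  shows "continuous_map (prod_topology TT (top_of_set (chart_img c))) euclideanreal (\<lambda>p. disc c (fst p) (snd p))"
  unfolding disc_def
proof (intro continuous_map_real_pow continuous_map_real_divide continuous_map_bdet)
  show "continuous_map (prod_topology TT (top_of_set (chart_img c))) euclideanreal
    (\<lambda>p. hess c (fst p) (snd p) (eb i) (eb j))" for i j
    unfolding hess_def by (rule continuous_map_jet[OF c])
  show "continuous_map (prod_topology TT (top_of_set (chart_img c))) euclideanreal (\<lambda>p. \<omega> c (snd p) (eb i) (eb j))" for i j
    using continuous_map_compose[OF continuous_map_snd, of "top_of_set (chart_img c)" euclideanreal "\<lambda>y. \<omega> c y (eb i) (eb j)"]
      smooth_on_continuous_on[OF form(3)[OF c]] by (simp add: comp_def)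
qed (use form(5)[OF c] in auto)

text \<open>Puts joint continuity into the form used below: one neighbourhood of \<open>f\<close>
  serves for a whole closed ball of points.\<close>

lemma jet_neighbourhood:
  assumes c: "c \<in> A" and f: "f \<in> Cinf X A" and y: "y \<in> chart_img c"
    and g: "continuous_map (prod_topology TT (top_of_set (chart_img c))) euclideanreal g" and e: "e > 0"
  shows "\<exists>V r. openin TT V \<and> f \<in> V \<and> r > 0 \<and> cball y r \<subseteq> chart_img c \<and>
    (\<forall>f'\<in>V. \<forall>z\<in>cball y r. \<bar>g (f', z) - g (f, y)\<bar> < e)"
proof -
  let ?Y = "prod_topology TT (top_of_set (chart_img c))"
  obtain W where W: "openin ?Y W" "(f, y) \<in> W" "\<And>q. q \<in> W \<Longrightarrow> dist (g q) (g (f, y)) < e"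
    using continuous_map_metricD[OF g, of "(f, y)" e] f y e by auto
  obtain V Z where VZ: "openin TT V" "openin (top_of_set (chart_img c)) Z" "f \<in> V" "y \<in> Z" "V \<times> Z \<subseteq> W"
    using W(1)[unfolded openin_prod_topology_alt, rule_format, OF W(2)] by (elim exE conjE) (rule that)
  have "open Z" using VZ(2) chart(2)[OF c] by (simp add: openin_open_eq)
  then obtain r where r: "r > 0" "cball y r \<subseteq> Z" using VZ(4) open_contains_cball by blast
  moreover have "Z \<subseteq> chart_img c" using openin_imp_subset[OF VZ(2)] .
  moreover have "\<bar>g (f', z) - g (f, y)\<bar> < e" if "f' \<in> V" "z \<in> cball y r" for f' z
  proof -
    have "(f', z) \<in> W" using VZ(5) r(2) that by blast
    then show ?thesis using W(3) by (simp add: dist_real_def)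
  qed
  ultimately show ?thesis using VZ(1,3) by blast
qed

text \<open>The critical point is a fixed point of the Newton-type map \<open>z \<mapsto> z - Li (grad f z)\<close>, where
  \<open>Li\<close> inverts the Hessian of the unperturbed function.\<close>

lemma selection_exists:
  assumes c: "c \<in> A" and f0: "f0 \<in> Cinf X A" and y0: "y0 \<in> chart_img c"
    and cr: "crit c f0 y0" and nd: "bdet (hess c f0 y0) \<noteq> 0"
  shows "\<exists>U r x. r > 0 \<and> f0 \<in> U \<and> selection U c x \<and> cball y0 r \<subseteq> chart_img c \<and>
    (\<forall>f\<in>U. \<forall>y\<in>cball y0 r. crit c f y \<longrightarrow> y = x f)"
proof -
  define grad where "grad f y = (\<Sum>b\<in>Basis. iter_deriv [b] (rp c f) y *\<^sub>R (b :: 'e))" for f y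
  define L where "L f y v = (\<Sum>b\<in>Basis. hess c f y v b *\<^sub>R (b :: 'e))" for f y v
  have crit_grad: "crit c f y \<longleftrightarrow> grad f y = 0" if "f \<in> Cinf X A" "y \<in> chart_img c" for f y
  proof
    show "crit c f y \<Longrightarrow> grad f y = 0" unfolding crit_def grad_def by (intro sum.neutral) simp
    assume g: "grad f y = 0"
    have 0: "iter_deriv [b] (rp c f) y = 0" if "b \<in> Basis" for b
      using inner_sum_left_Basis[OF that, of "\<lambda>b. iter_deriv [b] (rp c f) y"] g by (simp add: grad_def del: iter_deriv.simps)
    have l: "linear (\<lambda>v. iter_deriv [v] (rp c f) y)"
      using linear_frechet_derivative[OF smooth_on_differentiable[OF smooth_rp[OF that(1) c] that(2)]] by simp
    show "crit c f y" unfolding crit_def by (rule allI, rule linear_eq_0_on_Basis[OF l 0])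
  qed
  have dgrad: "(grad f has_derivative L f y) (at y)" if "f \<in> Cinf X A" "y \<in> chart_img c" for f y
    unfolding grad_def[abs_def] L_def[abs_def] hess_def iter_deriv.simps
    by (intro has_derivative_sum has_derivative_scaleR_left fd_works
        smooth_on_differentiable[OF smooth_on_fd[OF smooth_rp[OF that(1) c]] that(2)])
  have linL: "linear (L f y)" if "f \<in> Cinf X A" "y \<in> chart_img c" for f y
    using dgrad[OF that] has_derivative_linear by blast
  have L0: "v = 0" if "L f y v = 0" "bdet (hess c f y) \<noteq> 0" "f \<in> Cinf X A" "y \<in> chart_img c" for f y v
  proof -
    note B = bilinear_hess[OF that(3) c that(4)]
    have "hess c f y v b = 0" if "b \<in> Basis" for b
      using inner_sum_left_Basis[OF that, of "hess c f y v"] \<open>L f y v = 0\<close> by (simp add: L_def)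
    moreover have "linear (\<lambda>w. hess c f y v w)" using B by (auto simp: bilinear_def)
    ultimately have "hess c f y v w = 0" for w using linear_eq_0_on_Basis[of "hess c f y v" w] by blast
    then show ?thesis using bdet_nonzero_iff[OF B] that(2) by blast
  qed
  have "inj (L f0 y0)" unfolding linear_injective_0[OF linL[OF f0 y0]] using L0[OF _ nd f0 y0] by blast
  then obtain Li where Li: "linear Li" "\<And>v. Li (L f0 y0 v) = v"
    using linear_injective_left_inverse[OF linL[OF f0 y0]] by (auto simp: fun_eq_iff)
  obtain K where K: "K > 0" "\<And>v. norm (Li v) \<le> norm v * K"
    using linear_conv_bounded_linear Li(1) bounded_linear.pos_bounded by blast
  have Li0: "Li v = 0 \<longleftrightarrow> v = 0" for v
  proof
    assume "Li v = 0"
    obtain w where w: "v = L f0 y0 w"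
      using linear_injective_imp_surjective[OF linL[OF f0 y0] \<open>inj (L f0 y0)\<close>] by (auto dest: surjD)
    then show "v = 0" using Li \<open>Li v = 0\<close> linear_0[OF linL[OF f0 y0]] by auto
  qed (simp add: linear_0[OF Li(1)])
  let ?s = "\<lambda>p. \<Sum>i\<in>Basis. \<Sum>j\<in>Basis. \<bar>hess c f0 y0 i j - hess c (fst p) (snd p) i (j::'e)\<bar>"
  have cs: "continuous_map (prod_topology TT (top_of_set (chart_img c))) euclideanreal ?s"
    unfolding hess_def
    by (intro continuous_map_sum continuous_map_real_abs continuous_map_diff continuous_map_jet[OF c]) auto
  \<comment> \<open>\<open>K\<close> bounds \<open>Li\<close>, so Hessians this close to the one of
    \<open>f0\<close> at \<open>y0\<close> make \<open>N f\<close> contract by the factor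
    1/2.\<close>
  have e1: "1 / (2 * K) > 0" using K by simp
  obtain V1 r where V1: "openin TT V1" "f0 \<in> V1" and r: "r > 0" "cball y0 r \<subseteq> chart_img c"
    and V1s: "\<And>f y. f \<in> V1 \<Longrightarrow> y \<in> cball y0 r \<Longrightarrow> \<bar>?s (f, y) - ?s (f0, y0)\<bar> < 1 / (2 * K)"
    using jet_neighbourhood[OF c f0 y0 cs e1] by blast
  have s_bound: "?s (f, y) \<le> 1 / (2 * K)" if "f \<in> V1" "y \<in> cball y0 r" for f y
    using V1s[OF that] by simp
  define N where "N f y = y - Li (grad f y)" for f y
  have V1C: "f \<in> Cinf X A" if "f \<in> V1" for f using openin_subset[OF V1(1)] that by auto
  have dN: "(N f has_derivative (\<lambda>v. Li (L f0 y0 v - L f y v))) (at y)"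
    and nN: "norm (Li (L f0 y0 v - L f y v)) \<le> 1/2 * norm v" if f: "f \<in> V1" and y: "y \<in> cball y0 r" for f y v
  proof -
    note fC = V1C[OF f] have yc: "y \<in> chart_img c" using y r by blast
    have "(N f has_derivative (\<lambda>v. v - Li (L f y v))) (at y)"
      unfolding N_def[abs_def]
      by (intro has_derivative_diff has_derivative_ident bounded_linear.has_derivative[OF _ dgrad[OF fC yc]])
        (use Li(1) linear_conv_bounded_linear in blast)
    then show "(N f has_derivative (\<lambda>v. Li (L f0 y0 v - L f y v))) (at y)" by (simp add: linear_diff[OF Li(1)] Li(2))
    have b: "bilinear (\<lambda>u v. hess c f0 y0 u v - hess c f y u v)"
      using bilinear_hess[OF fC c yc] bilinear_hess[OF f0 c y0] by (simp add: bilinear_def linear_compose_sub)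
    have "norm (L f0 y0 v - L f y v) \<le> 1 / (2 * K) * norm v"
      using bilinear_bound[OF b, of "1 / (2 * K)" v] s_bound[OF f y]
      by (simp add: L_def sum_subtractf scaleR_diff_left)
    then have "norm (L f0 y0 v - L f y v) * K \<le> 1 / (2 * K) * norm v * K" using K(1) by (intro mult_right_mono) auto
    also have "\<dots> = 1/2 * norm v" using K(1) by simp
    finally show "norm (Li (L f0 y0 v - L f y v)) \<le> 1/2 * norm v" by (rule order_trans[OF K(2)])
  qed
  have contr: "norm (N f y - N f z) \<le> 1/2 * norm (y - z)" if "f \<in> V1" "y \<in> cball y0 r" "z \<in> cball y0 r" for f y z
  proof (rule differentiable_bound[OF convex_cball _ _ that(2,3)])
    fix x assume x: "x \<in> cball y0 r"
    show "(N f has_derivative (\<lambda>v. Li (L f0 y0 v - L f x v))) (at x within cball y0 r)"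
      using dN[OF that(1) x] has_derivative_at_withinI by blast
    show "onorm (\<lambda>v. Li (L f0 y0 v - L f x v)) \<le> 1/2" by (rule onorm_le) (rule nN[OF that(1) x])
  qed
  let ?g = "\<lambda>p. \<Sum>b\<in>Basis. \<bar>iter_deriv [b::'e] (rp c (fst p)) (snd p)\<bar>"
  have cg: "continuous_map (prod_topology TT (top_of_set (chart_img c))) euclideanreal ?g"
    by (intro continuous_map_sum continuous_map_real_abs continuous_map_jet[OF c]) auto
  \<comment> \<open>A gradient below this bound moves the centre by at most \<open>r / 2\<close>;
    contraction allows another \<open>r / 2\<close>, so the ball is mapped into itself.\<close>
  have e2: "r / (2 * K) > 0" using K r by simp
  obtain V2 r2 where V2: "openin TT V2" "f0 \<in> V2" "r2 > 0"
    and V2g: "\<And>f y. f \<in> V2 \<Longrightarrow> y \<in> cball y0 r2 \<Longrightarrow> \<bar>?g (f, y) - ?g (f0, y0)\<bar> < r / (2 * K)"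
    using jet_neighbourhood[OF c f0 y0 cg e2] by blast
  have grad_le: "norm (grad f y) \<le> ?g (f, y)" for f y
    unfolding grad_def by (rule order_trans[OF norm_sum]) (simp add: sum_mono)
  have g0: "?g (f0, y0) = 0" using cr unfolding crit_def by (intro sum.neutral) simp
  define U where "U = V1 \<inter> V2"
  have U: "openin TT U" "f0 \<in> U" "U \<subseteq> V1" using V1 V2 by (auto simp: U_def)
  have small: "norm (Li (grad f y0)) \<le> r / 2" if "f \<in> U" for f
  proof -
    have "?g (f, y0) < r / (2 * K)" using V2g[of f y0] that g0 V2(3) by (auto simp: U_def)
    then have "norm (grad f y0) * K \<le> r / (2 * K) * K"
      using grad_le[of f y0] K(1) by (intro mult_right_mono) auto
    also have "\<dots> = r / 2" using K(1) by simp
    finally show ?thesis by (rule order_trans[OF K(2)])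
  qed
  have ex1: "\<exists>!y. y \<in> cball y0 r \<and> N f y = y" if f: "f \<in> U" for f
  proof -
    have fV: "f \<in> V1" using f U by blast
    have "N f ` cball y0 r \<subseteq> cball y0 r"
    proof safe
      fix y assume y: "y \<in> cball y0 r"
      have "norm (N f y - y0) \<le> norm (N f y - N f y0) + norm (N f y0 - y0)"
        using norm_triangle_ineq[of "N f y - N f y0" "N f y0 - y0"] by simp
      also have "\<dots> \<le> 1/2 * norm (y - y0) + r / 2"
        using contr[OF fV y, of y0] small[OF f] r by (intro add_mono) (auto simp: N_def)
      also have "\<dots> \<le> r" using y by (simp add: dist_norm norm_minus_commute)
      finally show "N f y \<in> cball y0 r" by (simp add: dist_norm norm_minus_commute)
    qed
    moreover have "complete (cball y0 r)" "cball y0 r \<noteq> {}" using r(1) by (auto simp: complete_eq_closed)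
    moreover have "dist (N f y) (N f z) \<le> 1/2 * dist y z" if "y \<in> cball y0 r" "z \<in> cball y0 r" for y z
      using contr[OF fV that] by (simp add: dist_norm)
    ultimately show ?thesis by (intro Banach_fix[where c="1/2"]) auto
  qed
  define x where "x f = (THE y. y \<in> cball y0 r \<and> N f y = y)" for f
  have x: "x f \<in> cball y0 r" "N f (x f) = x f" if "f \<in> U" for f
    using theI'[OF ex1[OF that]] unfolding x_def by blast+
  have Ncrit: "N f y = y \<longleftrightarrow> crit c f y" if "f \<in> U" "y \<in> cball y0 r" for f y
  proof -
    have "f \<in> Cinf X A" "y \<in> chart_img c" using V1C U(3) that r by auto
    then show ?thesis using Li0 crit_grad by (simp add: N_def)
  qed
  have uniq: "y = x f" if "f \<in> U" "y \<in> cball y0 r" "crit c f y" for f y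
    using ex1[OF that(1)] x[OF that(1)] Ncrit[OF that(1,2)] that by blast
  have "selection U c x"
    unfolding selection_def
  proof (intro conjI ballI c U)
    fix f assume f: "f \<in> U"
    note fV = subsetD[OF U(3) f]
    show xi: "x f \<in> chart_img c" using x(1)[OF f] r by blast
    show "crit c f (x f)" using x[OF f] Ncrit[OF f] by blast
    show "bdet (hess c f (x f)) \<noteq> 0"
      unfolding bdet_nonzero_iff[OF bilinear_hess[OF V1C[OF fV] c xi]]
    proof safe
      \<comment> \<open>On the kernel of the Hessian at \<open>x f\<close> the derivative of
        \<open>N f\<close> acts as the identity, which the bound 1/2 on it permits only for
        \<open>v = 0\<close>.\<close>
      fix v assume "\<forall>w. hess c f (x f) v w = 0"
      then have "L f (x f) v = 0" by (simp add: L_def)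
      then have "norm v \<le> 1/2 * norm v" using nN[OF fV x(1)[OF f], of v] by (simp add: Li(2))
      then show "v = 0" by simp
    qed
  next
    show "continuous_map (subtopology TT U) euclidean x"
    proof (rule continuous_map_metricI)
      fix f1 and e :: real assume "f1 \<in> topspace (subtopology TT U)" and e: "e > 0"
      then have f1: "f1 \<in> U" by simp
      have xi: "x f1 \<in> chart_img c" using x(1)[OF f1] r by blast
      have e3: "e / (2 * K) > 0" using e K by simp
      obtain V3 r3 where V3: "openin TT V3" "f1 \<in> V3" "r3 > 0"
        and V3g: "\<And>f y. f \<in> V3 \<Longrightarrow> y \<in> cball (x f1) r3 \<Longrightarrow> \<bar>?g (f, y) - ?g (f1, x f1)\<bar> < e / (2 * K)"
        using jet_neighbourhood[OF c V1C[OF subsetD[OF U(3) f1]] xi cg e3] by blast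
      have g1: "?g (f1, x f1) = 0"
        using Ncrit[OF f1 x(1)[OF f1]] x(2)[OF f1] unfolding crit_def by (intro sum.neutral) simp
      have "dist (x f) (x f1) < e" if f: "f \<in> U \<inter> V3" for f
      proof -
        have fU: "f \<in> U" "f \<in> V1" using f U by auto
        have "?g (f, x f1) < e / (2 * K)" using V3g[of f "x f1"] f g1 V3(3) by auto
        then have "norm (grad f (x f1)) * K < e / (2 * K) * K"
          using grad_le[of f "x f1"] K(1) by (intro mult_strict_right_mono) auto
        also have "\<dots> = e / 2" using K(1) by simp
        finally have sm: "norm (Li (grad f (x f1))) < e / 2" by (rule order_le_less_trans[OF K(2)])
        \<comment> \<open>Contraction absorbs half of the distance, so \<open>x f\<close> lies
          within twice the length of the step that \<open>N f\<close> makes from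
          \<open>x f1\<close>.\<close>
        have "norm (x f - x f1) \<le> norm (N f (x f) - N f (x f1)) + norm (N f (x f1) - x f1)"
          using norm_triangle_ineq[of "N f (x f) - N f (x f1)" "N f (x f1) - x f1"] x(2)[OF fU(1)] by simp
        also have "\<dots> \<le> 1/2 * norm (x f - x f1) + norm (Li (grad f (x f1)))"
          using contr[OF fU(2) x(1)[OF fU(1)] x(1)[OF f1]] by (simp add: N_def)
        finally show ?thesis using sm by (simp add: dist_norm)
      qed
      moreover have "openin (subtopology TT U) (U \<inter> V3)" using V3(1) by (simp add: openin_subtopology_Int2)
      ultimately show "\<exists>V. openin (subtopology TT U) V \<and> f1 \<in> V \<and> (\<forall>f\<in>V. dist (x f) (x f1) < e)"
        using f1 V3(2) by blast
    qed
  qed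
  then show ?thesis using r U(2) uniq by blast
qed

lemma jalg_contrib:
  assumes s: "selection U c x"
  shows "jalg U k (\<lambda>f H. flat 0 (disc c f (x f) - \<delta>) * hinv c f (x f))"
proof (rule jalg.mult)
  note c = selectionD(1)[OF s]
  have w: "jalg U k (\<lambda>f H. bdet (\<omega> c (x f)))" by (rule jalg.point[OF s smooth_bdet_form[OF c]])
  have wnz: "bdet (\<omega> c (x f)) \<noteq> 0" if "f \<in> U" for f using form(5)[OF c selectionD(5)[OF s that]] .
  have fl: "smooth_on UNIV (\<lambda>t. flat 0 (t\<^sup>2 - \<delta>))"
    unfolding power2_eq_square
    by (rule smooth_on_compose[OF open_UNIV open_UNIV _ smooth_on_flat])
      (intro smooth_on_diff smooth_on_mult smooth_on_const smooth_on_ident open_UNIV, simp)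
  have q: "jalg U k (\<lambda>f H. bdet (hess c f (x f)) / bdet (\<omega> c (x f)))"
    by (rule jalg_divide[OF jalg_bdet_hess[OF s] w wnz])
  show "jalg U k (\<lambda>f H. flat 0 (disc c f (x f) - \<delta>))"
    unfolding disc_def by (rule jalg.comp[OF q fl])
  have "jalg U k (\<lambda>f H. bdet (\<lambda>u v. hess c f (x f) u v + \<omega> c (x f) u v))"
    unfolding bdet_def hess_def
    by (intro jalg_ndet jalg.add jalg.jet[OF s] jalg.point[OF s] form(3)[OF c])
  from jalg_divide[OF this w wnz]
  show "jalg U k (\<lambda>f H. hinv c f (x f))" unfolding hinv_def .
qed

text \<open>Every contribution from \<open>W\<close> sits on the branch \<open>x\<close>. The
  inclusion is one-sided because the branch point may drop below the threshold or leave
  \<open>W\<close>.\<close>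

definition isolates :: "real \<Rightarrow> ('x \<Rightarrow> real) set \<Rightarrow> 'x set \<Rightarrow> ('x, 'e) chart \<Rightarrow> (('x \<Rightarrow> real) \<Rightarrow> 'e) \<Rightarrow> bool" where
  "isolates \<delta> U W c x \<longleftrightarrow> selection U c x \<and> (\<forall>f\<in>U. supp \<delta> f \<inter> W \<subseteq> {chart_inv c (x f)})"

lemma supp_chart:
  assumes "f \<in> Cinf X A" "c \<in> A" "z \<in> supp \<delta> f" "z \<in> fst c"
  shows "crit c f (snd c z)" "disc c f (snd c z) > \<delta>"
proof -
  have "contrib \<delta> c f (snd c z) \<noteq> 0" using assms pt_contrib_chart[OF assms(1,2,4), of \<delta>] by (simp add: supp_def)
  then show "crit c f (snd c z)" "disc c f (snd c z) > \<delta>"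
    by (auto simp: contrib_def flat_def split: if_splits)
qed

text \<open>Three cases for \<open>z\<close> and \<open>f0\<close>. Around a nondegenerate critical
  point there is a unique branch; at a degenerate one \<open>disc\<close> is 0 and stays below
  \<open>\<delta>\<close> nearby; at any other point some first derivative stays nonzero
  nearby.\<close>

lemma supp_local:
  assumes f0: "f0 \<in> Cinf X A" and z: "z \<in> topspace X" and \<delta>: "\<delta> > 0"
  shows "\<exists>U W. openin TT U \<and> f0 \<in> U \<and> openin X W \<and> z \<in> W \<and>
    ((\<forall>f\<in>U. supp \<delta> f \<inter> W = {}) \<or> (\<exists>c x. isolates \<delta> U W c x \<and> z = chart_inv c (x f0)))"
proof -
  obtain c where c: "c \<in> A" "z \<in> fst c" using cover[OF z] by blast
  define y where "y = snd c z"
  have y: "y \<in> chart_img c" "chart_inv c y = z" using chart_inv[OF c(1)] c(2) by (auto simp: y_def)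
  have nbh: "openin X {z' \<in> fst c. snd c z' \<in> ball y r}" "z \<in> {z' \<in> fst c. snd c z' \<in> ball y r}" if "r > 0" for r
    using openin_chart_preimage[OF c(1), of "ball y r"] c(2) that by (auto simp: y_def)
  show ?thesis
  proof (cases "crit c f0 y \<and> bdet (hess c f0 y) \<noteq> 0")
    case True
    then obtain U r x where *: "r > 0" "f0 \<in> U" "selection U c x" "cball y r \<subseteq> chart_img c"
      "\<And>f z. f \<in> U \<Longrightarrow> z \<in> cball y r \<Longrightarrow> crit c f z \<Longrightarrow> z = x f"
      using selection_exists[OF c(1) f0 y(1)] by blast
    let ?W = "{z' \<in> fst c. snd c z' \<in> ball y r}"
    have "isolates \<delta> U ?W c x"
      unfolding isolates_def
    proof (intro conjI ballI *(3) subsetI)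
      fix f z' assume f: "f \<in> U" and z': "z' \<in> supp \<delta> f \<inter> ?W"
      have "snd c z' = x f"
        using z' supp_chart(1)[OF selectionD(4)[OF *(3) f] c(1)] by (intro *(5)[OF f]) auto
      then show "z' \<in> {chart_inv c (x f)}" using chart_inv(1)[OF c(1), of z'] z' by simp
    qed
    moreover have "z = chart_inv c (x f0)" using *(5)[OF *(2), of y] *(1) True y(2) by simp
    ultimately show ?thesis using nbh[OF *(1)] *(2) selectionD(2)[OF *(3)] by blast
  next
    case False
    have "\<exists>V r. openin TT V \<and> f0 \<in> V \<and> r > 0 \<and> cball y r \<subseteq> chart_img c \<and>
      (\<forall>f\<in>V. \<forall>z\<in>cball y r. \<not> (crit c f z \<and> disc c f z > \<delta>))"
    proof (cases "crit c f0 y")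
      case True
      then have d0: "disc c f0 y = 0" using False by (simp add: disc_def)
      obtain V r where V: "openin TT V" "f0 \<in> V" "r > 0" "cball y r \<subseteq> chart_img c"
        "\<And>f z. f \<in> V \<Longrightarrow> z \<in> cball y r \<Longrightarrow> \<bar>disc c f z - disc c f0 y\<bar> < \<delta>"
        using jet_neighbourhood[OF c(1) f0 y(1) continuous_map_disc[OF c(1)] \<delta>] by auto
      have "\<not> disc c f z > \<delta>" if "f \<in> V" "z \<in> cball y r" for f z
        using V(5)[OF that] by (simp add: d0)
      then show ?thesis using V(1-4) by blast
    next
      case nc: False
      then obtain v where v: "iter_deriv [v] (rp c f0) y \<noteq> 0" by (auto simp: crit_def)
      then have e: "\<bar>iter_deriv [v] (rp c f0) y\<bar> > 0" by simp
      obtain V r where V: "openin TT V" "f0 \<in> V" "r > 0" "cball y r \<subseteq> chart_img c"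
        "\<And>f z. f \<in> V \<Longrightarrow> z \<in> cball y r \<Longrightarrow> \<bar>iter_deriv [v] (rp c f) z - iter_deriv [v] (rp c f0) y\<bar> < \<bar>iter_deriv [v] (rp c f0) y\<bar>"
        using jet_neighbourhood[OF c(1) f0 y(1) continuous_map_jet[OF c(1), of "[v]"] e]
        unfolding fst_conv snd_conv by (elim exE conjE) (rule that, assumption+, drule bspec, assumption, drule bspec)
      have "\<not> crit c f z" if "f \<in> V" "z \<in> cball y r" for f z
        using V(5)[OF that] unfolding crit_def by force
      then show ?thesis using V(1-4) by blast
    qed
    then obtain V r where V: "openin TT V" "f0 \<in> V" "r > 0"
      "\<And>f z. f \<in> V \<Longrightarrow> z \<in> cball y r \<Longrightarrow> \<not> (crit c f z \<and> disc c f z > \<delta>)"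
      by blast
    have "supp \<delta> f \<inter> {z' \<in> fst c. snd c z' \<in> ball y r} = {}" if f: "f \<in> V" for f
    proof -
      have fC: "f \<in> Cinf X A" using openin_subset[OF V(1)] f by auto
      show ?thesis using supp_chart[OF fC c(1), of _ \<delta>] V(4)[OF f] by fastforce
    qed
    then show ?thesis using nbh[OF V(3)] V(1,2) by blast
  qed
qed

lemma selection_point_continuous:
  assumes "selection U c x"
  shows "continuous_map (subtopology TT U) X (\<lambda>f. chart_inv c (x f))"
proof -
  have "continuous_map (subtopology TT U) (top_of_set (chart_img c)) x"
    using selectionD(3)[OF assms] selectionD(5)[OF assms] by (auto simp: continuous_map_in_subtopology)
  from continuous_map_compose[OF this continuous_map_chart_inv[OF selectionD(1)[OF assms]]]
  show ?thesis by (simp add: comp_def)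
qed

text \<open>Keeps two branches apart on a whole neighbourhood of \<open>f0\<close>, so that a sum
  over branches counts no point twice.\<close>

lemma selections_distinct:
  assumes s: "selection U c x" "selection U' c' x'" and f0: "f0 \<in> U" "f0 \<in> U'"
    and ne: "chart_inv c (x f0) \<noteq> chart_inv c' (x' f0)"
  shows "\<exists>V. openin TT V \<and> f0 \<in> V \<and> (\<forall>f\<in>V. chart_inv c (x f) \<noteq> chart_inv c' (x' f))"
proof -
  have in_X: "chart_inv c (x f0) \<in> topspace X" "chart_inv c' (x' f0) \<in> topspace X"
    using chart_inv(3) chart(3) selectionD(1,5)[OF s(1)] selectionD(1,5)[OF s(2)] f0 by blast+
  have "Hausdorff_space X" using mfd by (simp add: smooth_manifold_def)
  then obtain W W' where W: "openin X W" "openin X W'" "chart_inv c (x f0) \<in> W" "chart_inv c' (x' f0) \<in> W'" "disjnt W W'"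
    using in_X ne unfolding Hausdorff_space_def by meson
  let ?V = "{f \<in> U. chart_inv c (x f) \<in> W}" and ?V' = "{f \<in> U'. chart_inv c' (x' f) \<in> W'}"
  have o: "openin TT {f \<in> U. chart_inv c (x f) \<in> W}" if "selection U c x" "openin X W" for U c x W
  proof -
    have "openin (subtopology TT U) {f \<in> topspace (subtopology TT U). chart_inv c (x f) \<in> W}"
      by (rule openin_continuous_map_preimage[OF selection_point_continuous[OF that(1)] that(2)])
    moreover have "{f \<in> topspace (subtopology TT U). chart_inv c (x f) \<in> W} = {f \<in> U. chart_inv c (x f) \<in> W}"
      using openin_subset[OF selectionD(2)[OF that(1)]] by auto
    ultimately show ?thesis using selectionD(2)[OF that(1)] by (simp add: openin_open_subtopology)
  qed
  have "openin TT (?V \<inter> ?V')" using o[OF s(1) W(1)] o[OF s(2) W(2)] by blast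
  then show ?thesis using W(3-5) f0 by (intro exI[of _ "?V \<inter> ?V'"]) (auto simp: disjnt_iff)
qed

text \<open>By compactness finitely many branches capture all contributions for functions near
  \<open>f0\<close>. Once they are kept apart, \<open>pfun\<close> is the sum over the branches,
  since branch points outside \<open>supp\<close> add 0.\<close>

theorem pfun_smooth:
  assumes \<delta>: "\<delta> > 0" and cpt: "compact_space X"
  shows "frechet_smooth TT (pfun \<delta>)"
proof (rule frechet_smooth_if_locally_jalg)
  fix f0 assume f0: "f0 \<in> Cinf X A"
  define good where "good z U W \<longleftrightarrow> openin TT U \<and> f0 \<in> U \<and> openin X W \<and> z \<in> W \<and>
    ((\<forall>f\<in>U. supp \<delta> f \<inter> W = {}) \<or> (\<exists>c x. isolates \<delta> U W c x \<and> z = chart_inv c (x f0)))" for z U W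
  have "\<forall>z\<in>topspace X. \<exists>p. good z (fst p) (snd p)"
    using supp_local[OF f0 _ \<delta>] by (fastforce simp: good_def)
  then obtain P where P: "\<And>z. z \<in> topspace X \<Longrightarrow> good z (fst (P z)) (snd (P z))" by metis
  define UU where "UU z = fst (P z)" for z
  define WW where "WW z = snd (P z)" for z
  have g: "good z (UU z) (WW z)" if "z \<in> topspace X" for z using P[OF that] by (simp add: UU_def WW_def)
  have "\<exists>F. finite F \<and> F \<subseteq> WW ` topspace X \<and> topspace X \<subseteq> \<Union>F"
    using cpt[unfolded compact_space_def compactin_def, THEN conjunct2, rule_format, of "WW ` topspace X"] g
    by (auto simp: good_def)
  then obtain I where I: "finite I" "I \<subseteq> topspace X" "topspace X \<subseteq> (\<Union>z\<in>I. WW z)"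
    by (metis finite_subset_image)
  \<comment> \<open>The centres that carry a branch. As the branch of \<open>z\<close> passes
    through \<open>z\<close> at \<open>f0\<close>, different centres have different branch points
    there, which \<open>selections_distinct\<close> requires.\<close>
  define J where "J = {z \<in> I. \<exists>c x. isolates \<delta> (UU z) (WW z) c x \<and> z = chart_inv c (x f0)}"
  have J: "finite J" "J \<subseteq> I" using I by (auto simp: J_def)
  have "\<forall>z\<in>J. \<exists>q. isolates \<delta> (UU z) (WW z) (fst q) (snd q) \<and> z = chart_inv (fst q) (snd q f0)"
    by (auto simp: J_def)
  then obtain q where q: "\<And>z. z \<in> J \<Longrightarrow> isolates \<delta> (UU z) (WW z) (fst (q z)) (snd (q z)) \<and> z = chart_inv (fst (q z)) (snd (q z) f0)"
    by metis
  define c where "c z = fst (q z)" for z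
  define x where "x z = snd (q z)" for z
  have iso: "isolates \<delta> (UU z) (WW z) (c z) (x z)" "z = chart_inv (c z) (x z f0)" if "z \<in> J" for z
    using q[OF that] by (simp_all add: c_def x_def)
  have sel: "selection (UU z) (c z) (x z)" if "z \<in> J" for z using iso[OF that] by (simp add: isolates_def)
  have f0UU: "f0 \<in> UU z" "openin TT (UU z)" if "z \<in> I" for z using g[of z] that I by (auto simp: good_def)
  define pt where "pt z f = chart_inv (c z) (x z f)" for z f
  have "\<forall>p\<in>{p \<in> J \<times> J. fst p \<noteq> snd p}. \<exists>V. openin TT V \<and> f0 \<in> V \<and> (\<forall>f\<in>V. pt (fst p) f \<noteq> pt (snd p) f)"
  proof
    fix p assume p: "p \<in> {p \<in> J \<times> J. fst p \<noteq> snd p}"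
    then show "\<exists>V. openin TT V \<and> f0 \<in> V \<and> (\<forall>f\<in>V. pt (fst p) f \<noteq> pt (snd p) f)"
      unfolding pt_def using iso(2)[of "fst p"] iso(2)[of "snd p"] J f0UU
      by (intro selections_distinct[OF sel sel]) auto
  qed
  from bchoice[OF this] obtain V where V0: "\<forall>p\<in>{p \<in> J \<times> J. fst p \<noteq> snd p}.
      openin TT (V p) \<and> f0 \<in> V p \<and> (\<forall>f\<in>V p. pt (fst p) f \<noteq> pt (snd p) f)"
    by (elim exE)
  have V: "openin TT (V p) \<and> f0 \<in> V p \<and> (\<forall>f\<in>V p. pt (fst p) f \<noteq> pt (snd p) f)"
    if "p \<in> J \<times> J" "fst p \<noteq> snd p" for p
    using bspec[OF V0, of p] that by simp
  define \<U> where "\<U> = Cinf X A \<inter> (\<Inter>z\<in>I. UU z) \<inter> (\<Inter>p\<in>{p \<in> J \<times> J. fst p \<noteq> snd p}. V p)"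
  have fin: "finite {p \<in> J \<times> J. fst p \<noteq> snd p}" using J by simp
  have oC: "openin TT (Cinf X A)" using openin_topspace[of TT] by simp
  have oI: "openin TT (T0 \<inter> (\<Inter>i\<in>S. B i))" if "finite S" "openin TT T0" "\<And>i. i \<in> S \<Longrightarrow> openin TT (B i)"
    for S :: "'b set" and B T0
    using that
  proof (induction S)
    case (insert i S)
    have "T0 \<inter> (\<Inter>i\<in>insert i S. B i) = B i \<inter> (T0 \<inter> (\<Inter>i\<in>S. B i))" by auto
    then show ?case using insert by (simp add: openin_Int)
  qed simp
  have oU: "openin TT \<U>"
    unfolding \<U>_def using f0UU V by (intro oI I fin oC) auto
  have f0U: "f0 \<in> \<U>" using f0 f0UU V by (auto simp: \<U>_def)
  have UC: "f \<in> Cinf X A" if "f \<in> \<U>" for f using that by (simp add: \<U>_def)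
  have sU: "selection \<U> (c z) (x z)" if "z \<in> J" for z
    by (rule selection_subset[OF sel[OF that] oU]) (use that J in \<open>auto simp: \<U>_def\<close>)
  let ?q = "\<lambda>f H. \<Sum>z\<in>J. flat 0 (disc (c z) f (x z f) - \<delta>) * hinv (c z) f (x z f)"
  have "pfun \<delta> f = ?q f H" if f: "f \<in> \<U>" for f H
  proof -
    have fC: "f \<in> Cinf X A" by (rule UC[OF f])
    have ptX: "pt z f \<in> fst (c z)" "snd (c z) (pt z f) = x z f" if "z \<in> J" for z
      using chart_inv[OF selectionD(1)[OF sU[OF that]]] selectionD(5)[OF sU[OF that] f] by (auto simp: pt_def)
    have inj: "inj_on (\<lambda>z. pt z f) J"
    proof (rule inj_onI, rule ccontr)
      fix z z' assume z: "z \<in> J" "z' \<in> J" "pt z f = pt z' f" "z \<noteq> z'"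
      then have "f \<in> V (z, z')" using f unfolding \<U>_def by force
      then show False using V[of "(z, z')"] z by simp
    qed
    have sub: "supp \<delta> f \<subseteq> (\<lambda>z. pt z f) ` J"
    proof
      fix z' assume z': "z' \<in> supp \<delta> f"
      then have "z' \<in> topspace X" by (simp add: supp_def)
      then obtain z where z: "z \<in> I" "z' \<in> WW z" using I by blast
      have fz: "f \<in> UU z" using f z by (auto simp: \<U>_def)
      have "good z (UU z) (WW z)" using g z I by blast
      then have "z \<in> J" using z' z fz by (auto simp: good_def J_def)
      then have "z' = pt z f" using iso(1)[of z] fz z' z by (auto simp: isolates_def pt_def)
      then show "z' \<in> (\<lambda>z. pt z f) ` J" using \<open>z \<in> J\<close> by blast
    qed
    have tX: "pt z f \<in> topspace X" if "z \<in> J" for z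
      using ptX(1)[OF that] chart(3)[OF selectionD(1)[OF sU[OF that]]] by blast
    have "pfun \<delta> f = (\<Sum>z\<in>(\<lambda>z. pt z f) ` J. pt_contrib \<delta> f z)"
      unfolding pfun_def
      by (rule sum.mono_neutral_left) (use J sub tX in \<open>auto simp: supp_def\<close>)
    also have "\<dots> = (\<Sum>z\<in>J. pt_contrib \<delta> f (pt z f))" by (subst sum.reindex[OF inj]) (simp add: comp_def)
    also have "\<dots> = ?q f H"
    proof (rule sum.cong[OF refl])
      fix z assume z: "z \<in> J"
      have "crit (c z) f (x z f)" using sU[OF z] f by (simp add: selection_def)
      then show "pt_contrib \<delta> f (pt z f) = flat 0 (disc (c z) f (x z f) - \<delta>) * hinv (c z) f (x z f)"
        using pt_contrib_chart[OF fC selectionD(1)[OF sU[OF z]] ptX(1)[OF z], of \<delta>] ptX(2)[OF z]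
        by (simp add: contrib_def)
    qed
    finally show ?thesis .
  qed
  moreover have "jalg \<U> 0 ?q" by (intro jalg_sum jalg_contrib sU)
  ultimately show "\<exists>U q. openin TT U \<and> f0 \<in> U \<and> jalg U 0 q \<and> (\<forall>g\<in>U. \<forall>H. pfun \<delta> g = q g H)"
    using oU f0U by blast
qed

end

section \<open>Volume preserving twists\<close>

lemma param_integral_derivative:
  fixes \<gamma> :: "'a::euclidean_space \<times> real \<Rightarrow> real"
  assumes \<gamma>: "smooth_on O' \<gamma>" and S: "open S" "convex S" "S \<times> {0..1} \<subseteq> O'" and y: "y \<in> S"
  shows "((\<lambda>y. integral {0..1} (\<lambda>s. \<gamma> (y, s))) has_derivative
    (\<lambda>v. integral {0..1} (\<lambda>s. fd \<gamma> (y, s) (v, 0)))) (at y)"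
proof -
  \<comment> \<open>The derivative as a bounded linear map, assembled from its values on the basis
    so that its continuity reduces to that of scalar functions.\<close>
  define fx where "fx y s = (\<Sum>b\<in>Basis. fd \<gamma> (y, s) (b, 0) *\<^sub>R blinfun_inner_left (b :: 'a))" for y s
  have fx_apply: "blinfun_apply (fx y s) v = fd \<gamma> (y, s) (v, 0)" if "y \<in> S" "s \<in> {0..1}" for y s v
  proof -
    have l: "linear (fd \<gamma> (y, s))"
      using linear_frechet_derivative[OF smooth_on_differentiable[OF \<gamma>]] S(3) that by blast
    have e: "(\<Sum>b\<in>Basis. (v \<bullet> b) *\<^sub>R (b, 0 :: real)) = (v, 0)"
      by (rule prod_eqI) (simp_all add: fst_sum snd_sum euclidean_representation)
    have "blinfun_apply (fx y s) v = (\<Sum>b\<in>Basis. (v \<bullet> b) *\<^sub>R fd \<gamma> (y, s) (b, 0))"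
      by (simp add: fx_def blinfun.sum_left blinfun.scaleR_left mult.commute)
    also have "\<dots> = fd \<gamma> (y, s) (\<Sum>b\<in>Basis. (v \<bullet> b) *\<^sub>R (b, 0 :: real))"
      unfolding linear_sum[OF l] linear_cmul[OF l] ..
    finally show ?thesis unfolding e .
  qed
  have cont: "continuous_on (S \<times> {0..1}) \<gamma>" "continuous_on (S \<times> {0..1}) (\<lambda>q. fd \<gamma> q v)" for v
    using smooth_on_continuous_on[OF \<gamma>] smooth_on_continuous_on[OF smooth_on_fd[OF \<gamma>]] S(3)
    by (blast intro: continuous_on_subset)+
  have sec: "continuous_on {0..1} (\<lambda>s. g (y, s))" if "continuous_on (S \<times> {0..1}) g" "y \<in> S"
    for g :: "'a \<times> real \<Rightarrow> 'c::topological_space" and y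
    by (rule continuous_on_compose2[OF that(1)]) (use that in \<open>auto intro!: continuous_intros\<close>)
  have cfx: "continuous_on (S \<times> {0..1}) (\<lambda>q. fx (fst q) (snd q))"
    unfolding fx_def by (intro continuous_intros cont(2)[unfolded prod.collapse] | simp add: cont)+
  have "((\<lambda>y. integral (cbox 0 1) (\<lambda>s. \<gamma> (y, s))) has_derivative integral (cbox 0 1) (fx y)) (at y within S)"
  proof (rule leibniz_rule[OF _ _ _ y S(2)])
    fix z and t :: real assume zt: "z \<in> S" "t \<in> cbox 0 1"
    then have "(z, t) \<in> O'" using S(3) by auto
    note d = smooth_on_differentiable[OF \<gamma> this]
    have "((\<lambda>z. \<gamma> (z, t)) has_derivative (\<lambda>v. fd \<gamma> (z, t) (v, 0))) (at z)"
      by (rule has_derivative_compose[of "\<lambda>z. (z, t)" "\<lambda>v. (v, 0)" z UNIV \<gamma> "fd \<gamma> (z, t)"])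
        (auto intro!: derivative_eq_intros fd_works d)
    moreover have "blinfun_apply (fx z t) = (\<lambda>v. fd \<gamma> (z, t) (v, 0))" using zt by (intro ext fx_apply) auto
    ultimately show "((\<lambda>z. \<gamma> (z, t)) has_derivative blinfun_apply (fx z t)) (at z within S)"
      by (simp add: has_derivative_at_withinI)
  next
    fix z assume "z \<in> S"
    then show "(\<lambda>s. \<gamma> (z, s)) integrable_on cbox 0 1"
      using integrable_continuous_real[OF sec[OF cont(1)]] by simp
  next
    show "continuous_on (S \<times> cbox 0 1) (\<lambda>(x, t). fx x t)" using cfx by (simp add: case_prod_beta')
  qed
  then have 1: "((\<lambda>y. integral {0..1} (\<lambda>s. \<gamma> (y, s))) has_derivative integral {0..1} (fx y)) (at y)"
    by (simp only: at_within_open[OF y S(1)] box_real)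
  have int: "fx y integrable_on {0..1}"
    using integrable_continuous_real[OF sec[OF cfx y]] by simp
  have 2: "blinfun_apply (integral {0..1} (fx y)) = (\<lambda>v. integral {0..1} (\<lambda>s. fd \<gamma> (y, s) (v, 0)))"
  proof
    fix v
    have "blinfun_apply (integral {0..1} (fx y)) v = integral {0..1} (\<lambda>s. blinfun_apply (fx y s) v)"
      by (rule blinfun_apply_integral[OF int])
    also have "\<dots> = integral {0..1} (\<lambda>s. fd \<gamma> (y, s) (v, 0))"
      by (rule integral_cong) (simp add: fx_apply y)
    finally show "blinfun_apply (integral {0..1} (fx y)) v = integral {0..1} (\<lambda>s. fd \<gamma> (y, s) (v, 0))" .
  qed
  show ?thesis by (rule has_derivative_eq_rhs[OF 1 2])
qed

text \<open>The derivative of such an integral is another one, with integrand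
  \<open>fd \<gamma> (y, s) (v, 0)\<close>; induction on the order, for all integrands at once,
  applies.\<close>

lemma smooth_on_param_integral:
  fixes \<gamma> :: "'a::euclidean_space \<times> real \<Rightarrow> real"
  assumes \<gamma>: "smooth_on O' \<gamma>" and S: "open S" "convex S" "S \<times> {0..1} \<subseteq> O'"
  shows "smooth_on S (\<lambda>y. integral {0..1} (\<lambda>s. \<gamma> (y, s)))"
  unfolding smooth_on_iff_ck
proof
  fix k show "ck k S (\<lambda>y. integral {0..1} (\<lambda>s. \<gamma> (y, s)))"
    using \<gamma>
  proof (induction k arbitrary: \<gamma>)
    case 0
    then show ?case using param_integral_derivative[OF 0 S] by (auto simp: ck_0 differentiable_def)
  next
    case (Suc k)
    show ?case
    proof (rule ck_SucI[OF S(1) param_integral_derivative[OF Suc.prems S]])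
      fix v show "ck k S (\<lambda>y. integral {0..1} (\<lambda>s. fd \<gamma> (y, s) (v, 0)))"
        by (rule Suc.IH[OF smooth_on_fd[OF Suc.prems, of "(v, 0)"]])
    qed
  qed
qed

text \<open>The Sherman-Morrison formula, used for the derivative of the inverse of the
  straightening map.\<close>

lemma rank_one_inverse:
  fixes p b :: "'e::euclidean_space"
  assumes "1 + b \<bullet> p \<noteq> 0"
  shows "(\<lambda>v. v - ((v \<bullet> p) / (1 + b \<bullet> p)) *\<^sub>R b) \<circ> (\<lambda>v. v + (v \<bullet> p) *\<^sub>R b) = id"
proof
  fix v
  have "(v + (v \<bullet> p) *\<^sub>R b) \<bullet> p = (v \<bullet> p) * (1 + b \<bullet> p)"
    by (simp add: inner_add_left algebra_simps)
  then show "((\<lambda>v. v - ((v \<bullet> p) / (1 + b \<bullet> p)) *\<^sub>R b) \<circ> (\<lambda>v. v + (v \<bullet> p) *\<^sub>R b)) v = id v"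
    using assms by simp
qed

text \<open>The new coordinate is the integral of the density along one coordinate direction.\<close>

lemma straighten_density:
  fixes \<rho> :: "'e::euclidean_space \<Rightarrow> real"
  assumes U: "open U" "y0 \<in> U" and \<rho>: "smooth_on U \<rho>" "\<rho> y0 \<noteq> 0"
  shows "\<exists>W \<Phi> \<Psi>. open W \<and> y0 \<in> W \<and> W \<subseteq> U \<and> smooth_on W \<Phi> \<and> inj_on \<Phi> W \<and> open (\<Phi> ` W) \<and>
    smooth_on (\<Phi> ` W) \<Psi> \<and> (\<forall>y\<in>W. \<Psi> (\<Phi> y) = y) \<and> \<Phi> y0 = y0 \<and> fd \<Phi> y0 = (\<lambda>v. v) \<and>
    (\<forall>y\<in>W. \<rho> y \<noteq> 0 \<and> tdet (fd \<Phi> y) = \<rho> y / \<rho> y0)"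
proof -
  \<comment> \<open>Normalised to 1 at \<open>y0\<close>, so that \<open>\<Phi>\<close> has the
    identity as derivative there and the conjugated twist keeps its rotation as derivative.\<close>
  define \<sigma> where "\<sigma> y = \<rho> y / \<rho> y0" for y
  have \<sigma>U: "smooth_on U \<sigma>" unfolding \<sigma>_def by (intro smooth_on_divide U \<rho> smooth_on_const)
  have \<sigma>0: "\<sigma> y0 = 1" using \<rho> by (simp add: \<sigma>_def)
  obtain b :: 'e where b: "b \<in> Basis" using nonempty_Basis by blast
  have bb: "b \<bullet> b = 1" using b by (simp add: inner_Basis)
  have "isCont \<sigma> y0" using smooth_on_continuous_on[OF \<sigma>U] U by (simp add: continuous_on_eq_continuous_at)
  then obtain r1 where r1: "r1 > 0" "\<And>y. dist y y0 < r1 \<Longrightarrow> dist (\<sigma> y) (\<sigma> y0) < 1"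
    unfolding continuous_at_eps_delta by (metis zero_less_one)
  obtain r2 where r2: "r2 > 0" "ball y0 r2 \<subseteq> U" using U openE by blast
  define W where "W = ball y0 (min r1 r2)"
  have W: "open W" "convex W" "y0 \<in> W" "W \<subseteq> U" using r1 r2 by (auto simp: W_def)
  have \<sigma>pos: "\<sigma> y > 0" if "y \<in> W" for y
    using r1(2)[of y] that \<sigma>0 by (auto simp: W_def dist_commute dist_real_def)
  have \<sigma>W: "smooth_on W \<sigma>" using smooth_on_subset[OF \<sigma>U W(4)] .
  define u where "u y = (y - y0) \<bullet> b" for y
  define P where "P y = y - u y *\<^sub>R b" for y
  \<comment> \<open>\<open>P\<close> projects to the hyperplane through \<open>y0\<close> orthogonal
    to \<open>b\<close>, and \<open>m (y, s)\<close> runs from \<open>P y\<close> to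
    \<open>y\<close>; for \<open>y\<close> in the ball \<open>W\<close> this segment stays in
    \<open>W\<close>.\<close>
  define m where "m q = P (fst q) + (snd q * u (fst q)) *\<^sub>R b" for q
  have sm_u: "smooth_on S u" if "open S" for S
    unfolding u_def by (intro smooth_on_inner_right smooth_on_diff smooth_on_ident smooth_on_const that)
  have sm_P: "smooth_on S P" if "open S" for S
    unfolding P_def by (intro smooth_on_diff smooth_on_ident smooth_on_scaleR smooth_on_const sm_u that)
  have sm_fst: "smooth_on S (fst :: 'e \<times> real \<Rightarrow> 'e)" and sm_snd: "smooth_on S (snd :: 'e \<times> real \<Rightarrow> real)" if "open S" for S
    using smooth_on_linear[OF bounded_linear_fst that smooth_on_ident] smooth_on_linear[OF bounded_linear_snd that smooth_on_ident] by auto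
  have sm_m: "smooth_on UNIV m"
    unfolding m_def
    by (intro smooth_on_add smooth_on_scaleR smooth_on_mult smooth_on_const open_UNIV sm_snd
        smooth_on_compose[OF open_UNIV open_UNIV sm_fst[OF open_UNIV] sm_P[OF open_UNIV]]
        smooth_on_compose[OF open_UNIV open_UNIV sm_fst[OF open_UNIV] sm_u[OF open_UNIV]] UNIV_I)
  define O' where "O' = m -` W"
  have oO: "open O'" unfolding O'_def
    by (rule open_vimage[OF W(1) smooth_on_continuous_on[OF sm_m]])
  have PW: "P y \<in> W" if "y \<in> W" for y
  proof -
    have "(norm (P y - y0))\<^sup>2 = (norm (y - y0))\<^sup>2 - (u y)\<^sup>2"
      unfolding power2_norm_eq_inner by (simp add: P_def u_def inner_diff_left inner_diff_right bb power2_eq_square inner_commute algebra_simps)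
    then have "(norm (P y - y0))\<^sup>2 \<le> (norm (y - y0))\<^sup>2" by simp
    then have "norm (P y - y0) \<le> norm (y - y0)" by (rule power2_le_imp_le) simp
    then show ?thesis using that by (simp add: W_def dist_norm norm_minus_commute)
  qed
  have mW: "m (y, s) \<in> W" if "y \<in> W" "s \<in> {0..1}" for y s
  proof -
    have "m (y, s) = (1 - s) *\<^sub>R P y + s *\<^sub>R y" by (simp add: m_def P_def algebra_simps)
    then show ?thesis using convexD[OF W(2) PW[OF that(1)] that(1), of "1 - s" s] that(2) by simp
  qed
  have WO: "W \<times> {0..1} \<subseteq> O'" using mW by (auto simp: O'_def)
  define \<gamma> where "\<gamma> q = \<sigma> (m q)" for q
  have sm\<gamma>: "smooth_on O' \<gamma>"
    unfolding \<gamma>_def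
    by (rule smooth_on_compose[OF oO W(1) smooth_on_subset[OF sm_m subset_UNIV] \<sigma>W]) (simp add: O'_def)
  define J where "J y = integral {0..1} (\<lambda>s. \<gamma> (y, s))" for y
  have smJ: "smooth_on W J" unfolding J_def by (rule smooth_on_param_integral[OF sm\<gamma> W(1,2) WO])
  \<comment> \<open>The integral of \<open>\<sigma>\<close> along \<open>b\<close> from the
    hyperplane to \<open>y\<close>, rescaled to \<open>{0..1}\<close> so that the interval of
    integration does not move with \<open>y\<close>.\<close>
  define F where "F y = u y * J y" for y
  have smF: "smooth_on W F" unfolding F_def by (intro smooth_on_mult sm_u smJ W)
  have du: "(u has_derivative (\<lambda>v. v \<bullet> b)) (at y)" for y
    unfolding u_def by (auto intro!: derivative_eq_intros)
  have dF: "(F has_derivative (\<lambda>v. u y * integral {0..1} (\<lambda>s. fd \<gamma> (y, s) (v, 0)) + (v \<bullet> b) * J y)) (at y)"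
    if "y \<in> W" for y
    unfolding F_def J_def
    by (rule has_derivative_mult[OF du param_integral_derivative[OF sm\<gamma> W(1,2) WO that]])
  have dP: "(P has_derivative (\<lambda>v. v - (v \<bullet> b) *\<^sub>R b)) (at y)" for y
    unfolding P_def by (auto intro!: derivative_eq_intros du)
  have Fb: "fd F y b = \<sigma> y" if y: "y \<in> W" for y
  proof -
    have dm1: "(m has_derivative (\<lambda>h. (fst h - (fst h \<bullet> b) *\<^sub>R b) + (s * (fst h \<bullet> b) + snd h * u y) *\<^sub>R b)) (at (y, s))" for s
      unfolding m_def
      by (rule derivative_eq_intros has_derivative_compose[OF has_derivative_fst[OF has_derivative_ident]] dP du refl | simp)+
    have d\<sigma>: "(\<sigma> has_derivative fd \<sigma> (m (y, s))) (at (m (y, s)))" if "s \<in> {0..1}" for s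
      using fd_works[OF smooth_on_differentiable[OF \<sigma>W mW[OF y that]]] .
    have lin: "linear (fd \<sigma> (m (y, s)))" if "s \<in> {0..1}" for s
      using linear_frechet_derivative[OF smooth_on_differentiable[OF \<sigma>W mW[OF y that]]] .
    have g1: "fd \<gamma> (y, s) (b, 0) = s * fd \<sigma> (m (y, s)) b" if "s \<in> {0..1}" for s
    proof -
      have "(\<gamma> has_derivative (\<lambda>h. fd \<sigma> (m (y, s)) ((fst h - (fst h \<bullet> b) *\<^sub>R b) + (s * (fst h \<bullet> b) + snd h * u y) *\<^sub>R b))) (at (y, s))"
        unfolding \<gamma>_def by (rule has_derivative_compose[OF dm1 d\<sigma>[OF that]])
      then show ?thesis using linear_cmul[OF lin[OF that]] by (simp add: fd_eq bb)
    qed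
    \<comment> \<open>The integrand of \<open>fd F y b\<close> is the derivative of this product in
      \<open>s\<close>, so that the integral is its end value \<open>\<sigma> y\<close>.\<close>
    have "((\<lambda>s. s * \<sigma> (m (y, s))) has_vector_derivative (\<sigma> (m (y, s)) + s * (u y * fd \<sigma> (m (y, s)) b))) (at s within {0..1})"
      if s: "s \<in> {0..1}" for s
    proof -
      have "((\<lambda>s. m (y, s)) has_derivative (\<lambda>h. (h * u y) *\<^sub>R b)) (at s)"
        unfolding m_def by (auto intro!: derivative_eq_intros)
      from has_derivative_compose[OF this d\<sigma>[OF s]]
      have "((\<lambda>s. \<sigma> (m (y, s))) has_derivative (\<lambda>h. fd \<sigma> (m (y, s)) ((h * u y) *\<^sub>R b))) (at s)" .
      then have "((\<lambda>s. \<sigma> (m (y, s))) has_real_derivative u y * fd \<sigma> (m (y, s)) b) (at s)"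
        unfolding has_field_derivative_def linear_cmul[OF lin[OF s]]
        by (rule has_derivative_eq_rhs) (simp add: fun_eq_iff)
      from DERIV_mult[OF DERIV_ident this]
      show ?thesis by (simp add: has_real_derivative_iff_has_vector_derivative[symmetric] has_field_derivative_at_within add.commute mult.commute)
    qed
    then have "((\<lambda>s. \<sigma> (m (y, s)) + s * (u y * fd \<sigma> (m (y, s)) b)) has_integral (1 * \<sigma> (m (y, 1)) - 0 * \<sigma> (m (y, 0)))) {0..1}"
      by (intro fundamental_theorem_of_calculus) auto
    moreover have "m (y, 1) = y" by (simp add: m_def P_def)
    ultimately have i: "((\<lambda>s. \<sigma> (m (y, s)) + s * (u y * fd \<sigma> (m (y, s)) b)) has_integral \<sigma> y) {0..1}" by simp
    have cs: "continuous_on {0..1} (\<lambda>s. g (y, s))" if "continuous_on O' g" for g :: "'e \<times> real \<Rightarrow> real"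
      by (rule continuous_on_compose2[OF that]) (use WO y in \<open>auto intro!: continuous_intros\<close>)
    have int: "(\<lambda>s. \<gamma> (y, s)) integrable_on {0..1}" "(\<lambda>s. fd \<gamma> (y, s) (b, 0)) integrable_on {0..1}"
      using integrable_continuous_real cs[OF smooth_on_continuous_on[OF sm\<gamma>]] cs[OF smooth_on_continuous_on[OF smooth_on_fd[OF sm\<gamma>]]] by blast+
    have "fd F y b = u y * integral {0..1} (\<lambda>s. fd \<gamma> (y, s) (b, 0)) + J y"
      using fd_eq[OF dF[OF y]] by (simp add: bb)
    also have "\<dots> = integral {0..1} (\<lambda>s. u y * fd \<gamma> (y, s) (b, 0)) + integral {0..1} (\<lambda>s. \<gamma> (y, s))"
      by (simp add: J_def)
    also have "\<dots> = integral {0..1} (\<lambda>s. u y * fd \<gamma> (y, s) (b, 0) + \<gamma> (y, s))"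
      by (rule integral_add[symmetric]) (use int integrable_on_mult_right in blast)+
    also have "\<dots> = integral {0..1} (\<lambda>s. \<sigma> (m (y, s)) + s * (u y * fd \<sigma> (m (y, s)) b))"
      by (rule integral_cong) (simp add: g1 \<gamma>_def)
    also have "\<dots> = \<sigma> y" using integral_unique[OF i] .
    finally show ?thesis .
  qed
  define \<Phi> where "\<Phi> y = P y + F y *\<^sub>R b" for y
  have sm\<Phi>: "smooth_on W \<Phi>" unfolding \<Phi>_def by (intro smooth_on_add sm_P smooth_on_scaleR smF smooth_on_const W)
  \<comment> \<open>The gradient of \<open>F\<close> minus \<open>b\<close>: the derivative of
    \<open>\<Phi>\<close> becomes \<open>v + (v \<bullet> p y) *\<^sub>R b\<close>, whose
    determinant \<open>1 + b \<bullet> p y\<close> is the derivative of \<open>F\<close> along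
    \<open>b\<close>.\<close>
  define p where "p y = (\<Sum>e\<in>Basis. fd F y e *\<^sub>R e) - b" for y
  have dFW: "F differentiable (at y)" if "y \<in> W" for y using smooth_on_differentiable[OF smF that] .
  have vp: "v \<bullet> p y = fd F y v - v \<bullet> b" if "y \<in> W" for y v
    using fd_sum_Basis[OF dFW[OF that], of v] by (simp add: p_def inner_diff_right inner_sum_right mult.commute)
  have d\<Phi>: "(\<Phi> has_derivative (\<lambda>v. v + (v \<bullet> p y) *\<^sub>R b)) (at y)" if "y \<in> W" for y
  proof -
    have "(\<Phi> has_derivative (\<lambda>v. (v - (v \<bullet> b) *\<^sub>R b) + fd F y v *\<^sub>R b)) (at y)"
      unfolding \<Phi>_def by (intro has_derivative_add dP has_derivative_scaleR_left fd_works dFW that)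
    then show ?thesis by (simp add: vp[OF that] algebra_simps)
  qed
  have bp: "1 + b \<bullet> p y = \<sigma> y" if "y \<in> W" for y using vp[OF that, of b] Fb[OF that] bb by simp
  have det: "tdet (fd \<Phi> y) = \<sigma> y" if "y \<in> W" for y
    unfolding fd_eq[OF d\<Phi>[OF that]] tdet_rank_one by (rule bp[OF that])
  have u0: "u y0 = 0" by (simp add: u_def)
  have m0: "m (y0, s) = y0" for s by (simp add: m_def P_def u0)
  have J0: "J y0 = 1" by (simp add: J_def \<gamma>_def m0 \<sigma>0)
  have \<Phi>0: "\<Phi> y0 = y0" by (simp add: \<Phi>_def P_def F_def u0)
  have d0: "fd \<Phi> y0 = (\<lambda>v. v)"
  proof -
    have "fd F y0 v = v \<bullet> b" for v using fd_eq[OF dF[OF W(3)]] by (simp add: u0 J0)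
    then show ?thesis unfolding fd_eq[OF d\<Phi>[OF W(3)]] by (simp add: vp[OF W(3)])
  qed
  have P\<Phi>: "P (\<Phi> y) = P y" for y
  proof -
    have "u (P y) = 0" by (simp add: u_def P_def inner_diff_left bb)
    then have "u (\<Phi> y) = F y" by (simp add: u_def \<Phi>_def inner_diff_left inner_add_left bb)
    then show ?thesis by (simp add: P_def \<Phi>_def)
  qed
  \<comment> \<open>\<open>\<Phi>\<close> preserves the lines parallel to \<open>b\<close> and is
    increasing on each of them within \<open>W\<close> because \<open>\<sigma>\<close> is positive
    there; this gives injectivity.\<close>
  have strict: "F y < F (y + t *\<^sub>R b)" if y: "y \<in> W" "y + t *\<^sub>R b \<in> W" and t: "t > 0" for y t
  proof -
    have "F (y + 0 *\<^sub>R b) < F (y + t *\<^sub>R b)"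
    proof (rule DERIV_pos_imp_increasing[OF t, of "\<lambda>s. F (y + s *\<^sub>R b)"])
      fix s assume s: "0 \<le> s" "s \<le> t"
      have "y + s *\<^sub>R b = (1 - s / t) *\<^sub>R y + (s / t) *\<^sub>R (y + t *\<^sub>R b)" using t by (simp add: algebra_simps)
      then have sW: "y + s *\<^sub>R b \<in> W" using convexD[OF W(2) y, of "1 - s / t" "s / t"] s t by (simp add: divide_le_eq)
      show "\<exists>d. ((\<lambda>s. F (y + s *\<^sub>R b)) has_real_derivative d) (at s) \<and> d > 0"
        using has_derivative_along_line[OF dFW[OF sW]] Fb[OF sW] \<sigma>pos[OF sW]
        by (auto simp: has_real_derivative_iff_has_vector_derivative)
    qed
    then show ?thesis by simp
  qed
  have inj: "inj_on \<Phi> W"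
  proof (rule inj_onI, rule ccontr)
    fix y z assume yz: "y \<in> W" "z \<in> W" "\<Phi> y = \<Phi> z" "y \<noteq> z"
    have Pyz: "P y = P z" using P\<Phi> yz(3) by metis
    then have Fyz: "F y = F z" using yz(3) b by (auto simp: \<Phi>_def)
    have e: "z = y + (u z - u y) *\<^sub>R b" "y = z + (u y - u z) *\<^sub>R b" using Pyz by (simp_all add: P_def algebra_simps)
    show False
    proof (cases "u y < u z")
      case True
      then show False using strict[of y "u z - u y"] e(1) yz Fyz by simp
    next
      case False
      then have "u z < u y" using e yz(4) by (metis add.right_neutral diff_self linorder_neqE_linordered_idom scaleR_zero_left)
      then show False using strict[of z "u y - u z"] e(2) yz Fyz by simp
    qed
  qed
  have cont: "continuous_on W \<Phi>" by (rule smooth_on_continuous_on[OF sm\<Phi>])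
  have op: "open (\<Phi> ` W)" by (rule invariance_of_domain[OF cont W(1) inj])
  obtain \<Psi> where hom: "homeomorphism W (\<Phi> ` W) \<Phi> \<Psi>"
    using invariance_of_domain_homeomorphism[OF W(1) cont _ inj] by auto
  have \<Psi>: "\<Psi> (\<Phi> y) = y" if "y \<in> W" for y using hom that by (simp add: homeomorphism_def)
  have \<Psi>': "\<Phi> (\<Psi> z) = z" "\<Psi> z \<in> W" if "z \<in> \<Phi> ` W" for z using hom that by (auto simp: homeomorphism_def)
  have d\<Psi>: "(\<Psi> has_derivative (\<lambda>v. v - ((fd F (\<Psi> z) v - v \<bullet> b) / \<sigma> (\<Psi> z)) *\<^sub>R b)) (at z)" if z: "z \<in> \<Phi> ` W" for z
  proof (rule has_derivative_inverse_basic[OF _ _ _ _ op z])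
    note y = \<Psi>'(2)[OF z]
    show "(\<Phi> has_derivative (\<lambda>v. v + (v \<bullet> p (\<Psi> z)) *\<^sub>R b)) (at (\<Psi> z))" by (rule d\<Phi>[OF y])
    have nz: "1 + b \<bullet> p (\<Psi> z) \<noteq> 0" using bp[OF y] \<sigma>pos[OF y] by simp
    have eq: "(\<lambda>v. v - ((fd F (\<Psi> z) v - v \<bullet> b) / \<sigma> (\<Psi> z)) *\<^sub>R b) = (\<lambda>v. v - ((v \<bullet> p (\<Psi> z)) / (1 + b \<bullet> p (\<Psi> z))) *\<^sub>R b)"
      unfolding bp[OF y] by (simp add: vp[OF y])
    show "(\<lambda>v. v - ((fd F (\<Psi> z) v - v \<bullet> b) / \<sigma> (\<Psi> z)) *\<^sub>R b) \<circ> (\<lambda>v. v + (v \<bullet> p (\<Psi> z)) *\<^sub>R b) = id"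
      unfolding eq by (rule rank_one_inverse[OF nz])
    show "bounded_linear (\<lambda>v. v - ((fd F (\<Psi> z) v - v \<bullet> b) / \<sigma> (\<Psi> z)) *\<^sub>R b)"
      unfolding eq linear_conv_bounded_linear[symmetric]
      by (rule linearI) (simp_all add: inner_add_left algebra_simps add_divide_distrib)
    have "continuous_on (\<Phi> ` W) \<Psi>" using hom unfolding homeomorphism_def by blast
    then show "continuous (at z) \<Psi>" using z op continuous_on_eq_continuous_at by blast
  qed (use \<Psi>' in auto)
  \<comment> \<open>Bootstrapping: the derivative of \<open>\<Psi>\<close> is a smooth expression
    evaluated at \<open>\<Psi> z\<close>, so every order of smoothness of \<open>\<Psi>\<close>
    yields the next.\<close>
  have "smooth_on (\<Phi> ` W) \<Psi>"
    unfolding smooth_on_iff_ck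
  proof
    fix k show "ck k (\<Phi> ` W) \<Psi>"
    proof (induction k)
      case 0
      show ?case using d\<Psi> by (auto simp: ck_0 differentiable_def)
    next
      case (Suc k)
      show ?case
      proof (rule ck_SucI[OF op d\<Psi>])
        fix v
        have "smooth_on W (\<lambda>y. (fd F y v - v \<bullet> b) / \<sigma> y)"
          using \<sigma>pos by (intro smooth_on_divide smooth_on_diff smooth_on_fd[OF smF] smooth_on_const \<sigma>W W) force
        then have "ck k W (\<lambda>y. (fd F y v - v \<bullet> b) / \<sigma> y)" by (simp add: smooth_on_iff_ck)
        from ck_compose[OF op W(1) Suc.IH this \<Psi>'(2)]
        show "ck k (\<Phi> ` W) (\<lambda>z. v - ((fd F (\<Psi> z) v - v \<bullet> b) / \<sigma> (\<Psi> z)) *\<^sub>R b)"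
          by (intro ck_diff ck_scaleR ck_const op)
      qed
    qed
  qed
  moreover have "\<rho> y \<noteq> 0" if "y \<in> W" for y using \<sigma>pos[OF that] by (auto simp: \<sigma>_def)
  ultimately show ?thesis using W(1,3,4) sm\<Phi> inj op \<Psi> \<Phi>0 d0 det[unfolded \<sigma>_def] by blast
qed

section \<open>Rotations in a coordinate plane and twists\<close>

context
  fixes a b :: "'e::euclidean_space"
  assumes a: "a \<in> Basis" and b: "b \<in> Basis" and ab: "a \<noteq> b"
begin

definition rot :: "real \<Rightarrow> 'e \<Rightarrow> 'e" where
  "rot \<alpha> v = v + ((cos \<alpha> - 1) * (v \<bullet> a) - sin \<alpha> * (v \<bullet> b)) *\<^sub>R a
     + (sin \<alpha> * (v \<bullet> a) + (cos \<alpha> - 1) * (v \<bullet> b)) *\<^sub>R b"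

lemma basis_inner: "a \<bullet> a = 1" "b \<bullet> b = 1" "a \<bullet> b = 0" "b \<bullet> a = 0"
  using a b ab by (auto simp: inner_Basis)

lemma rot_inner: "rot \<alpha> v \<bullet> a = cos \<alpha> * (v \<bullet> a) - sin \<alpha> * (v \<bullet> b)"
    "rot \<alpha> v \<bullet> b = sin \<alpha> * (v \<bullet> a) + cos \<alpha> * (v \<bullet> b)"
  by (simp_all add: rot_def inner_add_left basis_inner algebra_simps)

lemma rot_rot: "rot \<alpha> (rot \<beta> v) = rot (\<alpha> + \<beta>) v"
proof -
  have "rot \<alpha> (rot \<beta> v) = rot \<beta> v + ((cos \<alpha> - 1) * (rot \<beta> v \<bullet> a) - sin \<alpha> * (rot \<beta> v \<bullet> b)) *\<^sub>R a
     + (sin \<alpha> * (rot \<beta> v \<bullet> a) + (cos \<alpha> - 1) * (rot \<beta> v \<bullet> b)) *\<^sub>R b"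
    by (rule rot_def)
  also have "\<dots> = v + (((cos \<beta> - 1) * (v \<bullet> a) - sin \<beta> * (v \<bullet> b)) + ((cos \<alpha> - 1) * (rot \<beta> v \<bullet> a) - sin \<alpha> * (rot \<beta> v \<bullet> b))) *\<^sub>R a
     + ((sin \<beta> * (v \<bullet> a) + (cos \<beta> - 1) * (v \<bullet> b)) + (sin \<alpha> * (rot \<beta> v \<bullet> a) + (cos \<alpha> - 1) * (rot \<beta> v \<bullet> b))) *\<^sub>R b"
    unfolding rot_def[of \<beta> v] scaleR_add_left by (simp only: ac_simps)
  also have "\<dots> = rot (\<alpha> + \<beta>) v"
  proof -
    have "((cos \<beta> - 1) * (v \<bullet> a) - sin \<beta> * (v \<bullet> b)) + ((cos \<alpha> - 1) * (rot \<beta> v \<bullet> a) - sin \<alpha> * (rot \<beta> v \<bullet> b)) =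
        (cos (\<alpha> + \<beta>) - 1) * (v \<bullet> a) - sin (\<alpha> + \<beta>) * (v \<bullet> b)"
      "(sin \<beta> * (v \<bullet> a) + (cos \<beta> - 1) * (v \<bullet> b)) + (sin \<alpha> * (rot \<beta> v \<bullet> a) + (cos \<alpha> - 1) * (rot \<beta> v \<bullet> b)) =
        sin (\<alpha> + \<beta>) * (v \<bullet> a) + (cos (\<alpha> + \<beta>) - 1) * (v \<bullet> b)"
      unfolding rot_inner cos_add sin_add by (simp_all add: algebra_simps)
    then show ?thesis unfolding rot_def[of "\<alpha> + \<beta>" v] by (simp only:)
  qed
  finally show ?thesis .
qed

lemma rot_0: "rot 0 v = v"
  by (simp add: rot_def)

lemma linear_rot: "linear (rot \<alpha>)"
  by (rule linearI) (simp_all add: rot_def inner_add_left algebra_simps)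

lemma norm_rot: "norm (rot \<alpha> v) = norm v"
proof -
  have "rot \<alpha> v \<bullet> rot \<alpha> v = rot \<alpha> v \<bullet> v + ((cos \<alpha> - 1) * (v \<bullet> a) - sin \<alpha> * (v \<bullet> b)) * (rot \<alpha> v \<bullet> a)
     + (sin \<alpha> * (v \<bullet> a) + (cos \<alpha> - 1) * (v \<bullet> b)) * (rot \<alpha> v \<bullet> b)"
    by (subst (2) rot_def) (simp add: inner_add_right)
  also have "rot \<alpha> v \<bullet> v = v \<bullet> v + ((cos \<alpha> - 1) * (v \<bullet> a) - sin \<alpha> * (v \<bullet> b)) * (v \<bullet> a)
     + (sin \<alpha> * (v \<bullet> a) + (cos \<alpha> - 1) * (v \<bullet> b)) * (v \<bullet> b)"
    by (simp add: rot_def inner_add_left inner_commute[of a v] inner_commute[of b v])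
  also have "v \<bullet> v + ((cos \<alpha> - 1) * (v \<bullet> a) - sin \<alpha> * (v \<bullet> b)) * (v \<bullet> a)
     + (sin \<alpha> * (v \<bullet> a) + (cos \<alpha> - 1) * (v \<bullet> b)) * (v \<bullet> b)
     + ((cos \<alpha> - 1) * (v \<bullet> a) - sin \<alpha> * (v \<bullet> b)) * (rot \<alpha> v \<bullet> a)
     + (sin \<alpha> * (v \<bullet> a) + (cos \<alpha> - 1) * (v \<bullet> b)) * (rot \<alpha> v \<bullet> b)
     = v \<bullet> v + ((cos \<alpha>)\<^sup>2 + (sin \<alpha>)\<^sup>2 - 1) * ((v \<bullet> a)\<^sup>2 + (v \<bullet> b)\<^sup>2)"
    unfolding rot_inner by algebra
  finally have "rot \<alpha> v \<bullet> rot \<alpha> v = v \<bullet> v" by simp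
  then show ?thesis by (simp add: norm_eq)
qed

lemma tdet_rot: "tdet (rot \<alpha>) = 1"
proof -
  have "a \<in> eb ` {..<DIM('e)}" "b \<in> eb ` {..<DIM('e)}"
    using bij_betw_eb[where 'e='e] a b by (simp_all add: bij_betw_def)
  then obtain i j where ij: "i < DIM('e)" "eb i = a" "j < DIM('e)" "eb j = b" by blast
  have ne: "i \<noteq> j" using ij ab by auto
  let ?m = "\<lambda>k l. rot \<alpha> (eb k) \<bullet> (eb l :: 'e)"
  have fixed: "rot \<alpha> (eb k) = eb k" if "k < DIM('e)" "k \<noteq> i" "k \<noteq> j" for k
  proof -
    have "eb k \<bullet> a = 0" "eb k \<bullet> b = 0" using that ij eb_inner[where 'e='e, of k i] eb_inner[where 'e='e, of k j] by simp_all
    then show ?thesis by (simp add: rot_def)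
  qed
  have col: "?m k l = (eb k :: 'e) \<bullet> eb l" if "l < DIM('e)" "l \<noteq> i" "l \<noteq> j" for k l
  proof -
    have "a \<bullet> eb l = 0" "b \<bullet> eb l = 0" using that ij eb_inner[where 'e='e, of i l] eb_inner[where 'e='e, of j l] by simp_all
    then show ?thesis by (simp add: rot_def inner_add_left)
  qed
  have "tdet (rot \<alpha>) = ndet DIM('e) ?m" by (simp add: tdet_def vdet_def)
  also have "\<dots> = (?m i i * ?m j j - ?m i j * ?m j i) * (\<Prod>k\<in>{..<DIM('e)} - {i, j}. ?m k k)"
  proof (rule ndet_block[OF ij(1,3) ne])
    fix k l assume kl: "k < DIM('e)" "l < DIM('e)" "k \<noteq> l" "{k, l} \<noteq> {i, j}"
    show "?m k l = 0"
    proof (cases "l \<noteq> i \<and> l \<noteq> j")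
      case True
      then show ?thesis using col kl by (simp add: eb_inner)
    next
      case False
      then have "k \<noteq> i" "k \<noteq> j" using kl by auto
      then show ?thesis using fixed kl by (simp add: eb_inner)
    qed
  qed
  also have "(\<Prod>k\<in>{..<DIM('e)} - {i, j}. ?m k k) = 1"
    by (rule prod.neutral) (auto simp: fixed eb_inner)
  also have "?m i i * ?m j j - ?m i j * ?m j i = (cos \<alpha>)\<^sup>2 + (sin \<alpha>)\<^sup>2"
    unfolding ij(2,4) rot_inner basis_inner by (simp add: power2_eq_square)
  finally show ?thesis by simp
qed

text \<open>The angle is a function of the distance from \<open>y0\<close>, which rotations
  preserve; therefore the twist by \<open>- \<theta>\<close> is the inverse. Using the squared
  distance keeps the angle smooth at \<open>y0\<close>.\<close>

definition twist :: "'e \<Rightarrow> real \<Rightarrow> real \<Rightarrow> 'e \<Rightarrow> 'e" where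
  "twist y0 s \<theta> z = y0 + rot (\<theta> * cutoff ((z - y0) \<bullet> (z - y0) / s\<^sup>2)) (z - y0)"

lemma twist_dist: "dist y0 (twist y0 s \<theta> z) = dist y0 z"
  by (simp add: twist_def dist_norm norm_rot norm_minus_commute)

lemma twist_inverse: "twist y0 s (- \<theta>) (twist y0 s \<theta> z) = z"
proof -
  have "(twist y0 s \<theta> z - y0) \<bullet> (twist y0 s \<theta> z - y0) = (z - y0) \<bullet> (z - y0)"
    by (simp add: twist_def norm_rot flip: power2_norm_eq_inner)
  moreover have "twist y0 s \<theta> z - y0 = rot (\<theta> * cutoff ((z - y0) \<bullet> (z - y0) / s\<^sup>2)) (z - y0)"
    by (simp add: twist_def)
  ultimately show ?thesis unfolding twist_def[of y0 s "- \<theta>"] by (simp add: rot_rot rot_0)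
qed

lemma twist_outside:
  assumes "s > 0" "dist y0 z \<ge> 2 * s"
  shows "twist y0 s \<theta> z = z"
proof -
  have "(2 * s)\<^sup>2 \<le> (norm (z - y0))\<^sup>2" using assms by (intro power_mono) (auto simp: dist_norm norm_minus_commute)
  then have "(z - y0) \<bullet> (z - y0) / s\<^sup>2 \<ge> 4" using assms(1) by (simp add: power2_norm_eq_inner power_mult_distrib le_divide_eq)
  then show ?thesis by (simp add: twist_def cutoff_simps rot_0)
qed

lemma smooth_twist: "smooth_on UNIV (twist y0 s \<theta>)"
proof -
  have t: "smooth_on UNIV (\<lambda>z. \<theta> * cutoff ((z - y0) \<bullet> (z - y0) / s\<^sup>2))"
    unfolding divide_inverse
    by (intro smooth_on_mult smooth_on_const open_UNIV smooth_on_compose[OF open_UNIV open_UNIV _ smooth_on_cutoff]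
        smooth_on_inner_self UNIV_I)
  have cs: "smooth_on UNIV (\<lambda>z. cos (\<theta> * cutoff ((z - y0) \<bullet> (z - y0) / s\<^sup>2)))"
    "smooth_on UNIV (\<lambda>z. sin (\<theta> * cutoff ((z - y0) \<bullet> (z - y0) / s\<^sup>2)))"
    using smooth_on_compose[OF open_UNIV open_UNIV t smooth_on_sin_cos[of 0 1]]
      smooth_on_compose[OF open_UNIV open_UNIV t smooth_on_sin_cos[of 1 0]] by simp_all
  show ?thesis
    unfolding twist_def[abs_def] rot_def
    by (intro smooth_on_add smooth_on_scaleR smooth_on_mult smooth_on_diff smooth_on_const smooth_on_ident
        smooth_on_inner_right cs open_UNIV)
qed

text \<open>Written as a rotation after a rank one perturbation of the identity. The change of angle
  moves points in a direction orthogonal to \<open>w\<close>, while the angle varies only along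
  \<open>w\<close>; so \<open>tdet_rank_one\<close> gives determinant 1 in
  \<open>tdet_twist\<close>.\<close>

lemma twist_derivative:
  fixes y0 z :: 'e and s \<theta> :: real
  defines "w \<equiv> z - y0"
  defines "\<phi> \<equiv> \<theta> * cutoff (w \<bullet> w / s\<^sup>2)"
  shows "\<exists>c. (twist y0 s \<theta> has_derivative
    (\<lambda>v. rot \<phi> (v + (v \<bullet> (c *\<^sub>R w)) *\<^sub>R (- (w \<bullet> b) *\<^sub>R a + (w \<bullet> a) *\<^sub>R b)))) (at z) \<and> (w = 0 \<longrightarrow> \<phi> = \<theta>)"
proof -
  have dc: "cutoff differentiable (at x)" for x using smooth_on_differentiable[OF smooth_on_cutoff] by simp
  define k where "k = fd cutoff (w \<bullet> w / s\<^sup>2) 1"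
  have kk: "fd cutoff (w \<bullet> w / s\<^sup>2) h = k * h" for h
  proof -
    have "fd cutoff (w \<bullet> w / s\<^sup>2) h = fd cutoff (w \<bullet> w / s\<^sup>2) (h *\<^sub>R 1)" by simp
    also have "\<dots> = h *\<^sub>R k" unfolding k_def by (rule linear_cmul[OF linear_frechet_derivative[OF dc]])
    finally show ?thesis by simp
  qed
  have dq: "((\<lambda>z. (z - y0) \<bullet> (z - y0) / s\<^sup>2) has_derivative (\<lambda>v. 2 * (v \<bullet> w) / s\<^sup>2)) (at z)"
  proof (rule bounded_linear.has_derivative[OF bounded_linear_divide])
    show "((\<lambda>z. (z - y0) \<bullet> (z - y0)) has_derivative (\<lambda>v. 2 * (v \<bullet> w))) (at z)"
      unfolding w_def by (auto intro!: derivative_eq_intros simp: inner_commute)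
  qed
  from has_derivative_compose[OF this fd_works[OF dc]]
  have "((\<lambda>z. cutoff ((z - y0) \<bullet> (z - y0) / s\<^sup>2)) has_derivative (\<lambda>v. k * (2 * (v \<bullet> w) / s\<^sup>2))) (at z)"
    unfolding w_def[symmetric] kk .
  from has_derivative_mult_right[OF this, of \<theta>]
  have dt: "((\<lambda>z. \<theta> * cutoff ((z - y0) \<bullet> (z - y0) / s\<^sup>2)) has_derivative (\<lambda>v. \<theta> * (k * (2 * (v \<bullet> w) / s\<^sup>2)))) (at z)" .
  define c where "c = \<theta> * k * 2 / s\<^sup>2"
  have dt': "((\<lambda>z. \<theta> * cutoff ((z - y0) \<bullet> (z - y0) / s\<^sup>2)) has_derivative (\<lambda>v. v \<bullet> (c *\<^sub>R w))) (at z)"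
    by (rule has_derivative_eq_rhs[OF dt]) (simp add: c_def fun_eq_iff)
  have dcos: "((\<lambda>z. cos (\<theta> * cutoff ((z - y0) \<bullet> (z - y0) / s\<^sup>2))) has_derivative (\<lambda>v. (v \<bullet> (c *\<^sub>R w)) * - sin \<phi>)) (at z)"
    and dsin: "((\<lambda>z. sin (\<theta> * cutoff ((z - y0) \<bullet> (z - y0) / s\<^sup>2))) has_derivative (\<lambda>v. (v \<bullet> (c *\<^sub>R w)) * cos \<phi>)) (at z)"
    unfolding \<phi>_def w_def by (rule has_derivative_cos[OF dt'[unfolded w_def]] has_derivative_sin[OF dt'[unfolded w_def]])+
  have dw: "((\<lambda>z. (z - y0) \<bullet> e) has_derivative (\<lambda>v. v \<bullet> e)) (at z)" for e
    by (auto intro!: derivative_eq_intros)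
  let ?t = "\<lambda>v. v \<bullet> (c *\<^sub>R w)"
  have "(twist y0 s \<theta> has_derivative (\<lambda>v. 0 + (v - 0 +
      (((cos \<phi> - 1) * (v \<bullet> a) + (?t v * - sin \<phi> - 0) * (w \<bullet> a)) - (sin \<phi> * (v \<bullet> b) + (?t v * cos \<phi>) * (w \<bullet> b))) *\<^sub>R a
    + ((sin \<phi> * (v \<bullet> a) + (?t v * cos \<phi>) * (w \<bullet> a)) + ((cos \<phi> - 1) * (v \<bullet> b) + (?t v * - sin \<phi> - 0) * (w \<bullet> b))) *\<^sub>R b))) (at z)"
    unfolding twist_def[abs_def] rot_def \<phi>_def w_def
    by (intro has_derivative_add has_derivative_diff has_derivative_const has_derivative_ident has_derivative_scaleR_left
        has_derivative_mult dcos[unfolded \<phi>_def w_def] dsin[unfolded \<phi>_def w_def] dw)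
  moreover have "0 + (v - 0 +
      (((cos \<phi> - 1) * (v \<bullet> a) + (?t v * - sin \<phi> - 0) * (w \<bullet> a)) - (sin \<phi> * (v \<bullet> b) + (?t v * cos \<phi>) * (w \<bullet> b))) *\<^sub>R a
    + ((sin \<phi> * (v \<bullet> a) + (?t v * cos \<phi>) * (w \<bullet> a)) + ((cos \<phi> - 1) * (v \<bullet> b) + (?t v * - sin \<phi> - 0) * (w \<bullet> b))) *\<^sub>R b)
    = rot \<phi> (v + ?t v *\<^sub>R (- (w \<bullet> b) *\<^sub>R a + (w \<bullet> a) *\<^sub>R b))" for v
    by (simp add: rot_def inner_add_left basis_inner algebra_simps)
  ultimately show ?thesis by (intro exI[of _ c]) (simp add: \<phi>_def cutoff_simps)
qed

lemma tdet_twist: "tdet (fd (twist y0 s \<theta>) z) = 1"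
proof -
  obtain c \<phi> where "(twist y0 s \<theta> has_derivative
    (\<lambda>v. rot \<phi> (v + (v \<bullet> (c *\<^sub>R (z - y0))) *\<^sub>R (- ((z - y0) \<bullet> b) *\<^sub>R a + ((z - y0) \<bullet> a) *\<^sub>R b)))) (at z)"
    using twist_derivative[of y0 s \<theta> z] by (elim exE conjE) (rule that)
  from fd_eq[OF this] have "tdet (fd (twist y0 s \<theta>) z) =
      tdet (\<lambda>v. rot \<phi> (v + (v \<bullet> (c *\<^sub>R (z - y0))) *\<^sub>R (- ((z - y0) \<bullet> b) *\<^sub>R a + ((z - y0) \<bullet> a) *\<^sub>R b)))"
    by (rule arg_cong)
  also have "\<dots> = tdet (\<lambda>v. v + (v \<bullet> (c *\<^sub>R (z - y0))) *\<^sub>R (- ((z - y0) \<bullet> b) *\<^sub>R a + ((z - y0) \<bullet> a) *\<^sub>R b)) * tdet (rot \<phi>)"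
    by (rule tdet_compose[OF linear_rot])
  also have "\<dots> = 1"
    unfolding tdet_rot tdet_rank_one
    by (simp add: inner_diff_left inner_diff_right inner_commute[of a] inner_commute[of b] algebra_simps)
  finally show ?thesis .
qed

lemma fd_twist_center: "fd (twist y0 s \<theta>) y0 = rot \<theta>"
proof -
  obtain c where "(twist y0 s \<theta> has_derivative
    (\<lambda>v. rot (\<theta> * cutoff ((y0 - y0) \<bullet> (y0 - y0) / s\<^sup>2)) (v + (v \<bullet> (c *\<^sub>R (y0 - y0))) *\<^sub>R (- ((y0 - y0) \<bullet> b) *\<^sub>R a + ((y0 - y0) \<bullet> a) *\<^sub>R b)))) (at y0)"
    using twist_derivative[of y0 s \<theta> y0] by (elim exE conjE) (rule that)
  from fd_eq[OF this] show ?thesis by (simp add: cutoff_simps)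
qed

text \<open>The twist preserves the standard volume, and \<open>\<Phi>\<close> turns the density
  \<open>\<rho>\<close> into the constant \<open>\<rho> y0\<close>; conjugation by
  \<open>\<Phi>\<close> therefore preserves \<open>\<rho>\<close>. As \<open>\<Phi>\<close> fixes
  \<open>y0\<close> with derivative the identity, the derivative of the conjugate there is still the
  rotation.\<close>

lemma volume_preserving_twist_aux:
  fixes \<rho> :: "'e \<Rightarrow> real"
  assumes U: "open U" "y0 \<in> U" and \<rho>: "smooth_on U \<rho>" "\<rho> y0 \<noteq> 0"
  shows "\<exists>K \<eta>. compact K \<and> K \<subseteq> U \<and> (\<forall>\<theta>. smooth_on U (\<eta> \<theta>) \<and> (\<forall>y\<in>U. \<eta> \<theta> y \<in> U \<and> \<eta> (- \<theta>) (\<eta> \<theta> y) = y \<and>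
      tdet (fd (\<eta> \<theta>) y) * \<rho> (\<eta> \<theta> y) = \<rho> y) \<and> (\<forall>y\<in>U - K. \<eta> \<theta> y = y) \<and> (\<forall>y\<in>K. \<eta> \<theta> y \<in> K) \<and>
      \<eta> \<theta> y0 = y0 \<and> fd (\<eta> \<theta>) y0 = rot \<theta>)"
proof -
  obtain W \<Phi> \<Psi> where W: "open W" "y0 \<in> W" "W \<subseteq> U" and \<Phi>: "smooth_on W \<Phi>" "inj_on \<Phi> W" "open (\<Phi> ` W)"
    and \<Psi>: "smooth_on (\<Phi> ` W) \<Psi>" "\<And>y. y \<in> W \<Longrightarrow> \<Psi> (\<Phi> y) = y" and \<Phi>0: "\<Phi> y0 = y0" "fd \<Phi> y0 = (\<lambda>v. v)"
    and det: "\<And>y. y \<in> W \<Longrightarrow> \<rho> y \<noteq> 0" "\<And>y. y \<in> W \<Longrightarrow> tdet (fd \<Phi> y) = \<rho> y / \<rho> y0"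
    using straighten_density[OF U \<rho>] by blast
  have "y0 \<in> \<Phi> ` W" using W(2) \<Phi>0(1) by (metis image_eqI)
  then obtain r where r: "r > 0" "cball y0 r \<subseteq> \<Phi> ` W" using \<Phi>(3) open_contains_cball by blast
  \<comment> \<open>The twist is the identity from distance \<open>2 * s = r\<close> on, hence
    outside the ball that lies in the image of \<open>\<Phi>\<close>.\<close>
  define s where "s = r / 2"
  have s: "s > 0" using r by (simp add: s_def)
  define \<kappa> where "\<kappa> = twist y0 s"
  define K where "K = \<Psi> ` cball y0 r"
  have cpt: "compact K" unfolding K_def
    by (rule compact_continuous_image[OF continuous_on_subset[OF smooth_on_continuous_on[OF \<Psi>(1)] r(2)] compact_cball])
  have KW: "K \<subseteq> W" using r(2) \<Psi>(2) by (fastforce simp: K_def)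
  have K_iff: "y \<in> K \<longleftrightarrow> \<Phi> y \<in> cball y0 r" if "y \<in> W" for y
  proof
    assume "\<Phi> y \<in> cball y0 r"
    then have "\<Psi> (\<Phi> y) \<in> K" unfolding K_def by (rule imageI)
    then show "y \<in> K" using \<Psi>(2)[OF that] by simp
  next
    assume "y \<in> K"
    then obtain z where z: "z \<in> cball y0 r" "y = \<Psi> z" by (auto simp: K_def)
    then obtain y' where "y' \<in> W" "z = \<Phi> y'" using r(2) by blast
    then show "\<Phi> y \<in> cball y0 r" using z \<Psi>(2) by metis
  qed
  have \<kappa>out: "\<kappa> \<theta> z = z" if "z \<notin> cball y0 r" for \<theta> z
    unfolding \<kappa>_def by (rule twist_outside[OF s]) (use that in \<open>simp add: s_def\<close>)
  have \<kappa>in: "\<kappa> \<theta> z \<in> cball y0 r \<longleftrightarrow> z \<in> cball y0 r" for \<theta> z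
    by (simp add: \<kappa>_def twist_dist)
  have \<kappa>W: "\<kappa> \<theta> (\<Phi> y) \<in> \<Phi> ` W" if "y \<in> W" for \<theta> y
    using \<kappa>out[of "\<Phi> y"] \<kappa>in[of \<theta> "\<Phi> y"] r(2) that by (cases "\<Phi> y \<in> cball y0 r") auto
  have \<Phi>\<Psi>: "\<Phi> (\<Psi> z) = z" "\<Psi> z \<in> W" if "z \<in> \<Phi> ` W" for z using that \<Psi>(2) by auto
  define \<eta> where "\<eta> \<theta> y = (if y \<in> W then \<Psi> (\<kappa> \<theta> (\<Phi> y)) else y)" for \<theta> y
  have \<eta>W: "\<eta> \<theta> y = \<Psi> (\<kappa> \<theta> (\<Phi> y))" "\<eta> \<theta> y \<in> W" if "y \<in> W" for \<theta> y
    using that \<Phi>\<Psi>(2)[OF \<kappa>W[OF that]] by (simp_all add: \<eta>_def)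
  have \<eta>out: "\<eta> \<theta> y = y" if "y \<notin> K" for \<theta> y
    using that K_iff[of y] \<kappa>out[of "\<Phi> y"] \<Psi>(2) by (auto simp: \<eta>_def)
  have sm\<kappa>: "smooth_on S (\<kappa> \<theta>)" for S \<theta> unfolding \<kappa>_def by (rule smooth_on_subset[OF smooth_twist]) simp
  have sm1: "smooth_on W (\<lambda>y. \<kappa> \<theta> (\<Phi> y))" for \<theta>
    by (rule smooth_on_compose[OF W(1) open_UNIV \<Phi>(1) sm\<kappa>]) simp
  have sm\<eta>W: "smooth_on W (\<lambda>y. \<Psi> (\<kappa> \<theta> (\<Phi> y)))" for \<theta>
    by (rule smooth_on_compose[OF W(1) \<Phi>(3) sm1 \<Psi>(1) \<kappa>W])
  have oUK: "open (U - K)" using U(1) cpt compact_imp_closed by blast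
  have sm: "smooth_on U (\<eta> \<theta>)" for \<theta>
  proof (rule smooth_on_local)
    fix y assume y: "y \<in> U"
    show "\<exists>V g. open V \<and> y \<in> V \<and> smooth_on V g \<and> (\<forall>z\<in>V. \<eta> \<theta> z = g z)"
    proof (cases "y \<in> W")
      case True
      then show ?thesis using W(1) sm\<eta>W \<eta>W(1) by blast
    next
      case False
      then have "y \<in> U - K" using y KW by blast
      then show ?thesis using oUK smooth_on_ident[of "U - K"] \<eta>out by blast
    qed
  qed
  have fd\<eta>: "fd (\<eta> \<theta>) y v = fd \<Psi> (\<kappa> \<theta> (\<Phi> y)) (fd (\<kappa> \<theta>) (\<Phi> y) (fd \<Phi> y v))" if y: "y \<in> W" for \<theta> y v
  proof -
    have "fd (\<eta> \<theta>) y = fd (\<lambda>y. \<Psi> (\<kappa> \<theta> (\<Phi> y))) y" by (rule fd_cong[OF W(1) y \<eta>W(1)])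
    then show ?thesis
      using fd_compose[OF smooth_on_differentiable[OF sm1 y] smooth_on_differentiable[OF \<Psi>(1) \<kappa>W[OF y]]]
        fd_compose[OF smooth_on_differentiable[OF \<Phi>(1) y] smooth_on_differentiable[OF sm\<kappa> UNIV_I]] by simp
  qed
  have lin\<Psi>: "linear (fd \<Psi> z)" if "z \<in> \<Phi> ` W" for z using linear_frechet_derivative[OF smooth_on_differentiable[OF \<Psi>(1) that]] .
  have lin\<kappa>: "linear (fd (\<kappa> \<theta>) z)" for \<theta> z using linear_frechet_derivative[OF smooth_on_differentiable[OF sm\<kappa> UNIV_I]] .
  have inv\<Psi>: "fd \<Psi> (\<Phi> y) (fd \<Phi> y v) = v" if "y \<in> W" for y v
  proof -
    have "fd (\<lambda>y. \<Psi> (\<Phi> y)) y = fd (\<lambda>y. y) y" by (rule fd_cong[OF W(1) that \<Psi>(2)])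
    then show ?thesis using fd_compose[OF smooth_on_differentiable[OF \<Phi>(1) that] smooth_on_differentiable[OF \<Psi>(1)], of v] that
      by simp
  qed
  have det\<Psi>: "tdet (fd \<Psi> (\<Phi> y)) * (\<rho> y / \<rho> y0) = 1" if "y \<in> W" for y
  proof -
    have "tdet (\<lambda>v. fd \<Psi> (\<Phi> y) (fd \<Phi> y v)) = tdet (fd \<Phi> y) * tdet (fd \<Psi> (\<Phi> y))"
      by (rule tdet_compose[OF lin\<Psi>]) (use that in blast)
    then have "1 = tdet (fd \<Phi> y) * tdet (fd \<Psi> (\<Phi> y))" by (simp only: inv\<Psi>[OF that] tdet_ident)
    then show ?thesis by (simp only: det(2)[OF that] mult.commute)
  qed
  have vol: "tdet (fd (\<eta> \<theta>) y) * \<rho> (\<eta> \<theta> y) = \<rho> y" if y: "y \<in> U" for \<theta> y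
  proof (cases "y \<in> W")
    case True
    let ?z = "\<kappa> \<theta> (\<Phi> y)"
    have z: "?z = \<Phi> (\<eta> \<theta> y)" using \<eta>W(1)[OF True] \<Phi>\<Psi>(1)[OF \<kappa>W[OF True]] by simp
    have "fd (\<eta> \<theta>) y = (\<lambda>v. fd \<Psi> ?z (fd (\<kappa> \<theta>) (\<Phi> y) (fd \<Phi> y v)))" using fd\<eta>[OF True] by blast
    then have "tdet (fd (\<eta> \<theta>) y) = tdet (\<lambda>v. fd (\<kappa> \<theta>) (\<Phi> y) (fd \<Phi> y v)) * tdet (fd \<Psi> ?z)"
      using tdet_compose[OF lin\<Psi>[OF \<kappa>W[OF True]], where T = "\<lambda>v. fd (\<kappa> \<theta>) (\<Phi> y) (fd \<Phi> y v)"] by metis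
    also have "tdet (\<lambda>v. fd (\<kappa> \<theta>) (\<Phi> y) (fd \<Phi> y v)) = tdet (fd \<Phi> y) * tdet (fd (\<kappa> \<theta>) (\<Phi> y))"
      by (rule tdet_compose[OF lin\<kappa>])
    finally have "tdet (fd (\<eta> \<theta>) y) = tdet (fd \<Phi> y) * tdet (fd (\<kappa> \<theta>) (\<Phi> y)) * tdet (fd \<Psi> ?z)" .
    also have "\<dots> = \<rho> y / \<rho> y0 * tdet (fd \<Psi> (\<Phi> (\<eta> \<theta> y)))"
      unfolding z[symmetric] by (simp add: det(2)[OF True] \<kappa>_def tdet_twist)
    finally have e: "tdet (fd (\<eta> \<theta>) y) = \<rho> y / \<rho> y0 * tdet (fd \<Psi> (\<Phi> (\<eta> \<theta> y)))" .
    have "tdet (fd (\<eta> \<theta>) y) * \<rho> (\<eta> \<theta> y) = \<rho> y * (tdet (fd \<Psi> (\<Phi> (\<eta> \<theta> y))) * (\<rho> (\<eta> \<theta> y) / \<rho> y0))"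
      unfolding e by simp
    then show ?thesis using det\<Psi>[OF \<eta>W(2)[OF True]] by simp
  next
    case False
    then have yK: "y \<in> U - K" using y KW by blast
    have "fd (\<eta> \<theta>) y = fd (\<lambda>y. y) y" by (rule fd_cong[OF oUK yK]) (simp add: \<eta>out)
    then show ?thesis using \<eta>out yK by (simp add: tdet_ident)
  qed
  have inv: "\<eta> (- \<theta>) (\<eta> \<theta> y) = y" for \<theta> y
  proof (cases "y \<in> W")
    case True
    have "\<eta> (- \<theta>) (\<eta> \<theta> y) = \<Psi> (\<kappa> (- \<theta>) (\<Phi> (\<Psi> (\<kappa> \<theta> (\<Phi> y)))))"
      using \<eta>W[OF True] \<eta>W(1)[OF \<eta>W(2)[OF True]] by simp
    then show ?thesis using \<Phi>\<Psi>(1)[OF \<kappa>W[OF True]] \<Psi>(2)[OF True] by (simp add: \<kappa>_def twist_inverse)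
  qed (simp add: \<eta>_def)
  have inU: "\<eta> \<theta> y \<in> U" if "y \<in> U" for \<theta> y using that \<eta>W(2)[of y \<theta>] W(3) by (cases "y \<in> W") (auto simp: \<eta>_def)
  have inK: "\<eta> \<theta> y \<in> K" if "y \<in> K" for \<theta> y
  proof -
    have yW: "y \<in> W" using that KW by blast
    have "\<Phi> (\<eta> \<theta> y) = \<kappa> \<theta> (\<Phi> y)" using \<eta>W(1)[OF yW] \<Phi>\<Psi>(1)[OF \<kappa>W[OF yW]] by simp
    then show ?thesis using K_iff[OF \<eta>W(2)[OF yW]] K_iff[OF yW] \<kappa>in that by simp
  qed
  have \<kappa>0: "\<kappa> \<theta> y0 = y0" for \<theta> using twist_dist[of y0 s \<theta> y0] by (simp add: \<kappa>_def)
  have \<eta>0: "\<eta> \<theta> y0 = y0" for \<theta> using \<eta>W(1)[OF W(2)] \<Psi>(2)[OF W(2)] by (simp add: \<Phi>0 \<kappa>0)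
  have "fd (\<eta> \<theta>) y0 = rot \<theta>" for \<theta>
  proof
    fix v
    have "fd \<Psi> y0 w = w" for w using inv\<Psi>[OF W(2), of w] by (simp add: \<Phi>0)
    then show "fd (\<eta> \<theta>) y0 v = rot \<theta> v" using fd\<eta>[OF W(2), of \<theta> v]
      by (simp add: \<Phi>0 \<kappa>0) (simp add: \<kappa>_def fd_twist_center)
  qed
  then show ?thesis using cpt KW W(3) sm inU inv vol \<eta>out inK \<eta>0 by (intro exI[of _ K] exI[of _ \<eta>]) auto
qed

text \<open>The density of \<open>\<omega>\<^sup>n\<close> never vanishes, but admitting identically vanishing densities spares
  the proof of that fact.\<close>

lemma volume_preserving_twist:
  fixes \<rho> :: "'e \<Rightarrow> real"
  assumes U: "open U" "y0 \<in> U" and \<rho>: "smooth_on U \<rho>" "\<rho> y0 \<noteq> 0 \<or> (\<forall>y\<in>U. \<rho> y = 0)"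
  shows "\<exists>K \<eta>. compact K \<and> K \<subseteq> U \<and> (\<forall>\<theta>. smooth_on U (\<eta> \<theta>) \<and> (\<forall>y\<in>U. \<eta> \<theta> y \<in> U \<and> \<eta> (- \<theta>) (\<eta> \<theta> y) = y \<and>
      tdet (fd (\<eta> \<theta>) y) * \<rho> (\<eta> \<theta> y) = \<rho> y) \<and> (\<forall>y\<in>U - K. \<eta> \<theta> y = y) \<and> (\<forall>y\<in>K. \<eta> \<theta> y \<in> K) \<and>
      \<eta> \<theta> y0 = y0 \<and> fd (\<eta> \<theta>) y0 = rot \<theta>)"
proof (cases "\<rho> y0 \<noteq> 0")
  case True
  then show ?thesis by (rule volume_preserving_twist_aux[OF U \<rho>(1)])
next
  case False
  then have z: "\<rho> y = 0" if "y \<in> U" for y using \<rho>(2) that by blast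
  have "1 \<noteq> (0::real)" by simp
  from volume_preserving_twist_aux[OF U smooth_on_const this]
  show ?thesis by (rule ex_forward, elim ex_forward) (use z in auto)
qed

end

section \<open>A quadratic form detecting a rotation\<close>

lemma tendsto_ndet:
  assumes "\<And>i j. i < k \<Longrightarrow> j < k \<Longrightarrow> ((\<lambda>r. m r i j) \<longlongrightarrow> m' i j) F"
  shows "((\<lambda>r. ndet k (m r)) \<longlongrightarrow> ndet k m') F"
  unfolding ndet_def
proof (intro tendsto_sum tendsto_mult tendsto_const tendsto_prod)
  fix \<sigma> i assume "\<sigma> \<in> {\<sigma>. \<sigma> permutes {..<k}}" "i \<in> {..<k}"
  then show "((\<lambda>r. m r i (\<sigma> i)) \<longlongrightarrow> m' i (\<sigma> i)) F"
    using permutes_in_image[of \<sigma> "{..<k}" i] by (intro assms) auto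
qed

lemma ndet_scale:
  "ndet k (\<lambda>i j. m i j / (l i * l j)) = ndet k m / (\<Prod>i<k. l i)\<^sup>2"
proof -
  have "(\<Prod>i<k. m i (\<sigma> i) / (l i * l (\<sigma> i))) = (\<Prod>i<k. m i (\<sigma> i)) / (\<Prod>i<k. l i)\<^sup>2"
    if "\<sigma> permutes {..<k}" for \<sigma>
    using prod.permute[OF that, of l]
    by (simp add: prod_dividef prod.distrib comp_def power2_eq_square)
  then show ?thesis by (simp add: ndet_def sum_divide_distrib)
qed

definition diag_form :: "(nat \<Rightarrow> real) \<Rightarrow> 'e::euclidean_space \<Rightarrow> 'e \<Rightarrow> real" where
  "diag_form \<mu> u v = (\<Sum>i<DIM('e). \<mu> i * ((u \<bullet> eb i) * (v \<bullet> eb i)))"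

lemma bilinear_diag_form: "bilinear (diag_form \<mu>)"
  unfolding bilinear_def diag_form_def
  by (auto intro!: linearI simp: inner_add_left algebra_simps sum.distrib sum_distrib_left)

lemma diag_form_eb:
  assumes "i < DIM('e)" "j < DIM('e)"
  shows "diag_form \<mu> (eb i :: 'e::euclidean_space) (eb j) = (if i = j then \<mu> i else 0)"
proof -
  have "diag_form \<mu> (eb i :: 'e) (eb j) = (\<Sum>k<DIM('e). if k = i then \<mu> i * (eb j \<bullet> (eb i :: 'e)) else 0)"
    unfolding diag_form_def by (rule sum.cong) (use assms in \<open>auto simp: eb_inner\<close>)
  then show ?thesis using assms by (simp add: eb_inner)
qed

lemma bdet_diag_form: "bdet (diag_form \<mu> :: 'e::euclidean_space \<Rightarrow> 'e \<Rightarrow> real) = (\<Prod>i<DIM('e). \<mu> i)"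
  unfolding bdet_def by (subst ndet_diag) (simp_all add: diag_form_eb)

text \<open>Makes a single entry of \<open>\<Omega>\<close> visible. With all weights but those of
  \<open>i\<close> and \<open>j\<close> large and the diagonal normalised to 1, every other entry
  off the diagonal tends to 0; the remaining block with diagonal 1 and entries
  \<open>\<Omega> (eb i) (eb j)\<close> and its negative has determinant
  \<open>1 + (\<Omega> (eb i) (eb j))\<^sup>2\<close>.\<close>

lemma diag_form_asymptotics:
  fixes \<Omega> :: "'e::euclidean_space \<Rightarrow> 'e \<Rightarrow> real"
  assumes alt: "\<And>u v. \<Omega> u v = - \<Omega> v u" and ij: "i < DIM('e)" "j < DIM('e)" "i \<noteq> j"
  defines "l r k \<equiv> if k = i \<or> k = j then 1 else (r :: real)"
  shows "((\<lambda>r. bdet (\<lambda>u v. diag_form (\<lambda>k. (l r k)\<^sup>2) u v + \<Omega> u v) / (\<Prod>k<DIM('e). l r k)\<^sup>2)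
    \<longlongrightarrow> 1 + (\<Omega> (eb i) (eb j))\<^sup>2) at_top"
proof -
  let ?N = "DIM('e)"
  let ?m = "\<lambda>r k k'. (diag_form (\<lambda>k. (l r k)\<^sup>2) (eb k :: 'e) (eb k') + \<Omega> (eb k) (eb k')) / (l r k * l r k')"
  define m' where "m' k k' = (if k = k' then 1 else if {k, k'} = {i, j} then \<Omega> (eb k) (eb k') else 0)" for k k'
  have \<Omega>0: "\<Omega> u u = 0" for u using alt[of u u] by simp
  have "((\<lambda>r. ndet ?N (?m r)) \<longlongrightarrow> ndet ?N m') at_top"
  proof (rule tendsto_ndet)
    fix k k' assume k: "k < ?N" "k' < ?N"
    show "((\<lambda>r. ?m r k k') \<longlongrightarrow> m' k k') at_top"
    proof (cases "k = k'")
      case True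
      have "\<forall>\<^sub>F r in at_top. ?m r k k' = 1"
        using eventually_gt_at_top[of "0::real"]
        by eventually_elim (use True k in \<open>simp add: diag_form_eb \<Omega>0 l_def power2_eq_square\<close>)
      then show ?thesis using True by (simp add: m'_def tendsto_eventually)
    next
      case ne: False
      then have m: "?m r k k' = \<Omega> (eb k) (eb k') / (l r k * l r k')" for r using k by (simp add: diag_form_eb)
      show ?thesis
      proof (cases "{k, k'} = {i, j}")
        case True
        then have "l r k = 1" "l r k' = 1" for r by (auto simp: l_def doubleton_eq_iff)
        then show ?thesis unfolding m using ne True by (simp add: m'_def)
      next
        case False
        have lim: "((\<lambda>r. \<Omega> (eb k) (eb k') / (l r k * l r k')) \<longlongrightarrow> 0) at_top"
        proof (rule tendsto_divide_0[OF tendsto_const filterlim_at_top_imp_at_infinity], rule filterlim_at_top_mono[OF filterlim_ident])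
          have "\<not> (k = i \<or> k = j) \<or> \<not> (k' = i \<or> k' = j)" using False ne by auto
          then have "r \<le> l r k * l r k'" if "1 \<le> r" for r
            using that by (auto simp: l_def mult_le_cancel_left1)
          then show "\<forall>\<^sub>F r in at_top. r \<le> l r k * l r k'"
            by (rule eventually_mono[OF eventually_ge_at_top])
        qed
        then show ?thesis unfolding m using ne False by (simp add: m'_def)
      qed
    qed
  qed
  also have "ndet ?N m' = 1 + (\<Omega> (eb i) (eb j))\<^sup>2"
  proof -
    have "ndet ?N m' = (m' i i * m' j j - m' i j * m' j i) * (\<Prod>k\<in>{..<?N} - {i, j}. m' k k)"
      by (rule ndet_block[OF ij]) (simp add: m'_def)
    then show ?thesis using ij alt[of "eb j" "eb i"] by (simp add: m'_def insert_commute power2_eq_square)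
  qed
  finally show ?thesis unfolding ndet_scale bdet_def .
qed

text \<open>Some rotation changes the square of an entry of \<open>\<Omega>\<close>, and by
  \<open>diag_form_asymptotics\<close> the determinants then differ for a diagonal form with large
  enough weights.\<close>

lemma rotation_detected:
  fixes \<Omega> :: "'e::euclidean_space \<Rightarrow> 'e \<Rightarrow> real"
  assumes B: "bilinear \<Omega>" and alt: "\<And>u. \<Omega> u u = 0" and nd: "bdet \<Omega> \<noteq> 0" and dim: "DIM('e) \<ge> 3"
  shows "\<exists>a b \<theta> \<mu>. a \<in> Basis \<and> b \<in> Basis \<and> a \<noteq> b \<and> (\<forall>i. \<mu> i > 0) \<and>
    bdet (\<lambda>u v. diag_form \<mu> (rot a b \<theta> u) (rot a b \<theta> v) + \<Omega> u v) \<noteq> bdet (\<lambda>u v. diag_form \<mu> u v + \<Omega> u v)"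
proof -
  let ?N = "DIM('e)"
  have anti: "\<Omega> u v = - \<Omega> v u" for u v
  proof -
    have "\<Omega> (u + v) (u + v) = \<Omega> u u + \<Omega> u v + (\<Omega> v u + \<Omega> v v)"
      by (simp add: bilinear_ladd[OF B] bilinear_radd[OF B])
    then show ?thesis using alt by simp
  qed
  have "\<exists>i j. i < ?N \<and> j < ?N \<and> \<Omega> (eb i) (eb j) \<noteq> 0"
  proof (rule ccontr)
    assume "\<not> ?thesis"
    then have z: "\<Omega> (eb i) (eb j) = 0" if "i < ?N" "j < ?N" for i j using that by blast
    have "bdet \<Omega> = bdet (\<lambda>u v :: 'e. 0)" unfolding bdet_def by (rule ndet_cong) (simp add: z)
    also have "\<dots> = (\<Prod>i<?N. 0)" unfolding bdet_def by (rule ndet_diag) simp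
    also have "\<dots> = 0" using dim by simp
    finally show False using nd by simp
  qed
  then obtain i j where ij: "i < ?N" "j < ?N" "\<Omega> (eb i) (eb j) \<noteq> 0" by blast
  have ne: "i \<noteq> j" using ij alt by auto
  \<comment> \<open>The rotation has to mix \<open>j\<close> with a third index: one in the plane of
    \<open>i\<close> and \<open>j\<close> would leave \<open>\<Omega> (eb i) (eb j)\<close>
    unchanged.\<close>
  have "card {i, j} < card {..<?N}" using dim ne by simp
  then obtain k where k: "k < ?N" "k \<noteq> i" "k \<noteq> j"
    by (metis card_mono finite.emptyI finite.insertI insertCI lessThan_iff linorder_not_le subsetI)
  define a where "a = (eb j :: 'e)"
  define b where "b = (eb k :: 'e)"
  have ab: "a \<in> Basis" "b \<in> Basis" "a \<noteq> b"
    using eb_Basis ij k eb_inner[where 'e='e, of j k] eb_inner[where 'e='e, of j j] by (auto simp: a_def b_def)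
  define R where "R = rot a b"
  have i_inner: "eb i \<bullet> a = 0" "eb i \<bullet> b = 0" using ij k ne by (simp_all add: a_def b_def eb_inner)
  have Ri: "R \<theta> (eb i) = eb i" for \<theta> by (simp add: R_def rot_def[OF ab] i_inner)
  have Rj: "R \<theta> (eb j) = cos \<theta> *\<^sub>R eb j + sin \<theta> *\<^sub>R eb k" for \<theta>
  proof -
    have "eb j \<bullet> a = 1" "eb j \<bullet> b = 0" using basis_inner[OF ab] by (simp_all add: a_def b_def)
    then show ?thesis unfolding R_def rot_def[OF ab] by (simp add: a_def b_def algebra_simps)
  qed
  have Rinv: "R (- \<theta>) (R \<theta> v) = v" for \<theta> v by (simp add: R_def rot_rot[OF ab] rot_0[OF ab])
  have linR: "linear (R \<theta>)" for \<theta> unfolding R_def by (rule linear_rot[OF ab])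
  \<comment> \<open>Rotating the quadratic form amounts to rotating \<open>\<Omega>\<close>
    backwards, because a simultaneous rotation of both has determinant 1.\<close>
  define \<Omega>' where "\<Omega>' \<theta> u v = \<Omega> (R (- \<theta>) u) (R (- \<theta>) v)" for \<theta> u v
  have B': "bilinear (\<Omega>' \<theta>)" for \<theta>
    using B linear_compose[OF linR, of "\<lambda>x. \<Omega> x _"] linear_compose[OF linR, of "\<Omega> _"]
    unfolding bilinear_def \<Omega>'_def comp_def by blast
  have anti': "\<Omega>' \<theta> u v = - \<Omega>' \<theta> v u" for \<theta> u v unfolding \<Omega>'_def by (rule anti)
  have \<Omega>'ij: "\<Omega>' \<theta> (eb i) (eb j) = cos \<theta> * \<Omega> (eb i) (eb j) - sin \<theta> * \<Omega> (eb i) (eb k)" for \<theta>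
    unfolding \<Omega>'_def Ri Rj by (simp add: bilinear_rsub[OF B] bilinear_rmul[OF B])
  \<comment> \<open>A quarter turn replaces the entry at \<open>i, j\<close> by the one at
    \<open>i, k\<close> up to sign. If their squares agree, an eighth turn makes the square 0 or
    doubles it.\<close>
  obtain \<theta> where \<theta>: "(\<Omega>' \<theta> (eb i) (eb j))\<^sup>2 \<noteq> (\<Omega> (eb i) (eb j))\<^sup>2"
  proof (cases "(\<Omega> (eb i) (eb k))\<^sup>2 = (\<Omega> (eb i) (eb j))\<^sup>2")
    case False
    then show ?thesis using that[of "pi / 2"] by (simp add: \<Omega>'ij)
  next
    case True
    have "(\<Omega>' (pi / 4) (eb i) (eb j))\<^sup>2 = (\<Omega> (eb i) (eb j) - \<Omega> (eb i) (eb k))\<^sup>2 / 2"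
      unfolding \<Omega>'ij cos_45 sin_45 right_diff_distrib[symmetric] power_mult_distrib by (simp add: power_divide)
    moreover have "\<Omega> (eb i) (eb k) = \<Omega> (eb i) (eb j) \<or> \<Omega> (eb i) (eb k) = - \<Omega> (eb i) (eb j)"
      using True by (simp add: power2_eq_iff)
    ultimately have "(\<Omega>' (pi / 4) (eb i) (eb j))\<^sup>2 = 0 \<or> (\<Omega>' (pi / 4) (eb i) (eb j))\<^sup>2 = 2 * (\<Omega> (eb i) (eb j))\<^sup>2"
      by (auto simp: power2_eq_square)
    then show ?thesis using that[of "pi / 4"] ij(3) by auto
  qed
  define \<mu> where "\<mu> r k = (if k = i \<or> k = j then 1 else (r::real))\<^sup>2" for r k
  have "\<exists>r>0. bdet (\<lambda>u v. diag_form (\<mu> r) u v + \<Omega>' \<theta> u v) \<noteq> bdet (\<lambda>u v. diag_form (\<mu> r) u v + \<Omega> u v)"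
  proof (rule ccontr)
    assume "\<not> ?thesis"
    then have eq: "bdet (\<lambda>u v. diag_form (\<mu> r) u v + \<Omega>' \<theta> u v) = bdet (\<lambda>u v. diag_form (\<mu> r) u v + \<Omega> u v)" if "r > 0" for r
      using that by blast
    let ?P = "\<lambda>r. (\<Prod>k<?N. if k = i \<or> k = j then 1 else (r::real))\<^sup>2"
    have l1: "((\<lambda>r. bdet (\<lambda>u v. diag_form (\<mu> r) u v + \<Omega> u v) / ?P r) \<longlongrightarrow> 1 + (\<Omega> (eb i) (eb j))\<^sup>2) at_top"
      unfolding \<mu>_def by (rule diag_form_asymptotics[OF anti ij(1,2) ne])
    have l2: "((\<lambda>r. bdet (\<lambda>u v. diag_form (\<mu> r) u v + \<Omega>' \<theta> u v) / ?P r) \<longlongrightarrow> 1 + (\<Omega>' \<theta> (eb i) (eb j))\<^sup>2) at_top"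
      unfolding \<mu>_def by (rule diag_form_asymptotics[OF anti' ij(1,2) ne])
    have "((\<lambda>r. bdet (\<lambda>u v. diag_form (\<mu> r) u v + \<Omega> u v) / ?P r) \<longlongrightarrow> 1 + (\<Omega>' \<theta> (eb i) (eb j))\<^sup>2) at_top"
      by (rule Lim_transform_eventually[OF l2])
        (use eventually_gt_at_top[of "0::real"] in \<open>eventually_elim, simp add: eq\<close>)
    then show False using tendsto_unique[OF _ l1] \<theta> by fastforce
  qed
  then obtain r where r: "r > 0" "bdet (\<lambda>u v. diag_form (\<mu> r) u v + \<Omega>' \<theta> u v) \<noteq> bdet (\<lambda>u v. diag_form (\<mu> r) u v + \<Omega> u v)"
    by blast
  have "bdet (\<lambda>u v. diag_form (\<mu> r) (R \<theta> u) (R \<theta> v) + \<Omega> u v) =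
      bdet (\<lambda>u v. (\<lambda>u v. diag_form (\<mu> r) u v + \<Omega>' \<theta> u v) (R \<theta> u) (R \<theta> v))"
    by (simp add: \<Omega>'_def Rinv)
  also have "\<dots> = (tdet (R \<theta>))\<^sup>2 * bdet (\<lambda>u v. diag_form (\<mu> r) u v + \<Omega>' \<theta> u v)"
    by (rule bdet_congruence[OF bilinear_add_fun[OF bilinear_diag_form B']])
  also have "\<dots> = bdet (\<lambda>u v. diag_form (\<mu> r) u v + \<Omega>' \<theta> u v)"
    by (simp add: R_def tdet_rot[OF ab])
  finally have "bdet (\<lambda>u v. diag_form (\<mu> r) (R \<theta> u) (R \<theta> v) + \<Omega> u v) \<noteq> bdet (\<lambda>u v. diag_form (\<mu> r) u v + \<Omega> u v)"
    using r(2) by simp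
  moreover have "\<mu> r i > 0" for i using r(1) by (simp add: \<mu>_def)
  ultimately show ?thesis using ab unfolding R_def by blast
qed

lemma quadratic_derivatives:
  fixes y0 :: "'e::euclidean_space" and \<mu> :: "nat \<Rightarrow> real"
  defines "q \<equiv> \<lambda>y. diag_form \<mu> (y - y0) (y - y0) / 2"
  shows "smooth_on UNIV q" "fd q y v = diag_form \<mu> (y - y0) v" "iter_deriv [u, v] q y = diag_form \<mu> u v"
proof -
  have "smooth_on UNIV (\<lambda>y. diag_form \<mu> (y - y0) (y - y0) * (1 / 2))"
    unfolding diag_form_def
    by (intro smooth_on_mult smooth_on_sum smooth_on_const smooth_on_inner_right smooth_on_diff smooth_on_ident open_UNIV)
  then show "smooth_on UNIV q" by (simp add: q_def)
  have d: "fd q y v = diag_form \<mu> (y - y0) v" for y v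
  proof -
    have "((\<lambda>y. diag_form \<mu> (y - y0) (y - y0)) has_derivative (\<lambda>v. 2 * diag_form \<mu> (y - y0) v)) (at y)"
      unfolding diag_form_def sum_distrib_left
      by (rule has_derivative_sum) (auto intro!: derivative_eq_intros simp: algebra_simps)
    from bounded_linear.has_derivative[OF bounded_linear_divide this, of 2]
    show ?thesis unfolding q_def by (simp add: fd_eq)
  qed
  then show "fd q y v = diag_form \<mu> (y - y0) v" .
  have l: "linear (\<lambda>u. diag_form \<mu> u v)" for v using bilinear_diag_form by (auto simp: bilinear_def)
  have "((\<lambda>y. diag_form \<mu> (y - y0) v) has_derivative (\<lambda>u. diag_form \<mu> u v)) (at y)"
    by (rule bounded_linear.has_derivative[OF l[unfolded linear_conv_bounded_linear]])
      (auto intro!: derivative_eq_intros)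
  then show "iter_deriv [u, v] q y = diag_form \<mu> u v" by (simp add: d fd_eq)
qed

section \<open>Extension of local objects to the manifold\<close>

context symplectic_manifold
begin

lemma rep_id:
  assumes "c \<in> A" "d \<in> A"
  shows "open (repdom c d id)" "smooth_on (repdom c d id) (rep c d id)"
    "y \<in> repdom c d id \<longleftrightarrow> y \<in> chart_img c \<and> chart_inv c y \<in> fst d"
    "rep c d id y = snd d (chart_inv c y)"
  using smooth_map_rep[OF smooth_map_id assms] by (simp_all add: repdom_def rep_def)

text \<open>Where the Hausdorff property enters gluing: the complement of the compact support is
  open, so functions and maps extend across it by 0 or by the identity.\<close>

lemma closedin_chart_compact:
  assumes c: "c \<in> A" and K: "compact K" "K \<subseteq> chart_img c"
  shows "closedin X (chart_inv c ` K)"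
proof -
  have "compactin (top_of_set (chart_img c)) K" using K by (simp add: compactin_subtopology)
  from image_compactin[OF this continuous_map_chart_inv[OF c]]
  have "compactin X (chart_inv c ` K)" .
  moreover have "Hausdorff_space X" using mfd by (simp add: smooth_manifold_def)
  ultimately show ?thesis by (rule compactin_imp_closedin[rotated])
qed

lemma open_outside:
  assumes c: "c \<in> A" and C: "closedin X C"
  shows "open {y \<in> chart_img c. chart_inv c y \<notin> C}"
proof -
  have o: "openin X (topspace X - C)" using C by (simp add: openin_diff)
  have "{y \<in> chart_img c. chart_inv c y \<in> topspace X - C} = {y \<in> chart_img c. chart_inv c y \<notin> C}"
    using chart_inv(3)[OF c] chart(3)[OF c] by blast
  then show ?thesis using open_chart_preimage[OF c o] by simp
qed

definition extend_fun :: "('x, 'e) chart \<Rightarrow> ('e \<Rightarrow> real) \<Rightarrow> 'x \<Rightarrow> real" where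
  "extend_fun c F x = (if x \<in> fst c then F (snd c x) else 0)"

lemma extend_fun_Cinf:
  assumes c: "c \<in> A" and K: "compact K" "K \<subseteq> chart_img c" and F: "smooth_on (chart_img c) F"
    and out: "\<And>y. y \<in> chart_img c - K \<Longrightarrow> F y = 0"
  shows "extend_fun c F \<in> Cinf X A"
proof -
  have "smooth_on (chart_img d) (rp d (extend_fun c F))" if d: "d \<in> A" for d
  proof (rule smooth_on_local)
    fix y assume y: "y \<in> chart_img d"
    show "\<exists>V g. open V \<and> y \<in> V \<and> smooth_on V g \<and> (\<forall>z\<in>V. rp d (extend_fun c F) z = g z)"
    proof (cases "chart_inv d y \<in> fst c")
      case True
      have "smooth_on (repdom d c id) (\<lambda>z. F (rep d c id z))"
        by (rule smooth_on_compose[OF rep_id(1)[OF d c] chart(2)[OF c] rep_id(2)[OF d c] F])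
          (use chart_inv(4)[OF c] rep_id(3,4)[OF d c] in simp)
      then show ?thesis
        using rep_id(1)[OF d c] rep_id(3,4)[OF d c] y True
        by (intro exI[of _ "repdom d c id"] exI[of _ "\<lambda>z. F (rep d c id z)"]) (simp add: extend_fun_def)
    next
      case False
      let ?V = "{z \<in> chart_img d. chart_inv d z \<notin> chart_inv c ` K}"
      have "chart_inv c ` K \<subseteq> fst c" using K(2) chart_inv(3)[OF c] by (intro image_subsetI) blast
      then have "y \<in> ?V" using y False by auto
      moreover have "rp d (extend_fun c F) z = 0" if z: "z \<in> ?V" for z
      proof (cases "chart_inv d z \<in> fst c")
        case True
        then have "snd c (chart_inv d z) \<in> chart_img c - K"
          using z chart_inv(1,4)[OF c True] by (auto simp: image_iff)
        then show ?thesis using out True by (simp add: extend_fun_def)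
      qed (simp add: extend_fun_def)
      ultimately show ?thesis
        using open_outside[OF d closedin_chart_compact[OF c K]] smooth_on_const by blast
    qed
  qed
  moreover have "extend_fun c F x = 0" if "x \<notin> topspace X" for x
    using that chart(3)[OF c] by (auto simp: extend_fun_def)
  ultimately show ?thesis by (simp add: Cinf_def smooth_fun_def)
qed

definition extend_map :: "('x, 'e) chart \<Rightarrow> 'e set \<Rightarrow> ('e \<Rightarrow> 'e) \<Rightarrow> 'x \<Rightarrow> 'x" where
  "extend_map c U \<eta> x = (if x \<in> fst c \<and> snd c x \<in> U then chart_inv c (\<eta> (snd c x)) else x)"

text \<open>Symmetric in the map and its inverse, so that what is proved for \<open>\<eta>\<close>
  also holds for \<open>\<eta>'\<close>.\<close>

definition chart_diffeo :: "('x, 'e) chart \<Rightarrow> 'e set \<Rightarrow> 'e set \<Rightarrow> ('e \<Rightarrow> 'e) \<Rightarrow> ('e \<Rightarrow> 'e) \<Rightarrow> bool" where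
  "chart_diffeo c U K \<eta> \<eta>' \<longleftrightarrow> c \<in> A \<and> open U \<and> U \<subseteq> chart_img c \<and> compact K \<and> K \<subseteq> U \<and>
    smooth_on U \<eta> \<and> smooth_on U \<eta>' \<and>
    (\<forall>y\<in>U. \<eta> y \<in> U \<and> \<eta>' y \<in> U \<and> \<eta>' (\<eta> y) = y \<and> \<eta> (\<eta>' y) = y) \<and> (\<forall>y\<in>U - K. \<eta> y = y \<and> \<eta>' y = y)"

lemma chart_diffeo_sym: "chart_diffeo c U K \<eta> \<eta>' \<Longrightarrow> chart_diffeo c U K \<eta>' \<eta>"
  unfolding chart_diffeo_def by blast

context
  fixes c U K \<eta> \<eta>'
  assumes cd: "chart_diffeo c U K \<eta> \<eta>'"
begin

lemma chart_diffeo_atlas: "c \<in> A"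
  and chart_diffeo_domain: "open U" "U \<subseteq> chart_img c"
  and chart_diffeo_support: "compact K" "K \<subseteq> U"
  and chart_diffeo_map: "smooth_on U \<eta>" "y \<in> U \<Longrightarrow> \<eta> y \<in> U" "y \<in> U - K \<Longrightarrow> \<eta> y = y"
  and chart_diffeo_inverse: "y \<in> U \<Longrightarrow> \<eta>' (\<eta> y) = y"
  using cd unfolding chart_diffeo_def by blast+

lemma extend_map_in:
  assumes "x \<in> fst c" "snd c x \<in> U"
  shows "extend_map c U \<eta> x = chart_inv c (\<eta> (snd c x))" "extend_map c U \<eta> x \<in> fst c"
    "snd c (extend_map c U \<eta> x) = \<eta> (snd c x)"
proof -
  have "\<eta> (snd c x) \<in> chart_img c" using chart_diffeo_map(2) assms chart_diffeo_domain(2) by blast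
  then show "extend_map c U \<eta> x = chart_inv c (\<eta> (snd c x))" "extend_map c U \<eta> x \<in> fst c"
    "snd c (extend_map c U \<eta> x) = \<eta> (snd c x)"
    using assms chart_inv(2,3)[OF chart_diffeo_atlas] by (simp_all add: extend_map_def)
qed

lemma extend_map_out:
  assumes "x \<notin> chart_inv c ` K"
  shows "extend_map c U \<eta> x = x"
proof (cases "x \<in> fst c \<and> snd c x \<in> U")
  case True
  then have x: "chart_inv c (snd c x) = x" using chart_inv(1)[OF chart_diffeo_atlas] by blast
  then have "snd c x \<notin> K" using assms by (metis image_eqI)
  then have "\<eta> (snd c x) = snd c x" using chart_diffeo_map(3) True by blast
  then show ?thesis using True x by (simp add: extend_map_def)
qed (auto simp: extend_map_def)

text \<open>The two overlapping open regions, on each of which the extended map is given by one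
  formula; the gluing arguments split along them.\<close>

lemma domain_or_outside: "(x \<in> fst c \<and> snd c x \<in> U) \<or> x \<notin> chart_inv c ` K"
proof -
  have "chart_inv c y \<in> fst c \<and> snd c (chart_inv c y) \<in> U" if "y \<in> K" for y
  proof -
    have y: "y \<in> U" "y \<in> chart_img c" using that chart_diffeo_support(2) chart_diffeo_domain(2) by blast+
    show ?thesis using chart_inv(2,3)[OF chart_diffeo_atlas y(2)] y(1) by simp
  qed
  then show ?thesis by blast
qed

lemma closed_support: "closedin X (chart_inv c ` K)"
  using closedin_chart_compact[OF chart_diffeo_atlas chart_diffeo_support(1)] chart_diffeo_support(2) chart_diffeo_domain(2) by blast

lemma extend_map_inverse: "extend_map c U \<eta>' (extend_map c U \<eta> x) = x"
proof (cases "x \<in> fst c \<and> snd c x \<in> U")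
  case True
  note e = extend_map_in[OF True[THEN conjunct1] True[THEN conjunct2]]
  have "snd c (extend_map c U \<eta> x) \<in> U" using e(3) chart_diffeo_map(2) True by simp
  then show ?thesis
    using e chart_diffeo_inverse(1) True chart_inv(1)[OF chart_diffeo_atlas] by (simp add: extend_map_def[of c U \<eta>'])
qed (auto simp: extend_map_def)

lemma extend_map_smooth: "smooth_map X A X A (extend_map c U \<eta>)"
proof -
  let ?h = "extend_map c U \<eta>"
  let ?N = "{x \<in> fst c. snd c x \<in> U}" and ?M = "topspace X - chart_inv c ` K"
  have oN: "openin X ?N" by (rule openin_chart_preimage[OF chart_diffeo_atlas chart_diffeo_domain(1)])
  have oM: "openin X ?M" using closed_support by (simp add: openin_diff)
  have "continuous_map X X ?h"
  proof (rule pasting_lemma[where I = "{True, False}" and T = "\<lambda>i. if i then ?N else ?M" and f = "\<lambda>_. ?h"])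
    fix i assume "i \<in> {True, False}"
    show "openin X (if i then ?N else ?M)" using oN oM by simp
    show "continuous_map (subtopology X (if i then ?N else ?M)) X ?h"
    proof (cases i)
      case True
      have "continuous_map (subtopology X ?N) (top_of_set U) (snd c)"
        using continuous_map_from_subtopology_mono[OF continuous_map_chart[OF chart_diffeo_atlas], of ?N]
        by (auto simp: continuous_map_in_subtopology)
      moreover have "continuous_map (top_of_set U) (top_of_set (chart_img c)) \<eta>"
        using smooth_on_continuous_on[OF chart_diffeo_map(1)] chart_diffeo_map(2) chart_diffeo_domain(2) by (auto simp: continuous_map_in_subtopology)
      ultimately have "continuous_map (subtopology X ?N) X (chart_inv c \<circ> (\<eta> \<circ> snd c))"
        by (intro continuous_map_compose[OF continuous_map_compose continuous_map_chart_inv[OF chart_diffeo_atlas]])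
      then have "continuous_map (subtopology X ?N) X ?h"
        by (rule continuous_map_eq) (auto simp: extend_map_def)
      then show ?thesis using True by simp
    next
      case False
      have "continuous_map (subtopology X ?M) X id" by (simp add: continuous_map_from_subtopology)
      then have "continuous_map (subtopology X ?M) X ?h"
        by (rule continuous_map_eq) (auto simp: extend_map_out)
      then show ?thesis using False by simp
    qed
  next
    fix x assume "x \<in> topspace X"
    then show "\<exists>j. j \<in> {True, False} \<and> x \<in> (if j then ?N else ?M) \<and> ?h x = ?h x"
      using domain_or_outside[of x] by (cases "x \<in> fst c \<and> snd c x \<in> U") auto
  qed auto
  moreover have "smooth_on (snd d ` {x \<in> fst d. ?h x \<in> fst e}) (snd e \<circ> ?h \<circ> chart_inv d)" if d: "d \<in> A" and e: "e \<in> A" for d e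
    unfolding chart_image_eq[OF d]
  proof (rule smooth_on_local)
    fix y assume "y \<in> {y \<in> chart_img d. ?h (chart_inv d y) \<in> fst e}"
    then have y: "y \<in> chart_img d" "?h (chart_inv d y) \<in> fst e" by auto
    let ?x = "chart_inv d y"
    show "\<exists>V g. open V \<and> y \<in> V \<and> smooth_on V g \<and> (\<forall>z\<in>V. (snd e \<circ> ?h \<circ> chart_inv d) z = g z)"
    proof (cases "?x \<in> fst c \<and> snd c ?x \<in> U")
      case True
      define V1 where "V1 = {z \<in> repdom d c id. rep d c id z \<in> U}"
      have oV1: "open V1"
        unfolding V1_def using continuous_open_preimage[OF smooth_on_continuous_on[OF rep_id(2)[OF d chart_diffeo_atlas]] rep_id(1)[OF d chart_diffeo_atlas] chart_diffeo_domain(1)]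
        by (simp add: vimage_def Int_def)
      have s1: "smooth_on V1 (\<lambda>z. \<eta> (rep d c id z))"
        by (rule smooth_on_compose[OF oV1 chart_diffeo_domain(1) smooth_on_subset[OF rep_id(2)[OF d chart_diffeo_atlas]] chart_diffeo_map(1)]) (auto simp: V1_def)
      define V where "V = {z \<in> V1. \<eta> (rep d c id z) \<in> repdom c e id}"
      have oV: "open V"
        unfolding V_def using continuous_open_preimage[OF smooth_on_continuous_on[OF s1] oV1 rep_id(1)[OF chart_diffeo_atlas e]]
        by (simp add: vimage_def Int_def)
      have sV: "smooth_on V (\<lambda>z. rep c e id (\<eta> (rep d c id z)))"
        by (rule smooth_on_compose[OF oV rep_id(1)[OF chart_diffeo_atlas e] smooth_on_subset[OF s1] rep_id(2)[OF chart_diffeo_atlas e]]) (auto simp: V_def)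
      have "?h ?x = chart_inv c (\<eta> (snd c ?x))" using extend_map_in(1) True by blast
      moreover have "\<eta> (snd c ?x) \<in> chart_img c" using chart_diffeo_map(2) True chart_diffeo_domain(2) by blast
      ultimately have "y \<in> V" using y True by (simp add: V_def V1_def rep_id(3,4)[OF d chart_diffeo_atlas] rep_id(3)[OF chart_diffeo_atlas e])
      moreover have "(snd e \<circ> ?h \<circ> chart_inv d) z = rep c e id (\<eta> (rep d c id z))" if "z \<in> V" for z
        using that extend_map_in(1)[of "chart_inv d z"] by (simp add: V_def V1_def rep_id(3,4)[OF d chart_diffeo_atlas] rep_id(4)[OF chart_diffeo_atlas e])
      ultimately show ?thesis using oV sV by blast
    next
      case False
      then have xM: "?x \<notin> chart_inv c ` K" using domain_or_outside by blast
      let ?V = "repdom d e id \<inter> {z \<in> chart_img d. chart_inv d z \<notin> chart_inv c ` K}"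
      have "open ?V" using rep_id(1)[OF d e] open_outside[OF d closed_support] by blast
      moreover have "y \<in> ?V" using y xM extend_map_out[OF xM] by (simp add: rep_id(3)[OF d e])
      moreover have "smooth_on ?V (rep d e id)" by (rule smooth_on_subset[OF rep_id(2)[OF d e]]) auto
      moreover have "(snd e \<circ> ?h \<circ> chart_inv d) z = rep d e id z" if "z \<in> ?V" for z
        using that extend_map_out by (simp add: rep_id(4)[OF d e])
      ultimately show ?thesis by blast
    qed
  qed
  ultimately show ?thesis by (simp add: smooth_map_def)
qed

text \<open>Over \<open>U\<close> the tangent map factors into a transition map, the derivative of
  \<open>\<eta>\<close> and another transition map. Transition maps preserve the form itself, so
  only the middle factor needs the determinant condition.\<close>

lemma extend_map_preserves_power:
  assumes n: "DIM('e) = 2 * n"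
    and vol: "\<And>y. y \<in> U \<Longrightarrow> tdet (fd \<eta> y) * wedge_power (\<omega> c (\<eta> y)) n eb = wedge_power (\<omega> c y) n eb"
  shows "preserves_power A \<omega> n (extend_map c U \<eta>)"
  unfolding preserves_power_def
proof (intro ballI impI allI)
  let ?h = "extend_map c U \<eta>"
  fix d e x v assume d: "d \<in> A" and e: "e \<in> A" and x: "x \<in> fst d" "?h x \<in> fst e"
  have trans: "wedge_power (\<omega> e' (snd e' x)) n (\<lambda>i. tangent_map d' e' id x (w i)) = wedge_power (\<omega> d' (snd d' x)) n w"
    if "d' \<in> A" "e' \<in> A" "x \<in> fst d'" "x \<in> fst e'" for d' e' x w
  proof -
    have eq: "\<omega> d' (snd d' x) = (\<lambda>u v. \<omega> e' (snd e' x) (tangent_map d' e' id x u) (tangent_map d' e' id x v))"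
      by (intro ext form_transition that)
    show ?thesis unfolding eq by (rule wedge_power_pullback[symmetric])
  qed
  have y: "snd d x \<in> chart_img d" "chart_inv d (snd d x) = x" using chart_inv[OF d] x by auto
  show "wedge_power (\<omega> e (snd e (?h x))) n (\<lambda>i. tangent_map d e ?h x (v i)) = wedge_power (\<omega> d (snd d x)) n v"
  proof (cases "x \<in> fst c \<and> snd c x \<in> U")
    case True
    note h = extend_map_in[OF True[THEN conjunct1] True[THEN conjunct2]]
    let ?y = "snd c x"
    have yU: "?y \<in> U" "\<eta> ?y \<in> U" "?y \<in> chart_img c" "\<eta> ?y \<in> chart_img c" using True chart_diffeo_map(2) chart_diffeo_domain(2) by blast+
    have r1: "rep d c id differentiable at (snd d x)" "rep d c id (snd d x) = ?y"
      using smooth_on_differentiable[OF rep_id(2)[OF d chart_diffeo_atlas]] y True by (simp_all add: rep_id(3,4)[OF d chart_diffeo_atlas])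
    have r2: "\<eta> differentiable at ?y" using smooth_on_differentiable[OF chart_diffeo_map(1) yU(1)] .
    have r3: "rep c e id differentiable at (\<eta> ?y)"
      by (rule smooth_on_differentiable[OF rep_id(2)[OF chart_diffeo_atlas e]]) (use yU x h(1) in \<open>simp add: rep_id(3)[OF chart_diffeo_atlas e]\<close>)
    let ?V = "{z \<in> chart_img d. chart_inv d z \<in> {x \<in> fst c. snd c x \<in> U}}"
    have "fd (rep d e ?h) (snd d x) = fd (\<lambda>z. rep c e id (\<eta> (rep d c id z))) (snd d x)"
    proof (rule fd_cong[OF open_chart_preimage[OF d openin_chart_preimage[OF chart_diffeo_atlas chart_diffeo_domain(1)]]])
      show "snd d x \<in> ?V" using y True by simp
      fix z assume "z \<in> ?V"
      then show "rep d e ?h z = rep c e id (\<eta> (rep d c id z))"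
        using extend_map_in(1)[of "chart_inv d z"] by (simp add: rep_id(4)[OF chart_diffeo_atlas e] rep_id(4)[OF d chart_diffeo_atlas] rep_def[of d e ?h])
    qed
    moreover have "fd (\<lambda>z. rep c e id (\<eta> (rep d c id z))) (snd d x) w =
        fd (rep c e id) (\<eta> ?y) (fd \<eta> ?y (fd (rep d c id) (snd d x) w))" for w
      using fd_compose[of "\<lambda>z. \<eta> (rep d c id z)" "snd d x" "rep c e id"] fd_compose[of "rep d c id" "snd d x" \<eta>]
        r1 r2 r3 differentiable_compose[of \<eta> "rep d c id" "snd d x"] by simp
    ultimately have T: "tangent_map d e ?h x w = tangent_map c e id (?h x) (fd \<eta> ?y (tangent_map d c id x w))" for w
      by (simp add: tangent_map_rep h(3))
    have "wedge_power (\<omega> e (snd e (?h x))) n (\<lambda>i. tangent_map d e ?h x (v i)) =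
        wedge_power (\<omega> c (\<eta> ?y)) n (\<lambda>i. fd \<eta> ?y (tangent_map d c id x (v i)))"
      unfolding T using trans[OF chart_diffeo_atlas e h(2) x(2), of "\<lambda>i. fd \<eta> ?y (tangent_map d c id x (v i))"] h(3) by simp
    also have "\<dots> = wedge_power (\<omega> c ?y) n (\<lambda>i. tangent_map d c id x (v i))"
      using form(1,2)[OF chart_diffeo_atlas yU(3)] form(1,2)[OF chart_diffeo_atlas yU(4)]
      by (intro wedge_power_tdet n linear_frechet_derivative[OF r2] vol yU(1)) auto
    also have "\<dots> = wedge_power (\<omega> d (snd d x)) n v" by (rule trans[OF d chart_diffeo_atlas x(1)]) (use True in blast)
    finally show ?thesis .
  next
    case False
    then have xM: "x \<notin> chart_inv c ` K" using domain_or_outside by blast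
    have hx: "?h x = x" by (rule extend_map_out[OF xM])
    have "fd (rep d e ?h) (snd d x) = fd (rep d e id) (snd d x)"
      by (rule fd_cong[OF open_outside[OF d closed_support]]) (use y xM extend_map_out in \<open>auto simp: rep_def\<close>)
    then show ?thesis using trans[OF d e x(1)] x(2) by (simp add: tangent_map_rep hx)
  qed
qed

end

lemma extend_map_diffeo:
  assumes cd: "chart_diffeo c U K \<eta> \<eta>'"
  shows "extend_map c U \<eta> \<in> diffeos X A"
proof -
  note i1 = extend_map_inverse[OF cd] and i2 = extend_map_inverse[OF chart_diffeo_sym[OF cd]]
  have "extend_map c U \<eta> permutes topspace X"
    unfolding permutes_def
  proof (intro conjI allI impI)
    fix x assume "x \<notin> topspace X"
    then show "extend_map c U \<eta> x = x" using chart(3)[OF chart_diffeo_atlas[OF cd]] by (auto simp: extend_map_def)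
  next
    fix y show "\<exists>!x. extend_map c U \<eta> x = y" using i1 i2 by metis
  qed
  moreover have "inv (extend_map c U \<eta>) = extend_map c U \<eta>'"
    by (rule inv_equality) (simp_all add: i1 i2)
  ultimately show ?thesis
    unfolding diffeos_def
    using extend_map_smooth[OF cd] extend_map_smooth[OF chart_diffeo_sym[OF cd]] by simp
qed

lemma smooth_wedge_power:
  assumes c: "c \<in> A"
  shows "smooth_on (chart_img c) (\<lambda>y. wedge_power (\<omega> c y) n v)"
proof (induction n arbitrary: v)
  case 0
  show ?case by (simp add: smooth_on_const)
next
  case (Suc n)
  have "smooth_on (chart_img c) (\<lambda>y. (\<Sum>\<sigma> | \<sigma> permutes {..<2 + 2 * n}. of_int (sign \<sigma>) * \<omega> c y (v (\<sigma> 0)) (v (\<sigma> 1)) *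
      wedge_power (\<omega> c y) n (\<lambda>i. v (\<sigma> (2 + i)))) * (1 / (fact 2 * fact (2 * n))))"
    by (intro smooth_on_mult smooth_on_sum smooth_on_const chart(2)[OF c] form(3)[OF c] Suc)
  then show ?case by (simp add: wedge_def)
qed

section \<open>Comparison of contributions and failure of volume invariance\<close>

lemma finite_supp:
  assumes f: "f \<in> Cinf X A" and \<delta>: "\<delta> > 0" and cpt: "compact_space X"
  shows "finite (supp \<delta> f)"
proof -
  have "\<exists>W. openin X W \<and> z \<in> W \<and> finite (supp \<delta> f \<inter> W)" if "z \<in> topspace X" for z
  proof -
    note z = that
    obtain V W where VW: "openin TT V" "f \<in> V" "openin X W" "z \<in> W"
      and s: "(\<forall>g\<in>V. supp \<delta> g \<inter> W = {}) \<or> (\<exists>c x. isolates \<delta> V W c x \<and> z = chart_inv c (x f))"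
      using supp_local[OF f z \<delta>] by (elim exE conjE) (rule that)
    have "finite (supp \<delta> f \<inter> W)"
      using s
    proof (elim disjE exE conjE)
      assume "\<forall>g\<in>V. supp \<delta> g \<inter> W = {}"
      then show ?thesis using VW(2) by simp
    next
      fix c x assume "isolates \<delta> V W c x"
      then have "supp \<delta> f \<inter> W \<subseteq> {chart_inv c (x f)}" using VW(2) unfolding isolates_def by blast
      then show ?thesis by (rule finite_subset) simp
    qed
    then show ?thesis using VW by blast
  qed
  then obtain W where W: "\<And>z. z \<in> topspace X \<Longrightarrow> openin X (W z) \<and> z \<in> W z \<and> finite (supp \<delta> f \<inter> W z)" by metis
  obtain F where F: "finite F" "F \<subseteq> W ` topspace X" "topspace X \<subseteq> \<Union>F"
    using cpt[unfolded compact_space_def compactin_def, THEN conjunct2, rule_format, of "W ` topspace X"] W by blast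
  have "supp \<delta> f \<subseteq> (\<Union>S\<in>F. supp \<delta> f \<inter> S)" using F(3) by (auto simp: supp_def)
  moreover have "finite (\<Union>S\<in>F. supp \<delta> f \<inter> S)" using F(1,2) W by blast
  ultimately show ?thesis by (rule finite_subset)
qed

lemma pfun_differs_at_point:
  assumes fg: "f \<in> Cinf X A" "g \<in> Cinf X A" and \<delta>: "\<delta> > 0" and cpt: "compact_space X"
    and x0: "x0 \<in> topspace X" and eq: "\<And>x. x \<in> topspace X \<Longrightarrow> x \<noteq> x0 \<Longrightarrow> pt_contrib \<delta> f x = pt_contrib \<delta> g x"
    and ne: "pt_contrib \<delta> f x0 \<noteq> pt_contrib \<delta> g x0"
  shows "pfun \<delta> f \<noteq> pfun \<delta> g"
proof -
  have split: "pfun \<delta> f = (\<Sum>x\<in>supp \<delta> f - {x0}. pt_contrib \<delta> f x) + pt_contrib \<delta> f x0" if "f \<in> Cinf X A" for f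
  proof -
    have fin: "finite (supp \<delta> f)" by (rule finite_supp[OF that \<delta> cpt])
    show ?thesis
    proof (cases "x0 \<in> supp \<delta> f")
      case True
      then show ?thesis unfolding pfun_def using sum.remove[OF fin True, of "pt_contrib \<delta> f"] by simp
    next
      case False
      then show ?thesis unfolding pfun_def using x0 by (simp add: supp_def)
    qed
  qed
  have "supp \<delta> f - {x0} = supp \<delta> g - {x0}" using eq by (auto simp: supp_def)
  moreover have "(\<Sum>x\<in>supp \<delta> f - {x0}. pt_contrib \<delta> f x) = (\<Sum>x\<in>supp \<delta> f - {x0}. pt_contrib \<delta> g x)"
    by (rule sum.cong) (auto simp: supp_def eq)
  ultimately show ?thesis using split[OF fg(1)] split[OF fg(2)] ne by simp
qed

lemma Cinf_compose_diffeo: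
  assumes f: "f \<in> Cinf X A" and h: "h \<in> diffeos X A"
  shows "f \<circ> h \<in> Cinf X A"
proof -
  have hs: "smooth_map X A X A h" and hp: "h permutes topspace X" using h by (auto simp: diffeos_def)
  have "smooth_on (chart_img c) (rp c (f \<circ> h))" if c: "c \<in> A" for c
  proof (rule smooth_on_local)
    fix y assume y: "y \<in> chart_img c"
    have "h (chart_inv c y) \<in> topspace X"
      using chart_inv(3)[OF c y] chart(3)[OF c] permutes_in_image[OF hp] by blast
    then obtain d where d: "d \<in> A" "h (chart_inv c y) \<in> fst d" using cover by blast
    note r = smooth_map_rep[OF hs c d(1)]
    have "smooth_on (repdom c d h) (\<lambda>z. rp d f (rep c d h z))"
      by (rule smooth_on_compose[OF r(1) chart(2)[OF d(1)] r(2) smooth_rp[OF f d(1)]])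
        (use chart_inv(4)[OF d(1)] in \<open>simp add: repdom_def rep_def\<close>)
    moreover have "rp c (f \<circ> h) z = rp d f (rep c d h z)" if "z \<in> repdom c d h" for z
      using that chart_inv(1)[OF d(1)] by (simp add: repdom_def rep_def)
    ultimately show "\<exists>V g. open V \<and> y \<in> V \<and> smooth_on V g \<and> (\<forall>z\<in>V. rp c (f \<circ> h) z = g z)"
      using r(1) y d(2) by (intro exI[of _ "repdom c d h"]) (auto simp: repdom_def)
  qed
  moreover have "(f \<circ> h) x = 0" if "x \<notin> topspace X" for x
    using that f hp by (simp add: Cinf_def permutes_def)
  ultimately show ?thesis by (simp add: Cinf_def smooth_fun_def)
qed

lemma contrib_cong:
  assumes "open V" "y \<in> V" "\<And>z. z \<in> V \<Longrightarrow> rp c f z = rp c g z"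
  shows "contrib \<delta> c f y = contrib \<delta> c g y"
proof -
  have "iter_deriv vs (rp c f) y = iter_deriv vs (rp c g) y" for vs
    by (rule iter_deriv_cong[OF assms(1,3,2)])
  note j = this
  have "hess c f y = hess c g y" by (intro ext) (simp only: hess_def j)
  then show ?thesis by (simp only: contrib_def crit_def disc_def hinv_def j)
qed

text \<open>\<open>\<xi>\<close> is quadratic near \<open>y0\<close>, with the form from
  \<open>rotation_detected\<close> as Hessian. The extended twist fixes this critical point and
  rotates the Hessian, which keeps \<open>disc\<close> and changes \<open>hinv\<close>. Nothing
  compensates elsewhere: in \<open>U\<close> neither function has another critical point, and off
  the support of the twist they coincide.\<close>

theorem not_volume_invariant:
  assumes ne: "topspace X \<noteq> {}" and cpt: "compact_space X" and n: "DIM('e) = 2 * n" and dim: "DIM('e) \<ge> 3"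
  shows "\<exists>\<delta>>0. \<exists>h\<in>diffeos X A. preserves_power A \<omega> n h \<and> (\<exists>\<xi>\<in>Cinf X A. pfun \<delta> (\<xi> \<circ> h) \<noteq> pfun \<delta> \<xi>)"
proof -
  obtain x1 c where x1: "c \<in> A" "x1 \<in> fst c" using ne cover by blast
  note c = x1(1)
  define \<rho> where "\<rho> y = wedge_power (\<omega> c y) n eb" for y
  have sm\<rho>: "smooth_on (chart_img c) \<rho>" unfolding \<rho>_def by (rule smooth_wedge_power[OF c])
  \<comment> \<open>Either the density is nonzero somewhere, or it vanishes on the whole chart and
    any point will do; these are the alternatives of \<open>volume_preserving_twist\<close>.\<close>
  obtain y0 where y0: "y0 \<in> chart_img c" "\<rho> y0 \<noteq> 0 \<or> (\<forall>y\<in>chart_img c. \<rho> y = 0)"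
    using chart_inv(4)[OF c x1(2)] by blast
  define x0 where "x0 = chart_inv c y0"
  have x0: "x0 \<in> fst c" "snd c x0 = y0" "x0 \<in> topspace X"
    using chart_inv(2,3)[OF c y0(1)] chart(3)[OF c] by (auto simp: x0_def)
  define \<Omega> where "\<Omega> = \<omega> c y0"
  have \<Omega>: "bilinear \<Omega>" "\<And>u. \<Omega> u u = 0" "bdet \<Omega> \<noteq> 0"
    using form(1,2,5)[OF c y0(1)] by (auto simp: \<Omega>_def)
  obtain a b \<theta> \<mu> where ab: "a \<in> Basis" "b \<in> Basis" "a \<noteq> b" and \<mu>: "\<And>i. \<mu> i > 0"
    and detect: "bdet (\<lambda>u v. diag_form \<mu> (rot a b \<theta> u) (rot a b \<theta> v) + \<Omega> u v) \<noteq> bdet (\<lambda>u v. diag_form \<mu> u v + \<Omega> u v)"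
    using rotation_detected[OF \<Omega> dim] by blast
  define H where "H = (diag_form \<mu> :: 'e \<Rightarrow> 'e \<Rightarrow> real)"
  have HB: "bilinear H" unfolding H_def by (rule bilinear_diag_form)
  have Hpos: "bdet H > 0" unfolding H_def bdet_diag_form using \<mu> by (intro prod_pos) auto
  have Hnd: "u = 0" if "\<And>v. H u v = 0" for u
    using bdet_nonzero_iff[OF HB] Hpos that by auto
  \<comment> \<open>Half of \<open>disc\<close> at \<open>y0\<close>, a value shared by
    \<open>\<xi>\<close> and \<open>\<xi> \<circ> h\<close> because rotations have determinant 1;
    the cutoff factor is \<open>flat 0 \<delta> > 0\<close> for both.\<close>
  define \<delta> where "\<delta> = (bdet H / bdet \<Omega>)\<^sup>2 / 2"
  have \<delta>: "\<delta> > 0" using Hpos \<Omega>(3) by (simp add: \<delta>_def)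
  obtain r where r: "r > 0" "cball y0 r \<subseteq> chart_img c" using chart(2)[OF c] y0(1) open_contains_cball by blast
  \<comment> \<open>The cutoff in \<open>F\<close> is 1 on the ball \<open>U\<close> of radius
    \<open>s\<close>, and \<open>F\<close> vanishes from distance \<open>2 * s = r\<close>
    on.\<close>
  define s where "s = r / 2"
  have s: "s > 0" using r by (simp add: s_def)
  define U where "U = ball y0 s"
  have U: "open U" "U \<subseteq> chart_img c" "y0 \<in> U" using r s by (auto simp: U_def s_def)
  have \<rho>U: "\<rho> y0 \<noteq> 0 \<or> (\<forall>y\<in>U. \<rho> y = 0)" using y0(2) U(2) by blast
  obtain K \<eta> where tw: "compact K \<and> K \<subseteq> U \<and> (\<forall>\<theta>. smooth_on U (\<eta> \<theta>) \<and>
      (\<forall>y\<in>U. \<eta> \<theta> y \<in> U \<and> \<eta> (- \<theta>) (\<eta> \<theta> y) = y \<and> tdet (fd (\<eta> \<theta>) y) * \<rho> (\<eta> \<theta> y) = \<rho> y) \<and>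
      (\<forall>y\<in>U - K. \<eta> \<theta> y = y) \<and> (\<forall>y\<in>K. \<eta> \<theta> y \<in> K) \<and> \<eta> \<theta> y0 = y0 \<and> fd (\<eta> \<theta>) y0 = rot a b \<theta>)"
    using volume_preserving_twist[OF ab U(1,3) smooth_on_subset[OF sm\<rho> U(2)] \<rho>U] by (elim exE)
  have K: "compact K" "K \<subseteq> U" using tw by blast+
  note tw = tw[THEN conjunct2, THEN conjunct2, rule_format]
  have sm\<eta>: "smooth_on U (\<eta> \<theta>)" for \<theta> using tw by blast
  have \<eta>U: "y \<in> U \<Longrightarrow> \<eta> \<theta> y \<in> U" "y \<in> U \<Longrightarrow> \<eta> (- \<theta>) (\<eta> \<theta> y) = y"
      "y \<in> U \<Longrightarrow> tdet (fd (\<eta> \<theta>) y) * \<rho> (\<eta> \<theta> y) = \<rho> y" "y \<in> U - K \<Longrightarrow> \<eta> \<theta> y = y" for \<theta> y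
    using tw[of \<theta>] by blast+
  have \<eta>0: "\<eta> \<theta> y0 = y0" "fd (\<eta> \<theta>) y0 = rot a b \<theta>" for \<theta> using tw[of \<theta>] by blast+
  have \<eta>U': "\<eta> \<theta> (\<eta> (- \<theta>) y) = y" if "y \<in> U" for y using \<eta>U(2)[OF that, of "- \<theta>"] by simp
  define h where "h = extend_map c U (\<eta> \<theta>)"
  have hyps: "chart_diffeo c U K (\<eta> \<theta>) (\<eta> (- \<theta>))"
    unfolding chart_diffeo_def by (intro conjI ballI c U K sm\<eta> \<eta>U \<eta>U')
  have h: "h \<in> diffeos X A" unfolding h_def by (rule extend_map_diffeo[OF hyps])
  have hvol: "preserves_power A \<omega> n h"
    unfolding h_def by (rule extend_map_preserves_power[OF hyps n]) (use \<eta>U(3) in \<open>simp_all add: \<rho>_def\<close>)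
  note h_in = extend_map_in[OF hyps, folded h_def] and h_out = extend_map_out[OF hyps, folded h_def]
    and domain_or_outside' = domain_or_outside[OF hyps]
  define q where "q = (\<lambda>y. diag_form \<mu> (y - y0) (y - y0) / 2)"
  have qd: "smooth_on UNIV q" "fd q y v = H (y - y0) v" "iter_deriv [u, v] q y = H u v" for y u v
    unfolding q_def H_def by (rule quadratic_derivatives)+
  define F where "F y = cutoff ((y - y0) \<bullet> (y - y0) / s\<^sup>2) * q y" for y
  have smF: "smooth_on UNIV F"
    unfolding F_def divide_inverse
    by (intro smooth_on_mult open_UNIV smooth_on_compose[OF open_UNIV open_UNIV _ smooth_on_cutoff] smooth_on_inner_self smooth_on_const qd(1) UNIV_I)
  have F_out: "F y = 0" if "y \<in> chart_img c - cball y0 r" for y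
  proof -
    have "(2 * s)\<^sup>2 \<le> (norm (y - y0))\<^sup>2" using that s by (intro power_mono) (auto simp: dist_norm norm_minus_commute s_def)
    then have "(y - y0) \<bullet> (y - y0) / s\<^sup>2 \<ge> 4" using s by (simp add: power2_norm_eq_inner power_mult_distrib le_divide_eq)
    then show ?thesis by (simp add: F_def cutoff_simps)
  qed
  have F_in: "F y = q y" if "y \<in> U" for y
  proof -
    have "(norm (y - y0))\<^sup>2 \<le> s\<^sup>2" using that s by (intro power_mono) (auto simp: U_def dist_norm norm_minus_commute)
    then have "(y - y0) \<bullet> (y - y0) / s\<^sup>2 \<le> 1" using s by (simp add: power2_norm_eq_inner)
    then show ?thesis by (simp add: F_def cutoff_simps)
  qed
  define \<xi> where "\<xi> = extend_fun c F"
  have \<xi>C: "\<xi> \<in> Cinf X A"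
    unfolding \<xi>_def by (rule extend_fun_Cinf[OF c compact_cball r(2) smooth_on_subset[OF smF] F_out]) auto
  have \<xi>hC: "\<xi> \<circ> h \<in> Cinf X A" by (rule Cinf_compose_diffeo[OF \<xi>C h])
  have rp1: "rp c \<xi> y = q y" if "y \<in> U" for y
    using that U(2) chart_inv(2,3)[OF c, of y] F_in[OF that] by (auto simp: \<xi>_def extend_fun_def)
  have rp2: "rp c (\<xi> \<circ> h) y = q (\<eta> \<theta> y)" if "y \<in> U" for y
  proof -
    have yc: "chart_inv c y \<in> fst c" "snd c (chart_inv c y) = y" using that U(2) chart_inv(2,3)[OF c, of y] by auto
    have "h (chart_inv c y) = chart_inv c (\<eta> \<theta> y)" using h_in(1)[OF yc(1)] yc(2) that by simp
    then show ?thesis using rp1[OF \<eta>U(1)[OF that]] by simp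
  qed
  have j1: "iter_deriv vs (rp c \<xi>) y = iter_deriv vs q y" if "y \<in> U" for vs y
    by (rule iter_deriv_cong[OF U(1) rp1 that])
  have j2: "iter_deriv vs (rp c (\<xi> \<circ> h)) y = iter_deriv vs (\<lambda>y. q (\<eta> \<theta> y)) y" if "y \<in> U" for vs y
    by (rule iter_deriv_cong[OF U(1) rp2 that])
  have dq: "q differentiable at z" for z using smooth_on_differentiable[OF qd(1)] by simp
  have crit1: "crit c \<xi> y \<longleftrightarrow> y = y0" if y: "y \<in> U" for y
  proof -
    have "crit c \<xi> y \<longleftrightarrow> (\<forall>v. H (y - y0) v = 0)" unfolding crit_def j1[OF y] by (simp add: qd(2))
    then show ?thesis using Hnd[of "y - y0"] bilinear_lzero[OF HB] by auto
  qed
  \<comment> \<open>The twist is invertible on \<open>U\<close>, so its derivative is surjective,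
    and a critical point of the composition at \<open>y\<close> means one of \<open>q\<close> at
    \<open>\<eta> \<theta> y\<close>, which is only \<open>y0\<close>.\<close>
  have crit2: "crit c (\<xi> \<circ> h) y \<longleftrightarrow> y = y0" if y: "y \<in> U" for y
  proof -
    have d\<eta>: "\<eta> \<theta> differentiable at y" by (rule smooth_on_differentiable[OF sm\<eta> y])
    have d\<eta>': "\<eta> (- \<theta>) differentiable at (\<eta> \<theta> y)" by (rule smooth_on_differentiable[OF sm\<eta> \<eta>U(1)[OF y]])
    have e: "fd (\<lambda>y. q (\<eta> \<theta> y)) y v = H (\<eta> \<theta> y - y0) (fd (\<eta> \<theta>) y v)" for v
      using fd_compose[OF d\<eta> dq] by (simp add: qd(2))
    have l: "linear (fd (\<eta> \<theta>) y)" by (rule linear_frechet_derivative[OF d\<eta>])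
    have "fd (\<eta> (- \<theta>)) (\<eta> \<theta> y) (fd (\<eta> \<theta>) y v) = v" for v
    proof -
      have "fd (\<lambda>y. \<eta> (- \<theta>) (\<eta> \<theta> y)) y = fd (\<lambda>y. y) y" by (rule fd_cong[OF U(1) y \<eta>U(2)])
      then show ?thesis using fd_compose[OF d\<eta> d\<eta>', of v] by simp
    qed
    then have "inj (fd (\<eta> \<theta>) y)" by (metis injI)
    then have surj: "surj (fd (\<eta> \<theta>) y)" using linear_injective_imp_surjective[OF l] by simp
    have "crit c (\<xi> \<circ> h) y \<longleftrightarrow> (\<forall>v. H (\<eta> \<theta> y - y0) (fd (\<eta> \<theta>) y v) = 0)"
      unfolding crit_def j2[OF y] by (simp add: e)
    also have "\<dots> \<longleftrightarrow> (\<forall>v. H (\<eta> \<theta> y - y0) v = 0)" using surj by (metis surjD)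
    also have "\<dots> \<longleftrightarrow> \<eta> \<theta> y = y0" using Hnd[of "\<eta> \<theta> y - y0"] bilinear_lzero[OF HB] by auto
    also have "\<dots> \<longleftrightarrow> y = y0" using \<eta>U(2)[OF y, of \<theta>] \<eta>0(1)[of \<theta>] \<eta>0(1)[of "- \<theta>"] by auto
    finally show ?thesis .
  qed
  have hess1: "hess c \<xi> y0 = H" unfolding hess_def j1[OF U(3)] by (simp only: qd(3))
  have hess2: "hess c (\<xi> \<circ> h) y0 = (\<lambda>u v. H (rot a b \<theta> u) (rot a b \<theta> v))"
  proof (intro ext)
    fix u v
    have "iter_deriv [u, v] (\<lambda>y. q (\<eta> \<theta> y)) y0 = iter_deriv [fd (\<eta> \<theta>) y0 u, fd (\<eta> \<theta>) y0 v] q (\<eta> \<theta> y0)"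
      by (rule hessian_pullback[OF U(1,3) open_UNIV UNIV_I sm\<eta> qd(1)]) (simp add: qd(2) \<eta>0 bilinear_lzero[OF HB])
    then show "hess c (\<xi> \<circ> h) y0 u v = H (rot a b \<theta> u) (rot a b \<theta> v)"
      unfolding hess_def j2[OF U(3)] by (simp only: qd(3) \<eta>0)
  qed
  have disc1: "disc c \<xi> y0 = 2 * \<delta>" by (simp add: disc_def hess1 \<delta>_def \<Omega>_def)
  have disc2: "disc c (\<xi> \<circ> h) y0 = 2 * \<delta>"
    using bdet_congruence[OF HB, of "rot a b \<theta>"] by (simp add: disc_def hess2 tdet_rot[OF ab] \<delta>_def \<Omega>_def)
  have "contrib \<delta> c (\<xi> \<circ> h) y0 \<noteq> contrib \<delta> c \<xi> y0"
    using crit1[OF U(3)] crit2[OF U(3)] detect \<Omega>(3) flat0_pos(1)[OF \<delta>]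
    by (simp add: contrib_def disc1 disc2 hinv_def hess1 hess2 H_def \<Omega>_def)
  then have d0: "pt_contrib \<delta> (\<xi> \<circ> h) x0 \<noteq> pt_contrib \<delta> \<xi> x0"
    using pt_contrib_chart[OF \<xi>C c x0(1), of \<delta>] pt_contrib_chart[OF \<xi>hC c x0(1), of \<delta>] by (simp add: x0(2))
  have same: "pt_contrib \<delta> (\<xi> \<circ> h) x = pt_contrib \<delta> \<xi> x" if x: "x \<in> topspace X" "x \<noteq> x0" for x
  proof (cases "x \<in> fst c \<and> snd c x \<in> U")
    case True
    then have "snd c x \<noteq> y0" using x(2) chart_inv(1)[OF c, of x] by (auto simp: x0_def)
    then show ?thesis
      using pt_contrib_chart[OF \<xi>C c, of x \<delta>] pt_contrib_chart[OF \<xi>hC c, of x \<delta>] True crit1 crit2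
      by (simp add: contrib_def)
  next
    case False
    then have xK: "x \<notin> chart_inv c ` K" using domain_or_outside' by blast
    note d = chart_at[OF x(1)]
    have cl: "closedin X (chart_inv c ` K)" using closedin_chart_compact[OF c K(1)] K(2) U(2) by blast
    show ?thesis
      unfolding pt_contrib_def
      by (rule contrib_cong[OF open_outside[OF d(1) cl]]) (use chart_inv[OF d(1)] d(2) xK h_out in auto)
  qed
  have "pfun \<delta> (\<xi> \<circ> h) \<noteq> pfun \<delta> \<xi>"
    by (rule pfun_differs_at_point[OF \<xi>hC \<xi>C \<delta> cpt x0(3) same d0])
  then show ?thesis using \<delta> h hvol \<xi>C by blast
qed

end

theorem theorem1p5:
  fixes X :: "'x topology"
    and A :: "('x, 'e::euclidean_space) chart set"
    and \<omega> :: "('x, 'e) two_form"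
    and n :: nat
  assumes "smooth_manifold X A"
    and "topspace X \<noteq> {}"
    and "connected_space X"
    and "compact_space X"
    and "symplectic_form A \<omega>"
    and "DIM('e) = 2 * n"
    and "DIM('e) \<ge> 4"
  shows "\<exists>p. frechet_smooth (Cinf_topology X A) p \<and>
    (\<forall>\<xi>\<in>Cinf X A. \<forall>g\<in>Ham X A \<omega>. p (\<xi> \<circ> g) = p \<xi>) \<and>
    (\<exists>h\<in>diffeos X A. preserves_power A \<omega> n h \<and> (\<exists>\<xi>\<in>Cinf X A. p (\<xi> \<circ> h) \<noteq> p \<xi>))"
proof -
  interpret symplectic_manifold X A \<omega>
    using assms by unfold_locales
  obtain \<delta> where "\<delta> > 0" and "\<exists>h\<in>diffeos X A. preserves_power A \<omega> n h \<and>
      (\<exists>\<xi>\<in>Cinf X A. pfun \<delta> (\<xi> \<circ> h) \<noteq> pfun \<delta> \<xi>)"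
    using not_volume_invariant[of n] assms by force
  moreover from this(1) have "frechet_smooth (Cinf_topology X A) (pfun \<delta>)"
    using assms(4) by (rule pfun_smooth)
  ultimately show ?thesis
    using pfun_Ham_invariant by blast
qed

end
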